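(* There is a deterministic algorithm $\textsc{LowConductanceCutOrCertify}(G,\phi,b)$ which, given an undirected graph $G$ with $n$ vertices and $m$ edges, an $\alpha$-approximate decremental All-Pairs Shortest-Paths (APSP) data structure, a conductance parameter $\phi\in(0,1]$ and a balance parameter $b\in[1/n,1/4]$, does one of the following: 1. it returns a cut $(S,\overline{S})$ with $\mathrm{vol}_G(S),\mathrm{vol}_G(\overline{S})\ge b\cdot\mathrm{vol}(G)$ and conductance $\Phi_G(S)\le\phi$; or 2. it certifies (i.e. correctly asserts) that every cut $(X,\overline{X})$ with $\mathrm{vol}_G(X),\mathrm{vol}_G(\overline{X})=\Omega(b\cdot\mathrm{vol}(G))$ has conductance at least $$\phi\cdot\Omega\left(\frac{1}{\alpha\,\log n\cdot\log(1/b)\cdot\log(\log(n)\,\alpha/(b\phi))}\right)=\phi\cdot\Omega\left(\frac{1}{\alpha\log^3 n}\right).$$ The algorithm requires the APSP data structure to undergo $O(\alpha\, m\,\phi^{-1}\log^3 n)$ updates, queries it $O(m)$ times, and spends an additional $O(\alpha\, m\,\phi^{-1}\log^3 n)$ time.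
   Context: For an undirected graph $G=(V,E)$ and $S\subseteq V$, $\overline{S}=V\setminus S$, $\mathrm{vol}_G(S)$ is the sum of the degrees of the vertices in $S$, $\mathrm{vol}(G)=\mathrm{vol}_G(V)$, and $E_G(S,\overline S)$ is the set of edges with exactly one endpoint in $S$. A cut is a pair $(S,\overline S)$ with $\emptyset\ne S\subsetneq V$. The conductance of the cut is $\Phi_G(S)=\frac{|E_G(S,\overline{S})|}{\min\{\mathrm{vol}_G(S),\mathrm{vol}_G(\overline{S})\}}$. An $\alpha$-approximate decremental APSP data structure ($\alpha\ge1$) is initialized on a (weighted) graph and supports: $\textsc{IncreaseEdgeWeight}(u,v,\Delta)$ (an update), which increases the weight of edge $(u,v)$ by $\Delta$; $\textsc{QueryDistance}(u,v)$, which returns an estimate $\tilde d(u,v)\in[d(u,v),\alpha\, d(u,v)]$, where $d$ is the distance in the current weighted graph; and $\textsc{QueryPath}(u,v)$, which returns a $u$-to-$v$ path in the current graph of total weight $\tilde d(u,v)$. The algorithm may choose the graph on which the data structure is initialized. All constants hidden in $O(\cdot)$ and $\Omega(\cdot)$ are universal; in item 2, "every cut with volumes $\Omega(b\cdot \mathrm{vol}(G))$" means every cut with both volumes at least $c\, b\cdot\mathrm{vol}(G)$ for some universal constant $c>0$. *)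

theory Defs
  imports Complex_Main "HOL-Library.Extended_Real"
begin

section \<open>Cuts and conductance\<close>

definition simple_graph :: "'a set \<Rightarrow> 'a set set \<Rightarrow> bool" where
  "simple_graph V E \<longleftrightarrow> finite V \<and> (\<forall>e\<in>E. \<exists>u\<in>V. \<exists>v\<in>V. u \<noteq> v \<and> e = {u, v})"

definition degree :: "'a set set \<Rightarrow> 'a \<Rightarrow> nat" where
  "degree E v = card {e \<in> E. v \<in> e}"

definition vol :: "'a set set \<Rightarrow> 'a set \<Rightarrow> nat" where
  "vol E S = (\<Sum>v\<in>S. degree E v)"

definition cut_edges :: "'a set set \<Rightarrow> 'a set \<Rightarrow> 'a set set" where
  "cut_edges E S = {e \<in> E. \<exists>u v. e = {u, v} \<and> u \<in> S \<and> v \<notin> S}"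

definition is_cut :: "'a set \<Rightarrow> 'a set \<Rightarrow> bool" where
  "is_cut V S \<longleftrightarrow> S \<noteq> {} \<and> S \<subset> V"

definition conductance :: "'a set \<Rightarrow> 'a set set \<Rightarrow> 'a set \<Rightarrow> real" where
  "conductance V E S = real (card (cut_edges E S)) / real (min (vol E S) (vol E (V - S)))"


section \<open>Weighted graphs and distances\<close>

text \<open>Weighted graphs have vertex set \<open>{..<nverts g}\<close>; an edge is a two-element vertex set.\<close>

record wgraph =
  nverts :: nat
  edges :: "nat set set"
  wt :: "nat set \<Rightarrow> real"

definition wf_wgraph :: "wgraph \<Rightarrow> bool" where
  "wf_wgraph g \<longleftrightarrow> simple_graph {..<nverts g} (edges g) \<and> (\<forall>e\<in>edges g. 0 < wt g e)"

definition is_path :: "wgraph \<Rightarrow> nat \<Rightarrow> nat \<Rightarrow> nat list \<Rightarrow> bool" where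
  "is_path g u v p \<longleftrightarrow> p \<noteq> [] \<and> hd p = u \<and> last p = v \<and> distinct p \<and> set p \<subseteq> {..<nverts g} \<and>
     (\<forall>i. Suc i < length p \<longrightarrow> {p ! i, p ! Suc i} \<in> edges g)"

definition path_weight :: "wgraph \<Rightarrow> nat list \<Rightarrow> real" where
  "path_weight g p = (\<Sum>i<length p - 1. wt g {p ! i, p ! Suc i})"

text \<open>The distance is \<open>\<infinity>\<close> when there is no path.\<close>

definition wdist :: "wgraph \<Rightarrow> nat \<Rightarrow> nat \<Rightarrow> ereal" where
  "wdist g u v = (INF p\<in>{p. is_path g u v p}. ereal (path_weight g p))"


section \<open>Decremental APSP data structures\<close>

datatype ds_op =
    IncreaseEdgeWeight nat nat real
  | QueryDistance nat nat
  | QueryPath nat nat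

fun apply_op :: "wgraph \<Rightarrow> ds_op \<Rightarrow> wgraph" where
  "apply_op g (IncreaseEdgeWeight u v d) = g\<lparr>wt := (wt g)({u, v} := wt g {u, v} + d)\<rparr>"
| "apply_op g (QueryDistance u v) = g"
| "apply_op g (QueryPath u v) = g"

definition current :: "wgraph \<Rightarrow> ds_op list \<Rightarrow> wgraph" where
  "current g h = foldl apply_op g h"

fun legal_op :: "wgraph \<Rightarrow> ds_op \<Rightarrow> bool" where
  "legal_op g (IncreaseEdgeWeight u v d) \<longleftrightarrow> {u, v} \<in> edges g \<and> 0 < d"
| "legal_op g (QueryDistance u v) \<longleftrightarrow> u < nverts g \<and> v < nverts g"
| "legal_op g (QueryPath u v) \<longleftrightarrow> u < nverts g \<and> v < nverts g \<and> wdist g u v < \<infinity>"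

fun legal :: "wgraph \<Rightarrow> ds_op list \<Rightarrow> bool" where
  "legal g [] \<longleftrightarrow> True"
| "legal g (x # h) \<longleftrightarrow> legal_op g x \<and> legal (apply_op g x) h"

text \<open>A data structure is represented by its observable behaviour: its answer to a query, as a
  function of the graph it was initialized on, the chronological list of all earlier operations
  (updates and queries), and the queried pair.  The internal state is thus arbitrary.\<close>

record apsp_ds =
  ds_dist :: "wgraph \<Rightarrow> ds_op list \<Rightarrow> nat \<Rightarrow> nat \<Rightarrow> ereal"
  ds_path :: "wgraph \<Rightarrow> ds_op list \<Rightarrow> nat \<Rightarrow> nat \<Rightarrow> nat list"

text \<open>The last two conjuncts say that the estimate does not change between updates, so that a path
  query has the weight reported by a preceding distance query.\<close>

definition approx_apsp :: "real \<Rightarrow> apsp_ds \<Rightarrow> bool" where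
  "approx_apsp \<alpha> D \<longleftrightarrow>
     (\<forall>g h u v. wf_wgraph g \<and> legal g h \<and> u < nverts g \<and> v < nverts g \<longrightarrow>
        wdist (current g h) u v \<le> ds_dist D g h u v \<and>
        ds_dist D g h u v \<le> ereal \<alpha> * wdist (current g h) u v \<and>
        (wdist (current g h) u v < \<infinity> \<longrightarrow>
           is_path (current g h) u v (ds_path D g h u v) \<and>
           ereal (path_weight (current g h) (ds_path D g h u v)) = ds_dist D g h u v) \<and>
        (\<forall>x y. legal_op (current g h) (QueryDistance x y) \<longrightarrow>
           ds_dist D g (h @ [QueryDistance x y]) u v = ds_dist D g h u v) \<and>
        (\<forall>x y. legal_op (current g h) (QueryPath x y) \<longrightarrow>
           ds_dist D g (h @ [QueryPath x y]) u v = ds_dist D g h u v))"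


section \<open>The machine model\<close>

text \<open>
  A real RAM with access to one decremental APSP data structure.  There are integer and real
  variables and (zero-initialized, unbounded) integer and real arrays, all named by numbers.
  Integers are machine words: no stored integer may exceed the bound \<open>W\<close> below, which will be
  polynomial in the number of vertices (words of logarithmic length).  Reals are exact and
  support field operations and comparison.  There is no conversion from reals to integers, and
  the only constants are natural numbers; otherwise one could hide unbounded computation or
  advice in unit-cost steps.
\<close>

datatype iexp =
    IConst nat | IVar nat | IGet nat iexp
  | IAdd iexp iexp | ISub iexp iexp | IMul iexp iexp | IDiv iexp iexp | IMod iexp iexp

datatype rexp =
    ROfInt iexp | RVar nat | RGet nat iexp
  | RAdd rexp rexp | RSub rexp rexp | RMul rexp rexp | RDiv rexp rexp

datatype bexp =
    ILess iexp iexp | RLess rexp rexp | BNot bexp | BAnd bexp bexp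

text \<open>
  \<open>DSInit N k a a' w\<close> initializes the data structure on the graph with vertices \<open>0, \<dots>, N - 1\<close> and
  \<open>k\<close> edges, the \<open>i\<close>-th of which joins \<open>a[i]\<close> and \<open>a'[i]\<close> and has weight \<open>w[i]\<close>.
  \<open>DSDist r x u v\<close> stores the estimate in the real variable \<open>r\<close> and sets the integer variable \<open>x\<close>
  to 1, or to 0 if the estimate is infinite.
  \<open>DSPath a x u v\<close> stores the vertices of the path in the integer array \<open>a\<close> and their number
  in \<open>x\<close>.
\<close>

datatype com =
    Skip
  | IAssign nat iexp
  | RAssign nat rexp
  | IPut nat iexp iexp
  | RPut nat iexp rexp
  | Seq com com
  | Cond bexp com com
  | While bexp com
  | DSInit iexp iexp nat nat nat
  | DSIncrease iexp iexp rexp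
  | DSDist nat nat iexp iexp
  | DSPath nat nat iexp iexp

record mstate =
  ivar :: "nat \<Rightarrow> nat"
  rvar :: "nat \<Rightarrow> real"
  iarr :: "nat \<Rightarrow> nat \<Rightarrow> nat"
  rarr :: "nat \<Rightarrow> nat \<Rightarrow> real"
  dstr :: "(wgraph \<times> ds_op list) option"

fun ieval :: "iexp \<Rightarrow> mstate \<Rightarrow> nat" where
  "ieval (IConst k) s = k"
| "ieval (IVar x) s = ivar s x"
| "ieval (IGet a i) s = iarr s a (ieval i s)"
| "ieval (IAdd e f) s = ieval e s + ieval f s"
| "ieval (ISub e f) s = ieval e s - ieval f s"
| "ieval (IMul e f) s = ieval e s * ieval f s"
| "ieval (IDiv e f) s = ieval e s div ieval f s"
| "ieval (IMod e f) s = ieval e s mod ieval f s"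

fun reval :: "rexp \<Rightarrow> mstate \<Rightarrow> real" where
  "reval (ROfInt e) s = real (ieval e s)"
| "reval (RVar x) s = rvar s x"
| "reval (RGet a i) s = rarr s a (ieval i s)"
| "reval (RAdd e f) s = reval e s + reval f s"
| "reval (RSub e f) s = reval e s - reval f s"
| "reval (RMul e f) s = reval e s * reval f s"
| "reval (RDiv e f) s = reval e s / reval f s"

fun beval :: "bexp \<Rightarrow> mstate \<Rightarrow> bool" where
  "beval (ILess e f) s \<longleftrightarrow> ieval e s < ieval f s"
| "beval (RLess e f) s \<longleftrightarrow> reval e s < reval f s"
| "beval (BNot c) s \<longleftrightarrow> \<not> beval c s"
| "beval (BAnd c d) s \<longleftrightarrow> beval c s \<and> beval d s"

definition set_ivar :: "nat \<Rightarrow> nat \<Rightarrow> mstate \<Rightarrow> mstate" where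
  "set_ivar x k s = s\<lparr>ivar := (ivar s)(x := k)\<rparr>"

definition set_rvar :: "nat \<Rightarrow> real \<Rightarrow> mstate \<Rightarrow> mstate" where
  "set_rvar x r s = s\<lparr>rvar := (rvar s)(x := r)\<rparr>"

definition set_iarr :: "nat \<Rightarrow> nat \<Rightarrow> nat \<Rightarrow> mstate \<Rightarrow> mstate" where
  "set_iarr a i k s = s\<lparr>iarr := (iarr s)(a := (iarr s a)(i := k))\<rparr>"

definition set_rarr :: "nat \<Rightarrow> nat \<Rightarrow> real \<Rightarrow> mstate \<Rightarrow> mstate" where
  "set_rarr a i r s = s\<lparr>rarr := (rarr s)(a := (rarr s a)(i := r))\<rparr>"

definition write_list :: "nat \<Rightarrow> nat list \<Rightarrow> mstate \<Rightarrow> mstate" where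
  "write_list a p s = s\<lparr>iarr := (iarr s)(a := (\<lambda>i. if i < length p then p ! i else iarr s a i))\<rparr>"

definition array_graph :: "mstate \<Rightarrow> nat \<Rightarrow> nat \<Rightarrow> nat \<Rightarrow> nat \<Rightarrow> nat \<Rightarrow> wgraph" where
  "array_graph s N k a a' w =
     \<lparr>nverts = N,
      edges = (\<lambda>i. {iarr s a i, iarr s a' i}) ` {..<k},
      wt = (\<lambda>e. \<Sum>i | i < k \<and> {iarr s a i, iarr s a' i} = e. rarr s w i)\<rparr>"

text \<open>
  \<open>exec D W c s t u q s'\<close>: started in \<open>s\<close>, the program \<open>c\<close> halts in \<open>s'\<close> after time \<open>t\<close>, having
  performed \<open>u\<close> updates and \<open>q\<close> queries of the data structure.  Every assignment, test and
  call of the data structure takes one time step (expressions in a fixed program have bounded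
  size), plus the size of the initial graph or of the reported path.  The time does not include
  the time spent inside the data structure.  There is no rule for storing an integer
  exceeding \<open>W\<close>, for illegal operations and for initializing the data structure twice, so
  a program doing so has no execution.
\<close>

inductive exec ::
  "apsp_ds \<Rightarrow> nat \<Rightarrow> com \<Rightarrow> mstate \<Rightarrow> nat \<Rightarrow> nat \<Rightarrow> nat \<Rightarrow> mstate \<Rightarrow> bool"
  for D :: apsp_ds and W :: nat
where
  Skip: "exec D W Skip s 1 0 0 s"
| IAssign: "ieval e s \<le> W \<Longrightarrow> exec D W (IAssign x e) s 1 0 0 (set_ivar x (ieval e s) s)"
| RAssign: "exec D W (RAssign x e) s 1 0 0 (set_rvar x (reval e s) s)"
| IPut: "ieval e s \<le> W \<Longrightarrow>
    exec D W (IPut a i e) s 1 0 0 (set_iarr a (ieval i s) (ieval e s) s)"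
| RPut: "exec D W (RPut a i e) s 1 0 0 (set_rarr a (ieval i s) (reval e s) s)"
| Seq: "exec D W c1 s1 t1 u1 q1 s2 \<Longrightarrow> exec D W c2 s2 t2 u2 q2 s3 \<Longrightarrow>
    exec D W (Seq c1 c2) s1 (t1 + t2) (u1 + u2) (q1 + q2) s3"
| CondTrue: "beval b s \<Longrightarrow> exec D W c1 s t u q s' \<Longrightarrow> exec D W (Cond b c1 c2) s (Suc t) u q s'"
| CondFalse: "\<not> beval b s \<Longrightarrow> exec D W c2 s t u q s' \<Longrightarrow> exec D W (Cond b c1 c2) s (Suc t) u q s'"
| WhileFalse: "\<not> beval b s \<Longrightarrow> exec D W (While b c) s 1 0 0 s"
| WhileTrue: "beval b s1 \<Longrightarrow> exec D W c s1 t1 u1 q1 s2 \<Longrightarrow>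
    exec D W (While b c) s2 t2 u2 q2 s3 \<Longrightarrow>
    exec D W (While b c) s1 (Suc (t1 + t2)) (u1 + u2) (q1 + q2) s3"
| DSInit: "dstr s = None \<Longrightarrow> ieval N s \<le> W \<Longrightarrow>
    g = array_graph s (ieval N s) (ieval k s) a a' w \<Longrightarrow> wf_wgraph g \<Longrightarrow>
    inj_on (\<lambda>i. {iarr s a i, iarr s a' i}) {..<ieval k s} \<Longrightarrow>
    exec D W (DSInit N k a a' w) s (1 + ieval k s) 0 0 (s\<lparr>dstr := Some (g, [])\<rparr>)"
| DSIncrease: "dstr s = Some (g, h) \<Longrightarrow> op = IncreaseEdgeWeight (ieval e s) (ieval f s) (reval d s) \<Longrightarrow>
    legal_op (current g h) op \<Longrightarrow>
    exec D W (DSIncrease e f d) s 1 1 0 (s\<lparr>dstr := Some (g, h @ [op])\<rparr>)"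
| DSDist: "dstr s = Some (g, h) \<Longrightarrow> op = QueryDistance (ieval e s) (ieval f s) \<Longrightarrow>
    legal_op (current g h) op \<Longrightarrow>
    d = ds_dist D g h (ieval e s) (ieval f s) \<Longrightarrow>
    exec D W (DSDist r x e f) s 1 0 1
      (set_rvar r (real_of_ereal d) (set_ivar x (if d = \<infinity> then 0 else 1)
        (s\<lparr>dstr := Some (g, h @ [op])\<rparr>)))"
| DSPath: "dstr s = Some (g, h) \<Longrightarrow> op = QueryPath (ieval e s) (ieval f s) \<Longrightarrow>
    legal_op (current g h) op \<Longrightarrow>
    p = ds_path D g h (ieval e s) (ieval f s) \<Longrightarrow>
    exec D W (DSPath a x e f) s (1 + length p) 0 1
      (write_list a p (set_ivar x (length p) (s\<lparr>dstr := Some (g, h @ [op])\<rparr>)))"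

inductive_cases exec_cases:
  "exec D W Skip s t u q s'" "exec D W (IAssign x e) s t u q s'" "exec D W (RAssign x r) s t u q s'"
  "exec D W (IPut a i e) s t u q s'" "exec D W (RPut a i r) s t u q s'"
  "exec D W (Seq c1 c2) s t u q s'" "exec D W (Cond b c1 c2) s t u q s'"
  "exec D W (While b c) s t u q s'"
  "exec D W (DSInit N k a a' w) s t u q s'" "exec D W (DSIncrease e f r) s t u q s'"
  "exec D W (DSDist x y e f) s t u q s'" "exec D W (DSPath x y e f) s t u q s'"

text \<open>Programs are deterministic, so an execution that exists is the only one.\<close>

lemma exec_deterministic:
  assumes "exec D W c s t u q s'" and "exec D W c s t2 u2 q2 s2"
  shows "t2 = t \<and> u2 = u \<and> q2 = q \<and> s2 = s'"
  using assms
proof (induction arbitrary: t2 u2 q2 s2 rule: exec.induct)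
  case (Seq c1 s1 t1 u1 q1 s2' c2 t2' u2' q2' s3)
  from Seq.prems show ?case
    by (rule exec_cases) (use Seq.IH in blast)
next
  case (CondTrue b s c1 t u q s' c2)
  from CondTrue.prems show ?case
    by (rule exec_cases) (use CondTrue in blast)+
next
  case (CondFalse b s c2 t u q s' c1)
  from CondFalse.prems show ?case
    by (rule exec_cases) (use CondFalse in blast)+
next
  case (WhileTrue b s1 c t1 u1 q1 s2' t2' u2' q2' s3)
  from WhileTrue.prems show ?case
    by (rule exec_cases) (use WhileTrue in blast)+
qed (auto elim: exec_cases)


section \<open>Input and output\<close>

text \<open>A graph on \<open>{..<n}\<close> is given by an arbitrary listing of its edges without repetition.\<close>

definition lists_edges :: "(nat \<times> nat) list \<Rightarrow> nat set set \<Rightarrow> bool" where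
  "lists_edges es E \<longleftrightarrow> E = (\<lambda>(u, v). {u, v}) ` set es \<and> length es = card E"

definition input_state :: "nat \<Rightarrow> (nat \<times> nat) list \<Rightarrow> real \<Rightarrow> real \<Rightarrow> real \<Rightarrow> mstate" where
  "input_state n es \<alpha> \<phi> b =
     \<lparr>ivar = (\<lambda>_. 0)(0 := n, 1 := length es),
      rvar = (\<lambda>_. 0)(0 := \<alpha>, 1 := \<phi>, 2 := b),
      iarr = (\<lambda>_ _. 0)(0 := (\<lambda>i. if i < length es then fst (es ! i) else 0),
                       1 := (\<lambda>i. if i < length es then snd (es ! i) else 0)),
      rarr = (\<lambda>_ _. 0),
      dstr = None\<rparr>"

text \<open>\<open>Some S\<close> is the cut returned by the algorithm, \<open>None\<close> is the assertion that every
  sufficiently balanced cut has large conductance.\<close>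

definition returned :: "nat \<Rightarrow> mstate \<Rightarrow> nat set option" where
  "returned n s = (if ivar s 0 = 0 then None else Some {v. v < n \<and> iarr s 0 v = 1})"

end

theory Submission
  imports Defs
begin

text \<open>
  The cut-matching game is replaced by one fixed expander.  Split every edge into two slots, one per
  endpoint, so that volumes count slots, and pull the explicit expander given by four affine maps on
  the torus $(\mathbb{Z}/k)^2$ with $k^2 = \Theta(m)$ back to a list of $\Theta(m)$ vertex pairs: every
  cut separates a number of pairs proportional to the smaller volume.  The pairs are routed along
  approximately shortest paths in levels $p = 1, 2, 4, \dots$, up to $1/(4b)$.  At level $p$ a pair is
  routed if its estimated distance is at most $\alpha L p$ with $L = \Theta(\log n / \phi)$, and an
  edge doubles its weight whenever $\kappa = \Theta(\alpha L \log (1/b))$ paths have used it.  A path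
  thus pays at most $\alpha L p$ for a growth of the total weight that is smaller by a factor $\kappa$,
  so that the total weight stays linear in $m$ at all levels.

  If more than $4N/p$ of the pairs stay unrouted at level $p$, with $N = 2m$, then their ends are more
  than $L p$ apart, and growing balls in the weighted graph yields a cut that is sparse and, since no
  ball contains both ends of such a pair, has volume $\Omega(N/p)$ on both sides.  Otherwise the
  number of unrouted pairs halves from level to level and ends below a fraction of $b N$.  Then a cut
  of volumes $\Omega(bN)$ is crossed by many routed paths, while an edge of weight $2^g$ carries at
  most $(\kappa + 1)(g + 1)$ of them, which bounds the conductance of the cut from below.
\<close>

section \<open>Expansion of the affine maps on the discrete torus\<close>

text \<open>Why there are levels at all: only paths of length about L / b can expose a cut whose
  smaller side has volume b N, but sending all pairs that far would cost a factor 1 / b. At level p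
  only O(N / p) pairs are left and each pays O(\<alpha> L p), so every level costs O(\<alpha> L N).
  On the other side, in a graph of total weight O(N) a ball of radius about L p has at some moment a
  boundary of O(N log n / (L p)) = O(\<phi> N / p) edges, which is sparse exactly against a side of
  volume N / p. Path length, number of waiting pairs and size of the smaller side are thus tied to
  one parameter.

  The machine shapes the rest. It cannot round reals, so roots, logarithms and the number of levels
  are found by counting loops. Weights are powers of two held as integers, so a ball can grow by a
  wave that advances one unit per tick; the total weight pays for the ticks, and no priority queue
  is needed. The expander has to be computable by such a program, and its expansion is proved by
  Fourier analysis, where shears of the torus become shears of frequencies.\<close>

lemma sum_int_shift:
  fixes g :: "int \<Rightarrow> 'b::comm_monoid_add"
  assumes k: "0 < k" and per: "\<And>x. g (x mod k) = g x"
  shows "(\<Sum>x\<in>{c..<c+k}. g (x + a)) = (\<Sum>x\<in>{0..<k}. g x)"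
proof -
  have b: "bij_betw (\<lambda>x. (x + a) mod k) {c..<c+k} {0..<k}"
  proof (rule bij_betw_byWitness[where f' = "\<lambda>y. c + (y - a - c) mod k"])
    show "\<forall>x\<in>{c..<c+k}. c + ((x + a) mod k - a - c) mod k = x"
    proof
      fix x assume x: "x \<in> {c..<c+k}"
      have "((x + a) mod k - a - c) mod k = (x - c) mod k"
        by (metis (no_types, opaque_lifting) add_diff_cancel_right' diff_diff_eq mod_diff_left_eq)
      with x show "c + ((x + a) mod k - a - c) mod k = x" by simp
    qed
    show "\<forall>y\<in>{0..<k}. (c + (y - a - c) mod k + a) mod k = y"
    proof
      fix y assume y: "y \<in> {0..<k}"
      have "(c + (y - a - c) mod k + a) mod k = (c + a + (y - a - c) mod k) mod k"
        by (simp add: algebra_simps)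
      also have "\<dots> = (c + a + (y - a - c)) mod k" by (rule mod_add_right_eq)
      finally show "(c + (y - a - c) mod k + a) mod k = y" using y by simp
    qed
  qed (use k in auto)
  have "(\<Sum>x\<in>{c..<c+k}. g (x + a)) = (\<Sum>x\<in>{c..<c+k}. g ((x + a) mod k))" by (simp add: per)
  also have "\<dots> = (\<Sum>x\<in>{0..<k}. g x)" by (rule sum.reindex_bij_betw[OF b])
  finally show ?thesis .
qed

lemma sum_int_window:
  fixes g :: "int \<Rightarrow> 'b::comm_monoid_add"
  assumes "0 < k" and "\<And>x. g (x mod k) = g x"
  shows "(\<Sum>x\<in>{c..<c+k}. g x) = (\<Sum>x\<in>{0..<k}. g x)"
  using sum_int_shift[where g = g and a = 0 and c = c, OF assms(1)] assms(2) by simp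

section \<open>Characters of Z/k and the discrete Fourier transform on the torus\<close>

definition echar :: "int \<Rightarrow> int \<Rightarrow> complex" where
  "echar k t = cis (2 * pi * real_of_int t / real_of_int k)"

lemma echar_add: "echar k (s + t) = echar k s * echar k t"
  by (simp add: echar_def cis_mult distrib_left add_divide_distrib)

lemma norm_echar [simp]: "cmod (echar k t) = 1"
  by (simp add: echar_def)

lemma echar_multiple: "k \<noteq> 0 \<Longrightarrow> echar k (k * t) = 1"
  using cis_multiple_2pi[of "real_of_int t"] by (simp add: echar_def mult.assoc)

lemma echar_mod: assumes "k \<noteq> 0" shows "echar k (t mod k) = echar k t"
proof -
  have "echar k t = echar k (k * (t div k) + t mod k)" by simp
  also have "\<dots> = echar k (t mod k)"
    unfolding echar_add using echar_multiple[OF assms, of "t div k"] by simp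
  finally show ?thesis by simp
qed

lemma echar_cong: "0 < k \<Longrightarrow> s mod k = t mod k \<Longrightarrow> echar k s = echar k t"
  by (metis echar_mod less_irrefl)

lemma echar_minus: "echar k (- t) = cnj (echar k t)"
  by (simp add: echar_def cis_cnj)

lemma norm_one_minus_echar: "(cmod (1 - echar k t))\<^sup>2 = 2 - 2 * cos (2 * pi * real_of_int t / real_of_int k)"
  using sin_cos_squared_add[of "2 * pi * real_of_int t / real_of_int k"]
  unfolding echar_def cmod_power2 by (simp add: power2_eq_square algebra_simps)

text \<open>The cutoff k/6 is where the cosine reaches 1/2. Beyond it a translation moves the
  character by at least 1 in norm, which lets translations control all large frequencies.\<close>

lemma norm_one_minus_echar_ge:
  assumes "0 < k" "k \<le> 6 * \<bar>t\<bar>" "2 * \<bar>t\<bar> \<le> k"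
  shows "1 \<le> (cmod (1 - echar k t))\<^sup>2"
proof -
  let ?x = "2 * pi * \<bar>real_of_int t\<bar> / real_of_int k"
  have "real_of_int k \<le> 6 * \<bar>real_of_int t\<bar>" using assms(2) by linarith
  hence "pi / 3 \<le> ?x" using assms(1) by (simp add: field_simps)
  moreover have "?x \<le> pi"
  proof -
    have "2 * \<bar>real_of_int t\<bar> \<le> real_of_int k" using assms(3) by linarith
    thus ?thesis using assms(1) by (simp add: field_simps)
  qed
  ultimately have "cos ?x \<le> cos (pi / 3)" by (intro cos_monotone_0_pi_le) auto
  moreover have "cos (2 * pi * real_of_int t / real_of_int k) = cos ?x"
    by (cases "t \<ge> 0") (auto simp: abs_if)
  ultimately show ?thesis by (simp add: norm_one_minus_echar cos_60)
qed

text \<open>Shifting the summation variable multiplies the geometric sum by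
  \<open>echar k t\<close>, which is 1 only if k divides t.\<close>

lemma sum_echar:
  assumes "0 < k" "\<bar>t\<bar> < k"
  shows "(\<Sum>a\<in>{0..<k}. echar k (a * t)) = (if t = 0 then of_int k else 0)"
proof (cases "t = 0")
  case True
  then show ?thesis using assms by (simp add: echar_def)
next
  case False
  let ?S = "\<Sum>a\<in>{0..<k}. echar k (a * t)"
  have per: "echar k (x mod k * t) = echar k (x * t)" for x
    using echar_mod[of k "x mod k * t"] echar_mod[of k "x * t"] assms by (simp add: mod_mult_left_eq)
  have "?S = (\<Sum>a\<in>{0..<0+k}. echar k ((a + 1) * t))"
    using sum_int_shift[where g = "\<lambda>a. echar k (a * t)" and c = 0 and a = 1, OF assms(1) per] by simp
  also have "\<dots> = echar k t * ?S"
  proof -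
    have "(a + 1) * t = t + a * t" for a by (simp add: algebra_simps)
    thus ?thesis by (simp add: echar_add sum_distrib_left)
  qed
  finally have "(1 - echar k t) * ?S = 0" by (simp add: algebra_simps)
  moreover have "echar k t \<noteq> 1"
  proof
    assume "echar k t = 1"
    hence "cos (2 * pi * real_of_int t / real_of_int k) = 1" by (simp add: echar_def complex_eq_iff)
    then obtain j :: int where "2 * pi * real_of_int t / real_of_int k = real_of_int j * 2 * pi"
      using cos_one_2pi_int by blast
    hence "real_of_int t = real_of_int j * real_of_int k" using assms(1) by (simp add: field_simps)
    hence "t = j * k" by (metis of_int_eq_iff of_int_mult)
    hence "k dvd t" by simp
    with False assms show False by (meson dvd_imp_le_int not_less abs_ge_self order.trans)
  qed
  ultimately show ?thesis using False by simp
qed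

text \<open>The square is expanded and the frequencies are summed first; orthogonality of the
  characters leaves the diagonal.\<close>

lemma parseval:
  fixes g :: "int \<Rightarrow> complex"
  assumes k: "0 < k"
  shows "(\<Sum>a\<in>{0..<k}. (cmod (\<Sum>x\<in>{0..<k}. g x * echar k (a * x)))\<^sup>2)
    = of_int k * (\<Sum>x\<in>{0..<k}. (cmod (g x))\<^sup>2)"
proof -
  have "complex_of_real (\<Sum>a\<in>{0..<k}. (cmod (\<Sum>x\<in>{0..<k}. g x * echar k (a * x)))\<^sup>2)
     = (\<Sum>a\<in>{0..<k}. (\<Sum>x\<in>{0..<k}. g x * echar k (a * x)) * cnj (\<Sum>x\<in>{0..<k}. g x * echar k (a * x)))"
    by (simp only: of_real_sum complex_norm_square)
  also have "\<dots> = (\<Sum>a\<in>{0..<k}. \<Sum>x\<in>{0..<k}. \<Sum>y\<in>{0..<k}. g x * cnj (g y) * echar k (a * (x - y)))"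
  proof -
    have "g x * echar k (a * x) * cnj (g y * echar k (a * y)) = g x * cnj (g y) * echar k (a * (x - y))" for a x y
      using echar_add[of k "a * x" "- (a * y)"] by (simp add: echar_minus right_diff_distrib)
    thus ?thesis by (simp only: sum_product cnj_sum)
  qed
  also have "\<dots> = (\<Sum>x\<in>{0..<k}. \<Sum>y\<in>{0..<k}. \<Sum>a\<in>{0..<k}. g x * cnj (g y) * echar k (a * (x - y)))"
    by (subst sum.swap, rule sum.cong[OF refl], rule sum.swap)
  also have "\<dots> = (\<Sum>x\<in>{0..<k}. \<Sum>y\<in>{0..<k}. g x * cnj (g y) * (if y = x then of_int k else 0))"
  proof (intro sum.cong refl)
    fix x y assume "x \<in> {0..<k}" "y \<in> {0..<k}"
    hence "\<bar>x - y\<bar> < k" by auto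
    thus "(\<Sum>a\<in>{0..<k}. g x * cnj (g y) * echar k (a * (x - y))) = g x * cnj (g y) * (if y = x then of_int k else 0)"
      using sum_echar[of k "x - y"] k by (simp add: sum_distrib_left[symmetric])
  qed
  also have "\<dots> = (\<Sum>x\<in>{0..<k}. g x * cnj (g x) * of_int k)"
    by (intro sum.cong refl) (simp add: if_distrib cong: if_cong)
  also have "\<dots> = complex_of_real (of_int k * (\<Sum>x\<in>{0..<k}. (cmod (g x))\<^sup>2))"
    by (simp only: of_real_mult of_real_sum complex_norm_square sum_distrib_left of_real_of_int_eq mult_ac)
  finally show ?thesis by (simp only: of_real_eq_iff)
qed

definition dft :: "int \<Rightarrow> (int \<Rightarrow> int \<Rightarrow> real) \<Rightarrow> int \<Rightarrow> int \<Rightarrow> complex" where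
  "dft k f a b = (\<Sum>x\<in>{0..<k}. \<Sum>y\<in>{0..<k}. of_real (f x y) * echar k (a * x + b * y))"

lemma dft_mod:
  assumes "0 < k" shows "dft k f (a mod k) (b mod k) = dft k f a b"
proof -
  have "echar k (a mod k * x + b mod k * y) = echar k (a * x + b * y)" for x y
    by (rule echar_cong[OF assms], rule mod_add_cong) (simp_all add: mod_mult_left_eq)
  thus ?thesis by (simp add: dft_def)
qed

lemma parseval2:
  assumes k: "0 < k"
  shows "(\<Sum>a\<in>{0..<k}. \<Sum>b\<in>{0..<k}. (cmod (dft k f a b))\<^sup>2)
    = (real_of_int k)\<^sup>2 * (\<Sum>x\<in>{0..<k}. \<Sum>y\<in>{0..<k}. (f x y)\<^sup>2)"
proof -
  have *: "dft k f a b = (\<Sum>y\<in>{0..<k}. (\<Sum>x\<in>{0..<k}. of_real (f x y) * echar k (a * x)) * echar k (b * y))" for a b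
    unfolding dft_def by (subst sum.swap) (simp add: echar_add sum_distrib_right mult.assoc)
  have "(\<Sum>a\<in>{0..<k}. \<Sum>b\<in>{0..<k}. (cmod (dft k f a b))\<^sup>2)
     = (\<Sum>a\<in>{0..<k}. real_of_int k * (\<Sum>y\<in>{0..<k}. (cmod (\<Sum>x\<in>{0..<k}. of_real (f x y) * echar k (a * x)))\<^sup>2))"
    unfolding * by (simp only: parseval[OF k])
  also have "\<dots> = real_of_int k * (\<Sum>y\<in>{0..<k}. \<Sum>a\<in>{0..<k}. (cmod (\<Sum>x\<in>{0..<k}. of_real (f x y) * echar k (a * x)))\<^sup>2)"
    unfolding sum_distrib_left[symmetric] by (subst sum.swap) simp
  also have "\<dots> = real_of_int k * (\<Sum>y\<in>{0..<k}. real_of_int k * (\<Sum>x\<in>{0..<k}. (f x y)\<^sup>2))"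
    unfolding parseval[OF k] by simp
  also have "\<dots> = (real_of_int k)\<^sup>2 * (\<Sum>y\<in>{0..<k}. \<Sum>x\<in>{0..<k}. (f x y)\<^sup>2)"
    by (simp add: sum_distrib_left power2_eq_square mult.assoc)
  finally show ?thesis using sum.swap[of "\<lambda>x y. (f x y)\<^sup>2" "{0..<k}" "{0..<k}"] by simp
qed

lemma dft_diff: "dft k (\<lambda>x y. f x y - g x y) a b = dft k f a b - dft k g a b"
  by (simp add: dft_def sum_subtractf left_diff_distrib)

text \<open>A shear of space acts on frequencies as the inverse transposed shear. This duality is
  what makes the affine maps tractable.\<close>

lemma dft_shear1:
  assumes k: "0 < k" and per: "\<And>x y. f (x mod k) y = f x y"
  shows "dft k (\<lambda>x y. f (x + y) y) a (a + b) = dft k f a b"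
proof -
  have "dft k (\<lambda>x y. f (x + y) y) a (a + b)
    = (\<Sum>y\<in>{0..<k}. \<Sum>x\<in>{0..<0+k}. of_real (f (x + y) y) * echar k (a * (x + y) + b * y))"
    unfolding dft_def by (subst sum.swap) (simp add: algebra_simps)
  also have "\<dots> = (\<Sum>y\<in>{0..<k}. \<Sum>x\<in>{0..<k}. of_real (f x y) * echar k (a * x + b * y))"
  proof (rule sum.cong[OF refl])
    fix y
    have "echar k (a * (x mod k) + b * y) = echar k (a * x + b * y)" for x
      by (rule echar_cong[OF k], rule mod_add_cong) (simp_all add: mod_mult_right_eq)
    thus "(\<Sum>x\<in>{0..<0+k}. of_real (f (x + y) y) * echar k (a * (x + y) + b * y))
      = (\<Sum>x\<in>{0..<k}. of_real (f x y) * echar k (a * x + b * y))"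
      by (intro sum_int_shift[where g = "\<lambda>x. of_real (f x y) * echar k (a * x + b * y)"]) (simp_all add: k per)
  qed
  finally show ?thesis unfolding dft_def by (subst sum.swap)
qed

lemma dft_swap: "dft k (\<lambda>x y. f y x) a b = dft k f b a"
  unfolding dft_def by (subst sum.swap) (simp add: add.commute)

lemma dft_translate:
  assumes k: "0 < k" and per: "\<And>x y. f (x mod k) y = f x y"
  shows "dft k (\<lambda>x y. f (x + 1) y) a b = echar k (- a) * dft k f a b"
proof -
  have "dft k (\<lambda>x y. f (x + 1) y) a b
    = (\<Sum>y\<in>{0..<k}. \<Sum>x\<in>{0..<0+k}. of_real (f (x + 1) y) * echar k (a * (x + 1 - 1) + b * y))"
    unfolding dft_def by (subst sum.swap) simp
  also have "\<dots> = (\<Sum>y\<in>{0..<k}. \<Sum>x\<in>{0..<k}. of_real (f x y) * echar k (a * (x - 1) + b * y))"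
  proof (rule sum.cong[OF refl])
    fix y
    have "echar k (a * (x mod k - 1) + b * y) = echar k (a * (x - 1) + b * y)" for x
    proof (rule echar_cong[OF k])
      have "a * ((x mod k - 1) mod k) mod k = a * ((x - 1) mod k) mod k" by (simp add: mod_simps)
      hence "(a * (x mod k - 1)) mod k = (a * (x - 1)) mod k" by (simp add: mod_mult_right_eq)
      thus "(a * (x mod k - 1) + b * y) mod k = (a * (x - 1) + b * y) mod k" by (metis mod_add_left_eq)
    qed
    thus "(\<Sum>x\<in>{0..<0+k}. of_real (f (x + 1) y) * echar k (a * (x + 1 - 1) + b * y))
      = (\<Sum>x\<in>{0..<k}. of_real (f x y) * echar k (a * (x - 1) + b * y))"
      by (intro sum_int_shift[where g = "\<lambda>x. of_real (f x y) * echar k (a * (x - 1) + b * y)"]) (simp_all add: k per)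
  qed
  also have "\<dots> = (\<Sum>y\<in>{0..<k}. \<Sum>x\<in>{0..<k}. echar k (- a) * (of_real (f x y) * echar k (a * x + b * y)))"
  proof -
    have "echar k (a * (x - 1) + b * y) = echar k (- a) * echar k (a * x + b * y)" for x y
      by (simp add: echar_add[symmetric] algebra_simps)
    thus ?thesis by (simp add: mult_ac)
  qed
  also have "\<dots> = echar k (- a) * dft k f a b"
    unfolding dft_def by (subst sum.swap) (simp add: sum_distrib_left)
  finally show ?thesis .
qed

text \<open>Representatives of the residues centred at 0, so that signs and absolute values of
  frequencies make sense.\<close>

definition window :: "int \<Rightarrow> int set" where
  "window k = {- ((k - 1) div 2)..< - ((k - 1) div 2) + k}"

lemma window_abs: "t \<in> window k \<Longrightarrow> 2 * \<bar>t\<bar> \<le> k"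
  by (auto simp: window_def abs_if)

lemma in_window: "2 * \<bar>t\<bar> < k \<Longrightarrow> t \<in> window k"
  by (cases "t < 0"; simp add: window_def; presburger)

lemma finite_window [simp]: "finite (window k)"
  by (simp add: window_def)

lemma sum_window:
  fixes g :: "int \<Rightarrow> 'b::comm_monoid_add"
  assumes "0 < k" and "\<And>x. g (x mod k) = g x"
  shows "(\<Sum>x\<in>window k. g x) = (\<Sum>x\<in>{0..<k}. g x)"
  unfolding window_def by (rule sum_int_window) (use assms in auto)

lemma sum_window2:
  fixes g :: "int \<Rightarrow> int \<Rightarrow> 'b::comm_monoid_add"
  assumes "0 < k" and "\<And>x y. g (x mod k) (y mod k) = g x y"
  shows "(\<Sum>x\<in>window k. \<Sum>y\<in>window k. g x y) = (\<Sum>x\<in>{0..<k}. \<Sum>y\<in>{0..<k}. g x y)"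
proof -
  have 1: "g (x mod k) y = g x y" "g x (y mod k) = g x y" for x y
    using assms(2)[of "x mod k" y] assms(2)[of x "y mod k"] assms(2)[of x y] by simp_all
  show ?thesis
    using sum_window[OF assms(1), where g = "\<lambda>x. \<Sum>y\<in>{0..<k}. g x y"] 1
      sum_window[OF assms(1), where g = "g x" for x] by simp
qed

lemma sum_window2_shear:
  fixes g :: "int \<Rightarrow> int \<Rightarrow> 'b::comm_monoid_add"
  assumes "0 < k" and "\<And>x y. g (x mod k) (y mod k) = g x y"
  shows "(\<Sum>x\<in>window k. \<Sum>y\<in>window k. g x (x + y)) = (\<Sum>x\<in>{0..<k}. \<Sum>y\<in>{0..<k}. g x y)"
proof -
  have 1: "g (x mod k) y = g x y" "g x (y mod k) = g x y" for x y
    using assms(2)[of "x mod k" y] assms(2)[of x "y mod k"] assms(2)[of x y] by simp_all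
  have "(\<Sum>y\<in>window k. g x (x + y)) = (\<Sum>y\<in>{0..<k}. g x y)" for x
    using sum_int_shift[OF assms(1), where g = "g x" and a = x and c = "- ((k - 1) div 2)"] 1
    by (simp add: add.commute window_def)
  thus ?thesis
    using sum_window[OF assms(1), where g = "\<lambda>x. \<Sum>y\<in>{0..<k}. g x y"] 1 by simp
qed

text \<open>The mixed term is split with weights 1/2 and 2. The point is a first factor below 2,
  because \<open>quadrant_bound\<close> compares each frequency with two others.\<close>

lemma norm_square_le:
  fixes u v :: complex
  shows "(cmod u)\<^sup>2 \<le> 3 / 2 * (cmod v)\<^sup>2 + 3 * (cmod (u - v))\<^sup>2"
proof -
  have "cmod u \<le> cmod v + cmod (u - v)" by (metis add.commute diff_add_cancel norm_triangle_ineq)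
  hence "(cmod u)\<^sup>2 \<le> (cmod v + cmod (u - v))\<^sup>2" by (intro power_mono) auto
  also have "\<dots> \<le> 3 / 2 * (cmod v)\<^sup>2 + 3 * (cmod (u - v))\<^sup>2"
    using zero_le_power2[of "cmod v - 2 * cmod (u - v)"]
    by (simp add: power2_eq_square algebra_simps)
  finally show ?thesis .
qed

text \<open>\<open>G\<close> is the energy at a frequency and \<open>Out\<close> the set of large
  frequencies. Where a and b have the same sign, (a, a + b) has the larger second coordinate in
  absolute value and (a + b, b) the larger first one. So the two shears are injective on P with
  disjoint images, and these stay in P or enter \<open>Out\<close>. Hence twice the energy of P is
  at most 3/2 of that of P and \<open>Out\<close>, up to the errors, and P can be absorbed. The
  mixed quadrants use the inverse shears, and each axis is sent into P or \<open>Out\<close> by one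
  shear.\<close>

lemma quadrant_bound:
  fixes G :: "int \<times> int \<Rightarrow> real" and k :: int
  defines "W \<equiv> window k \<times> window k"
  assumes G0: "\<And>x. 0 \<le> G x" and Gz: "G (0, 0) = 0"
    and S: "\<And>B. B \<subseteq> W \<Longrightarrow> sum G B \<le> 3 / 2 * (\<Sum>(a, b)\<in>B. G (a, a + b)) + 3 * s"
    and T: "\<And>B. B \<subseteq> W \<Longrightarrow> sum G B \<le> 3 / 2 * (\<Sum>(a, b)\<in>B. G (a + b, b)) + 3 * t"
    and S': "\<And>B. B \<subseteq> W \<Longrightarrow> sum G B \<le> 3 / 2 * (\<Sum>(a, b)\<in>B. G (a, b - a)) + 3 * s"
    and T': "\<And>B. B \<subseteq> W \<Longrightarrow> sum G B \<le> 3 / 2 * (\<Sum>(a, b)\<in>B. G (a - b, b)) + 3 * t"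
    and O: "sum G {(a, b) \<in> W. k \<le> 6 * \<bar>a\<bar> \<or> k \<le> 6 * \<bar>b\<bar>} \<le> e"
  shows "sum G W \<le> 19 * e + 33 * (s + t)"
proof -
  define Out where "Out = {(a, b) \<in> W. k \<le> 6 * \<bar>a\<bar> \<or> k \<le> 6 * \<bar>b\<bar>}"
  define P where "P = {(a, b) \<in> W - Out. 0 < a \<and> 0 < b \<or> a < 0 \<and> b < 0}"
  define P' where "P' = {(a, b) \<in> W - Out. 0 < a \<and> b < 0 \<or> a < 0 \<and> 0 < b}"
  define X where "X = {(a, b) \<in> W - Out. b = 0 \<and> a \<noteq> 0}"
  define Y where "Y = {(a, b) \<in> W - Out. a = 0 \<and> b \<noteq> 0}"
  have fW: "finite W" by (simp add: W_def)
  have fin: "finite Out" "finite P" "finite P'" "finite X" "finite Y"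
    by (rule finite_subset[OF _ fW]; auto simp: Out_def P_def P'_def X_def Y_def)+
  have inW: "(a, b) \<in> W" if "2 * \<bar>a\<bar> < k" "2 * \<bar>b\<bar> < k" for a b
    using that by (simp add: W_def in_window)
  have small: "6 * \<bar>a\<bar> < k \<and> 6 * \<bar>b\<bar> < k" if "(a, b) \<in> W - Out" for a b
    using that by (auto simp: Out_def)
  have sub2: "sum G (A \<union> B) \<le> sum G C + sum G Out"
    if "A \<inter> B = {}" "A \<union> B \<subseteq> C \<union> Out" "finite C" for A B C
  proof -
    have "sum G (A \<union> B) \<le> sum G (C \<union> Out)" using that fin G0 by (intro sum_mono2) auto
    also have "\<dots> \<le> sum G C + sum G Out" using that fin G0 by (simp add: sum_Un sum_nonneg)
    finally show ?thesis .
  qed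
  \<comment> \<open>Adding the bounds for \<open>f\<close> and \<open>g\<close> gives 2 Q \<le> 3/2
    (Q + e) + 3 (s + t) for the energy Q, which is solved for Q.\<close>
  have pair: "sum G Q \<le> 3 * e + 3 * (s + t) + 3 * (s + t)"
    if Q: "Q \<subseteq> W" "finite Q"
      and f: "sum G Q \<le> 3 / 2 * (\<Sum>x\<in>Q. G (f x)) + 3 * s"
      and g: "sum G Q \<le> 3 / 2 * (\<Sum>x\<in>Q. G (g x)) + 3 * t"
      and i: "inj_on f Q" "inj_on g Q" "f ` Q \<inter> g ` Q = {}" "f ` Q \<union> g ` Q \<subseteq> Q \<union> Out" for Q f g
  proof -
    have "(\<Sum>x\<in>Q. G (f x)) + (\<Sum>x\<in>Q. G (g x)) = sum G (f ` Q \<union> g ` Q)"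
      using i Q by (simp add: sum.union_disjoint sum.reindex)
    also have "\<dots> \<le> sum G Q + sum G Out" using i Q by (intro sub2) auto
    finally have "(\<Sum>x\<in>Q. G (f x)) + (\<Sum>x\<in>Q. G (g x)) \<le> sum G Q + e"
      using O by (simp add: Out_def)
    with f g show ?thesis by argo
  qed
  have imgP: "(a, a + b) \<in> P \<union> Out \<and> (a + b, b) \<in> P \<union> Out" if "(a, b) \<in> P" for a b
    using that small[of a b] inW[of a "a + b"] inW[of "a + b" b] by (auto simp: P_def)
  have imgP': "(a, b - a) \<in> P' \<union> Out \<and> (a - b, b) \<in> P' \<union> Out" if "(a, b) \<in> P'" for a b
    using that small[of a b] inW[of a "b - a"] inW[of "a - b" b] by (auto simp: P'_def)
  have imgX: "(a, a + b) \<in> P \<union> Out" if "(a, b) \<in> X" for a b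
    using that small[of a b] inW[of a "a + b"] by (auto simp: P_def X_def)
  have imgY: "(a + b, b) \<in> P \<union> Out" if "(a, b) \<in> Y" for a b
    using that small[of a b] inW[of "a + b" b] by (auto simp: P_def Y_def)
  have sub: "P \<subseteq> W" "P' \<subseteq> W" "X \<subseteq> W" "Y \<subseteq> W" by (auto simp: P_def P'_def X_def Y_def)
  have P: "sum G P \<le> 3 * e + 3 * (s + t) + 3 * (s + t)"
  proof (rule pair[where f = "\<lambda>(a, b). (a, a + b)" and g = "\<lambda>(a, b). (a + b, b)"])
    show "sum G P \<le> 3 / 2 * (\<Sum>x\<in>P. G (case x of (a, b) \<Rightarrow> (a, a + b))) + 3 * s"
      using S[OF sub(1)] by (simp add: case_prod_unfold)
    show "sum G P \<le> 3 / 2 * (\<Sum>x\<in>P. G (case x of (a, b) \<Rightarrow> (a + b, b))) + 3 * t"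
      using T[OF sub(1)] by (simp add: case_prod_unfold)
    show "(\<lambda>(a, b). (a, a + b)) ` P \<inter> (\<lambda>(a, b). (a + b, b)) ` P = {}"
      by (auto simp: P_def)
    show "(\<lambda>(a, b). (a, a + b)) ` P \<union> (\<lambda>(a, b). (a + b, b)) ` P \<subseteq> P \<union> Out"
      using imgP by fast
  qed (use sub fin in \<open>auto simp: inj_on_def\<close>)
  have P': "sum G P' \<le> 3 * e + 3 * (s + t) + 3 * (s + t)"
  proof (rule pair[where f = "\<lambda>(a, b). (a, b - a)" and g = "\<lambda>(a, b). (a - b, b)"])
    show "sum G P' \<le> 3 / 2 * (\<Sum>x\<in>P'. G (case x of (a, b) \<Rightarrow> (a, b - a))) + 3 * s"
      using S'[OF sub(2)] by (simp add: case_prod_unfold)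
    show "sum G P' \<le> 3 / 2 * (\<Sum>x\<in>P'. G (case x of (a, b) \<Rightarrow> (a - b, b))) + 3 * t"
      using T'[OF sub(2)] by (simp add: case_prod_unfold)
    show "(\<lambda>(a, b). (a, b - a)) ` P' \<inter> (\<lambda>(a, b). (a - b, b)) ` P' = {}"
      by (auto simp: P'_def)
    show "(\<lambda>(a, b). (a, b - a)) ` P' \<union> (\<lambda>(a, b). (a - b, b)) ` P' \<subseteq> P' \<union> Out"
      using imgP' by fast
  qed (use sub fin in \<open>auto simp: inj_on_def\<close>)
  have X: "sum G X \<le> 3 / 2 * (sum G P + e) + 3 * s"
  proof -
    have "(\<Sum>(a, b)\<in>X. G (a, a + b)) = sum G ((\<lambda>(a, b). (a, a + b)) ` X)"
      by (subst sum.reindex) (auto simp: inj_on_def case_prod_unfold)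
    also have "\<dots> \<le> sum G P + sum G Out"
    proof -
      have "(\<lambda>(a, b). (a, a + b)) ` X \<subseteq> P \<union> Out" using imgX by fast
      thus ?thesis using sub2[of "(\<lambda>(a, b). (a, a + b)) ` X" "{}" P] fin(2) by simp
    qed
    finally show ?thesis using S[OF sub(3)] O unfolding Out_def by argo
  qed
  have Y: "sum G Y \<le> 3 / 2 * (sum G P + e) + 3 * t"
  proof -
    have "(\<Sum>(a, b)\<in>Y. G (a + b, b)) = sum G ((\<lambda>(a, b). (a + b, b)) ` Y)"
      by (subst sum.reindex) (auto simp: inj_on_def case_prod_unfold)
    also have "\<dots> \<le> sum G P + sum G Out"
    proof -
      have "(\<lambda>(a, b). (a + b, b)) ` Y \<subseteq> P \<union> Out" using imgY by fast
      thus ?thesis using sub2[of "(\<lambda>(a, b). (a + b, b)) ` Y" "{}" P] fin(2) by simp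
    qed
    finally show ?thesis using T[OF sub(4)] O unfolding Out_def by argo
  qed
  have "W \<subseteq> {(0, 0)} \<union> Out \<union> P \<union> P' \<union> X \<union> Y" by (auto simp: P_def P'_def X_def Y_def)
  hence "sum G W \<le> sum G ({(0, 0)} \<union> Out \<union> P \<union> P' \<union> X \<union> Y)"
    using fin G0 by (intro sum_mono2) auto
  also have "\<dots> \<le> G (0, 0) + sum G Out + sum G P + sum G P' + sum G X + sum G Y"
  proof -
    have U: "sum G (A \<union> B) \<le> sum G A + sum G B" if "finite A" "finite B" for A B
      using that G0 by (simp add: sum_Un sum_nonneg)
    have "sum G ({(0, 0)} \<union> Out \<union> P \<union> P' \<union> X \<union> Y)
        \<le> sum G {(0, 0)} + sum G Out + sum G P + sum G P' + sum G X + sum G Y"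
      by (intro order.trans[OF U] add_mono order.refl fin finite_UnI) auto
    thus ?thesis by simp
  qed
  \<comment> \<open>P and P' are at most 3 e + 6 (s + t), and X + Y is at most 3 (P + e) + 3 (s +
    t); together with e for \<open>Out\<close> this is 19 e + 33 (s + t).\<close>
  finally show ?thesis using P P' X Y O Gz unfolding Out_def[symmetric] by argo
qed

section \<open>The spectral gap of the affine maps\<close>

lemma shear_energy:
  fixes k :: int and f :: "int \<Rightarrow> int \<Rightarrow> real"
  assumes k: "0 < k" and per: "\<And>x y. f (x mod k) (y mod k) = f x y"
  defines "Q \<equiv> (real_of_int k)\<^sup>2 * (\<Sum>x\<in>{0..<k}. \<Sum>y\<in>{0..<k}. (f (x + y) y - f x y)\<^sup>2)"
  shows "(\<Sum>a\<in>window k. \<Sum>b\<in>window k. (cmod (dft k f a b - dft k f a (a + b)))\<^sup>2) = Q"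
    and "(\<Sum>a\<in>window k. \<Sum>b\<in>window k. (cmod (dft k f a b - dft k f a (b - a)))\<^sup>2) = Q"
proof -
  let ?H = "dft k (\<lambda>x y. f (x + y) y - f x y)"
  have per1: "f (x mod k) y = f x y" for x y
    using per[of "x mod k" y] per[of x y] by simp
  have H: "?H a b = dft k f a (b - a) - dft k f a b" for a b
    unfolding dft_diff using dft_shear1[where f = f, OF k per1, of a "b - a"] by simp
  have perH: "(cmod (?H (x mod k) (y mod k)))\<^sup>2 = (cmod (?H x y))\<^sup>2" for x y by (simp add: dft_mod[OF k])
  show "(\<Sum>a\<in>window k. \<Sum>b\<in>window k. (cmod (dft k f a b - dft k f a (a + b)))\<^sup>2) = Q"
    using sum_window2_shear[where g = "\<lambda>a b. (cmod (?H a b))\<^sup>2", OF k perH] unfolding parseval2[OF k] Q_def by (simp add: H)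
  show "(\<Sum>a\<in>window k. \<Sum>b\<in>window k. (cmod (dft k f a b - dft k f a (b - a)))\<^sup>2) = Q"
    using sum_window2[where g = "\<lambda>a b. (cmod (?H a b))\<^sup>2", OF k perH] unfolding parseval2[OF k] Q_def by (simp add: H norm_minus_commute)
qed

text \<open>A translation multiplies the transform by a character value, which has distance at least
  1 from 1 at these frequencies.\<close>

lemma translate_energy:
  fixes k :: int and f :: "int \<Rightarrow> int \<Rightarrow> real"
  assumes k: "0 < k" and per: "\<And>x y. f (x mod k) (y mod k) = f x y"
  shows "(\<Sum>a\<in>{a \<in> window k. k \<le> 6 * \<bar>a\<bar>}. \<Sum>b\<in>window k. (cmod (dft k f a b))\<^sup>2)
    \<le> (real_of_int k)\<^sup>2 * (\<Sum>x\<in>{0..<k}. \<Sum>y\<in>{0..<k}. (f (x + 1) y - f x y)\<^sup>2)"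
proof -
  let ?H = "dft k (\<lambda>x y. f (x + 1) y - f x y)"
  have per1: "f (x mod k) y = f x y" for x y
    using per[of "x mod k" y] per[of x y] by simp
  have H: "?H a b = (echar k (- a) - 1) * dft k f a b" for a b
    unfolding dft_diff dft_translate[where f = f, OF k per1] by (simp add: algebra_simps)
  have perH: "(cmod (?H (x mod k) (y mod k)))\<^sup>2 = (cmod (?H x y))\<^sup>2" for x y by (simp add: dft_mod[OF k])
  have "(\<Sum>a\<in>{a \<in> window k. k \<le> 6 * \<bar>a\<bar>}. \<Sum>b\<in>window k. (cmod (dft k f a b))\<^sup>2)
    \<le> (\<Sum>a\<in>{a \<in> window k. k \<le> 6 * \<bar>a\<bar>}. \<Sum>b\<in>window k. (cmod (?H a b))\<^sup>2)"
  proof (intro sum_mono)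
    fix a b assume a: "a \<in> {a \<in> window k. k \<le> 6 * \<bar>a\<bar>}"
    hence "1 \<le> (cmod (1 - echar k (- a)))\<^sup>2"
      using norm_one_minus_echar_ge[OF k, of "- a"] window_abs[of a k] by simp
    hence "1 * (cmod (dft k f a b))\<^sup>2 \<le> (cmod (echar k (- a) - 1))\<^sup>2 * (cmod (dft k f a b))\<^sup>2"
      by (intro mult_right_mono) (auto simp: norm_minus_commute)
    thus "(cmod (dft k f a b))\<^sup>2 \<le> (cmod (?H a b))\<^sup>2" by (simp add: H norm_mult power_mult_distrib)
  qed
  also have "\<dots> \<le> (\<Sum>a\<in>window k. \<Sum>b\<in>window k. (cmod (?H a b))\<^sup>2)"
    by (intro sum_mono2) (auto intro: sum_nonneg)
  also have "\<dots> = (real_of_int k)\<^sup>2 * (\<Sum>x\<in>{0..<k}. \<Sum>y\<in>{0..<k}. (f (x + 1) y - f x y)\<^sup>2)"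
    unfolding sum_window2[where g = "\<lambda>a b. (cmod (?H a b))\<^sup>2", OF k perH] parseval2[OF k] ..
  finally show ?thesis .
qed

text \<open>Mean zero removes the frequency (0, 0), translations bound the large frequencies and
  shears the small ones. Exchanging the coordinates reduces the second shear and the second
  translation to the first ones.\<close>

lemma spectral_gap:
  fixes k :: int and f :: "int \<Rightarrow> int \<Rightarrow> real"
  assumes k: "0 < k" and per: "\<And>x y. f (x mod k) (y mod k) = f x y"
    and zero: "(\<Sum>x\<in>{0..<k}. \<Sum>y\<in>{0..<k}. f x y) = 0"
  shows "(\<Sum>x\<in>{0..<k}. \<Sum>y\<in>{0..<k}. (f x y)\<^sup>2) \<le>
    33 * (\<Sum>x\<in>{0..<k}. \<Sum>y\<in>{0..<k}. (f (x + y) y - f x y)\<^sup>2 + (f x (x + y) - f x y)\<^sup>2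
       + (f (x + 1) y - f x y)\<^sup>2 + (f x (y + 1) - f x y)\<^sup>2)"
    (is "_ \<le> 33 * ?R")
proof -
  let ?W = "window k \<times> window k"
  define G where "G = (\<lambda>(a, b). (cmod (dft k f a b))\<^sup>2)"
  define f' where "f' = (\<lambda>x y. f y x)"
  have per': "f' (x mod k) (y mod k) = f' x y" for x y by (simp add: f'_def per)
  have F': "dft k f' a b = dft k f b a" for a b unfolding f'_def by (rule dft_swap)
  define S where "S = (\<Sum>x\<in>{0..<k}. \<Sum>y\<in>{0..<k}. (f (x + y) y - f x y)\<^sup>2)"
  define T where "T = (\<Sum>x\<in>{0..<k}. \<Sum>y\<in>{0..<k}. (f x (x + y) - f x y)\<^sup>2)"
  define U where "U = (\<Sum>x\<in>{0..<k}. \<Sum>y\<in>{0..<k}. (f (x + 1) y - f x y)\<^sup>2)"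
  define V where "V = (\<Sum>x\<in>{0..<k}. \<Sum>y\<in>{0..<k}. (f x (y + 1) - f x y)\<^sup>2)"
  have T': "T = (\<Sum>x\<in>{0..<k}. \<Sum>y\<in>{0..<k}. (f' (x + y) y - f' x y)\<^sup>2)"
    unfolding T_def f'_def by (subst sum.swap) (simp add: add.commute)
  have V': "V = (\<Sum>x\<in>{0..<k}. \<Sum>y\<in>{0..<k}. (f' (x + 1) y - f' x y)\<^sup>2)"
    unfolding V_def f'_def by (rule sum.swap)
  let ?k = "(real_of_int k)\<^sup>2"
  have step: "sum G B \<le> 3 / 2 * (\<Sum>(a, b)\<in>B. G (g a b, h a b)) + 3 * c"
    if B: "B \<subseteq> ?W" and c: "(\<Sum>(a, b)\<in>?W. (cmod (dft k f a b - dft k f (g a b) (h a b)))\<^sup>2) \<le> c" for B c g h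
  proof -
    have "sum G B \<le> (\<Sum>(a, b)\<in>B. 3 / 2 * G (g a b, h a b) + 3 * (cmod (dft k f a b - dft k f (g a b) (h a b)))\<^sup>2)"
      unfolding G_def by (intro sum_mono) (clarsimp simp only: prod.case norm_square_le)
    also have "\<dots> = 3 / 2 * (\<Sum>(a, b)\<in>B. G (g a b, h a b))
        + 3 * (\<Sum>(a, b)\<in>B. (cmod (dft k f a b - dft k f (g a b) (h a b)))\<^sup>2)"
      by (simp add: case_prod_unfold sum.distrib sum_distrib_left)
    also have "(\<Sum>(a, b)\<in>B. (cmod (dft k f a b - dft k f (g a b) (h a b)))\<^sup>2)
        \<le> (\<Sum>(a, b)\<in>?W. (cmod (dft k f a b - dft k f (g a b) (h a b)))\<^sup>2)"
      using B by (intro sum_mono2) auto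
    finally show ?thesis using c by simp
  qed
  have "sum G ?W \<le> 19 * (?k * U + ?k * V) + 33 * (?k * S + ?k * T)"
  proof (rule quadrant_bound)
    show "0 \<le> G x" for x by (simp add: G_def split: prod.split)
    have "dft k f 0 0 = of_real (\<Sum>x\<in>{0..<k}. \<Sum>y\<in>{0..<k}. f x y)"
      by (simp add: dft_def echar_def)
    thus "G (0, 0) = 0" using zero by (simp add: G_def)
    show "sum G B \<le> 3 / 2 * (\<Sum>(a, b)\<in>B. G (a, a + b)) + 3 * (?k * S)" if "B \<subseteq> ?W" for B
      by (rule step[OF that]) (simp add: sum.cartesian_product[symmetric] shear_energy(1)[where f = f, OF k per] S_def)
    show "sum G B \<le> 3 / 2 * (\<Sum>(a, b)\<in>B. G (a, b - a)) + 3 * (?k * S)" if "B \<subseteq> ?W" for B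
      by (rule step[OF that]) (simp add: sum.cartesian_product[symmetric] shear_energy(2)[where f = f, OF k per] S_def)
    show "sum G B \<le> 3 / 2 * (\<Sum>(a, b)\<in>B. G (a + b, b)) + 3 * (?k * T)" if "B \<subseteq> ?W" for B
    proof (rule step[OF that])
      show "(\<Sum>(a, b)\<in>?W. (cmod (dft k f a b - dft k f (a + b) b))\<^sup>2) \<le> ?k * T"
        using shear_energy(1)[where f = f', OF k per'] unfolding T' F' sum.cartesian_product[symmetric]
        by (subst sum.swap) (simp add: add.commute)
    qed
    show "sum G B \<le> 3 / 2 * (\<Sum>(a, b)\<in>B. G (a - b, b)) + 3 * (?k * T)" if "B \<subseteq> ?W" for B
    proof (rule step[OF that])
      show "(\<Sum>(a, b)\<in>?W. (cmod (dft k f a b - dft k f (a - b) b))\<^sup>2) \<le> ?k * T"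
        using shear_energy(2)[where f = f', OF k per'] unfolding T' F' sum.cartesian_product[symmetric]
        by (subst sum.swap) simp
    qed
    let ?X = "{a \<in> window k. k \<le> 6 * \<bar>a\<bar>}"
    have eq: "{(a, b) \<in> ?W. k \<le> 6 * \<bar>a\<bar> \<or> k \<le> 6 * \<bar>b\<bar>} = ?X \<times> window k \<union> window k \<times> ?X" by auto
    have "sum G (?X \<times> window k \<union> window k \<times> ?X) \<le> sum G (?X \<times> window k) + sum G (window k \<times> ?X)"
      by (simp add: sum_Un sum_nonneg G_def split: prod.split)
    also have "sum G (?X \<times> window k) \<le> ?k * U"
      using translate_energy[where f = f, OF k per] unfolding U_def G_def sum.cartesian_product[symmetric] .
    also have "sum G (window k \<times> ?X) \<le> ?k * V"
      using translate_energy[where f = f', OF k per'] unfolding V' F' G_def sum.cartesian_product[symmetric]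
      by (subst sum.swap)
    finally show "sum G {(a, b) \<in> ?W. k \<le> 6 * \<bar>a\<bar> \<or> k \<le> 6 * \<bar>b\<bar>} \<le> ?k * U + ?k * V"
      unfolding eq by simp
  qed
  moreover have "sum G ?W = ?k * (\<Sum>x\<in>{0..<k}. \<Sum>y\<in>{0..<k}. (f x y)\<^sup>2)"
    unfolding G_def sum.cartesian_product[symmetric]
    by (subst sum_window2[OF k]) (simp_all add: dft_mod[OF k] parseval2[OF k])
  moreover have "0 \<le> U" "0 \<le> V" unfolding U_def V_def by (intro sum_nonneg; simp)+
  hence "19 * (?k * U + ?k * V) + 33 * (?k * S + ?k * T) \<le> ?k * (33 * ?R)"
    unfolding S_def[symmetric] T_def[symmetric] U_def[symmetric] V_def[symmetric] sum.distrib
    using zero_le_power2[of "real_of_int k"] by (auto simp: algebra_simps intro!: add_mono mult_left_mono)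
  ultimately have "?k * (\<Sum>x\<in>{0..<k}. \<Sum>y\<in>{0..<k}. (f x y)\<^sup>2) \<le> ?k * (33 * ?R)" by linarith
  thus ?thesis using k by (simp add: mult_le_cancel_left)
qed

section \<open>Edge expansion of the torus\<close>

lemma sum_square_indicator_diff:
  assumes "finite Z" "bij_betw g Z Z" "A \<subseteq> Z"
  shows "(\<Sum>z\<in>Z. (of_bool (g z \<in> A) - of_bool (z \<in> A))\<^sup>2) = (2 * real (card {z \<in> A. g z \<notin> A}) :: real)"
proof -
  let ?I = "{z \<in> Z. g z \<in> A}"
  have fin: "finite A" "finite ?I" using assms finite_subset by auto
  have "g ` ?I = A" using assms(2,3) by (auto simp: bij_betw_def)
  moreover have "inj_on g ?I" using assms(2) by (auto simp: bij_betw_def inj_on_def)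
  ultimately have cI: "card ?I = card A" by (metis card_image)
  have "(\<Sum>z\<in>Z. (of_bool (g z \<in> A) - of_bool (z \<in> A))\<^sup>2) = (\<Sum>z\<in>Z. of_bool (z \<in> ?I - A \<union> (A - ?I)) :: real)"
    by (intro sum.cong refl) (use assms in auto)
  also have "\<dots> = real (card (?I - A \<union> (A - ?I)))"
    using assms fin by (subst sum_of_bool_eq) (auto intro!: arg_cong[where f = card])
  also have "\<dots> = real (card (?I - A)) + real (card (A - ?I))"
    using fin by (subst card_Un_disjoint) auto
  \<comment> \<open>A bijection brings in as many points as it takes out; hence maps without their
    inverses suffice for counting.\<close>
  also have "card (?I - A) = card (A - ?I)"
    using card_Diff_subset_Int[of ?I A] card_Diff_subset_Int[of A ?I] fin cI by (simp add: Int_commute)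
  also have "A - ?I = {z \<in> A. g z \<notin> A}" using assms by auto
  finally show ?thesis by simp
qed

lemma bij_betw_finite_inv:
  assumes "finite Z" "\<And>z. z \<in> Z \<Longrightarrow> g z \<in> Z" "\<And>z. z \<in> Z \<Longrightarrow> h (g z) = z"
  shows "bij_betw g Z Z"
proof -
  have "inj_on g Z" using assms(3) by (rule inj_on_inverseI)
  moreover have "g ` Z \<subseteq> Z" using assms(2) by auto
  ultimately show ?thesis using assms(1) by (simp add: bij_betw_def endo_inj_surj)
qed

text \<open>The gap is applied to the indicator of \<open>A\<close> minus its density
  \<open>c\<close>. Its square sum (1 - c) |A| is at least half of the smaller side. The factor 132
  is 33 from the gap, 2 from counting points that enter and points that leave, and 2 from this
  half.\<close>

lemma torus_expansion:
  fixes k :: int and A :: "(int \<times> int) set"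
  assumes k: "0 < k" and A: "A \<subseteq> {0..<k} \<times> {0..<k}"
  shows "real (min (card A) (card ({0..<k} \<times> {0..<k} - A))) \<le>
    132 * (real (card {(x, y) \<in> A. ((x + y) mod k, y) \<notin> A}) + real (card {(x, y) \<in> A. (x, (x + y) mod k) \<notin> A})
     + real (card {(x, y) \<in> A. ((x + 1) mod k, y) \<notin> A}) + real (card {(x, y) \<in> A. (x, (y + 1) mod k) \<notin> A}))"
    (is "_ \<le> 132 * (?s + ?t + ?u + ?v)")
proof -
  let ?Z = "{0..<k} \<times> {0..<k}"
  define c where "c = real (card A) / (real_of_int k)\<^sup>2"
  define f where "f = (\<lambda>x y. of_bool ((x mod k, y mod k) \<in> A) - c)"
  have cZ: "real (card ?Z) = (real_of_int k)\<^sup>2" using k by (simp add: card_cartesian_product power2_eq_square)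
  have fA: "finite A" using A finite_subset by auto
  have per: "f (x mod k) (y mod k) = f x y" for x y by (simp add: f_def)
  have ind: "(\<Sum>(x, y)\<in>?Z. of_bool ((x mod k, y mod k) \<in> A)) = real (card A)"
  proof -
    have "(\<Sum>(x, y)\<in>?Z. of_bool ((x mod k, y mod k) \<in> A)) = (\<Sum>z\<in>?Z. of_bool (z \<in> A) :: real)"
      by (intro sum.cong refl) auto
    also have "\<dots> = real (card A)" using A by (subst sum_of_bool_eq) (auto intro!: arg_cong[where f = card])
    finally show ?thesis .
  qed
  have zero: "(\<Sum>x\<in>{0..<k}. \<Sum>y\<in>{0..<k}. f x y) = 0"
    using ind k unfolding sum.cartesian_product f_def case_prod_unfold sum_subtractf
    by (simp add: c_def power2_eq_square card_cartesian_product)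
  have diff: "(\<Sum>x\<in>{0..<k}. \<Sum>y\<in>{0..<k}. (f (g1 x y) (g2 x y) - f x y)\<^sup>2)
      = 2 * real (card {(x, y) \<in> A. (g1 x y mod k, g2 x y mod k) \<notin> A})"
    if h: "\<And>x y. (x, y) \<in> ?Z \<Longrightarrow> h (g1 x y mod k, g2 x y mod k) = (x, y)" for g1 g2 h
  proof -
    let ?g = "\<lambda>(x, y). (g1 x y mod k, g2 x y mod k)"
    have "bij_betw ?g ?Z ?Z"
      by (rule bij_betw_finite_inv[where h = h]) (use k h in auto)
    from sum_square_indicator_diff[OF _ this A]
    have "(\<Sum>z\<in>?Z. (of_bool (?g z \<in> A) - of_bool (z \<in> A))\<^sup>2) = 2 * real (card {z \<in> A. ?g z \<notin> A})" by simp
    moreover have "(\<Sum>z\<in>?Z. (of_bool (?g z \<in> A) - of_bool (z \<in> A))\<^sup>2)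
       = (\<Sum>(x, y)\<in>?Z. (f (g1 x y) (g2 x y) - f x y)\<^sup>2)"
      by (intro sum.cong refl) (auto simp: f_def)
    moreover have "{z \<in> A. ?g z \<notin> A} = {(x, y) \<in> A. (g1 x y mod k, g2 x y mod k) \<notin> A}" by auto
    ultimately show ?thesis by (simp add: sum.cartesian_product)
  qed
  have inA: "{(x, y) \<in> A. (p x y, y mod k) \<notin> A} = {(x, y) \<in> A. (p x y, y) \<notin> A}"
    "{(x, y) \<in> A. (x mod k, p x y) \<notin> A} = {(x, y) \<in> A. (x, p x y) \<notin> A}" for p
    using A by auto
  have "(\<Sum>x\<in>{0..<k}. \<Sum>y\<in>{0..<k}. (f x y)\<^sup>2) \<le> 33 * (2 * (?s + ?t + ?u + ?v))"
  proof -
    have "(\<Sum>x\<in>{0..<k}. \<Sum>y\<in>{0..<k}. (f (x + y) y - f x y)\<^sup>2) = 2 * ?s"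
      using diff[of "\<lambda>(x, y). ((x - y) mod k, y)" "\<lambda>x y. x + y" "\<lambda>x y. y"]
      by (simp add: inA mod_diff_left_eq)
    moreover have "(\<Sum>x\<in>{0..<k}. \<Sum>y\<in>{0..<k}. (f x (x + y) - f x y)\<^sup>2) = 2 * ?t"
      using diff[of "\<lambda>(x, y). (x, (y - x) mod k)" "\<lambda>x y. x" "\<lambda>x y. x + y"]
      by (simp add: inA mod_diff_left_eq)
    moreover have "(\<Sum>x\<in>{0..<k}. \<Sum>y\<in>{0..<k}. (f (x + 1) y - f x y)\<^sup>2) = 2 * ?u"
      using diff[of "\<lambda>(x, y). ((x - 1) mod k, y)" "\<lambda>x y. x + 1" "\<lambda>x y. y"]
      by (simp add: inA mod_diff_left_eq)
    moreover have "(\<Sum>x\<in>{0..<k}. \<Sum>y\<in>{0..<k}. (f x (y + 1) - f x y)\<^sup>2) = 2 * ?v"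
      using diff[of "\<lambda>(x, y). (x, (y - 1) mod k)" "\<lambda>x y. x" "\<lambda>x y. y + 1"]
      by (simp add: inA mod_diff_left_eq)
    ultimately show ?thesis using spectral_gap[where f = f, OF k per zero] by (simp add: sum.distrib)
  qed
  moreover have "(\<Sum>x\<in>{0..<k}. \<Sum>y\<in>{0..<k}. (f x y)\<^sup>2) = real (card A) - c * real (card A)"
  proof -
    have "(\<Sum>x\<in>{0..<k}. \<Sum>y\<in>{0..<k}. (f x y)\<^sup>2)
      = (\<Sum>(x, y)\<in>?Z. (1 - 2 * c) * of_bool ((x mod k, y mod k) \<in> A) + c\<^sup>2)"
      unfolding sum.cartesian_product f_def
      by (intro sum.cong refl) (auto simp: power2_eq_square algebra_simps)
    also have "\<dots> = (1 - 2 * c) * real (card A) + real (card ?Z) * c\<^sup>2"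
      unfolding ind[symmetric] by (simp add: case_prod_unfold sum.distrib sum_distrib_left)
    also have "\<dots> = real (card A) - c * real (card A)"
      unfolding cZ using k by (simp add: c_def field_simps power2_eq_square)
    finally show ?thesis .
  qed
  moreover have "real (min (card A) (card (?Z - A))) / 2 \<le> real (card A) - c * real (card A)"
  proof -
    have AZ: "real (card (?Z - A)) = (real_of_int k)\<^sup>2 - real (card A)"
      using A fA card_mono[of ?Z A] by (simp add: card_Diff_subset of_nat_diff cZ[symmetric])
    have k2: "0 < (real_of_int k)\<^sup>2" using k by simp
    show ?thesis
    proof (cases "2 * real (card A) \<le> (real_of_int k)\<^sup>2")
      case True
      hence "c \<le> 1 / 2" using k2 by (simp add: c_def field_simps)
      hence "c * real (card A) \<le> 1 / 2 * real (card A)" by (intro mult_right_mono) auto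
      thus ?thesis by simp
    next
      case False
      hence "1 / 2 \<le> c" using k2 by (simp add: c_def field_simps)
      hence "1 / 2 * real (card (?Z - A)) \<le> c * real (card (?Z - A))" by (intro mult_right_mono) auto
      also have "\<dots> = real (card A) - c * real (card A)"
        unfolding AZ using k2 by (simp add: c_def field_simps)
      finally show ?thesis by simp
    qed
  qed
  ultimately show ?thesis by linarith
qed

section \<open>Weakest preconditions with credits\<close>

inductive_cases exec_SkipE: "exec D W Skip s t u q s'"
inductive_cases exec_IAssignE: "exec D W (IAssign x e) s t u q s'"
inductive_cases exec_RAssignE: "exec D W (RAssign x r) s t u q s'"
inductive_cases exec_IPutE: "exec D W (IPut a i e) s t u q s'"
inductive_cases exec_RPutE: "exec D W (RPut a i r) s t u q s'"
inductive_cases exec_SeqE: "exec D W (Seq c1 c2) s t u q s'"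
inductive_cases exec_CondE: "exec D W (Cond b c1 c2) s t u q s'"

text \<open>Every update takes a time step, so the bound on updates follows from the bound on time
  without accounting of its own.\<close>

lemma exec_updates_le_time: "exec D W c s t u q s' \<Longrightarrow> u \<le> t"
  by (induction rule: exec.induct) auto

text \<open>Weakest precondition with credits: \<open>T\<close> and \<open>q\<close> are the remaining allowances of time and
  queries, and the postcondition sees what is left of them.\<close>

definition wp :: "apsp_ds \<Rightarrow> nat \<Rightarrow> com \<Rightarrow> (mstate \<Rightarrow> real \<Rightarrow> real \<Rightarrow> bool) \<Rightarrow> mstate \<Rightarrow> real \<Rightarrow> real \<Rightarrow> bool" where
  "wp D W c Q s T q \<longleftrightarrow> (\<exists>t u q' s'. exec D W c s t u q' s' \<and> real t \<le> T \<and> real q' \<le> q \<and>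
     Q s' (T - real t) (q - real q'))"

lemma wpI:
  assumes "exec D W c s t u q' s'" "real t \<le> T" "real q' \<le> q" "Q s' (T - real t) (q - real q')"
  shows "wp D W c Q s T q"
  using assms unfolding wp_def by blast

lemma wpE:
  assumes "wp D W c Q s T q"
  obtains t u q' s' where "exec D W c s t u q' s'" "real t \<le> T" "real q' \<le> q"
    "Q s' (T - real t) (q - real q')"
  using assms unfolding wp_def by blast

lemma wp_Skip: "wp D W Skip Q s T q \<longleftrightarrow> 1 \<le> T \<and> 0 \<le> q \<and> Q s (T - 1) q"
  unfolding wp_def by (fastforce intro: exec.Skip elim: exec_SkipE)

lemma wp_IAssign: "wp D W (IAssign x e) Q s T q \<longleftrightarrow>
    ieval e s \<le> W \<and> 1 \<le> T \<and> 0 \<le> q \<and> Q (set_ivar x (ieval e s) s) (T - 1) q"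
  unfolding wp_def by (fastforce intro: exec.IAssign elim: exec_IAssignE)

lemma wp_RAssign: "wp D W (RAssign x e) Q s T q \<longleftrightarrow>
    1 \<le> T \<and> 0 \<le> q \<and> Q (set_rvar x (reval e s) s) (T - 1) q"
  unfolding wp_def by (fastforce intro: exec.RAssign elim: exec_RAssignE)

lemma wp_IPut: "wp D W (IPut a i e) Q s T q \<longleftrightarrow>
    ieval e s \<le> W \<and> 1 \<le> T \<and> 0 \<le> q \<and> Q (set_iarr a (ieval i s) (ieval e s) s) (T - 1) q"
  unfolding wp_def by (fastforce intro: exec.IPut elim: exec_IPutE)

lemma wp_RPut: "wp D W (RPut a i e) Q s T q \<longleftrightarrow>
    1 \<le> T \<and> 0 \<le> q \<and> Q (set_rarr a (ieval i s) (reval e s) s) (T - 1) q"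
  unfolding wp_def by (fastforce intro: exec.RPut elim: exec_RPutE)

lemma wp_Seq: "wp D W (Seq c1 c2) Q s T q \<longleftrightarrow> wp D W c1 (wp D W c2 Q) s T q"
proof
  assume "wp D W (Seq c1 c2) Q s T q"
  thus "wp D W c1 (wp D W c2 Q) s T q"
  proof (rule wpE)
    fix t u q' s' assume 0: "exec D W (Seq c1 c2) s t u q' s'"
      and 1: "real t \<le> T" "real q' \<le> q" "Q s' (T - real t) (q - real q')"
    from 0 show ?thesis
    proof (rule exec_SeqE)
      fix t1 u1 q1 s2 t2 u2 q2 assume 2: "t = t1 + t2" "u = u1 + u2" "q' = q1 + q2"
        "exec D W c1 s t1 u1 q1 s2" "exec D W c2 s2 t2 u2 q2 s'"
      have "wp D W c2 Q s2 (T - real t1) (q - real q1)"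
        by (rule wpI[OF 2(5)]) (use 1 2 in \<open>auto simp: algebra_simps\<close>)
      thus ?thesis by (intro wpI[OF 2(4)]) (use 1 2 in auto)
    qed
  qed
next
  assume "wp D W c1 (wp D W c2 Q) s T q"
  thus "wp D W (Seq c1 c2) Q s T q"
  proof (rule wpE)
    fix t u q' s' assume 1: "exec D W c1 s t u q' s'" "real t \<le> T" "real q' \<le> q"
      and "wp D W c2 Q s' (T - real t) (q - real q')"
    from this(4) show ?thesis
    proof (rule wpE)
      fix t2 u2 q2 s2 assume 2: "exec D W c2 s' t2 u2 q2 s2" "real t2 \<le> T - real t" "real q2 \<le> q - real q'"
        "Q s2 (T - real t - real t2) (q - real q' - real q2)"
      from exec.Seq[OF 1(1) 2(1)] show ?thesis
        by (rule wpI) (use 1 2 in \<open>auto simp: algebra_simps\<close>)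
    qed
  qed
qed

lemma wp_Cond: "wp D W (Cond b c1 c2) Q s T q \<longleftrightarrow>
    (if beval b s then wp D W c1 Q s (T - 1) q else wp D W c2 Q s (T - 1) q)" (is "?l \<longleftrightarrow> ?r")
proof
  assume ?l
  thus ?r
  proof (rule wpE)
    fix t u q' s' assume 0: "exec D W (Cond b c1 c2) s t u q' s'"
      and 1: "real t \<le> T" "real q' \<le> q" "Q s' (T - real t) (q - real q')"
    from 0 show ?thesis
      by (rule exec_CondE) (use 1 in \<open>auto intro!: wpI simp: algebra_simps\<close>)
  qed
next
  assume r: ?r
  show ?l
  proof (cases "beval b s")
    case True
    with r have "wp D W c1 Q s (T - 1) q" by simp
    thus ?thesis
    proof (rule wpE)
      fix t u q' s' assume 1: "exec D W c1 s t u q' s'" "real t \<le> T - 1" "real q' \<le> q"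
        "Q s' (T - 1 - real t) (q - real q')"
      from exec.CondTrue[of b, OF True 1(1)] show ?thesis
        by (rule wpI) (use 1 in \<open>auto simp: algebra_simps\<close>)
    qed
  next
    case False
    with r have "wp D W c2 Q s (T - 1) q" by simp
    thus ?thesis
    proof (rule wpE)
      fix t u q' s' assume 1: "exec D W c2 s t u q' s'" "real t \<le> T - 1" "real q' \<le> q"
        "Q s' (T - 1 - real t) (q - real q')"
      from exec.CondFalse[of b, OF False 1(1)] show ?thesis
        by (rule wpI) (use 1 in \<open>auto simp: algebra_simps\<close>)
    qed
  qed
qed

lemma wp_WhileFalse:
  assumes "\<not> beval b s" "1 \<le> T" "0 \<le> q" "Q s (T - 1) q"
  shows "wp D W (While b c) Q s T q"
  by (rule wpI, rule exec.WhileFalse) (use assms in auto)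

lemma wp_WhileTrue:
  assumes b: "beval b s" and "wp D W c (wp D W (While b c) Q) s (T - 1) q"
  shows "wp D W (While b c) Q s T q"
  using assms(2)
proof (rule wpE)
  fix t u q' s' assume 1: "exec D W c s t u q' s'" "real t \<le> T - 1" "real q' \<le> q"
    and "wp D W (While b c) Q s' (T - 1 - real t) (q - real q')"
  from this(4) show ?thesis
  proof (rule wpE)
    fix t2 u2 q2 s2 assume 2: "exec D W (While b c) s' t2 u2 q2 s2" "real t2 \<le> T - 1 - real t"
      "real q2 \<le> q - real q'" "Q s2 (T - 1 - real t - real t2) (q - real q' - real q2)"
    from exec.WhileTrue[OF b 1(1) 2(1)] show ?thesis
      by (rule wpI) (use 1 2 in \<open>auto simp: algebra_simps\<close>)
  qed
qed

text \<open>Every iteration consumes a unit of credit, hence no separate termination measure.\<close>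

lemma wp_While:
  assumes I: "I s T q"
    and step: "\<And>s T q. I s T q \<Longrightarrow> beval b s \<Longrightarrow> 0 \<le> T \<and> wp D W c I s (T - 1) q"
    and exit: "\<And>s T q. I s T q \<Longrightarrow> \<not> beval b s \<Longrightarrow> 1 \<le> T \<and> 0 \<le> q \<and> Q s (T - 1) q"
  shows "wp D W (While b c) Q s T q"
proof -
  have "I s T q \<Longrightarrow> wp D W (While b c) Q s T q" for s T q
  \<comment> \<open>The offset 1 makes the rounded credit drop strictly even from T = 0.\<close>
  proof (induction "nat \<lceil>T + 1\<rceil>" arbitrary: s T q rule: less_induct)
    case less
    show ?case
    proof (cases "beval b s")
      case False
      thus ?thesis using exit[OF less.prems] by (intro wp_WhileFalse) auto
    next
      case True
      have T: "0 \<le> T" and w: "wp D W c I s (T - 1) q" using step[OF less.prems True] by auto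
      have "wp D W c (wp D W (While b c) Q) s (T - 1) q"
        using w
      proof (rule wpE)
        fix t u q' s' assume h: "exec D W c s t u q' s'" "real t \<le> T - 1" "real q' \<le> q"
          "I s' (T - 1 - real t) (q - real q')"
        have "nat \<lceil>T - 1 - real t + 1\<rceil> < nat \<lceil>T + 1\<rceil>" using T h(2) by linarith
        from h(1-3) less.hyps[OF this h(4)] show ?thesis by (rule wpI)
      qed
      with True show ?thesis by (rule wp_WhileTrue)
    qed
  qed
  thus ?thesis using I .
qed

lemma wp_DSInit:
  assumes "dstr s = None" "ieval N s \<le> W" "g = array_graph s (ieval N s) (ieval k s) a a' w" "wf_wgraph g"
    "inj_on (\<lambda>i. {iarr s a i, iarr s a' i}) {..<ieval k s}"
    "1 + real (ieval k s) \<le> T" "0 \<le> q" "Q (s\<lparr>dstr := Some (g, [])\<rparr>) (T - (1 + real (ieval k s))) q"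
  shows "wp D W (DSInit N k a a' w) Q s T q"
  by (rule wpI, rule exec.DSInit) (use assms in auto)

lemma wp_DSIncrease:
  assumes "dstr s = Some (g, h)" "op = IncreaseEdgeWeight (ieval e s) (ieval f s) (reval d s)"
    "legal_op (current g h) op" "1 \<le> T" "0 \<le> q" "Q (s\<lparr>dstr := Some (g, h @ [op])\<rparr>) (T - 1) q"
  shows "wp D W (DSIncrease e f d) Q s T q"
  by (rule wpI, rule exec.DSIncrease) (use assms in auto)

lemma wp_DSDist:
  assumes "dstr s = Some (g, h)" "op = QueryDistance (ieval e s) (ieval f s)"
    "legal_op (current g h) op" "d = ds_dist D g h (ieval e s) (ieval f s)" "1 \<le> T" "1 \<le> q"
    "Q (set_rvar r (real_of_ereal d) (set_ivar x (if d = \<infinity> then 0 else 1)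
        (s\<lparr>dstr := Some (g, h @ [op])\<rparr>))) (T - 1) (q - 1)"
  shows "wp D W (DSDist r x e f) Q s T q"
  by (rule wpI, rule exec.DSDist) (use assms in auto)

lemma wp_DSPath:
  assumes "dstr s = Some (g, h)" "op = QueryPath (ieval e s) (ieval f s)"
    "legal_op (current g h) op" "p = ds_path D g h (ieval e s) (ieval f s)"
    "1 + real (length p) \<le> T" "1 \<le> q"
    "Q (write_list a p (set_ivar x (length p) (s\<lparr>dstr := Some (g, h @ [op])\<rparr>))) (T - (1 + real (length p))) (q - 1)"
  shows "wp D W (DSPath a x e f) Q s T q"
  by (rule wpI, rule exec.DSPath) (use assms in auto)

lemmas wp_simps = wp_Skip wp_IAssign wp_RAssign wp_IPut wp_RPut wp_Seq wp_Cond

lemma ivar_upd [simp]: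
  "ivar (set_ivar x k s) y = (if y = x then k else ivar s y)"
  "ivar (set_rvar x r s) = ivar s" "ivar (set_iarr a i k s) = ivar s"
  "ivar (set_rarr a i r s) = ivar s" "ivar (write_list a p s) = ivar s"
  by (simp_all add: set_ivar_def set_rvar_def set_iarr_def set_rarr_def write_list_def)

lemma rvar_upd [simp]:
  "rvar (set_rvar x r s) y = (if y = x then r else rvar s y)"
  "rvar (set_ivar x k s) = rvar s" "rvar (set_iarr a i k s) = rvar s"
  "rvar (set_rarr a i r s) = rvar s" "rvar (write_list a p s) = rvar s"
  by (simp_all add: set_ivar_def set_rvar_def set_iarr_def set_rarr_def write_list_def)

lemma iarr_upd [simp]:
  "iarr (set_iarr a i k s) b = (if b = a then (iarr s a)(i := k) else iarr s b)"
  "iarr (set_rvar x r s) = iarr s" "iarr (set_ivar x k s) = iarr s"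
  "iarr (set_rarr a i r s) = iarr s"
  "iarr (write_list a p s) b = (if b = a then (\<lambda>i. if i < length p then p ! i else iarr s a i) else iarr s b)"
  by (simp_all add: set_ivar_def set_rvar_def set_iarr_def set_rarr_def write_list_def)

lemma rarr_upd [simp]:
  "rarr (set_rarr a i r s) b = (if b = a then (rarr s a)(i := r) else rarr s b)"
  "rarr (set_rvar x r s) = rarr s" "rarr (set_ivar x k s) = rarr s"
  "rarr (set_iarr a i k s) = rarr s" "rarr (write_list a p s) = rarr s"
  by (simp_all add: set_ivar_def set_rvar_def set_iarr_def set_rarr_def write_list_def)

lemma dstr_upd [simp]:
  "dstr (set_rvar x r s) = dstr s" "dstr (set_ivar x k s) = dstr s"
  "dstr (set_iarr a i k s) = dstr s" "dstr (set_rarr a i r s) = dstr s" "dstr (write_list a p s) = dstr s"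
  by (simp_all add: set_ivar_def set_rvar_def set_iarr_def set_rarr_def write_list_def)

section \<open>Ball growing\<close>

text \<open>A walk of total weight at most d. A relation that is monotone in d avoids minima over
  walks, and balls only need upper bounds on distances.\<close>

inductive reach :: "nat \<Rightarrow> (nat \<Rightarrow> nat) \<Rightarrow> (nat \<Rightarrow> nat) \<Rightarrow> (nat \<Rightarrow> nat) \<Rightarrow> nat \<Rightarrow> nat \<Rightarrow> nat \<Rightarrow> bool"
  for N sv so ws u where
  start: "reach N sv so ws u u d"
| step: "reach N sv so ws u (sv s) d \<Longrightarrow> s < N \<Longrightarrow> d + ws s \<le> d' \<Longrightarrow> reach N sv so ws u (so s) d'"

lemma reach_mono: "reach N sv so ws u v d \<Longrightarrow> d \<le> d' \<Longrightarrow> reach N sv so ws u v d'"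
  by (erule reach.cases) (auto intro: reach.start reach.step[OF _ _ order.trans])

lemma reach_trans:
  assumes "reach N sv so ws v x e" "reach N sv so ws u v d" shows "reach N sv so ws u x (d + e)"
  using assms(1)
proof induction
  case (start d')
  then show ?case using assms(2) reach_mono by fastforce
next
  case (step s d' d'')
  then show ?case by (auto intro!: reach.step[of N sv so ws u s "d + d'"])
qed

text \<open>\<open>pt\<close> is the slot at the other end of the same edge. With slots, volumes are
  plain cardinalities and an edge can be entered from either end.\<close>

locale slot_graph =
  fixes N :: nat and sv so ws pt :: "nat \<Rightarrow> nat"
  assumes pt_less: "s < N \<Longrightarrow> pt s < N" and pt_pt: "s < N \<Longrightarrow> pt (pt s) = s"
    and pt_neq: "s < N \<Longrightarrow> pt s \<noteq> s"
    and sv_pt: "s < N \<Longrightarrow> sv (pt s) = so s" and so_pt: "s < N \<Longrightarrow> so (pt s) = sv s"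
    and ws_pt: "s < N \<Longrightarrow> ws (pt s) = ws s" and no_loop: "s < N \<Longrightarrow> so s \<noteq> sv s"
    and ws_pos: "s < N \<Longrightarrow> 1 \<le> ws s"
begin

abbreviation "rch \<equiv> reach N sv so ws"

lemma reach_sym: "rch u v d \<Longrightarrow> rch v u d"
proof (induction rule: reach.induct)
  case (start d)
  show ?case by (rule reach.start)
next
  case (step s d d')
  have "rch (so s) (sv s) (ws s)"
    using reach.step[of N sv so ws "so s" "pt s" 0 "ws s"] step.hyps pt_less
    by (auto simp: sv_pt so_pt ws_pt intro: reach.start)
  from reach_trans[OF step.IH this] show ?case
    using step.hyps by (auto intro: reach_mono)
qed

definition volc :: "nat set \<Rightarrow> nat" where
  "volc S = card {s. s < N \<and> sv s \<in> S}"

definition cutc :: "nat set \<Rightarrow> nat" where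
  "cutc S = card {s. s < N \<and> sv s \<in> S \<and> so s \<notin> S}"

lemma volc_compl: "volc S + volc (- S) = N"
proof -
  have "card ({s. s < N \<and> sv s \<in> S} \<union> {s. s < N \<and> sv s \<in> - S}) = volc S + volc (- S)"
    unfolding volc_def by (rule card_Un_disjoint) auto
  moreover have "{s. s < N \<and> sv s \<in> S} \<union> {s. s < N \<and> sv s \<in> - S} = {..<N}" by auto
  ultimately show ?thesis by simp
qed

lemma volc_mono: "S \<subseteq> T \<Longrightarrow> volc S \<le> volc T"
  unfolding volc_def by (rule card_mono) auto

lemma cutc_compl: "cutc (- S) = cutc S"
proof -
  have "bij_betw pt {s. s < N \<and> sv s \<in> - S \<and> so s \<notin> - S} {s. s < N \<and> sv s \<in> S \<and> so s \<notin> S}"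
    by (rule bij_betw_byWitness[where f' = pt]) (auto simp: pt_pt sv_pt so_pt pt_less)
  thus ?thesis unfolding cutc_def by (rule bij_betw_same_card)
qed

definition claimed :: "(nat \<Rightarrow> nat) \<Rightarrow> (nat \<Rightarrow> nat) \<Rightarrow> nat \<Rightarrow> nat set" where
  "claimed stamp dl c = {s. s < N \<and> dl s \<noteq> 0 \<and> stamp (sv s) = c}"

lemma finite_claimed [simp]: "finite (claimed stamp dl c)"
  by (simp add: claimed_def)

text \<open>The partner of a claimed slot is unclaimed and has the same weight, so each edge is
  counted at most once out of twice.\<close>

lemma sum_claimed_le:
  assumes "\<And>s. s < N \<Longrightarrow> dl s \<noteq> 0 \<Longrightarrow> dl (pt s) = 0" and "A \<subseteq> {s. s < N \<and> dl s \<noteq> 0}"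
  shows "2 * sum ws A \<le> sum ws {..<N}"
proof -
  have A: "A \<subseteq> {..<N}" using assms(2) by auto
  hence fA: "finite A" by (rule finite_subset) simp
  have inj: "inj_on pt A" using A by (intro inj_on_inverseI[where g = pt]) (auto simp: pt_pt)
  have "sum ws (pt ` A) = sum ws A"
    using A by (subst sum.reindex[OF inj]) (auto intro!: sum.cong simp: ws_pt)
  moreover have "sum ws (A \<union> pt ` A) = sum ws A + sum ws (pt ` A)"
    using fA assms by (intro sum.union_disjoint) (auto simp: subset_iff)
  moreover have "sum ws (A \<union> pt ` A) \<le> sum ws {..<N}"
    using A by (intro sum_mono2) (auto simp: pt_less)
  ultimately show ?thesis by simp
qed

text \<open>Invariant of the growth of one ball: a vertex is stamped \<open>cur\<close> if it is in the ball, 0 if it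
  is untouched, and with a smaller number if it was removed earlier.  A slot is claimed (\<open>dl s > 0\<close>)
  when its vertex joins while the other end is untouched; \<open>dl s\<close> is the time at which the wave
  that traverses the edge at unit speed arrives.\<close>

definition binv where
  "binv stamp0 dl0 u stamp dl cur r L \<longleftrightarrow>
     (\<forall>v. stamp0 v < cur \<and> (stamp v = cur \<and> stamp0 v = 0 \<or> stamp v = stamp0 v)) \<and>
     (\<forall>s<N. stamp0 (sv s) \<noteq> 0 \<longrightarrow> dl s = dl0 s) \<and>
     distinct L \<and> (\<forall>s\<in>set L. s < N \<and> stamp (sv s) = cur \<and> dl s \<noteq> 0) \<and>
     (\<forall>s<N. stamp (sv s) = cur \<and> stamp (so s) = 0 \<longrightarrow> s \<in> set L) \<and>
     (\<forall>s<N. dl s \<noteq> 0 \<longrightarrow> stamp (sv s) \<noteq> 0 \<and> dl (pt s) = 0) \<and>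
     (\<forall>s<N. dl s \<noteq> 0 \<and> stamp (sv s) = cur \<longrightarrow>
        ws s \<le> dl s \<and> dl s \<le> r + ws s \<and> rch u (sv s) (dl s - ws s)) \<and>
     (\<forall>v. stamp v = cur \<longrightarrow> rch u v r)"

definition claims :: "(nat \<Rightarrow> nat) \<Rightarrow> nat list \<Rightarrow> nat list" where
  "claims stamp as = filter (\<lambda>s. stamp (so s) = 0) as"

definition arrive :: "(nat \<Rightarrow> nat) \<Rightarrow> nat \<Rightarrow> nat list \<Rightarrow> nat \<Rightarrow> nat" where
  "arrive dl r C s = (if s \<in> set C then r + ws s else dl s)"

text \<open>A join is the only event that claims slots. Slots towards vertices that were reached or
  removed before are left out, so an edge is traversed from one end only and two partners are never
  both claimed.\<close>

lemma binv_join: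
  assumes inv: "binv stamp0 dl0 u stamp dl cur r L" and z: "stamp z = 0" "rch u z r"
    and as: "set as = {s. s < N \<and> sv s = z}" "distinct as"
  defines "C \<equiv> claims (stamp(z := cur)) as"
  shows "binv stamp0 dl0 u (stamp(z := cur)) (arrive dl r C) cur r (L @ C)"
proof -
  have inv':
    "\<And>v. stamp0 v < cur" "\<And>v. stamp v = cur \<and> stamp0 v = 0 \<or> stamp v = stamp0 v"
    "\<And>s. s < N \<Longrightarrow> stamp0 (sv s) \<noteq> 0 \<Longrightarrow> dl s = dl0 s"
    "distinct L" "\<And>s. s \<in> set L \<Longrightarrow> s < N \<and> stamp (sv s) = cur \<and> dl s \<noteq> 0"
    "\<And>s. s < N \<Longrightarrow> stamp (sv s) = cur \<Longrightarrow> stamp (so s) = 0 \<Longrightarrow> s \<in> set L"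
    "\<And>s. s < N \<Longrightarrow> dl s \<noteq> 0 \<Longrightarrow> stamp (sv s) \<noteq> 0 \<and> dl (pt s) = 0"
    "\<And>s. s < N \<Longrightarrow> dl s \<noteq> 0 \<Longrightarrow> stamp (sv s) = cur \<Longrightarrow>
        ws s \<le> dl s \<and> dl s \<le> r + ws s \<and> rch u (sv s) (dl s - ws s)"
    "\<And>v. stamp v = cur \<Longrightarrow> rch u v r"
    using inv unfolding binv_def by blast+
  have cur: "0 < cur" using inv'(1)[of z] by simp
  have C: "set C = {s. s < N \<and> sv s = z \<and> stamp (so s) = 0}" "distinct C"
    using as no_loop cur by (auto simp: C_def claims_def)
  have ptC: "pt s \<notin> set C" if "s < N" "s \<in> set C" for s
    using that no_loop by (auto simp: C sv_pt)
  have dlz: "dl s = 0" if "s < N" "sv s = z" for s using inv'(7)[OF that(1)] that z by auto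
  show ?thesis unfolding binv_def
  proof (intro conjI allI impI ballI)
    fix v
    show "stamp0 v < cur" by (rule inv')
    show "(stamp(z := cur)) v = cur \<and> stamp0 v = 0 \<or> (stamp(z := cur)) v = stamp0 v"
      using inv'(2)[of v] z cur by auto
    assume "(stamp(z := cur)) v = cur" thus "rch u v r" using inv'(9)[of v] z by (auto split: if_splits)
  next
    fix s assume s: "s < N" "stamp0 (sv s) \<noteq> 0"
    have "s \<notin> set C" using inv'(2)[of z] s z cur by (auto simp: C)
    thus "arrive dl r C s = dl0 s" using inv'(3) s by (simp add: arrive_def)
  next
    show "distinct (L @ C)" using inv'(4,5) C z cur by auto
  next
    fix s assume "s \<in> set (L @ C)"
    thus "s < N" "(stamp(z := cur)) (sv s) = cur" "arrive dl r C s \<noteq> 0"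
      using inv'(5)[of s] ws_pos[of s] by (auto simp: C arrive_def)
  next
    fix s assume s: "s < N" and "(stamp(z := cur)) (sv s) = cur \<and> (stamp(z := cur)) (so s) = 0"
    thus "s \<in> set (L @ C)" using inv'(6)[OF s] cur by (auto simp: C split: if_splits)
  next
    fix s assume s: "s < N" "arrive dl r C s \<noteq> 0"
    show "(stamp(z := cur)) (sv s) \<noteq> 0"
      using s inv'(7)[of s] cur by (auto simp: C arrive_def split: if_splits)
    have "dl (pt s) = 0" if "s \<in> set C"
    proof (rule ccontr)
      assume "dl (pt s) \<noteq> 0"
      hence "stamp (so s) \<noteq> 0" using inv'(7)[of "pt s"] s by (simp add: pt_less sv_pt)
      thus False using that by (simp add: C)
    qed
    moreover have "pt s \<notin> set C" if "dl s \<noteq> 0"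
    proof
      assume "pt s \<in> set C"
      hence "stamp (sv s) = 0" using s by (simp add: C so_pt)
      thus False using inv'(7)[of s] s that by simp
    qed
    ultimately show "arrive dl r C (pt s) = 0"
      using s inv'(7)[of s] ptC[of s] by (auto simp: arrive_def split: if_splits)
  next
    fix s assume s: "s < N" "arrive dl r C s \<noteq> 0 \<and> (stamp(z := cur)) (sv s) = cur"
    have "ws s \<le> arrive dl r C s \<and> arrive dl r C s \<le> r + ws s \<and> rch u (sv s) (arrive dl r C s - ws s)"
      using s inv'(8)[of s] z C dlz[of s] by (cases "s \<in> set C") (auto simp: arrive_def split: if_splits)
    thus "ws s \<le> arrive dl r C s" "arrive dl r C s \<le> r + ws s" "rch u (sv s) (arrive dl r C s - ws s)"
      by auto
  qed
qed

lemma binv_tick: "binv stamp0 dl0 u stamp dl cur r L \<Longrightarrow> binv stamp0 dl0 u stamp dl cur (Suc r) L"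
  unfolding binv_def by (simp add: le_SucI reach_mono[where d = r and d' = "Suc r"])

lemma binv_filter: "binv stamp0 dl0 u stamp dl cur r L \<Longrightarrow>
    binv stamp0 dl0 u stamp dl cur r (filter (\<lambda>s. stamp (so s) = 0) L)"
  unfolding binv_def by auto

text \<open>The wave entered the edge at time \<open>dl s - ws s\<close>, a bound for the distance
  of the near end; at time \<open>dl s\<close> it has arrived at the far end.\<close>

lemma binv_due:
  assumes inv: "binv stamp0 dl0 u stamp dl cur r L" and s: "s \<in> set L" "dl s \<le> r"
  shows "rch u (so s) r"
proof -
  have "s < N" "ws s \<le> dl s" "rch u (sv s) (dl s - ws s)" using inv s unfolding binv_def by auto
  thus ?thesis using s by (intro reach.step[of N sv so ws u s "dl s - ws s"]) auto
qed

definition wB where "wB stamp dl cur = sum ws (claimed stamp dl cur)"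
text \<open>Length of the claimed edges covered up to time \<open>r\<close>. Truncated subtraction
  makes the remaining length 0 once the wave has passed, and the term is then the full
  weight.\<close>

definition wave where "wave stamp dl cur r = (\<Sum>s\<in>claimed stamp dl cur. ws s - (dl s - r))"

lemma wave_le_wB: "wave stamp dl cur r \<le> wB stamp dl cur"
  unfolding wave_def wB_def by (rule sum_mono) auto

lemma wB_le:
  assumes "binv stamp0 dl0 u stamp dl cur r L"
  shows "2 * wB stamp dl cur \<le> sum ws {..<N}"
  unfolding wB_def using assms
  by (intro sum_claimed_le[of dl]) (auto simp: binv_def claimed_def)

lemma claimed_join:
  assumes inv: "binv stamp0 dl0 u stamp dl cur r L" and z: "stamp z = 0"
    and as: "set as = {s. s < N \<and> sv s = z}" "distinct as"
  defines "C \<equiv> claims (stamp(z := cur)) as"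
  shows "claimed (stamp(z := cur)) (arrive dl r C) cur = claimed stamp dl cur \<union> set C"
    and "claimed stamp dl cur \<inter> set C = {}" and "distinct C"
proof -
  have cur: "0 < cur" using inv unfolding binv_def by auto
  have dl: "dl s \<noteq> 0 \<Longrightarrow> stamp (sv s) \<noteq> 0" if "s < N" for s using inv that unfolding binv_def by blast
  have C: "set C = {s. s < N \<and> sv s = z \<and> stamp (so s) = 0}" "distinct C"
    using as no_loop cur by (auto simp: C_def claims_def)
  show "claimed (stamp(z := cur)) (arrive dl r C) cur = claimed stamp dl cur \<union> set C"
    using z dl cur ws_pos by (force simp: C claimed_def arrive_def split: if_splits)
  show "claimed stamp dl cur \<inter> set C = {}" using z cur by (auto simp: C claimed_def)
  show "distinct C" by (rule C)
qed

lemma wB_join: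
  assumes "binv stamp0 dl0 u stamp dl cur r L" "stamp z = 0"
    "set as = {s. s < N \<and> sv s = z}" "distinct as"
  defines "C \<equiv> claims (stamp(z := cur)) as"
  shows "wB (stamp(z := cur)) (arrive dl r C) cur = wB stamp dl cur + sum_list (map ws C)"
  using claimed_join[OF assms(1-4)] unfolding wB_def C_def
  by (simp add: sum.union_disjoint sum_list_distinct_conv_sum_set)

lemma wave_join:
  assumes "binv stamp0 dl0 u stamp dl cur r L" "stamp z = 0"
    "set as = {s. s < N \<and> sv s = z}" "distinct as"
  defines "C \<equiv> claims (stamp(z := cur)) as"
  shows "wave stamp dl cur r \<le> wave (stamp(z := cur)) (arrive dl r C) cur r"
proof -
  have "wave stamp dl cur r = (\<Sum>s\<in>claimed stamp dl cur. ws s - (arrive dl r C s - r))"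
    unfolding wave_def using claimed_join(2)[OF assms(1-4)]
    by (intro sum.cong refl) (auto simp: arrive_def C_def)
  also have "\<dots> \<le> (\<Sum>s\<in>claimed stamp dl cur \<union> set C. ws s - (arrive dl r C s - r))"
    by (rule sum_mono2) auto
  finally show ?thesis using claimed_join(1)[OF assms(1-4)] unfolding wave_def C_def by simp
qed

text \<open>The wave is still inside the edge of every active slot, so a tick covers one more unit
  of each. In discrete form, the size of a ball grows at the rate of its boundary.\<close>

lemma wave_tick:
  assumes inv: "binv stamp0 dl0 u stamp dl cur r L" and late: "\<And>s. s \<in> set L \<Longrightarrow> r < dl s"
  shows "wave stamp dl cur r + length L \<le> wave stamp dl cur (Suc r)"
proof -
  have L: "distinct L" "set L \<subseteq> claimed stamp dl cur"
    using inv unfolding binv_def claimed_def by auto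
  have "wave stamp dl cur r + length L = (\<Sum>s\<in>claimed stamp dl cur. (ws s - (dl s - r)) + of_bool (s \<in> set L))"
    using L by (simp add: wave_def sum.distrib distinct_card[symmetric] sum_of_bool_eq Int_absorb1)
  also have "\<dots> \<le> (\<Sum>s\<in>claimed stamp dl cur. ws s - (dl s - Suc r))"
  proof (rule sum_mono)
    fix s assume "s \<in> claimed stamp dl cur"
    hence "dl s \<le> r + ws s" using inv unfolding binv_def claimed_def by auto
    thus "(ws s - (dl s - r)) + of_bool (s \<in> set L) \<le> ws s - (dl s - Suc r)"
      using late[of s] by auto
  qed
  finally show ?thesis by (simp add: wave_def)
qed

lemma volc_join:
  fixes stamp :: "nat \<Rightarrow> nat" and cur :: nat
  assumes "stamp z = 0" "0 < cur" "set as = {s. s < N \<and> sv s = z}" "distinct as"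
  shows "volc {v. (stamp(z := cur)) v = cur} = volc {v. stamp v = cur} + length as"
proof -
  define B where "B = {s. s < N \<and> stamp (sv s) = cur}"
  have "cur \<noteq> stamp z" using assms(1,2) by simp
  hence disj: "B \<inter> set as = {}" by (auto simp: B_def assms(3))
  have fin: "finite B" by (simp add: B_def)
  have "{s. s < N \<and> (stamp(z := cur)) (sv s) = cur} = B \<union> set as"
    by (auto simp: B_def assms(3))
  hence "volc {v. (stamp(z := cur)) v = cur} = card (B \<union> set as)" by (simp only: volc_def mem_Collect_eq)
  also have "\<dots> = card B + length as"
    unfolding distinct_card[OF assms(4), symmetric] by (rule card_Un_disjoint[OF fin _ disj]) simp
  finally show ?thesis by (simp only: volc_def B_def mem_Collect_eq)
qed

end

text \<open>
  Variables and arrays of the program.  Integer variables: 0 is the result flag (it initially holds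
  \<open>n \<noteq> 0\<close>), 1 to 3 are \<open>m\<close>, \<open>n\<close>, \<open>N\<close>, 5 is \<open>k\<close>, 6 is the logarithm \<open>l\<close>, 8 the level \<open>p\<close>, 11 the number of
  unrouted pairs, 12 is 0 when the main loop ends.  Real variables: 0 to 4 are \<open>\<alpha>\<close>, \<open>\<phi>\<close>, \<open>b\<close>, \<open>Lb\<close>, \<open>\<kappa>\<close>.
  Integer arrays: 2 and 3 are the vertices \<open>sv s\<close>, \<open>so s\<close> at the slot \<open>s\<close> and at the other end of its
  edge, 4 and 5 the slots of a vertex as linked lists (shifted by 1, with 0 for the end), 6 maps the
  code \<open>u * n + v\<close> to the number of the edge, 7 holds the weights, 8 their binary logarithms,
  9 the numbers of paths since the last doubling, 10 and 11 the pairs, 12 the path, 13 and 14 the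
  stamps and arrival times of ball growing, 0 the cut.
\<close>

abbreviation (input) V where "V \<equiv> IVar"
abbreviation (input) K where "K \<equiv> IConst"
notation Seq (infixr ";;" 60)

section \<open>The program that grows balls and writes down the cut\<close>

definition join_prog :: com where
  "join_prog =
     IPut 13 (V 26) (V 17);; IAssign 31 (IGet 4 (V 26));;
     While (ILess (K 0) (V 31))
       (IAssign 32 (ISub (V 31) (K 1));; IAssign 31 (IGet 5 (V 32));; IAssign 21 (IAdd (V 21) (K 1));;
        Cond (ILess (IGet 13 (IGet 3 (V 32))) (K 1))
          (IAssign 22 (IAdd (V 22) (IGet 7 (IMod (V 32) (V 1))));;
           IPut 14 (V 32) (IAdd (V 23) (IGet 7 (IMod (V 32) (V 1))));;
           IPut 15 (V 24) (V 32);; IAssign 24 (IAdd (V 24) (K 1)))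
          Skip)"

text \<open>The limit \<open>V 25\<close> is the length of the list before the pass. Slots appended
  meanwhile cannot be due at the same tick, because weights are at least 1.\<close>

definition pass1_prog :: com where
  "pass1_prog =
     IAssign 28 (K 0);;
     While (ILess (V 28) (V 25))
       (IAssign 30 (IGet 15 (V 28));; IAssign 28 (IAdd (V 28) (K 1));; IAssign 26 (IGet 3 (V 30));;
        Cond (BAnd (ILess (IGet 13 (V 26)) (K 1)) (BNot (ILess (V 23) (IGet 14 (V 30))))) join_prog Skip)"

text \<open>After this compaction the length of the list is exactly the boundary of the ball towards
  untouched vertices.\<close>

definition pass2_prog :: com where
  "pass2_prog =
     IAssign 28 (K 0);; IAssign 29 (K 0);;
     While (ILess (V 28) (V 24))
       (IAssign 30 (IGet 15 (V 28));; IAssign 28 (IAdd (V 28) (K 1));;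
        Cond (ILess (IGet 13 (IGet 3 (V 30))) (K 1))
          (IPut 15 (V 29) (V 30);; IAssign 29 (IAdd (V 29) (K 1))) Skip);;
     IAssign 24 (V 29)"

definition setq_prog :: com where
  "setq_prog = Cond (ILess (V 3) (IMul (K 2) (V 21))) (IAssign 27 (IMul (K 2) (V 3)))
     (IAssign 27 (IAdd (V 22) (IMul (V 8) (V 21))))"

definition tick_prog :: com where
  "tick_prog = IAssign 23 (IAdd (V 23) (K 1));; IAssign 25 (V 24);; pass1_prog;; pass2_prog;; setq_prog"

text \<open>A ball grows on while its boundary exceeds \<phi> / (21 p) times the quota. The 21 is 5
  * 4 + 1: \<open>goodI\<close> spends it on an allowance of 5 N, where N is at most 4 p times a
  volume, and on p times that volume.\<close>

definition reject :: bexp where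
  "reject = RLess (RMul (RVar 1) (ROfInt (V 27))) (ROfInt (IMul (IMul (K 21) (V 8)) (V 24)))"

definition ball_prog :: com where
  "ball_prog = IAssign 17 (IAdd (V 17) (K 1));; IAssign 21 (K 0);; IAssign 22 (K 0);; IAssign 23 (K 0);;
     IAssign 24 (K 0);; IAssign 26 (IGet 2 (V 19));; join_prog;; setq_prog;; While reject tick_prog"

text \<open>When the loop ends, \<open>V 20\<close> is the least stamp in the cut: 1 for the union
  of all balls, or the current stamp for a giant ball taken alone.\<close>

definition balls_prog :: com where
  "balls_prog =
     While (ILess (V 20) (K 1))
       (Cond (ILess (IGet 13 (IGet 2 (V 19))) (K 1))
         (ball_prog;;
          Cond (ILess (V 3) (IMul (K 2) (V 21))) (IAssign 20 (V 17))
            (IAssign 18 (IAdd (V 18) (V 21));;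
             Cond (ILess (IMul (IMul (K 4) (V 8)) (V 18)) (V 3)) Skip (IAssign 20 (K 1))))
         Skip;;
        IAssign 19 (IAdd (V 19) (K 1)))"

definition cut_prog :: com where
  "cut_prog =
     IAssign 17 (K 0);; IAssign 18 (K 0);; IAssign 19 (K 0);; IAssign 20 (K 0);; balls_prog;;
     IAssign 28 (K 0);;
     While (ILess (V 28) (V 3))
       (IAssign 26 (IGet 2 (V 28));;
        Cond (ILess (IGet 13 (V 26)) (V 20)) (IPut 0 (V 26) (K 0)) (IPut 0 (V 26) (K 1));;
        IAssign 28 (IAdd (V 28) (K 1)))"

fun chain :: "(nat \<Rightarrow> nat) \<Rightarrow> nat \<Rightarrow> nat list \<Rightarrow> bool" where
  "chain nx h [] \<longleftrightarrow> h = 0"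
| "chain nx h (s # l) \<longleftrightarrow> h = Suc s \<and> chain nx (nx s) l"

definition holds :: "(nat \<Rightarrow> nat) \<Rightarrow> nat list \<Rightarrow> bool" where
  "holds a L \<longleftrightarrow> (\<forall>i<length L. a i = L ! i)"

lemma holds_append: "holds a L \<Longrightarrow> holds (a(length L := x)) (L @ [x])"
  by (auto simp: holds_def nth_append less_Suc_eq)

text \<open>The bound \<open>W3\<close> is what routing guarantees: m edges of total weight at most
  m + N = 3 m, each seen from both of its slots.\<close>

locale cut_phase = slot_graph N sv so ws pt for N sv so ws pt +
  fixes D :: apsp_ds and Wd m p :: nat and hd nx wt :: "nat \<Rightarrow> nat" and adj :: "nat \<Rightarrow> nat list"
    and \<phi> :: real
  assumes adj: "chain nx (hd v) (adj v)" "set (adj v) = {s. s < N \<and> sv s = v}" "distinct (adj v)"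
    and ws: "s < N \<Longrightarrow> ws s = wt (s mod m)"
    and sv_Wd: "s < N \<Longrightarrow> sv s \<le> Wd"
    and W3: "sum ws {..<N} \<le> 3 * N"
    and big: "8 * (N + 1) * (p + 1) \<le> Wd" and p: "1 \<le> p" and phi: "0 < \<phi>" "\<phi> \<le> 1"
begin

definition env :: "mstate \<Rightarrow> bool" where
  "env s \<longleftrightarrow> ivar s 0 \<noteq> 0 \<and> ivar s 1 = m \<and> ivar s 3 = N \<and> ivar s 8 = p \<and> rvar s 1 = \<phi> \<and> iarr s 2 = sv \<and>
     iarr s 3 = so \<and> iarr s 4 = hd \<and> iarr s 5 = nx \<and> iarr s 7 = wt"

definition outer where
  "outer cur vs sl lo s \<longleftrightarrow> env s \<and> ivar s 17 = cur \<and> ivar s 18 = vs \<and> ivar s 19 = sl \<and> ivar s 20 = lo"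

definition ballst where
  "ballst r stamp dl L vb wb s \<longleftrightarrow> ivar s 23 = r \<and> ivar s 24 = length L \<and> ivar s 21 = vb \<and> ivar s 22 = wb \<and>
     iarr s 13 = stamp \<and> iarr s 14 = dl \<and> holds (iarr s 15) L"

lemma N_Wd: "N + 1 \<le> Wd" "8 * N + 8 \<le> Wd" "2 * N + p * N \<le> Wd" "2 * N + 2 \<le> Wd"
proof -
  have "8 * (N + 1) * (p + 1) = 8 * N + 8 * (p * N) + 8 * p + 8" by (simp add: algebra_simps)
  thus "N + 1 \<le> Wd" "8 * N + 8 \<le> Wd" "2 * N + p * N \<le> Wd" "2 * N + 2 \<le> Wd" using big by linarith+
qed

lemma so_Wd: "s < N \<Longrightarrow> so s \<le> Wd"
  using sv_Wd[of "pt s"] by (simp add: pt_less sv_pt)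

lemma claims_Cons: "claims st (as @ [a]) = (if st (so a) = 0 then claims st as @ [a] else claims st as)"
  by (simp add: claims_def)

lemma wp_join:
  assumes pre: "outer cur vs sl lo s" "ballst r stamp dl L vb wb s" "ivar s 26 = z" "ivar s 25 = l0" "ivar s 28 = i"
    and bnd: "cur \<le> Wd" "vb + length (adj z) \<le> Wd" "length L + length (adj z) \<le> Wd"
      "wb + sum_list (map ws (claims (stamp(z := cur)) (adj z))) \<le> Wd" "r + 2 * N \<le> Wd"
    and T: "3 + 9 * real (length (adj z)) \<le> T" "0 \<le> q"
    and post: "\<And>s' T'. \<lbrakk>outer cur vs sl lo s';
        ballst r (stamp(z := cur)) (arrive dl r (claims (stamp(z := cur)) (adj z))) (L @ claims (stamp(z := cur)) (adj z))
           (vb + length (adj z)) (wb + sum_list (map ws (claims (stamp(z := cur)) (adj z)))) s';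
        ivar s' 25 = l0; ivar s' 28 = i; T - (3 + 9 * real (length (adj z))) \<le> T'\<rbrakk> \<Longrightarrow> Q s' T' q"
  shows "wp D Wd join_prog Q s T q"
proof -
  define st where "st = stamp(z := cur)"
  define Tf where "Tf = T - (3 + 9 * real (length (adj z)))"
  define I where "I = (\<lambda>s T' q'. q' = q \<and> (\<exists>as1 as2. adj z = as1 @ as2 \<and> chain nx (ivar s 31) as2 \<and>
      outer cur vs sl lo s \<and> ballst r st (arrive dl r (claims st as1)) (L @ claims st as1)
         (vb + length as1) (wb + sum_list (map ws (claims st as1))) s \<and> ivar s 25 = l0 \<and> ivar s 28 = i \<and>
      Tf + 1 + 9 * real (length as2) \<le> T'))"
  have ws_le: "ws s \<le> 2 * N" if "s < N" for s
  proof -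
    have "sum ws {s, pt s} \<le> sum ws {..<N}" using that by (intro sum_mono2) (auto simp: pt_less)
    moreover have "sum ws {s, pt s} = 2 * ws s" using that pt_neq[OF that] by (simp add: ws_pt)
    ultimately show ?thesis using W3 by linarith
  qed
  have hdW: "hd z \<le> Wd"
  proof (cases "adj z")
    case Nil
    thus ?thesis using adj(1)[of z] by simp
  next
    case (Cons a l)
    have "a \<in> {s. s < N \<and> sv s = z}" unfolding adj(2)[symmetric] Cons by simp
    thus ?thesis using adj(1)[of z] Cons N_Wd(1) by simp
  qed
  have while: "wp D Wd (While (ILess (K 0) (V 31)) (IAssign 32 (ISub (V 31) (K 1));; IAssign 31 (IGet 5 (V 32));; IAssign 21 (IAdd (V 21) (K 1));;
        Cond (ILess (IGet 13 (IGet 3 (V 32))) (K 1))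
          (IAssign 22 (IAdd (V 22) (IGet 7 (IMod (V 32) (V 1))));;
           IPut 14 (V 32) (IAdd (V 23) (IGet 7 (IMod (V 32) (V 1))));;
           IPut 15 (V 24) (V 32);; IAssign 24 (IAdd (V 24) (K 1)))
          Skip)) Q (set_ivar 31 (iarr s 4 (ivar s 26)) (set_iarr 13 (ivar s 26) (ivar s 17) s)) (T - 2) q"
    proof (rule wp_While[where I = I])
      show "I (set_ivar 31 (iarr s 4 (ivar s 26)) (set_iarr 13 (ivar s 26) (ivar s 17) s)) (T - 2) q"
        unfolding I_def using pre adj(1)[of z]
        by (intro conjI refl exI[of _ "[]"] exI[of _ "adj z"])
          (auto simp: outer_def env_def ballst_def claims_def arrive_def st_def Tf_def fun_eq_iff)
    next
      fix s T' q' assume "I s T' q'" and b: "beval (ILess (K 0) (V 31)) s"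
      then obtain as1 as2 where i: "q' = q" "adj z = as1 @ as2" "chain nx (ivar s 31) as2" "outer cur vs sl lo s"
        "ballst r st (arrive dl r (claims st as1)) (L @ claims st as1)
         (vb + length as1) (wb + sum_list (map ws (claims st as1))) s" "ivar s 25 = l0" "ivar s 28 = i"
        "Tf + 1 + 9 * real (length as2) \<le> T'" unfolding I_def by blast
      from b i(3) obtain a as where as2: "as2 = a # as" "ivar s 31 = Suc a" "chain nx (nx a) as"
        by (cases as2) auto
      have mem: "x < N" if "x \<in> set as2" for x
      proof -
        have "x \<in> {s. s < N \<and> sv s = z}" unfolding adj(2)[symmetric] i(2) using that by simp
        thus ?thesis by simp
      qed
      have a: "a < N" using mem as2 by simp
      hence aW: "a \<le> Wd" using N_Wd(1) by simp
      have nxW: "nx a \<le> Wd"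
      proof (cases as)
        case (Cons a' as')
        hence "a' < N" using mem as2 by simp
        thus ?thesis using Cons as2(3) N_Wd(1) by simp
      qed (use as2(3) in simp)
      have Tf: "0 \<le> Tf" using T by (simp add: Tf_def)
      have mono: "sum_list (map ws (claims st (as1 @ [a]))) \<le> sum_list (map ws (claims st (adj z)))"
        unfolding i(2) as2 claims_def by simp
      have len: "length (claims st as1) \<le> length as1" by (simp add: claims_def)
      have ad: "a \<in> set (adj z)" "a \<notin> set as1" using i(2) as2 adj(3)[of z] by auto
      have ladj: "length (adj z) = length as1 + 1 + length as" using i(2) as2 by simp
      show "0 \<le> T' \<and> wp D Wd (IAssign 32 (ISub (V 31) (K 1));; IAssign 31 (IGet 5 (V 32));; IAssign 21 (IAdd (V 21) (K 1));;
        Cond (ILess (IGet 13 (IGet 3 (V 32))) (K 1))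
          (IAssign 22 (IAdd (V 22) (IGet 7 (IMod (V 32) (V 1))));;
           IPut 14 (V 32) (IAdd (V 23) (IGet 7 (IMod (V 32) (V 1))));;
           IPut 15 (V 24) (V 32);; IAssign 24 (IAdd (V 24) (K 1)))
          Skip) I s (T' - 1) q'"
      proof (cases "st (so a) = 0")
        case True
        have C: "claims st (as1 @ [a]) = claims st as1 @ [a]" using True by (simp add: claims_Cons)
        have b1: "wb + sum_list (map ws (claims st as1)) + ws a \<le> Wd"
          using mono bnd(4) unfolding st_def[symmetric] by (simp add: C)
        have b2: "r + ws a \<le> Wd" using ws_le[OF a] bnd by linarith
        have arr: "(arrive dl r (claims st as1))(a := r + ws a) = arrive dl r (claims st as1 @ [a])"
          by (auto simp: arrive_def)
        have "I (set_ivar 24 (Suc (length (L @ claims st as1))) (set_iarr 15 (length (L @ claims st as1)) a (set_iarr 14 a (r + ws a)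
           (set_ivar 22 (wb + sum_list (map ws (claims st as1)) + ws a) (set_ivar 21 (Suc (vb + length as1))
            (set_ivar 31 (nx a) (set_ivar 32 a s))))))) (T' - 9) q"
          unfolding I_def
          using i as2 C arr holds_append[of "iarr s 15" "L @ claims st as1" a]
          by (intro conjI refl exI[of _ "as1 @ [a]"] exI[of _ as])
            (simp_all add: outer_def env_def ballst_def)
        thus ?thesis using i as2 True nxW aW Tf bnd T(2) ladj len b1 b2 ws[OF a]
          by (simp add: wp_simps outer_def env_def ballst_def)
      next
        case False
        have C: "claims st (as1 @ [a]) = claims st as1" using False by (simp add: claims_Cons)
        have "I (set_ivar 21 (Suc (vb + length as1)) (set_ivar 31 (nx a) (set_ivar 32 a s))) (T' - 6) q"
          unfolding I_def using i as2 C
          by (intro conjI refl exI[of _ "as1 @ [a]"] exI[of _ as])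
            (simp_all add: outer_def env_def ballst_def)
        thus ?thesis using i as2 False nxW aW Tf bnd T(2) ladj
          by (simp add: wp_simps outer_def env_def ballst_def)
      qed
    next
      fix s T' q' assume "I s T' q'" and b: "\<not> beval (ILess (K 0) (V 31)) s"
      then obtain as1 as2 where i: "q' = q" "adj z = as1 @ as2" "chain nx (ivar s 31) as2" "outer cur vs sl lo s"
        "ballst r st (arrive dl r (claims st as1)) (L @ claims st as1)
         (vb + length as1) (wb + sum_list (map ws (claims st as1))) s" "ivar s 25 = l0" "ivar s 28 = i"
        "Tf + 1 + 9 * real (length as2) \<le> T'" unfolding I_def by blast
      with b have "as2 = []" by (cases as2) auto
      with i T show "1 \<le> T' \<and> 0 \<le> q' \<and> Q s (T' - 1) q'"
        by (auto simp: Tf_def st_def intro!: post)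
    qed
  show ?thesis unfolding join_prog_def using while pre hdW bnd T
    by (simp add: wp_simps outer_def env_def)
qed

end

section \<open>Amortized running time of growing a ball\<close>

context cut_phase begin

definition ballinv where
  "ballinv stamp0 dl0 u cur r stamp dl L s \<longleftrightarrow> binv stamp0 dl0 u stamp dl cur r L \<and>
     ballst r stamp dl L (volc {v. stamp v = cur}) (wB stamp dl cur) s"

text \<open>Credit for the future of the current ball. An active slot holds 24 per unit of length
  still to be covered, for being scanned at every tick. An untouched slot holds the same for its
  later activity, and 18 for the moment when its vertex joins.\<close>

definition pot :: "(nat \<Rightarrow> nat) \<Rightarrow> (nat \<Rightarrow> nat) \<Rightarrow> nat \<Rightarrow> nat list \<Rightarrow> real" where
  "pot stamp dl r L = real (24 * (\<Sum>s\<leftarrow>L. dl s - r) + (\<Sum>s | s < N \<and> stamp (sv s) = 0. 18 + 24 * ws s))"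

lemma pot_nonneg: "0 \<le> pot stamp dl r L"
  unfolding pot_def by (rule of_nat_0_le_iff)

lemma binv_bounds:
  assumes "binv stamp0 dl0 u stamp dl cur r L"
  shows "length L \<le> N" "2 * wB stamp dl cur \<le> 3 * N" "volc S \<le> N" "s \<in> set L \<Longrightarrow> s < N"
proof -
  have L: "distinct L" "set L \<subseteq> {..<N}" using assms unfolding binv_def by auto
  show "length L \<le> N" using card_mono[OF _ L(2)] distinct_card[OF L(1)] by simp
  show "2 * wB stamp dl cur \<le> 3 * N" using wB_le[OF assms] W3 by simp
  show "volc S \<le> N" using volc_compl[of S] by simp
  show "s \<in> set L \<Longrightarrow> s < N" using L by auto
qed

text \<open>A claimed slot turns from untouched to active without loss, as its remaining length is
  its whole weight. The 18 set free per slot of the vertex pay 9 in the loop of the join, 3 towards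
  its constant cost, and 6 for the next compaction.\<close>

lemma pot_join:
  assumes inv: "binv stamp0 dl0 u stamp dl cur r L" and z: "stamp z = 0"
  defines "C \<equiv> claims (stamp(z := cur)) (adj z)"
  shows "pot (stamp(z := cur)) (arrive dl r C) r (L @ C) + 18 * real (length (adj z)) \<le> pot stamp dl r L"
proof -
  have cur: "0 < cur" using inv unfolding binv_def by auto
  have L: "s < N \<and> stamp (sv s) = cur" if "s \<in> set L" for s using inv that unfolding binv_def by blast
  have C: "set C \<subseteq> set (adj z)" "distinct C" using adj(3) by (auto simp: C_def claims_def)
  have LC: "s \<notin> set C" if "s \<in> set L" for s
  proof
    assume "s \<in> set C"
    hence "s \<in> {s. s < N \<and> sv s = z}" using C adj(2) by blast
    thus False using L[OF that] z cur by auto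
  qed
  have 1: "(\<Sum>s\<leftarrow>L @ C. arrive dl r C s - r) = (\<Sum>s\<leftarrow>L. dl s - r) + (\<Sum>s\<leftarrow>C. ws s)"
    using LC by (simp add: arrive_def cong: map_cong)
  have "{s. s < N \<and> stamp (sv s) = 0} = {s. s < N \<and> (stamp(z := cur)) (sv s) = 0} \<union> set (adj z)"
    unfolding adj(2) using z cur by auto
  moreover have "{s. s < N \<and> (stamp(z := cur)) (sv s) = 0} \<inter> set (adj z) = {}"
    unfolding adj(2) using cur by auto
  ultimately have 2: "(\<Sum>s | s < N \<and> stamp (sv s) = 0. 18 + 24 * ws s)
     = (\<Sum>s | s < N \<and> (stamp(z := cur)) (sv s) = 0. 18 + 24 * ws s) + (\<Sum>s\<in>set (adj z). 18 + 24 * ws s)"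
    by (simp add: sum.union_disjoint)
  have "(\<Sum>s\<leftarrow>C. ws s) = sum ws (set C)" using C by (simp add: sum_list_distinct_conv_sum_set)
  also have "\<dots> \<le> sum ws (set (adj z))" using C by (intro sum_mono2) auto
  finally have "18 * length (adj z) + 24 * (\<Sum>s\<leftarrow>C. ws s) \<le> (\<Sum>s\<in>set (adj z). 18 + 24 * ws s)"
    using adj(3) by (simp add: sum.distrib sum_distrib_left[symmetric] distinct_card)
  with 1 2 have "24 * (\<Sum>s\<leftarrow>L @ C. arrive dl r C s - r) + (\<Sum>s | s < N \<and> (stamp(z := cur)) (sv s) = 0. 18 + 24 * ws s)
     + 18 * length (adj z) \<le> 24 * (\<Sum>s\<leftarrow>L. dl s - r) + (\<Sum>s | s < N \<and> stamp (sv s) = 0. 18 + 24 * ws s)"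
    by linarith
  hence "real (24 * (\<Sum>s\<leftarrow>L @ C. arrive dl r C s - r) + (\<Sum>s | s < N \<and> (stamp(z := cur)) (sv s) = 0. 18 + 24 * ws s)
     + 18 * length (adj z)) \<le> real (24 * (\<Sum>s\<leftarrow>L. dl s - r) + (\<Sum>s | s < N \<and> stamp (sv s) = 0. 18 + 24 * ws s))"
    by (rule of_nat_mono)
  thus ?thesis unfolding pot_def by simp
qed

lemma wp_join_inv:
  assumes pre: "outer cur vs sl lo s" "ballinv stamp0 dl0 u cur r stamp dl L s" "ivar s 26 = z" "ivar s 25 = l0" "ivar s 28 = i"
    and z: "stamp z = 0" "rch u z r"
    and bnd: "cur \<le> N" "r \<le> 2 * N + 1"
    and T: "3 + 9 * real (length (adj z)) \<le> T" "0 \<le> q"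
    and post: "\<And>s' T' C. \<lbrakk>C = claims (stamp(z := cur)) (adj z); outer cur vs sl lo s';
        ballinv stamp0 dl0 u cur r (stamp(z := cur)) (arrive dl r C) (L @ C) s';
        ivar s' 25 = l0; ivar s' 28 = i; T - (3 + 9 * real (length (adj z))) \<le> T';
        wave stamp dl cur r \<le> wave (stamp(z := cur)) (arrive dl r C) cur r;
        volc {v. (stamp(z := cur)) v = cur} = volc {v. stamp v = cur} + length (adj z)\<rbrakk> \<Longrightarrow> Q s' T' q"
  shows "wp D Wd join_prog Q s T q"
proof -
  have inv: "binv stamp0 dl0 u stamp dl cur r L" using pre(2) unfolding ballinv_def by simp
  have cur: "0 < cur" using inv unfolding binv_def by auto
  let ?C = "claims (stamp(z := cur)) (adj z)"
  note inv' = binv_join[OF inv z adj(2,3)]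
  note b = binv_bounds[OF inv'] and b0 = binv_bounds[OF inv]
  note w = wB_join[OF inv z(1) adj(2,3)] and v = volc_join[where stamp = stamp, OF z(1) cur adj(2,3)]
  have la: "length (adj z) \<le> N"
    using distinct_card[OF adj(3)[of z]] card_mono[of "{..<N}" "set (adj z)"] adj(2)[of z] by fastforce
  show ?thesis
  proof (rule wp_join[OF pre(1) _ pre(3-5)])
    show "ballst r stamp dl L (volc {v. stamp v = cur}) (wB stamp dl cur) s"
      using pre(2) unfolding ballinv_def by simp
    show "cur \<le> Wd" "r + 2 * N \<le> Wd" using bnd N_Wd by linarith+
    show "volc {v. stamp v = cur} + length (adj z) \<le> Wd" using b(3) v N_Wd by (metis add_leD1 order.trans)
    show "length L + length (adj z) \<le> Wd" using b0(1) la N_Wd by linarith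
    show "wB stamp dl cur + sum_list (map ws ?C) \<le> Wd" using b(2) w N_Wd by linarith
  next
    fix s' T'
    assume *: "outer cur vs sl lo s'"
      "ballst r (stamp(z := cur)) (arrive dl r ?C) (L @ ?C) (volc {v. stamp v = cur} + length (adj z))
         (wB stamp dl cur + sum_list (map ws ?C)) s'"
      "ivar s' 25 = l0" "ivar s' 28 = i" "T - (3 + 9 * real (length (adj z))) \<le> T'"
    show "Q s' T' q"
    proof (rule post[OF refl *(1) _ *(3-5) wave_join[OF inv z(1) adj(2,3)] v])
      show "ballinv stamp0 dl0 u cur r (stamp(z := cur)) (arrive dl r ?C) (L @ ?C) s'"
        unfolding ballinv_def using inv' *(2) by (simp only: w v)
    qed
  qed (use T in auto)
qed

text \<open>Of the 12 units per active slot, 6 pay for the iteration and 6 are handed on to the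
  compaction.\<close>

lemma wp_pass1:
  assumes pre: "outer cur vs sl lo s" "ballinv stamp0 dl0 u cur r stamp dl L s" "ivar s 25 = length L"
    and bnd: "cur \<le> N" "r \<le> 2 * N + 1"
    and T: "2 + 12 * real (length L) + pot stamp dl r L \<le> T" "0 \<le> q"
    and post: "\<And>s' T' stamp' dl' L'. \<lbrakk>outer cur vs sl lo s'; ballinv stamp0 dl0 u cur r stamp' dl' L' s';
        wave stamp dl cur r \<le> wave stamp' dl' cur r; {v. stamp v = cur} \<subseteq> {v. stamp' v = cur};
        \<And>s. s \<in> set L' \<Longrightarrow> stamp' (so s) = 0 \<Longrightarrow> r < dl' s;
        T - (2 + 12 * real (length L) + pot stamp dl r L) + 6 * real (length L') + pot stamp' dl' r L' \<le> T'\<rbrakk> \<Longrightarrow> Q s' T' q"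
  shows "wp D Wd pass1_prog Q s T q"
proof -
  define Tf where "Tf = T - (2 + 12 * real (length L) + pot stamp dl r L)"
  define I where "I = (\<lambda>s T' q'. q' = q \<and> (\<exists>stamp' dl' new i. i \<le> length L \<and> outer cur vs sl lo s \<and>
     ballinv stamp0 dl0 u cur r stamp' dl' (L @ new) s \<and> ivar s 28 = i \<and> ivar s 25 = length L \<and>
     wave stamp dl cur r \<le> wave stamp' dl' cur r \<and> {v. stamp v = cur} \<subseteq> {v. stamp' v = cur} \<and>
     (\<forall>j<i. stamp' (so (L ! j)) = 0 \<longrightarrow> r < dl' (L ! j)) \<and> (\<forall>s\<in>set new. r < dl' s) \<and>
     Tf + 1 + 6 * real (length L - i) + 6 * real (length L + length new) + pot stamp' dl' r (L @ new) \<le> T'))"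
  have Tf: "0 \<le> Tf" using T by (simp add: Tf_def)
  let ?body = "IAssign 30 (IGet 15 (V 28));; IAssign 28 (IAdd (V 28) (K 1));; IAssign 26 (IGet 3 (V 30));;
        Cond (BAnd (ILess (IGet 13 (V 26)) (K 1)) (BNot (ILess (V 23) (IGet 14 (V 30))))) join_prog Skip"
  have while: "wp D Wd (While (ILess (V 28) (V 25)) ?body) Q (set_ivar 28 0 s) (T - 1) q"
  proof (rule wp_While[where I = I])
    show "I (set_ivar 28 0 s) (T - 1) q"
      unfolding I_def using pre T
      by (intro conjI refl exI[of _ stamp] exI[of _ dl] exI[of _ "[]"] exI[of _ 0])
        (auto simp: outer_def env_def ballinv_def ballst_def Tf_def)
  next
    fix s T' q' assume "I s T' q'" and b: "beval (ILess (V 28) (V 25)) s"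
    then obtain stamp' dl' new i where i: "q' = q" "i \<le> length L" "outer cur vs sl lo s"
      "ballinv stamp0 dl0 u cur r stamp' dl' (L @ new) s" "ivar s 28 = i" "ivar s 25 = length L"
      "wave stamp dl cur r \<le> wave stamp' dl' cur r" "{v. stamp v = cur} \<subseteq> {v. stamp' v = cur}"
      "\<And>j. j < i \<Longrightarrow> stamp' (so (L ! j)) = 0 \<Longrightarrow> r < dl' (L ! j)" "\<And>s. s \<in> set new \<Longrightarrow> r < dl' s"
      "Tf + 1 + 6 * real (length L - i) + 6 * real (length L + length new) + pot stamp' dl' r (L @ new) \<le> T'"
      unfolding I_def by blast
    have iL: "i < length L" using b i by simp
    let ?s = "L ! i"
    have inv: "binv stamp0 dl0 u stamp' dl' cur r (L @ new)" using i(4) unfolding ballinv_def by simp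
    have sL: "?s \<in> set (L @ new)" using iL by simp
    have sN: "?s < N" using binv_bounds(4)[OF inv sL] .
    have act: "iarr s 15 i = ?s" using i(4) iL by (auto simp: ballinv_def ballst_def holds_def nth_append)
    have pot0: "0 \<le> pot stamp' dl' r (L @ new)" by (rule pot_nonneg)
    have Li: "real (length L - i) = real (length L - Suc i) + 1" using iL by simp
    have st: "iarr s 13 = stamp'" "iarr s 14 = dl'" "ivar s 23 = r" "iarr s 3 = so"
      using i(3,4) by (auto simp: ballinv_def ballst_def outer_def env_def)
    have W: "?s \<le> Wd" "so ?s \<le> Wd" "Suc i \<le> Wd"
      using sN so_Wd[OF sN] N_Wd(1) iL binv_bounds(1)[OF inv] by simp_all
    let ?s3 = "set_ivar 26 (so ?s) (set_ivar 28 (Suc i) (set_ivar 30 ?s s))"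
    have pre3: "outer cur vs sl lo ?s3" "ballinv stamp0 dl0 u cur r stamp' dl' (L @ new) ?s3"
      "ivar ?s3 26 = so ?s" "ivar ?s3 25 = length L" "ivar ?s3 28 = Suc i"
      using i by (auto simp: outer_def env_def ballinv_def ballst_def)
    show "0 \<le> T' \<and> wp D Wd ?body I s (T' - 1) q'"
    proof (cases "stamp' (so ?s) = 0 \<and> dl' ?s \<le> r")
      case True
      hence z: "stamp' (so ?s) = 0" "rch u (so ?s) r" using binv_due[OF inv sL] by auto
      let ?z = "so ?s"
      \<comment> \<open>The partner of the due slot sits at the joining vertex, so the degree is
        positive and covers the constant cost of the join.\<close>
      have deg: "1 \<le> length (adj ?z)"
      proof -
        have "pt ?s \<in> set (adj ?z)" unfolding adj(2) using sN by (simp add: pt_less sv_pt)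
        thus ?thesis by (cases "adj ?z") auto
      qed
      note pj = pot_join[OF inv z(1)]
      have T3: "3 + 9 * real (length (adj ?z)) \<le> T' - 5"
        using i(11) pj deg Tf pot_nonneg[of "stamp'(?z := cur)" "arrive dl' r (claims (stamp'(?z := cur)) (adj ?z))" r
            "(L @ new) @ claims (stamp'(?z := cur)) (adj ?z)"] Li by simp
      have "wp D Wd join_prog I ?s3 (T' - 5) q"
      proof (rule wp_join_inv[OF pre3 z bnd T3 T(2)])
        fix s' T'' C
        assume C: "C = claims (stamp'(?z := cur)) (adj ?z)" and o: "outer cur vs sl lo s'"
          and inv': "ballinv stamp0 dl0 u cur r (stamp'(?z := cur)) (arrive dl' r C) ((L @ new) @ C) s'"
          and iv: "ivar s' 25 = length L" "ivar s' 28 = Suc i" and T'': "T' - 5 - (3 + 9 * real (length (adj ?z))) \<le> T''"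
          and wv: "wave stamp' dl' cur r \<le> wave (stamp'(?z := cur)) (arrive dl' r C) cur r"
          and vl: "volc {v. (stamp'(?z := cur)) v = cur} = volc {v. stamp' v = cur} + length (adj ?z)"
        have lC: "length C \<le> length (adj ?z)" by (simp add: C claims_def)
        have CN: "s < N" if "s \<in> set C" for s
        proof -
          have "s \<in> {s. s < N \<and> sv s = ?z}" using that unfolding adj(2)[symmetric] by (simp add: C claims_def)
          thus ?thesis by simp
        qed
        have late: "r < arrive dl' r C s" if "r < dl' s \<or> s \<in> set C" for s
          using that ws_pos[OF CN, of s] by (auto simp: arrive_def)
        have "ivar s' 28 = Suc i \<and> (\<forall>j<Suc i. (stamp'(?z := cur)) (so (L ! j)) = 0 \<longrightarrow> r < arrive dl' r C (L ! j))
          \<and> (\<forall>s\<in>set (new @ C). r < arrive dl' r C s)"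
        proof (intro conjI allI impI ballI)
          fix j assume j: "j < Suc i" and a: "(stamp'(?z := cur)) (so (L ! j)) = 0"
          have cur: "cur \<noteq> 0" using inv unfolding binv_def by auto
          with a have "so (L ! j) \<noteq> ?z" "stamp' (so (L ! j)) = 0" by (auto split: if_splits)
          with j have "j < i" by (metis less_antisym)
          thus "r < arrive dl' r C (L ! j)" using i(9) \<open>stamp' (so (L ! j)) = 0\<close> late by blast
        qed (use i(10) late iv in auto)
        moreover have "Tf + 1 + 6 * real (length L - Suc i) + 6 * real (length L + length (new @ C))
            + pot (stamp'(?z := cur)) (arrive dl' r C) r (L @ new @ C) \<le> T''"
          using i(11) T'' pj[folded C] deg lC Li by simp
        moreover have "{v. stamp v = cur} \<subseteq> {v. (stamp'(?z := cur)) v = cur}" using i(8) by auto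
        ultimately show "I s' T'' q" unfolding I_def
          using o inv' iv wv i(7) iL
          by (intro conjI refl exI[of _ "stamp'(?z := cur)"] exI[of _ "arrive dl' r C"] exI[of _ "new @ C"] exI[of _ "Suc i"])
            simp_all
      qed
      moreover have "8 \<le> T'" using T3 by simp
      ultimately show ?thesis using i True st act W T(2) by (simp add: wp_simps)
    next
      case False
      have "\<forall>j<Suc i. stamp' (so (L ! j)) = 0 \<longrightarrow> r < dl' (L ! j)"
        using i(9) False by (auto simp: less_Suc_eq not_le)
      hence "I ?s3 (T' - 6) q" unfolding I_def using i pre3 iL Li
        by (intro conjI refl exI[of _ stamp'] exI[of _ dl'] exI[of _ new] exI[of _ "Suc i"]) simp_all
      moreover have "7 \<le> T'" using i(11) Li Tf pot0 by simp
      ultimately show ?thesis using i False st act W T(2) by (auto simp: wp_simps)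
    qed
  next
    fix s T' q' assume "I s T' q'" and b: "\<not> beval (ILess (V 28) (V 25)) s"
    then obtain stamp' dl' new i where i: "q' = q" "i \<le> length L" "outer cur vs sl lo s"
      "ballinv stamp0 dl0 u cur r stamp' dl' (L @ new) s" "ivar s 28 = i" "ivar s 25 = length L"
      "wave stamp dl cur r \<le> wave stamp' dl' cur r" "{v. stamp v = cur} \<subseteq> {v. stamp' v = cur}"
      "\<And>j. j < i \<Longrightarrow> stamp' (so (L ! j)) = 0 \<Longrightarrow> r < dl' (L ! j)" "\<And>s. s \<in> set new \<Longrightarrow> r < dl' s"
      "Tf + 1 + 6 * real (length L - i) + 6 * real (length L + length new) + pot stamp' dl' r (L @ new) \<le> T'"
      unfolding I_def by blast
    have iL: "i = length L" using b i by simp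
    have "Q s (T' - 1) q"
    proof (rule post[OF i(3,4,7,8)])
      show "r < dl' s" if "s \<in> set (L @ new)" "stamp' (so s) = 0" for s
        using that i(9,10) iL by (auto simp: in_set_conv_nth)
      show "T - (2 + 12 * real (length L) + pot stamp dl r L) + 6 * real (length (L @ new)) + pot stamp' dl' r (L @ new) \<le> T' - 1"
        using i(11) iL by (simp add: Tf_def)
    qed
    moreover have "1 \<le> T'" using i(11) Tf pot_nonneg[of stamp' dl' r "L @ new"] by simp
    ultimately show "1 \<le> T' \<and> 0 \<le> q' \<and> Q s (T' - 1) q'" using i(1) T(2) by simp
  qed
  have "1 \<le> T" using T pot_nonneg[of stamp dl r L] by simp
  with while show ?thesis unfolding pass1_prog_def using T(2) by (simp add: wp_simps)
qed


text \<open>Filtering in place is safe because the write position never overtakes the read position;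
  the unread part of the array stays intact.\<close>

lemma wp_pass2:
  assumes pre: "outer cur vs sl lo s" "ballinv stamp0 dl0 u cur r stamp dl L s"
    and T: "4 + 6 * real (length L) \<le> T" "0 \<le> q"
    and post: "\<And>s' T'. \<lbrakk>outer cur vs sl lo s';
        ballinv stamp0 dl0 u cur r stamp dl (filter (\<lambda>s. stamp (so s) = 0) L) s';
        T - (4 + 6 * real (length L)) \<le> T'\<rbrakk> \<Longrightarrow> Q s' T' q"
  shows "wp D Wd pass2_prog Q s T q"
proof -
  let ?P = "\<lambda>s. stamp (so s) = 0"
  define Tf where "Tf = T - (4 + 6 * real (length L))"
  define vb where "vb = volc {v. stamp v = cur}"
  define wb where "wb = wB stamp dl cur"
  have inv: "binv stamp0 dl0 u stamp dl cur r L" using pre(2) unfolding ballinv_def by simp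
  have Tf: "0 \<le> Tf" using T by (simp add: Tf_def)
  define I where "I = (\<lambda>s T' q'. q' = q \<and> (\<exists>i. i \<le> length L \<and> outer cur vs sl lo s \<and> ivar s 28 = i \<and>
     ivar s 23 = r \<and> ivar s 24 = length L \<and> ivar s 21 = vb \<and> ivar s 22 = wb \<and> iarr s 13 = stamp \<and> iarr s 14 = dl \<and>
     ivar s 29 = length (filter ?P (take i L)) \<and> holds (iarr s 15) (filter ?P (take i L)) \<and>
     (\<forall>j. i \<le> j \<and> j < length L \<longrightarrow> iarr s 15 j = L ! j) \<and> Tf + 2 + 6 * real (length L - i) \<le> T'))"
  let ?body = "IAssign 30 (IGet 15 (V 28));; IAssign 28 (IAdd (V 28) (K 1));;
        Cond (ILess (IGet 13 (IGet 3 (V 30))) (K 1)) (IPut 15 (V 29) (V 30);; IAssign 29 (IAdd (V 29) (K 1))) Skip"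
  have while: "wp D Wd (While (ILess (V 28) (V 24)) ?body) (wp D Wd (IAssign 24 (V 29)) Q)
      (set_ivar 29 0 (set_ivar 28 0 s)) (T - 2) q"
  proof (rule wp_While[where I = I])
    show "I (set_ivar 29 0 (set_ivar 28 0 s)) (T - 2) q"
      unfolding I_def using pre
      by (intro conjI refl exI[of _ 0])
        (auto simp: outer_def env_def ballinv_def ballst_def Tf_def holds_def vb_def wb_def)
  next
    fix s T' q' assume "I s T' q'" and b: "beval (ILess (V 28) (V 24)) s"
    then obtain i where i: "q' = q" "i \<le> length L" "outer cur vs sl lo s" "ivar s 28 = i"
     "ivar s 23 = r" "ivar s 24 = length L" "ivar s 21 = vb" "ivar s 22 = wb" "iarr s 13 = stamp" "iarr s 14 = dl"
     "ivar s 29 = length (filter ?P (take i L))" "holds (iarr s 15) (filter ?P (take i L))"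
     "\<And>j. i \<le> j \<Longrightarrow> j < length L \<Longrightarrow> iarr s 15 j = L ! j" "Tf + 2 + 6 * real (length L - i) \<le> T'"
      unfolding I_def by blast
    have iL: "i < length L" using b i by simp
    have Li: "real (length L - i) = real (length L - Suc i) + 1" using iL by simp
    have tk: "take (Suc i) L = take i L @ [L ! i]" using iL by (rule take_Suc_conv_app_nth)
    have le: "length (filter ?P (take i L)) \<le> i"
      using length_filter_le[of ?P "take i L"] iL by simp
    have W: "L ! i \<le> Wd" "Suc i \<le> Wd" "Suc (length (filter ?P (take i L))) \<le> Wd"
      using binv_bounds(4)[OF inv, of "L ! i"] binv_bounds(1)[OF inv] N_Wd(1) iL le by simp_all
    have so: "iarr s 3 = so" using i(3) by (simp add: outer_def env_def)
    have T7: "7 \<le> T'" using i(14) Li Tf by simp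
    show "0 \<le> T' \<and> wp D Wd ?body I s (T' - 1) q'"
    proof (cases "?P (L ! i)")
      case True
      have "I (set_ivar 29 (Suc (length (filter ?P (take i L)))) (set_iarr 15 (length (filter ?P (take i L))) (L ! i)
          (set_ivar 28 (Suc i) (set_ivar 30 (L ! i) s)))) (T' - 6) q"
        unfolding I_def using i iL tk True le Li holds_append[OF i(12), of "L ! i"]
        by (intro conjI refl exI[of _ "Suc i"]) (simp_all add: outer_def env_def)
      thus ?thesis using i so True W T(2) T7 iL by (simp add: wp_simps)
    next
      case False
      have "I (set_ivar 28 (Suc i) (set_ivar 30 (L ! i) s)) (T' - 5) q"
        unfolding I_def using i iL tk False le Li
        by (intro conjI refl exI[of _ "Suc i"]) (simp_all add: outer_def env_def)
      thus ?thesis using i so False W T(2) T7 iL by (simp add: wp_simps)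
    qed
  next
    fix s T' q' assume "I s T' q'" and b: "\<not> beval (ILess (V 28) (V 24)) s"
    then obtain i where i: "q' = q" "i \<le> length L" "outer cur vs sl lo s" "ivar s 28 = i"
     "ivar s 23 = r" "ivar s 24 = length L" "ivar s 21 = vb" "ivar s 22 = wb" "iarr s 13 = stamp" "iarr s 14 = dl"
     "ivar s 29 = length (filter ?P (take i L))" "holds (iarr s 15) (filter ?P (take i L))"
     "Tf + 2 + 6 * real (length L - i) \<le> T'"
      unfolding I_def by blast
    have iL: "i = length L" using b i by simp
    have "Q (set_ivar 24 (length (filter ?P L)) s) (T' - 2) q"
    proof (rule post)
      show "outer cur vs sl lo (set_ivar 24 (length (filter ?P L)) s)" using i by (simp add: outer_def env_def)
      show "ballinv stamp0 dl0 u cur r stamp dl (filter ?P L) (set_ivar 24 (length (filter ?P L)) s)"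
        using binv_filter[OF inv] i iL by (simp add: ballinv_def ballst_def vb_def wb_def)
      show "T - (4 + 6 * real (length L)) \<le> T' - 2" using i(13) iL by (simp add: Tf_def)
    qed
    moreover have "length (filter ?P L) \<le> Wd"
      using length_filter_le[of ?P L] binv_bounds(1)[OF inv] N_Wd(1) by linarith
    ultimately show "1 \<le> T' \<and> 0 \<le> q' \<and> wp D Wd (IAssign 24 (V 29)) Q s (T' - 1) q'"
      using i iL T(2) Tf by (simp add: wp_simps)
  qed
  show ?thesis unfolding pass2_prog_def using while T by (simp add: wp_simps)
qed

text \<open>Up to half of the volume a ball affords its boundary by its own weight and p times its
  volume. Beyond that the complement is the side that has to afford the cut, and the allowance is a
  constant of the order of the total weight.\<close>

definition quota where
  "quota stamp dl cur = (if N < 2 * volc {v. stamp v = cur} then 2 * N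
     else wB stamp dl cur + p * volc {v. stamp v = cur})"

definition exact where
  "exact stamp dl r L \<longleftrightarrow> (\<forall>s\<in>set L. stamp (so s) = 0 \<and> r < dl s)"

lemma wp_setq:
  assumes pre: "outer cur vs sl lo s" "ballinv stamp0 dl0 u cur r stamp dl L s"
    and T: "2 \<le> T" "0 \<le> q"
    and post: "\<And>s'. \<lbrakk>outer cur vs sl lo s'; ballinv stamp0 dl0 u cur r stamp dl L s';
        ivar s' 27 = quota stamp dl cur\<rbrakk> \<Longrightarrow> Q s' (T - 2) q"
  shows "wp D Wd setq_prog Q s T q"
proof -
  have inv: "binv stamp0 dl0 u stamp dl cur r L" using pre(2) unfolding ballinv_def by simp
  have "p * volc {v. stamp v = cur} \<le> p * N" using binv_bounds(3)[OF inv] by simp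
  hence W: "wB stamp dl cur + p * volc {v. stamp v = cur} \<le> Wd" "2 * N \<le> Wd"
    using binv_bounds(2)[OF inv] N_Wd by linarith+
  have "Q (set_ivar 27 (quota stamp dl cur) s) (T - 2) q"
    by (rule post) (use pre in \<open>auto simp: outer_def env_def ballinv_def ballst_def\<close>)
  thus ?thesis using pre T W
    by (auto simp: setq_prog_def wp_simps quota_def outer_def env_def ballinv_def ballst_def)
qed

text \<open>No active slot is due, so truncation does not interfere and each remaining length drops
  by exactly 1.\<close>

lemma pot_tick:
  assumes "exact stamp dl r L"
  shows "pot stamp dl (Suc r) L + 24 * real (length L) = pot stamp dl r L"
proof -
  have "(\<Sum>s\<leftarrow>L. dl s - r) = (\<Sum>s\<leftarrow>L. dl s - Suc r) + length L"
    using assms by (induction L) (auto simp: exact_def)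
  thus ?thesis by (simp add: pot_def)
qed

lemma pot_filter: "pot stamp dl r (filter P L) \<le> pot stamp dl r L"
proof -
  have "(\<Sum>s\<leftarrow>filter P L. dl s - r) \<le> (\<Sum>s\<leftarrow>L. dl s - r)" by (induction L) auto
  hence "24 * (\<Sum>s\<leftarrow>filter P L. dl s - r) + (\<Sum>s | s < N \<and> stamp (sv s) = 0. 18 + 24 * ws s)
     \<le> 24 * (\<Sum>s\<leftarrow>L. dl s - r) + (\<Sum>s | s < N \<and> stamp (sv s) = 0. 18 + 24 * ws s)" by simp
  thus ?thesis unfolding pot_def by (rule of_nat_mono)
qed

text \<open>A tick sets 24 free per active slot. The passes use 12 of them; as at least one slot is
  active, the other 12 cover the constant costs and leave 2 for the surrounding loop.\<close>

lemma wp_tick: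
  assumes pre: "outer cur vs sl lo s" "ballinv stamp0 dl0 u cur r stamp dl L s" "exact stamp dl r L" "L \<noteq> []"
    and bnd: "cur \<le> N" "r \<le> 2 * N"
    and T: "pot stamp dl r L \<le> T" "0 \<le> q"
    and post: "\<And>s' T' stamp' dl' L'. \<lbrakk>outer cur vs sl lo s'; ballinv stamp0 dl0 u cur (Suc r) stamp' dl' L' s';
        exact stamp' dl' (Suc r) L'; ivar s' 27 = quota stamp' dl' cur;
        wave stamp dl cur r + length L \<le> wave stamp' dl' cur (Suc r);
        {v. stamp v = cur} \<subseteq> {v. stamp' v = cur};
        T - pot stamp dl r L + pot stamp' dl' (Suc r) L' + 2 \<le> T'\<rbrakk> \<Longrightarrow> Q s' T' q"
  shows "wp D Wd tick_prog Q s T q"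
proof -
  let ?s = "set_ivar 25 (length L) (set_ivar 23 (Suc r) s)"
  have inv: "binv stamp0 dl0 u stamp dl cur r L" using pre(2) unfolding ballinv_def by simp
  have L1: "1 \<le> real (length L)" using pre(4) by (cases L) auto
  note pt = pot_tick[OF pre(3)]
  have pt0: "0 \<le> pot stamp dl (Suc r) L" by (rule pot_nonneg)
  have w1: "wave stamp dl cur r + length L \<le> wave stamp dl cur (Suc r)"
    by (rule wave_tick[OF inv]) (use pre(3) in \<open>simp add: exact_def\<close>)
  have "wp D Wd pass1_prog (wp D Wd (pass2_prog;; setq_prog) Q) ?s (T - 2) q"
  proof (rule wp_pass1[where r = "Suc r" and L = L and stamp = stamp and dl = dl])
    show "outer cur vs sl lo ?s" using pre(1) by (simp add: outer_def env_def)
    show "ballinv stamp0 dl0 u cur (Suc r) stamp dl L ?s"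
      using pre(2) binv_tick[OF inv] by (simp add: ballinv_def ballst_def)
    show "2 + 12 * real (length L) + pot stamp dl (Suc r) L \<le> T - 2" using T pt L1 by linarith
  next
    fix s' T' stamp' dl' L'
    assume o: "outer cur vs sl lo s'" and b: "ballinv stamp0 dl0 u cur (Suc r) stamp' dl' L' s'"
      and w: "wave stamp dl cur (Suc r) \<le> wave stamp' dl' cur (Suc r)"
      and v: "{v. stamp v = cur} \<subseteq> {v. stamp' v = cur}"
      and late: "\<And>s. s \<in> set L' \<Longrightarrow> stamp' (so s) = 0 \<Longrightarrow> Suc r < dl' s"
      and T': "T - 2 - (2 + 12 * real (length L) + pot stamp dl (Suc r) L) + 6 * real (length L') + pot stamp' dl' (Suc r) L' \<le> T'"
    let ?L = "filter (\<lambda>s. stamp' (so s) = 0) L'"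
    have pn: "0 \<le> pot stamp' dl' (Suc r) L'" by (rule pot_nonneg)
    show "wp D Wd (pass2_prog;; setq_prog) Q s' T' q" unfolding wp_Seq
    proof (rule wp_pass2[OF o b _ T(2)])
      show "4 + 6 * real (length L') \<le> T'" using T' T pt L1 pn by linarith
    next
      fix s'' T''
      assume o': "outer cur vs sl lo s''" and b': "ballinv stamp0 dl0 u cur (Suc r) stamp' dl' ?L s''"
        and T'': "T' - (4 + 6 * real (length L')) \<le> T''"
      show "wp D Wd setq_prog Q s'' T'' q"
      proof (rule wp_setq[OF o' b' _ T(2)])
        show "2 \<le> T''" using T'' T' T pt L1 pn by linarith
      next
        fix s3
        assume a: "outer cur vs sl lo s3" "ballinv stamp0 dl0 u cur (Suc r) stamp' dl' ?L s3"
          "ivar s3 27 = quota stamp' dl' cur"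
        show "Q s3 (T'' - 2) q"
        proof (rule post[OF a(1,2) _ a(3) _ v])
          show "exact stamp' dl' (Suc r) ?L" using late by (auto simp: exact_def)
          show "wave stamp dl cur r + length L \<le> wave stamp' dl' cur (Suc r)" using w w1 by simp
          show "T - pot stamp dl r L + pot stamp' dl' (Suc r) ?L + 2 \<le> T'' - 2"
            using T'' T' pt L1 pot_filter[of stamp' dl' "Suc r" "\<lambda>s. stamp' (so s) = 0" L'] by linarith
        qed
      qed
    qed
  qed (use bnd T in auto)
  moreover have "r + 1 \<le> Wd" "length L \<le> Wd" using bnd N_Wd binv_bounds(1)[OF inv] by linarith+
  moreover have "2 \<le> T" using T pt L1 pt0 by linarith
  ultimately show ?thesis unfolding tick_prog_def using T pre
    by (simp add: wp_simps ballinv_def ballst_def)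
qed

end

section \<open>Accounting when a ball is closed\<close>

context slot_graph begin

definition stinv where
  "stinv stamp dl cur \<longleftrightarrow> (\<forall>v. stamp v \<le> cur) \<and> (\<forall>s<N. dl s \<noteq> 0 \<longrightarrow> stamp (sv s) \<noteq> 0 \<and> dl (pt s) = 0)"

definition used where
  "used dl = sum ws {s. s < N \<and> dl s \<noteq> 0}"

text \<open>Slots that leave the union start in an older ball, or in the new ball towards untouched
  vertices, where they are in \<open>L\<close>. For the cut of the new ball alone, an edge to an
  older ball is charged to the cut of the older union through its partner slot.\<close>

lemma ball_close:
  assumes inv: "binv stamp0 dl0 u stamp dl cur r L" and st: "stinv stamp0 dl0 cur0" "cur0 < cur"
  shows "stinv stamp dl cur"
    and "volc {v. stamp v \<noteq> 0} = volc {v. stamp0 v \<noteq> 0} + volc {v. stamp v = cur}"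
    and "cutc {v. stamp v \<noteq> 0} \<le> cutc {v. stamp0 v \<noteq> 0} + length L"
    and "used dl = used dl0 + wB stamp dl cur"
    and "cutc {v. stamp v = cur} \<le> cutc {v. stamp0 v \<noteq> 0} + length L"
proof -
  have i: "\<And>v. stamp v = cur \<and> stamp0 v = 0 \<or> stamp v = stamp0 v" "\<And>v. stamp0 v < cur"
    "\<And>s. s < N \<Longrightarrow> stamp0 (sv s) \<noteq> 0 \<Longrightarrow> dl s = dl0 s"
    "\<And>s. s < N \<Longrightarrow> dl s \<noteq> 0 \<Longrightarrow> stamp (sv s) \<noteq> 0 \<and> dl (pt s) = 0"
    "\<And>s. s < N \<Longrightarrow> stamp (sv s) = cur \<Longrightarrow> stamp (so s) = 0 \<Longrightarrow> s \<in> set L"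
    using inv unfolding binv_def by blast+
  have st0: "\<And>s. s < N \<Longrightarrow> dl0 s \<noteq> 0 \<Longrightarrow> stamp0 (sv s) \<noteq> 0" using st(1) unfolding stinv_def by blast
  have le: "stamp v \<le> cur" for v using i(1,2)[of v] by auto
  have ne: "stamp v \<noteq> 0 \<longleftrightarrow> stamp0 v \<noteq> 0 \<or> stamp v = cur" for v using i(1,2)[of v] by auto
  have dj: "stamp v = cur \<Longrightarrow> stamp0 v = 0" for v using i(1,2)[of v] by auto
  show "stinv stamp dl cur" unfolding stinv_def using le i(4) by blast
  have "{s. s < N \<and> sv s \<in> {v. stamp v \<noteq> 0}}
    = {s. s < N \<and> sv s \<in> {v. stamp0 v \<noteq> 0}} \<union> {s. s < N \<and> sv s \<in> {v. stamp v = cur}}"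
    using ne by auto
  thus "volc {v. stamp v \<noteq> 0} = volc {v. stamp0 v \<noteq> 0} + volc {v. stamp v = cur}"
    unfolding volc_def by (simp, subst card_Un_disjoint) (use dj in auto)
  have cL: "card (set L) \<le> length L" by (rule card_length)
  have "{s. s < N \<and> sv s \<in> {v. stamp v \<noteq> 0} \<and> so s \<notin> {v. stamp v \<noteq> 0}}
    \<subseteq> {s. s < N \<and> sv s \<in> {v. stamp0 v \<noteq> 0} \<and> so s \<notin> {v. stamp0 v \<noteq> 0}} \<union> set L"
  proof
    fix s assume s: "s \<in> {s. s < N \<and> sv s \<in> {v. stamp v \<noteq> 0} \<and> so s \<notin> {v. stamp v \<noteq> 0}}"
    show "s \<in> {s. s < N \<and> sv s \<in> {v. stamp0 v \<noteq> 0} \<and> so s \<notin> {v. stamp0 v \<noteq> 0}} \<union> set L"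
      using s ne[of "sv s"] ne[of "so s"] i(5)[of s] by (cases "stamp (sv s) = cur") simp_all
  qed
  from card_mono[OF _ this] card_Un_le[of "{s. s < N \<and> sv s \<in> {v. stamp0 v \<noteq> 0} \<and> so s \<notin> {v. stamp0 v \<noteq> 0}}" "set L"] cL
  show "cutc {v. stamp v \<noteq> 0} \<le> cutc {v. stamp0 v \<noteq> 0} + length L" unfolding cutc_def by simp
  have "{s. s < N \<and> dl s \<noteq> 0} = {s. s < N \<and> dl0 s \<noteq> 0} \<union> claimed stamp dl cur"
    using ne i(3,4) st0 dj unfolding claimed_def by fastforce
  moreover have "{s. s < N \<and> dl0 s \<noteq> 0} \<inter> claimed stamp dl cur = {}"
    using st0 dj unfolding claimed_def by fastforce
  ultimately show "used dl = used dl0 + wB stamp dl cur"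
    unfolding used_def wB_def by (simp add: sum.union_disjoint)
  let ?O = "{s. s < N \<and> sv s \<in> {v. stamp0 v \<noteq> 0} \<and> so s \<notin> {v. stamp0 v \<noteq> 0}}"
  have "{s. s < N \<and> sv s \<in> {v. stamp v = cur} \<and> so s \<notin> {v. stamp v = cur}} \<subseteq> pt ` ?O \<union> set L"
  proof
    fix s assume s: "s \<in> {s. s < N \<and> sv s \<in> {v. stamp v = cur} \<and> so s \<notin> {v. stamp v = cur}}"
    show "s \<in> pt ` ?O \<union> set L"
    proof (cases "stamp (so s) = 0")
      case True
      thus ?thesis using s i(5) by simp
    next
      case False
      hence "pt s \<in> ?O" using s ne[of "so s"] dj[of "sv s"] by (simp add: pt_less sv_pt so_pt)
      hence "pt (pt s) \<in> pt ` ?O" by (rule imageI)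
      thus ?thesis using s by (simp add: pt_pt)
    qed
  qed
  from card_mono[OF _ this] card_Un_le[of "pt ` ?O" "set L"] cL card_image_le[of ?O pt]
  show "cutc {v. stamp v = cur} \<le> cutc {v. stamp0 v \<noteq> 0} + length L" unfolding cutc_def by simp
qed

lemma used_le: "stinv stamp dl cur \<Longrightarrow> 2 * used dl \<le> sum ws {..<N}"
  unfolding used_def by (rule sum_claimed_le[of dl]) (auto simp: stinv_def)

end

section \<open>Growth of a rejected ball and the resulting bound on its radius\<close>

context cut_phase begin

text \<open>The growth rate that rejection enforces: the boundary then exceeds \<open>delta\<close>
  times the quota.\<close>

definition delta :: real where "delta = \<phi> / (21 * real p)"

lemma delta: "0 < delta" "delta \<le> 1" "delta * (21 * real p) = \<phi>"
  using phi p by (auto simp: delta_def field_simps)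

text \<open>\<open>r1\<close> counts the ticks with at most half of the volume, during which weight
  plus p times volume grows by the factor 1 + \<open>delta\<close>. Afterwards the wave gains at
  least 2 N \<open>delta\<close> per tick. The conjunct r \<le> \<open>wave\<close> is a crude bound
  on the radius that keeps times within machine words.\<close>

definition growth where
  "growth stamp dl cur r \<longleftrightarrow> r \<le> wave stamp dl cur r \<and>
     (\<exists>r1\<le>r. (1 + delta) ^ r1 * real p \<le> real p * real (volc {v. stamp v = cur}) + real (wave stamp dl cur r) \<and>
        real (r - r1) * delta * (2 * real N) \<le> real (wave stamp dl cur r) \<and>
        (2 * volc {v. stamp v = cur} \<le> N \<longrightarrow> r1 = r))"

lemma growth_step:
  assumes g: "growth stamp dl cur r"
    and rej: "\<phi> * real (quota stamp dl cur) < 21 * real p * real l" 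
    and w: "wave stamp dl cur r + l \<le> wave stamp' dl' cur (Suc r)"
    and v: "volc {v. stamp v = cur} \<le> volc {v. stamp' v = cur}"
  shows "growth stamp' dl' cur (Suc r)"
proof -
  let ?w = "wave stamp dl cur r" and ?w' = "wave stamp' dl' cur (Suc r)"
  let ?v = "volc {v. stamp v = cur}" and ?v' = "volc {v. stamp' v = cur}"
  have dl: "delta * real (quota stamp dl cur) < real l"
  proof -
    have "(21 * real p) * (delta * real (quota stamp dl cur)) < (21 * real p) * real l"
      using rej delta(3) by (metis mult.assoc mult.commute)
    thus ?thesis using p by (simp add: mult_less_cancel_left)
  qed
  have l1: "1 \<le> l" using dl delta(1) by (cases l) (auto simp: mult_less_0_iff not_less)
  from g obtain r1 where r1: "r1 \<le> r" "(1 + delta) ^ r1 * real p \<le> real p * real ?v + real ?w"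
    "real (r - r1) * delta * (2 * real N) \<le> real ?w" "2 * ?v \<le> N \<longrightarrow> r1 = r" "r \<le> ?w"
    unfolding growth_def by blast
  have pv: "real p * real ?v \<le> real p * real ?v'" using v by (intro mult_left_mono) auto
  have w': "real ?w + real l \<le> real ?w'" using w by linarith
  show ?thesis
  proof (cases "2 * ?v \<le> N")
    case True
    hence "quota stamp dl cur = wB stamp dl cur + p * ?v" by (simp add: quota_def)
    hence "real ?w + real p * real ?v \<le> real (quota stamp dl cur)"
      using wave_le_wB[of stamp dl cur r] by simp
    hence "delta * (real ?w + real p * real ?v) \<le> delta * real (quota stamp dl cur)"
      using delta(1) by simp
    hence "(1 + delta) * (real ?w + real p * real ?v) \<le> real ?w' + real p * real ?v'"
      using dl w' pv by (simp add: distrib_right)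
    moreover have "(1 + delta) ^ Suc r1 * real p \<le> (1 + delta) * (real ?w + real p * real ?v)"
      using r1(2) delta(1) by (simp add: mult.assoc add.commute)
    ultimately show ?thesis unfolding growth_def
      using r1 True w l1 by (intro conjI exI[of _ "Suc r1"]) auto
  next
    case False
    hence q: "quota stamp dl cur = 2 * N" by (simp add: quota_def)
    have "real (Suc r - r1) * delta * (2 * real N) = real (r - r1) * delta * (2 * real N) + delta * (2 * real N)"
      using r1(1) by (simp add: of_nat_diff algebra_simps)
    also have "\<dots> \<le> real ?w'" using r1(3) dl w' q by simp
    finally show ?thesis unfolding growth_def
      using r1 False w l1 v pv w' by (intro conjI exI[of _ r1]) auto
  qed
qed

text \<open>By Bernoulli's inequality about 1/d steps double the power; rounding 1/d up costs at
  most a factor 2, because d \<le> 1.\<close>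

lemma one_plus_power_ge:
  assumes "0 < d" "d \<le> (1::real)" "2 * real l \<le> d * real r" shows "2 ^ l \<le> (1 + d) ^ r"
proof -
  define k where "k = nat \<lceil>1 / d\<rceil>"
  have k: "1 / d \<le> real k" "real k \<le> 1 / d + 1" using assms by (auto simp: k_def)
  have "1 \<le> real k * d" using k(1) assms by (simp add: field_simps)
  hence "2 \<le> (1 + d) ^ k" using Bernoulli_inequality[of d k] assms by (simp add: mult.commute)
  hence "2 ^ l \<le> ((1 + d) ^ k) ^ l" by (intro power_mono) auto
  also have "\<dots> = (1 + d) ^ (k * l)" by (simp add: power_mult)
  also have "\<dots> \<le> (1 + d) ^ r"
  proof (rule power_increasing)
    have "real (k * l) * d \<le> (1 / d + 1) * real l * d"
      using k(2) assms by (simp add: mult_right_mono)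
    also have "\<dots> = (1 + d) * real l" using assms by (simp add: field_simps)
    also have "\<dots> \<le> 2 * real l" using assms by (intro mult_right_mono) auto
    also have "\<dots> \<le> real r * d" using assms by (simp add: mult.commute)
    finally have "real (k * l) \<le> real r" using assms by simp
    thus "k * l \<le> r" by (simp only: of_nat_le_iff)
  qed (use assms in auto)
  finally show ?thesis .
qed

text \<open>The wave covers at most 3 N / 2. So the linear phase lasts at most 1 /
  \<open>delta\<close> ticks, and the exponential one at most 2 l / \<open>delta\<close>, since 2^l
  \<ge> 4 N. The radius is at most 3 l / \<open>delta\<close> = 63 l p / \<phi>, and the diameter
  twice that, which is the origin of 126 in \<open>Lb\<close>.\<close>

lemma radius_bound:
  assumes g: "growth stamp dl cur r" and inv: "binv stamp0 dl0 u stamp dl cur r L"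
    and l: "4 * N \<le> 2 ^ l" and N: "1 \<le> N"
  shows "2 * real r \<le> 126 * real l * real p / \<phi>"
proof -
  let ?w = "wave stamp dl cur r" and ?v = "volc {v. stamp v = cur}"
  from g obtain r1 where r1: "r1 \<le> r" "(1 + delta) ^ r1 * real p \<le> real p * real ?v + real ?w"
    "real (r - r1) * delta * (2 * real N) \<le> real ?w"
    unfolding growth_def by blast
  have w: "2 * real ?w \<le> 3 * real N"
    using wave_le_wB[of stamp dl cur r] binv_bounds(2)[OF inv] by linarith
  have l1: "1 \<le> l" using l N by (cases l) auto
  have "real (r - r1) * delta \<le> 1"
  proof (rule ccontr)
    assume "\<not> real (r - r1) * delta \<le> 1"
    hence "1 \<le> real (r - r1) * delta" by linarith
    hence "1 * (2 * real N) \<le> real (r - r1) * delta * (2 * real N)" by (rule mult_right_mono) simp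
    moreover have "1 \<le> real N" using N by simp
    ultimately show False using r1(3) w by linarith
  qed
  moreover have "delta * real r1 \<le> 2 * real l"
  proof (rule ccontr)
    assume "\<not> delta * real r1 \<le> 2 * real l"
    hence "2 ^ l \<le> (1 + delta) ^ r1" using delta by (intro one_plus_power_ge) auto
    hence "2 ^ l * real p \<le> (1 + delta) ^ r1 * real p" by (intro mult_right_mono) auto
    moreover have "real p * real ?v \<le> real p * real N" using binv_bounds(3)[OF inv] by (intro mult_left_mono) auto
    moreover have "4 * real N * real p \<le> 2 ^ l * real p"
    proof (rule mult_right_mono)
      have "real (4 * N) \<le> real (2 ^ l)" using l by (rule of_nat_mono)
      thus "4 * real N \<le> 2 ^ l" by simp
    qed simp
    moreover have "1 * real N \<le> real p * real N" using p by (intro mult_right_mono) auto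
    moreover have "0 < real p * real N" using p N by simp
    ultimately show False using r1(2) w by (simp add: algebra_simps)
  qed
  ultimately have "delta * real r \<le> 3 * real l"
    using r1(1) l1 by (simp add: of_nat_diff algebra_simps)
  hence "real r \<le> 3 * real l / delta" using delta(1) by (simp add: field_simps)
  also have "\<dots> = 63 * real l * real p / \<phi>" by (simp add: delta_def)
  finally show ?thesis by simp
qed

text \<open>The part of \<open>pot\<close> that survives from ball to ball; the credit of slots that
  are active when a ball is closed is given up.\<close>

definition upot :: "(nat \<Rightarrow> nat) \<Rightarrow> real" where
  "upot stamp = real (\<Sum>s | s < N \<and> stamp (sv s) = 0. 18 + 24 * ws s)"

lemma upot_le_pot: "upot stamp \<le> pot stamp dl r L"
  unfolding upot_def pot_def by (rule of_nat_mono) simp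

lemma upot_nonneg: "0 \<le> upot stamp"
  unfolding upot_def by (rule of_nat_0_le_iff)

lemma wp_ball:
  assumes pre: "outer cur0 vs sl lo s" "iarr s 13 = stamp0" "iarr s 14 = dl0"
    and st: "stinv stamp0 dl0 cur0" "sl < N" "stamp0 (sv sl) = 0" "cur0 < N"
    and T: "12 + upot stamp0 \<le> T" "0 \<le> q"
    and post: "\<And>s' T' stamp dl L r. \<lbrakk>outer (Suc cur0) vs sl lo s';
        ballinv stamp0 dl0 (sv sl) (Suc cur0) r stamp dl L s'; growth stamp dl (Suc cur0) r;
        21 * real p * real (length L) \<le> \<phi> * real (quota stamp dl (Suc cur0));
        stamp (sv sl) = Suc cur0;
        T - 12 - upot stamp0 + upot stamp \<le> T'\<rbrakk> \<Longrightarrow> Q s' T' q"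
  shows "wp D Wd ball_prog Q s T q"
proof -
  define u where "u = sv sl"
  define cur where "cur = Suc cur0"
  define Tf where "Tf = T - 12 - upot stamp0"
  have Tf: "0 \<le> Tf" using T by (simp add: Tf_def)
  let ?s = "set_ivar 26 u (set_ivar 24 0 (set_ivar 23 0 (set_ivar 22 0 (set_ivar 21 0 (set_ivar 17 cur s)))))"
  have stz: "stamp0 v < cur" for v using st(1) by (simp add: stinv_def cur_def less_Suc_eq_le)
  have none: "{v. stamp0 v = cur} = {}" using stz by force
  have binv0: "binv stamp0 dl0 u stamp0 dl0 cur 0 []"
    using st(1) stz unfolding binv_def stinv_def by (auto dest: less_imp_neq)
  have cl0: "claimed stamp0 dl0 cur = {}" using none by (auto simp: claimed_def)
  have ball0: "ballinv stamp0 dl0 u cur 0 stamp0 dl0 [] ?s"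
    using binv0 pre none cl0 by (simp add: ballinv_def ballst_def volc_def wB_def holds_def)
  have u0: "stamp0 u = 0" using st by (simp add: u_def)
  have up0: "pot stamp0 dl0 0 [] = upot stamp0" by (simp add: pot_def upot_def)
  have slu: "sl \<in> set (adj u)" unfolding adj(2) using st by (simp add: u_def)
  hence deg: "1 \<le> length (adj u)" by (cases "adj u") auto
  note pj = pot_join[OF binv0 u0, unfolded up0]
  have "wp D Wd join_prog (wp D Wd (setq_prog;; While reject tick_prog) Q) ?s (T - 6) q"
  proof (rule wp_join_inv[where r = 0 and stamp = stamp0 and dl = dl0 and L = "[]" and z = u])
    show "outer cur vs sl lo ?s" using pre(1) by (simp add: outer_def env_def)
    show "ballinv stamp0 dl0 u cur 0 stamp0 dl0 [] ?s" by (rule ball0)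
    show "rch u u 0" by (rule reach.start)
    show "cur \<le> N" using st by (simp add: cur_def)
    show "3 + 9 * real (length (adj u)) \<le> T - 6"
      using T pj pot_nonneg[of "stamp0(u := cur)" "arrive dl0 0 (claims (stamp0(u := cur)) (adj u))" 0
         "[] @ claims (stamp0(u := cur)) (adj u)"] deg by simp
  next
    fix s' T' C
    assume C: "C = claims (stamp0(u := cur)) (adj u)" and o: "outer cur vs sl lo s'"
      and b: "ballinv stamp0 dl0 u cur 0 (stamp0(u := cur)) (arrive dl0 0 C) ([] @ C) s'"
      and T': "T - 6 - (3 + 9 * real (length (adj u))) \<le> T'"
      and v: "volc {v. (stamp0(u := cur)) v = cur} = volc {v. stamp0 v = cur} + length (adj u)"
    let ?st = "stamp0(u := cur)" and ?dl = "arrive dl0 0 C"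
    have vge: "1 \<le> volc {v. ?st v = cur}" using v deg by simp
    have ex0: "exact ?st ?dl 0 C"
    proof -
      have "1 \<le> ws s" if "s \<in> set C" for s
      proof -
        have "s \<in> {s. s < N \<and> sv s = u}" using that unfolding adj(2)[symmetric] by (simp add: C claims_def)
        thus ?thesis using ws_pos by simp
      qed
      thus ?thesis by (fastforce simp: exact_def arrive_def C claims_def)
    qed
    have gr0: "growth ?st ?dl cur 0"
    proof -
      have "real p * 1 \<le> real p * real (volc {v. ?st v = cur})" using vge by (intro mult_left_mono) auto
      thus ?thesis unfolding growth_def by (intro conjI exI[of _ 0]) auto
    qed
    have Tp: "Tf + 3 + pot ?st ?dl 0 C \<le> T'"
      using T' pj[folded C] deg by (simp add: Tf_def)
    define I where "I = (\<lambda>s T' q'. q' = q \<and> (\<exists>stamp dl L r. outer cur vs sl lo s \<and>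
       ballinv stamp0 dl0 u cur r stamp dl L s \<and> exact stamp dl r L \<and> growth stamp dl cur r \<and>
       ivar s 27 = quota stamp dl cur \<and> stamp u = cur \<and> Tf + 1 + pot stamp dl r L \<le> T'))"
    have p0: "0 \<le> pot ?st ?dl 0 C" by (rule pot_nonneg)
    show "wp D Wd (setq_prog;; While reject tick_prog) Q s' T' q" unfolding wp_Seq
    proof (rule wp_setq[OF o b _ T(2)])
      show "2 \<le> T'" using Tp Tf p0 by linarith
    next
      fix s2 assume s2: "outer cur vs sl lo s2" "ballinv stamp0 dl0 u cur 0 ?st ?dl ([] @ C) s2"
        "ivar s2 27 = quota ?st ?dl cur"
      show "wp D Wd (While reject tick_prog) Q s2 (T' - 2) q"
      proof (rule wp_While[where I = I])
        show "I s2 (T' - 2) q" unfolding I_def using s2 ex0 gr0 Tp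
          by (intro conjI refl exI[of _ ?st] exI[of _ ?dl] exI[of _ C] exI[of _ 0]) auto
      next
        fix s T' q' assume "I s T' q'" and rj: "beval reject s"
        then obtain stamp dl L r where i: "q' = q" "outer cur vs sl lo s" "ballinv stamp0 dl0 u cur r stamp dl L s"
          "exact stamp dl r L" "growth stamp dl cur r" "ivar s 27 = quota stamp dl cur" "stamp u = cur"
          "Tf + 1 + pot stamp dl r L \<le> T'" unfolding I_def by blast
        have inv: "binv stamp0 dl0 u stamp dl cur r L" using i(3) by (simp add: ballinv_def)
        have rej: "\<phi> * real (quota stamp dl cur) < 21 * real p * real (length L)"
          using rj i(2,3,6) by (simp add: reject_def outer_def env_def ballinv_def ballst_def)
        have L: "L \<noteq> []" using rej phi by (cases L) (auto simp: mult_less_0_iff)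
        have r: "r \<le> 2 * N"
          using i(5) wave_le_wB[of stamp dl cur r] binv_bounds(2)[OF inv] unfolding growth_def by linarith
        have "wp D Wd tick_prog I s (T' - 1) q"
        proof (rule wp_tick[OF i(2,3,4) L _ r _ T(2)])
          show "cur \<le> N" using st by (simp add: cur_def)
          show "pot stamp dl r L \<le> T' - 1" using i(8) Tf by simp
        next
          fix s' T'' stamp' dl' L'
          assume a: "outer cur vs sl lo s'" "ballinv stamp0 dl0 u cur (Suc r) stamp' dl' L' s'"
            "exact stamp' dl' (Suc r) L'" "ivar s' 27 = quota stamp' dl' cur"
            and w: "wave stamp dl cur r + length L \<le> wave stamp' dl' cur (Suc r)"
            and sub: "{v. stamp v = cur} \<subseteq> {v. stamp' v = cur}"
            and T'': "T' - 1 - pot stamp dl r L + pot stamp' dl' (Suc r) L' + 2 \<le> T''"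
          have v: "volc {v. stamp v = cur} \<le> volc {v. stamp' v = cur}" by (rule volc_mono[OF sub])
          have "stamp' u = cur" using sub i(7) by auto
          thus "I s' T'' q" unfolding I_def using a growth_step[OF i(5) rej w v] T'' i(8)
            by (intro conjI refl exI[of _ stamp'] exI[of _ dl'] exI[of _ L'] exI[of _ "Suc r"]) auto
        qed
        thus "0 \<le> T' \<and> wp D Wd tick_prog I s (T' - 1) q'"
          using i(1,8) Tf pot_nonneg[of stamp dl r L] by simp
      next
        fix s T' q' assume "I s T' q'" and rj: "\<not> beval reject s"
        then obtain stamp dl L r where i: "q' = q" "outer cur vs sl lo s" "ballinv stamp0 dl0 u cur r stamp dl L s"
          "exact stamp dl r L" "growth stamp dl cur r" "ivar s 27 = quota stamp dl cur" "stamp u = cur"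
          "Tf + 1 + pot stamp dl r L \<le> T'" unfolding I_def by blast
        have acc: "21 * real p * real (length L) \<le> \<phi> * real (quota stamp dl cur)"
          using rj i(2,3,6) by (simp add: reject_def outer_def env_def ballinv_def ballst_def)
        have "Q s (T' - 1) q"
          by (rule post[OF _ _ _ acc[unfolded cur_def]])
            (use i upot_le_pot[of stamp dl r L] in \<open>auto simp: cur_def u_def Tf_def\<close>)
        thus "1 \<le> T' \<and> 0 \<le> q' \<and> Q s (T' - 1) q'"
          using i(1,8) Tf T(2) pot_nonneg[of stamp dl r L] by simp
      qed
    qed
  qed (use T u0 in auto)
  moreover have "6 \<le> T" using T upot_nonneg[of stamp0] by simp
  moreover have "u \<le> Wd" "cur \<le> Wd" using sv_Wd[OF st(2)] st(4) N_Wd(1) by (simp_all add: u_def cur_def)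
  ultimately show ?thesis using pre T
    by (simp add: ball_prog_def wp_simps outer_def env_def u_def cur_def)
qed

end

section \<open>From balls to a balanced sparse cut\<close>

lemma wp_Seq_fun: "wp D W (Seq c1 c2) Q = wp D W c1 (wp D W c2 Q)"
  by (intro ext) (rule wp_Seq)

text \<open>\<open>far\<close> is the contribution of the unrouted pairs: no set of small diameter
  contains both ends of one of them, so such a set leaves a volume of at least N / (4 p)
  outside.\<close>

locale cut_phase_goal = cut_phase N sv so ws pt D Wd m p hd nx wt adj \<phi>
  for N sv so ws pt D Wd m p hd nx wt adj \<phi> +
  fixes l :: nat and b :: real
  assumes l: "4 * N \<le> 2 ^ l" and N: "1 \<le> N" and b: "0 < b" "b * (4 * real p) \<le> 1"
    and far: "\<And>B d. \<lbrakk>\<And>x y. x \<in> B \<Longrightarrow> y \<in> B \<Longrightarrow> rch x y d; real d \<le> 126 * real l * real p / \<phi>\<rbrakk>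
      \<Longrightarrow> N \<le> 4 * p * volc (- B)"
begin

text \<open>Conductance is bounded against each side by a product, without division. The condition
  is symmetric, so a giant ball can be treated through its complement.\<close>

definition good where
  "good S \<longleftrightarrow> b * real N \<le> real (volc S) \<and> b * real N \<le> real (volc (- S)) \<and>
     real (cutc S) \<le> \<phi> * real (volc S) \<and> real (cutc S) \<le> \<phi> * real (volc (- S))"

lemma good_compl: "good (- S) = good S"
  unfolding good_def by (auto simp: cutc_compl)

lemma b_le: "real N \<le> 4 * real p * x \<Longrightarrow> b * real N \<le> x"
proof -
  assume x: "real N \<le> 4 * real p * x"
  hence "b * real N \<le> b * (4 * real p * x)" using b(1) by (intro mult_left_mono) auto
  also have "\<dots> = (b * (4 * real p)) * x" by simp
  also have "\<dots> \<le> 1 * x"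
  proof (rule mult_right_mono[OF b(2)])
    have "0 \<le> 4 * real p * x" using x by (rule order.trans[rotated]) simp
    thus "0 \<le> x" using p by (simp add: zero_le_mult_iff)
  qed
  finally show ?thesis by simp
qed

text \<open>In the first alternative S is the complement of a giant ball, hence the smaller side,
  and 5 N + p vol S is at most 21 p vol S. In the second one S is a union of balls with an allowance
  of only 3 N / 2, so at most 7 p vol S in all and the cut is at most \<phi> / 3 times the volume;
  the factor 3 makes up for a complement that may be as small as N / 4.\<close>

lemma goodI:
  assumes v: "real N \<le> 4 * real p * real (volc S)" and v3: "4 * volc S \<le> 3 * N"
    and c: "21 * real p * real (cutc S) \<le> \<phi> * (5 * real N + real p * real (volc S)) \<and> N \<le> 2 * volc (- S) \<or>
      21 * real p * real (cutc S) \<le> \<phi> * (3 / 2 * real N + real p * real (volc S))"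
  shows "good S"
proof -
  let ?v = "real (volc S)" and ?w = "real (volc (- S))"
  have vw: "?v + ?w = real N" using volc_compl[of S] by linarith
  have p: "0 < real p" using p by simp
  have w: "real N \<le> 4 * ?w" using v3 vw by linarith
  have pw: "1 * ?w \<le> real p * ?w" using p by (intro mult_right_mono) auto
  hence "real N \<le> 4 * real p * ?w" using w by simp
  note bal = b_le[OF v] b_le[OF this]
  have dv: "real (cutc S) \<le> \<phi> * ?v \<and> 3 * real (cutc S) \<le> \<phi> * ?v \<or> real (cutc S) \<le> \<phi> * ?v \<and> ?v \<le> ?w"
    using c
  proof
    assume h: "21 * real p * real (cutc S) \<le> \<phi> * (3 / 2 * real N + real p * ?v)"
    have "\<phi> * (3 / 2 * real N + real p * ?v) \<le> \<phi> * (3 / 2 * (4 * real p * ?v) + real p * ?v)"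
      using v phi by (intro mult_left_mono add_mono) auto
    hence "(7 * real p) * (3 * real (cutc S)) \<le> (7 * real p) * (\<phi> * ?v)" using h by (simp add: algebra_simps)
    hence "3 * real (cutc S) \<le> \<phi> * ?v" using p by (simp add: mult_le_cancel_left)
    thus ?thesis by linarith
  next
    assume h: "21 * real p * real (cutc S) \<le> \<phi> * (5 * real N + real p * ?v) \<and> N \<le> 2 * volc (- S)"
    have "\<phi> * (5 * real N + real p * ?v) \<le> \<phi> * (5 * (4 * real p * ?v) + real p * ?v)"
      using v phi by (intro mult_left_mono add_mono) auto
    hence "(21 * real p) * real (cutc S) \<le> (21 * real p) * (\<phi> * ?v)" using h by (simp add: algebra_simps)
    hence "real (cutc S) \<le> \<phi> * ?v" using p by (simp add: mult_le_cancel_left)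
    moreover have "?v \<le> ?w" using h vw by linarith
    ultimately show ?thesis by simp
  qed
  have "real (cutc S) \<le> \<phi> * ?w"
    using dv
  proof
    assume "real (cutc S) \<le> \<phi> * ?v \<and> 3 * real (cutc S) \<le> \<phi> * ?v"
    moreover have "\<phi> * ?v \<le> \<phi> * (3 * ?w)" using w vw phi by (intro mult_left_mono) auto
    ultimately show ?thesis by simp
  next
    assume "real (cutc S) \<le> \<phi> * ?v \<and> ?v \<le> ?w"
    moreover from this have "\<phi> * ?v \<le> \<phi> * ?w" using phi by (intro mult_left_mono) auto
    ultimately show ?thesis by simp
  qed
  thus ?thesis using dv bal unfolding good_def by blast
qed

lemma wp_balls:
  assumes pre: "outer 0 0 0 0 s" "iarr s 13 = (\<lambda>_. 0)" "iarr s 14 = (\<lambda>_. 0)"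
    and T: "1 + 20 * real N + upot (\<lambda>_. 0) \<le> T" "0 \<le> q"
    and post: "\<And>s' T' stamp lo. \<lbrakk>env s'; ivar s' 20 = lo; iarr s' 13 = stamp; good {v. lo \<le> stamp v};
        T - (1 + 20 * real N + upot (\<lambda>_. 0)) \<le> T'\<rbrakk> \<Longrightarrow> Q s' T' q"
  shows "wp D Wd balls_prog Q s T q"
proof -
  define Tf where "Tf = T - (1 + 20 * real N + upot (\<lambda>_. 0))"
  have Tf: "0 \<le> Tf" using T by (simp add: Tf_def)
  define A where "A = (\<lambda>cur vs sl (stamp :: nat \<Rightarrow> nat) (dl :: nat \<Rightarrow> nat). sl \<le> N \<and> cur \<le> sl \<and> stinv stamp dl cur \<and> vs = volc {v. stamp v \<noteq> 0} \<and> 4 * p * vs < N \<and>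
       (\<forall>s<sl. stamp (sv s) \<noteq> 0) \<and>
       21 * real p * real (cutc {v. stamp v \<noteq> 0}) \<le> \<phi> * (real (used dl) + real p * real vs))"
  define I where "I = (\<lambda>s T' q'. q' = q \<and> (\<exists>cur vs sl lo stamp dl. outer cur vs sl lo s \<and> iarr s 13 = stamp \<and> iarr s 14 = dl \<and>
     (lo = 0 \<and> A cur vs sl stamp dl \<and> Tf + 1 + 20 * real (N - sl) + upot stamp \<le> T' \<or>
      lo \<noteq> 0 \<and> good {v. lo \<le> stamp v} \<and> Tf + 1 \<le> T')))"
  have I0: "I s T' q" if "outer cur vs sl 0 s" "A cur vs sl (iarr s 13) (iarr s 14)"
      "Tf + 1 + 20 * real (N - sl) + upot (iarr s 13) \<le> T'" for s T' cur vs sl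
    unfolding I_def using that by blast
  have I1: "I s T' q" if "outer cur vs sl lo s" "lo \<noteq> 0" "good {v. lo \<le> iarr s 13 v}" "Tf + 1 \<le> T'" for s T' cur vs sl lo
    unfolding I_def using that by blast
  let ?fin = "Cond (ILess (V 3) (IMul (K 2) (V 21))) (IAssign 20 (V 17))
            (IAssign 18 (IAdd (V 18) (V 21));;
             Cond (ILess (IMul (IMul (K 4) (V 8)) (V 18)) (V 3)) Skip (IAssign 20 (K 1)))"
  let ?inc = "IAssign 19 (IAdd (V 19) (K 1))"
  show ?thesis unfolding balls_prog_def
  proof (rule wp_While[where I = I])
    have "A 0 0 0 (\<lambda>_. 0) (\<lambda>_. 0)" using N by (simp add: A_def stinv_def volc_def cutc_def used_def)
    thus "I s T q" using I0[OF pre(1)] pre T by (simp add: Tf_def)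
  next
    fix s T' q' assume "I s T' q'" and b: "beval (ILess (V 20) (K 1)) s"
    then obtain cur vs sl lo stamp dl where i: "q' = q" "outer cur vs sl lo s" "iarr s 13 = stamp" "iarr s 14 = dl"
      and lo: "lo = 0 \<and> A cur vs sl stamp dl \<and> Tf + 1 + 20 * real (N - sl) + upot stamp \<le> T' \<or>
        lo \<noteq> 0 \<and> good {v. lo \<le> stamp v} \<and> Tf + 1 \<le> T'"
      unfolding I_def by blast
    have lo0: "lo = 0" using b i(2) by (simp add: outer_def)
    with lo have a: "sl \<le> N" "cur \<le> sl" "stinv stamp dl cur" "vs = volc {v. stamp v \<noteq> 0}" "4 * p * vs < N"
       "\<And>s. s < sl \<Longrightarrow> stamp (sv s) \<noteq> 0"
       "21 * real p * real (cutc {v. stamp v \<noteq> 0}) \<le> \<phi> * (real (used dl) + real p * real vs)"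
       and T': "Tf + 1 + 20 * real (N - sl) + upot stamp \<le> T'" unfolding A_def by auto
    \<comment> \<open>If all slots had been scanned, the balls would contain the whole volume N,
      against 4 p vs < N.\<close>
    have slN: "sl < N"
    proof (rule ccontr)
      assume "\<not> sl < N"
      hence "sl = N" using a(1) by simp
      hence "{s. s < N \<and> sv s \<in> {v. stamp v \<noteq> 0}} = {..<N}" using a(6) by auto
      hence "vs = N" unfolding a(4) volc_def by simp
      moreover have "1 * N \<le> 4 * p * N" using p by (intro mult_right_mono) auto
      ultimately show False using a(5) by simp
    qed
    have Ns: "real (N - sl) = real (N - Suc sl) + 1" using slN by simp
    have up: "0 \<le> upot stamp" by (rule upot_nonneg)
    have e: "iarr s 2 = sv" "ivar s 19 = sl" using i(2) by (auto simp: outer_def env_def)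
    have T20: "21 \<le> T'" using T' Ns Tf up by linarith
    show "0 \<le> T' \<and> wp D Wd (Cond (ILess (IGet 13 (IGet 2 (V 19))) (K 1)) (ball_prog;; ?fin) Skip;; ?inc) I s (T' - 1) q'"
    proof (cases "stamp (sv sl) = 0")
      case False
      have "A cur vs (Suc sl) stamp dl" unfolding A_def
        using a slN False by (auto simp: less_Suc_eq)
      hence "I (set_ivar 19 (Suc sl) s) (T' - 4) q"
        using i lo0 T' Ns by (intro I0[of cur vs "Suc sl"]) (simp_all add: outer_def env_def)
      thus ?thesis using i e False T20 T(2) slN N_Wd(1) by (simp add: wp_simps)
    next
      case True
      let ?cur = "Suc cur"
      have "wp D Wd ball_prog (wp D Wd (?fin;; ?inc) I) s (T' - 2) q"
      proof (rule wp_ball[OF i(2-4) a(3) slN True])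
        show "cur < N" using a slN by simp
        show "12 + upot stamp \<le> T' - 2" using T' Ns Tf by simp
      next
        fix s' T'' stamp' dl' L r
        assume o: "outer ?cur vs sl lo s'" and bi: "ballinv stamp dl (sv sl) ?cur r stamp' dl' L s'"
          and g: "growth stamp' dl' ?cur r"
          and acc: "21 * real p * real (length L) \<le> \<phi> * real (quota stamp' dl' ?cur)"
          and u: "stamp' (sv sl) = ?cur" and T'': "T' - 2 - 12 - upot stamp + upot stamp' \<le> T''"
        have inv: "binv stamp dl (sv sl) stamp' dl' ?cur r L" using bi by (simp add: ballinv_def)
        note bc = ball_close[OF inv a(3) lessI]
        let ?B = "{v. stamp' v = ?cur}"
        have up': "0 \<le> upot stamp'" by (rule upot_nonneg)
        have T6: "Tf + 1 + 20 * real (N - Suc sl) + upot stamp' + 6 \<le> T''" using T'' T' Ns by simp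
        have T8: "7 \<le> T''" using T6 Tf up' by simp
        have st: "ivar s' 17 = ?cur" "ivar s' 18 = vs" "ivar s' 3 = N" "ivar s' 8 = p" "ivar s' 19 = sl" "ivar s' 20 = 0"
          "ivar s' 21 = volc ?B" "iarr s' 13 = stamp'" "iarr s' 14 = dl'"
          using o bi lo0 by (auto simp: outer_def env_def ballinv_def ballst_def)
        have oenv: "env s'" using o by (simp add: outer_def)
        have stle: "stamp' v \<le> ?cur" for v using bc(1) by (simp add: stinv_def)
        have vols: "volc ?B \<le> N" by (rule binv_bounds(3)[OF inv])
        have slW: "Suc sl \<le> Wd" "?cur \<le> Wd" "vs + volc ?B \<le> Wd"
          using slN a(2) N_Wd(1) bc(2) a(4) binv_bounds(3)[OF inv, of "{v. stamp' v \<noteq> 0}"] by linarith+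
        have ud: "2 * used dl \<le> 3 * N" "2 * used dl' \<le> 3 * N"
          using used_le[OF a(3)] used_le[OF bc(1)] W3 by linarith+
        show "wp D Wd (?fin;; ?inc) I s' T'' q"
        proof (cases "N < 2 * volc ?B")
          case True
          define B where "B = ?B"
          note giant = True[folded B_def] and bc5 = bc(5)[folded B_def] and st = st[folded B_def]
          have iv: "stamp v < ?cur \<and> (stamp' v = ?cur \<and> stamp v = 0 \<or> stamp' v = stamp v)" for v
            using inv unfolding binv_def by blast
          have quo: "quota stamp' dl' ?cur = 2 * N" using True by (simp add: quota_def)
          \<comment> \<open>Two points of the ball are joined through its centre.\<close>
          have rch2: "rch x y (2 * r)" if "x \<in> B" "y \<in> B" for x y
          proof -
            have "rch (sv sl) x r" "rch (sv sl) y r" using inv that unfolding binv_def B_def by auto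
            from reach_trans[OF this(2) reach_sym[OF this(1)]] show ?thesis by (simp add: mult_2)
          qed
          have vc: "volc B + volc (- B) = N" by (rule volc_compl)
          have "N \<le> 4 * p * volc (- B)"
            by (rule far[OF rch2]) (use radius_bound[OF g inv l N] in simp_all)
          hence "real N \<le> real (4 * p * volc (- B))" by (rule of_nat_mono)
          hence g1: "real N \<le> 4 * real p * real (volc (- B))" by simp
          have g2: "4 * volc (- B) \<le> 3 * N" using giant vc by linarith
          \<comment> \<open>The older balls lie in the complement of the giant ball, so their share
            p vs is absorbed by p times the volume of the complement.\<close>
          have g3: "21 * real p * real (cutc (- B)) \<le> \<phi> * (5 * real N + real p * real (volc (- B)))"
          proof -
            have "real (cutc B) \<le> real (cutc {v. stamp v \<noteq> 0}) + real (length L)" using bc5 by linarith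
            hence "21 * real p * real (cutc B) \<le> 21 * real p * (real (cutc {v. stamp v \<noteq> 0}) + real (length L))"
              by (intro mult_left_mono) auto
            also have "\<dots> \<le> \<phi> * (real (used dl) + real p * real vs) + \<phi> * (2 * real N)"
              using a(7) acc quo by (simp add: distrib_left)
            also have "\<dots> = \<phi> * (real (used dl) + 2 * real N + real p * real vs)" by (simp add: algebra_simps)
            also have "\<dots> \<le> \<phi> * (5 * real N + real p * real (volc (- B)))"
            proof (intro mult_left_mono add_mono)
              show "real (used dl) + 2 * real N \<le> 5 * real N" using ud by linarith
              have "vs \<le> volc (- B)" unfolding a(4)
              proof (rule volc_mono, rule subsetI)
                fix v assume "v \<in> {v. stamp v \<noteq> 0}"
                thus "v \<in> - B" using iv[of v] by (auto simp: B_def)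
              qed
              thus "real vs \<le> real (volc (- B))" by simp
            qed (use phi in auto)
            finally show ?thesis by (simp add: cutc_compl)
          qed
          have g4: "N \<le> 2 * volc (- (- B))" using giant by simp
          have "good (- B)" by (rule goodI[OF g1 g2 disjI1[OF conjI[OF g3 g4]]])
          hence gd: "good B" by (simp add: good_compl)
          have "{v. ?cur \<le> stamp' v} = B" unfolding B_def using stle by (auto simp: le_antisym)
          hence "I (set_ivar 19 (Suc sl) (set_ivar 20 ?cur s')) (T'' - 3) q"
            using oenv st gd T6 up' Tf
            by (intro I1[of ?cur vs "Suc sl" ?cur]) (simp_all add: outer_def env_def)
          thus ?thesis using st giant slW T8 T(2) by (simp add: wp_simps)
        next
          case small: False
          define vs' where "vs' = vs + volc ?B"
          have vs': "vs' = volc {v. stamp' v \<noteq> 0}" by (simp only: vs'_def bc(2) a(4))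
          have quo: "quota stamp' dl' ?cur = wB stamp' dl' ?cur + p * volc ?B" using small by (simp add: quota_def)
          have cut': "21 * real p * real (cutc {v. stamp' v \<noteq> 0}) \<le> \<phi> * (real (used dl') + real p * real vs')"
          proof -
            have "real (cutc {v. stamp' v \<noteq> 0}) \<le> real (cutc {v. stamp v \<noteq> 0}) + real (length L)" using bc(3) by linarith
            hence "21 * real p * real (cutc {v. stamp' v \<noteq> 0}) \<le> 21 * real p * (real (cutc {v. stamp v \<noteq> 0}) + real (length L))"
              by (intro mult_left_mono) auto
            also have "\<dots> \<le> \<phi> * (real (used dl) + real p * real vs) + \<phi> * real (wB stamp' dl' ?cur + p * volc ?B)"
              using a(7) acc quo by (simp add: distrib_left)
            also have "\<dots> = \<phi> * (real (used dl') + real p * real vs')"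
              unfolding vs'_def bc(4) by (simp add: algebra_simps)
            finally show ?thesis .
          qed
          show ?thesis
          proof (cases "4 * p * vs' < N")
            case True
            have "A ?cur vs' (Suc sl) stamp' dl'" unfolding A_def
            proof (intro conjI allI impI)
              fix s assume s: "s < Suc sl"
              show "stamp' (sv s) \<noteq> 0"
              proof (cases "s = sl")
                case False
                hence "stamp (sv s) \<noteq> 0" using a(6) s by simp
                moreover have "stamp' (sv s) = ?cur \<and> stamp (sv s) = 0 \<or> stamp' (sv s) = stamp (sv s)"
                  using inv unfolding binv_def by blast
                ultimately show ?thesis by auto
              qed (use u in simp)
            qed (use slN a(2) bc(1) vs' True cut' in auto)
            hence "I (set_ivar 19 (Suc sl) (set_ivar 18 vs' s')) (T'' - 5) q"
              using oenv st T6
              by (intro I0[of ?cur vs' "Suc sl"]) (simp_all add: outer_def env_def)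
            thus ?thesis using st small slW T8 T(2) True unfolding vs'_def by (simp add: wp_simps)
          next
            case False
            have "real N \<le> real (4 * p * vs')" using False by (intro of_nat_mono) simp
            hence g1: "real N \<le> 4 * real p * real (volc {v. stamp' v \<noteq> 0})"
              unfolding vs'[symmetric] by simp
            \<comment> \<open>Before the last ball the union had volume below N / 4, and the last
              ball has at most N / 2.\<close>
            have g2: "4 * volc {v. stamp' v \<noteq> 0} \<le> 3 * N"
            proof -
              have "1 * (4 * vs) \<le> p * (4 * vs)" using p by (intro mult_right_mono) auto
              moreover have "p * (4 * vs) = 4 * p * vs" by simp
              ultimately have "4 * vs \<le> N" using a(5) by linarith
              hence "4 * (vs + k) \<le> 3 * N" if "\<not> N < 2 * k" for k using that by simp
              from this[OF small] show ?thesis by (simp only: vs'[symmetric] vs'_def)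
            qed
            have g3: "21 * real p * real (cutc {v. stamp' v \<noteq> 0})
                \<le> \<phi> * (3 / 2 * real N + real p * real (volc {v. stamp' v \<noteq> 0}))"
            proof -
              have "\<phi> * (real (used dl') + real p * real vs') \<le> \<phi> * (3 / 2 * real N + real p * real vs')"
                using ud phi by (intro mult_left_mono add_mono) auto
              thus ?thesis using cut' unfolding vs' by linarith
            qed
            have gd: "good {v. stamp' v \<noteq> 0}" by (rule goodI[OF g1 g2 disjI2[OF g3]])
            have "{v. Suc 0 \<le> stamp' v} = {v. stamp' v \<noteq> 0}" by auto
            hence "I (set_ivar 19 (Suc sl) (set_ivar 20 (Suc 0) (set_ivar 18 vs' s'))) (T'' - 5) q"
              using oenv st gd T6 up'
              by (intro I1[of ?cur vs' "Suc sl" "Suc 0"]) (simp_all add: outer_def env_def)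
            thus ?thesis using st small slW T8 T(2) False N_Wd(1) unfolding vs'_def by (simp add: wp_simps)
          qed
        qed
      qed (rule T(2))
      thus ?thesis using i(1,3) e True T20 by (simp add: wp_simps wp_Seq_fun)
    qed
  next
    fix s T' q' assume "I s T' q'" and b: "\<not> beval (ILess (V 20) (K 1)) s"
    then obtain cur vs sl lo stamp dl where i: "q' = q" "outer cur vs sl lo s" "iarr s 13 = stamp" "iarr s 14 = dl"
      and lo: "lo = 0 \<and> A cur vs sl stamp dl \<and> Tf + 1 + 20 * real (N - sl) + upot stamp \<le> T' \<or>
        lo \<noteq> 0 \<and> good {v. lo \<le> stamp v} \<and> Tf + 1 \<le> T'"
      unfolding I_def by blast
    have "lo \<noteq> 0" using b i(2) by (simp add: outer_def)
    with lo have lo: "good {v. lo \<le> stamp v}" "Tf + 1 \<le> T'" by auto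
    have "Q s (T' - 1) q"
      by (rule post[OF _ _ i(3) lo(1)]) (use i lo in \<open>auto simp: outer_def Tf_def\<close>)
    thus "1 \<le> T' \<and> 0 \<le> q' \<and> Q s (T' - 1) q'" using i(1) lo(2) Tf T(2) by simp
  qed
qed

text \<open>The initial potential is at most (18 + 24 * 3) N = 90 N; the searches for a start take
  20 N, writing the cut takes 5 N, and the rest of 135 N covers the constants, as N \<ge> 1.\<close>

lemma wp_cut:
  assumes pre: "env s" "iarr s 13 = (\<lambda>_. 0)" "iarr s 14 = (\<lambda>_. 0)"
    and T: "135 * real N \<le> T" "0 \<le> q"
    and post: "\<And>s' T' S. \<lbrakk>ivar s' 0 \<noteq> 0; good S; \<And>s. s < N \<Longrightarrow> iarr s' 0 (sv s) = 1 \<longleftrightarrow> sv s \<in> S; T - 135 * real N \<le> T'\<rbrakk> \<Longrightarrow> Q s' T' q"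
  shows "wp D Wd cut_prog Q s T q"
proof -
  have up: "upot (\<lambda>_. 0) \<le> 90 * real N"
  proof -
    have "(\<Sum>s | s < N \<and> 0 = (0::nat). 18 + 24 * ws s) = 18 * N + 24 * sum ws {..<N}"
      by (simp add: sum.distrib sum_distrib_left lessThan_def)
    also have "\<dots> \<le> 90 * N" using W3 by simp
    finally have "real (\<Sum>s | s < N \<and> 0 = (0::nat). 18 + 24 * ws s) \<le> real (90 * N)" by (rule of_nat_mono)
    thus ?thesis unfolding upot_def by simp
  qed
  define Tf where "Tf = T - 135 * real N"
  have Tf: "0 \<le> Tf" using T by (simp add: Tf_def)
  have N1: "1 \<le> real N" using N by simp
  let ?s = "set_ivar 20 0 (set_ivar 19 0 (set_ivar 18 0 (set_ivar 17 0 s)))"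
  let ?body = "IAssign 26 (IGet 2 (V 28));;
        Cond (ILess (IGet 13 (V 26)) (V 20)) (IPut 0 (V 26) (K 0)) (IPut 0 (V 26) (K 1));;
        IAssign 28 (IAdd (V 28) (K 1))"
  have "wp D Wd balls_prog (wp D Wd (IAssign 28 (K 0);; While (ILess (V 28) (V 3)) ?body) Q) ?s (T - 4) q"
  proof (rule wp_balls)
    show "outer 0 0 0 0 ?s" using pre by (simp add: outer_def env_def)
    show "1 + 20 * real N + upot (\<lambda>_. 0) \<le> T - 4" using T up N1 by linarith
  next
    fix s' T' stamp lo
    assume e: "env s'" "ivar s' 20 = lo" "iarr s' 13 = stamp" and g: "good {v. lo \<le> stamp v}"
      and T': "T - 4 - (1 + 20 * real N + upot (\<lambda>_. 0)) \<le> T'"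
    have T5: "Tf + 2 + 5 * real N \<le> T'" using T' up N1 unfolding Tf_def by linarith
    define I where "I = (\<lambda>s T' q'. q' = q \<and> env s \<and> ivar s 20 = lo \<and> iarr s 13 = stamp \<and> ivar s 28 \<le> N \<and>
       (\<forall>j<ivar s 28. iarr s 0 (sv j) = (if stamp (sv j) < lo then 0 else 1)) \<and> Tf + 1 + 5 * real (N - ivar s 28) \<le> T')"
    have "wp D Wd (While (ILess (V 28) (V 3)) ?body) Q (set_ivar 28 0 s') (T' - 1) q"
    proof (rule wp_While[where I = I])
      show "I (set_ivar 28 0 s') (T' - 1) q" using e T5 by (simp add: I_def env_def)
    next
      fix s T' q' assume I: "I s T' q'" and b: "beval (ILess (V 28) (V 3)) s"
      define i where "i = ivar s 28"
      let ?f = "\<lambda>j. if stamp (sv j) < lo then 0 else 1 :: nat"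
      have I': "q' = q" "env s" "ivar s 20 = lo" "iarr s 13 = stamp" "\<And>j. j < i \<Longrightarrow> iarr s 0 (sv j) = ?f j"
        "Tf + 1 + 5 * real (N - i) \<le> T'" using I unfolding I_def i_def by blast+
      have e: "iarr s 2 = sv" "ivar s 3 = N" using I'(2) by (simp_all add: env_def)
      have i: "i < N" using b e by (simp add: i_def)
      have Ni: "real (N - i) = real (N - Suc i) + 1" using i by simp
      have T6: "Tf + 6 + 5 * real (N - Suc i) \<le> T'" using I'(6) Ni by linarith
      have "\<forall>j<Suc i. (if sv j = sv i then ?f i else iarr s 0 (sv j)) = ?f j"
        using I'(5) by (simp add: less_Suc_eq)
      moreover have "env (set_ivar 28 (Suc i) (set_iarr 0 (sv i) (?f i) (set_ivar 26 (sv i) s)))"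
        using I'(2) by (simp add: env_def)
      ultimately have "I (set_ivar 28 (Suc i) (set_iarr 0 (sv i) (?f i) (set_ivar 26 (sv i) s))) (T' - 5) q"
        using I' i T6 unfolding I_def by simp
      thus "0 \<le> T' \<and> wp D Wd ?body I s (T' - 1) q'"
        using I'(1,3,4) e i T6 Tf T(2) sv_Wd[OF i] N_Wd(1)
        by (cases "stamp (sv i) < lo") (simp_all add: wp_simps i_def[symmetric])
    next
      fix s T' q' assume I: "I s T' q'" and b: "\<not> beval (ILess (V 28) (V 3)) s"
      have I': "q' = q" "env s" "ivar s 28 \<le> N" "\<And>j. j < ivar s 28 \<Longrightarrow> iarr s 0 (sv j) = (if stamp (sv j) < lo then 0 else 1)"
        "Tf + 1 + 5 * real (N - ivar s 28) \<le> T'" using I unfolding I_def by blast+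
      have "ivar s 28 = N" using I'(2,3) b by (simp add: env_def)
      with I'(4) have r: "iarr s 0 (sv j) = 1 \<longleftrightarrow> sv j \<in> {v. lo \<le> stamp v}" if "j < N" for j using that by simp
      have "ivar s 0 \<noteq> 0" using I'(2) by (simp add: env_def)
      hence "Q s (T' - 1) q" using r I'(5) by (intro post[OF _ g]) (simp_all add: Tf_def)
      thus "1 \<le> T' \<and> 0 \<le> q' \<and> Q s (T' - 1) q'" using I'(1,5) Tf T(2) by simp
    qed
    thus "wp D Wd (IAssign 28 (K 0);; While (ILess (V 28) (V 3)) ?body) Q s' T' q"
      using T5 Tf T(2) by (simp add: wp_simps)
  qed (use pre T in auto)
  thus ?thesis using T N1 by (simp add: cut_prog_def wp_simps)
qed

end

section \<open>Routing with multiplicative weights\<close>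

text \<open>\<kappa> remains a real number that is compared with the counter; rounding it would need
  a conversion that the machine does not offer.\<close>

definition edge_prog :: com where
  "edge_prog =
     IAssign 16 (IGet 6 (IAdd (IMul (IGet 12 (V 15)) (V 2)) (IGet 12 (IAdd (V 15) (K 1)))));;
     IPut 9 (V 16) (IAdd (IGet 9 (V 16)) (K 1));;
     Cond (RLess (ROfInt (IGet 9 (V 16))) (RVar 4)) Skip
       (DSIncrease (IGet 12 (V 15)) (IGet 12 (IAdd (V 15) (K 1))) (ROfInt (IGet 7 (V 16)));;
        IPut 7 (V 16) (IMul (K 2) (IGet 7 (V 16)));;
        IPut 8 (V 16) (IAdd (IGet 8 (V 16)) (K 1));;
        IPut 9 (V 16) (K 0));;
     IAssign 15 (IAdd (V 15) (K 1))"

definition path_prog :: com where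
  "path_prog = IAssign 15 (K 0);; While (ILess (IAdd (V 15) (K 1)) (V 14)) edge_prog"

text \<open>The pairs that stay unrouted are moved to the front of the same arrays, so the next
  level pays only for them.\<close>

definition level_prog :: com where
  "level_prog =
     IAssign 4 (K 0);; IAssign 13 (K 0);;
     While (ILess (V 4) (V 11))
       (DSDist 5 14 (IGet 10 (V 4)) (IGet 11 (V 4));;
        Cond (BAnd (ILess (K 0) (V 14)) (BNot (RLess (RMul (RMul (RVar 0) (RVar 3)) (ROfInt (V 8))) (RVar 5))))
          (DSPath 12 14 (IGet 10 (V 4)) (IGet 11 (V 4));; path_prog)
          (IPut 10 (V 13) (IGet 10 (V 4));; IPut 11 (V 13) (IGet 11 (V 4));; IAssign 13 (IAdd (V 13) (K 1)));;
        IAssign 4 (IAdd (V 4) (K 1)));;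
     IAssign 11 (V 13)"

lemma current_append: "current g (h @ [x]) = apply_op (current g h) x"
  by (simp add: current_def)

lemma legal_append: "legal g (h @ [x]) \<longleftrightarrow> legal g h \<and> legal_op (current g h) x"
  by (induction h arbitrary: g) (auto simp: current_def)

text \<open>\<open>eid\<close> inverts the code u * n + v in both orientations, so that a path given
  by its vertices is charged to edges in constant time per step.\<close>

locale routing =
  fixes n m :: nat and sv so eid :: "nat \<Rightarrow> nat" and E :: "nat set set" and D :: apsp_ds and Wd :: nat
    and \<alpha> \<kappa> :: real
  assumes E: "E = (\<lambda>e. {sv e, so e}) ` {..<m}" and inj: "inj_on (\<lambda>e. {sv e, so e}) {..<m}"
    and ends: "e < m \<Longrightarrow> sv e < n" "e < m \<Longrightarrow> so e < n" "e < m \<Longrightarrow> sv e \<noteq> so e"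
    and eid: "e < m \<Longrightarrow> eid (sv e * n + so e) = e" "e < m \<Longrightarrow> eid (so e * n + sv e) = e"
    and apsp: "approx_apsp \<alpha> D" and alpha: "1 \<le> \<alpha>" and kappa: "1 \<le> \<kappa>"
    and Wd: "2 * n + 1 \<le> Wd" "16 * m + 16 \<le> Wd"
begin

text \<open>Updates change neither vertices nor edges, so paths can be spoken of in this one graph;
  its weights are dummies.\<close>

definition gr :: wgraph where "gr = \<lparr>nverts = n, edges = E, wt = \<lambda>_. 0\<rparr>"

definition eix where "eix P t = eid (P ! t * n + P ! Suc t)"

definition pathw :: "(nat \<Rightarrow> nat) \<Rightarrow> nat list \<Rightarrow> real" where
  "pathw w P = (\<Sum>t<length P - 1. real (w (eix P t)))"

definition farp where
  "farp w u v A \<longleftrightarrow> (\<forall>P. is_path gr u v P \<longrightarrow> A < pathw w P)"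

text \<open>Of the history only its legality and the current weights are kept; interspersed queries
  are irrelevant to both.\<close>

definition dsok :: "(nat \<Rightarrow> nat) \<Rightarrow> (wgraph \<times> ds_op list) option \<Rightarrow> bool" where
  "dsok w ds \<longleftrightarrow> (\<exists>g h. ds = Some (g, h) \<and> wf_wgraph g \<and> legal g h \<and> nverts g = n \<and>
     nverts (current g h) = n \<and> edges (current g h) = E \<and> (\<forall>e<m. wt (current g h) {sv e, so e} = real (w e)))"

lemma eid_edge:
  assumes "{u, v} \<in> E" shows "eid (u * n + v) < m" "{sv (eid (u * n + v)), so (eid (u * n + v))} = {u, v}"
proof -
  obtain e where e: "e < m" "{u, v} = {sv e, so e}" using assms E by auto
  hence "u = sv e \<and> v = so e \<or> u = so e \<and> v = sv e" by (auto simp: doubleton_eq_iff)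
  hence "eid (u * n + v) = e" using eid e by auto
  thus "eid (u * n + v) < m" "{sv (eid (u * n + v)), so (eid (u * n + v))} = {u, v}" using e by simp_all
qed

lemma path_edge:
  assumes "is_path gr u v P" "Suc t < length P"
  shows "eix P t < m" "{sv (eix P t), so (eix P t)} = {P ! t, P ! Suc t}" "P ! t < n" "P ! Suc t < n"
    "{P ! t, P ! Suc t} \<in> E"
proof -
  have e: "{P ! t, P ! Suc t} \<in> E" "set P \<subseteq> {..<n}" using assms unfolding is_path_def gr_def by auto
  thus "eix P t < m" "{sv (eix P t), so (eix P t)} = {P ! t, P ! Suc t}" "{P ! t, P ! Suc t} \<in> E"
    unfolding eix_def by (auto dest: eid_edge)
  have "P ! t \<in> set P" "P ! Suc t \<in> set P" using assms(2) by auto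
  thus "P ! t < n" "P ! Suc t < n" using e by auto
qed

text \<open>The vertices of a path are distinct, so no edge occurs twice and a doubling on the way
  cannot affect a later edge of the same path.\<close>

lemma eix_inj:
  assumes "is_path gr u v P" shows "inj_on (eix P) {..<length P - 1}"
proof (rule inj_onI)
  fix a b assume ab: "a \<in> {..<length P - 1}" "b \<in> {..<length P - 1}" "eix P a = eix P b"
  have "{P ! a, P ! Suc a} = {P ! b, P ! Suc b}"
    using path_edge(2)[OF assms, of a] path_edge(2)[OF assms, of b] ab by auto
  moreover have "distinct P" using assms by (simp add: is_path_def)
  ultimately show "a = b" using ab by (auto simp: doubleton_eq_iff nth_eq_iff_index_eq)
qed

lemma is_path_gr: "nverts g = n \<Longrightarrow> edges g = E \<Longrightarrow> is_path g u v P \<longleftrightarrow> is_path gr u v P"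
  by (simp add: is_path_def gr_def)

lemma pathw_eq:
  assumes "is_path gr u v P" "\<forall>e<m. wt g {sv e, so e} = real (w e)"
  shows "path_weight g P = pathw w P"
  unfolding path_weight_def pathw_def
proof (rule sum.cong[OF refl])
  fix t assume "t \<in> {..<length P - 1}"
  hence t: "Suc t < length P" by simp
  show "wt g {P ! t, P ! Suc t} = real (w (eix P t))"
    using assms(2) path_edge(1,2)[OF assms(1) t] by metis
qed

lemma pathw_mono:
  assumes "is_path gr u v P" "\<And>e. e < m \<Longrightarrow> w e \<le> w' e" shows "pathw w P \<le> pathw w' P"
  unfolding pathw_def using assms path_edge(1)[OF assms(1)] by (intro sum_mono) auto

lemma farp_mono:
  assumes "farp w u v A" "\<And>e. e < m \<Longrightarrow> w e \<le> w' e" shows "farp w' u v A"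
  using assms pathw_mono unfolding farp_def by (meson order.strict_trans2)

text \<open>The path is requested after the distance, but queries do not change the estimate, so the
  path has the weight that was tested. The last part divides an estimate that is too large by
  \<alpha> and obtains a lower bound for every path.\<close>

lemma dist_spec:
  assumes g: "wf_wgraph g" "legal g h" "nverts g = n" "nverts (current g h) = n" "edges (current g h) = E"
      "\<forall>e<m. wt (current g h) {sv e, so e} = real (w e)"
    and uv: "u < n" "v < n"
  defines "d \<equiv> ds_dist D g h u v"
  shows "d \<noteq> \<infinity> \<Longrightarrow> wdist (current g h) u v < \<infinity>"
    and "d \<noteq> \<infinity> \<Longrightarrow> is_path gr u v (ds_path D g (h @ [QueryDistance u v]) u v)"
    and "d \<noteq> \<infinity> \<Longrightarrow> pathw w (ds_path D g (h @ [QueryDistance u v]) u v) = real_of_ereal d"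
    and "d = \<infinity> \<or> \<alpha> * A < real_of_ereal d \<Longrightarrow> farp w u v A"
proof -
  let ?h = "h @ [QueryDistance u v]"
  have lg: "legal_op (current g h) (QueryDistance u v)" using g uv by simp
  have leg: "legal g ?h" using g lg by (simp add: legal_append)
  have cur: "current g ?h = current g h" by (simp add: current_append)
  have a: "wdist (current g h) u v \<le> d" "d \<le> ereal \<alpha> * wdist (current g h) u v"
    "ds_dist D g ?h u v = d"
    using apsp g uv lg unfolding approx_apsp_def d_def by blast+
  have b: "wdist (current g h) u v < \<infinity> \<Longrightarrow> is_path (current g h) u v (ds_path D g ?h u v) \<and>
       ereal (path_weight (current g h) (ds_path D g ?h u v)) = d"
    using apsp g uv leg cur a(3) unfolding approx_apsp_def by metis
  show fin: "d \<noteq> \<infinity> \<Longrightarrow> wdist (current g h) u v < \<infinity>" using a(1) by (metis ereal_infty_less(1) ereal_infty_less_eq(1))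
  show p: "d \<noteq> \<infinity> \<Longrightarrow> is_path gr u v (ds_path D g ?h u v)"
    using b[OF fin] is_path_gr[OF g(4,5)] by blast
  show "d \<noteq> \<infinity> \<Longrightarrow> pathw w (ds_path D g ?h u v) = real_of_ereal d"
    using b[OF fin] pathw_eq[OF p g(6)] by (metis real_of_ereal.simps(1))
  show "farp w u v A" if far: "d = \<infinity> \<or> \<alpha> * A < real_of_ereal d"
    unfolding farp_def
  proof (intro allI impI)
    fix P assume P: "is_path gr u v P"
    have "wdist (current g h) u v \<le> ereal (path_weight (current g h) P)"
      unfolding wdist_def by (rule INF_lower) (use P is_path_gr[OF g(4,5)] in simp)
    hence "wdist (current g h) u v \<le> ereal (pathw w P)" by (simp add: pathw_eq[OF P g(6)])
    hence "ereal \<alpha> * wdist (current g h) u v \<le> ereal \<alpha> * ereal (pathw w P)"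
      using alpha by (intro ereal_mult_left_mono) auto
    with a(2) have le: "d \<le> ereal (\<alpha> * pathw w P)" by simp
    hence "d \<noteq> \<infinity>" by auto
    with far have "\<alpha> * A < real_of_ereal d" by simp
    also have "\<dots> \<le> \<alpha> * pathw w P"
    proof -
      \<comment> \<open>\<open>real_of_ereal\<close> maps minus infinity to 0, which is harmless as
        weights of paths are not negative.\<close>
      have "d = ereal (real_of_ereal d) \<or> d = -\<infinity>" using \<open>d \<noteq> \<infinity>\<close> by (cases d) auto
      moreover have "0 \<le> \<alpha> * pathw w P" using alpha by (simp add: pathw_def sum_nonneg)
      ultimately show ?thesis using le by (metis ereal_less_eq(3) real_of_ereal.simps(3))
    qed
    finally show "A < pathw w P" using alpha by simp
  qed
qed

text \<open>The potential makes every routed path pay for the later doubling of its edges.\<close>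

definition zpot :: "(nat \<Rightarrow> nat) \<Rightarrow> (nat \<Rightarrow> nat) \<Rightarrow> real" where
  "zpot w cnt = (\<Sum>e<m. (real (w e) - 1) * \<kappa> + real (cnt e) * real (w e))"

text \<open>An upper bound for the number of paths through the edge \<open>e\<close>.\<close>

definition ub :: "(nat \<Rightarrow> nat) \<Rightarrow> (nat \<Rightarrow> nat) \<Rightarrow> nat \<Rightarrow> real" where
  "ub lg cnt e = (\<kappa> + 1) * real (lg e) + real (cnt e)"

text \<open>The bound \<open>Bw\<close> can be maintained because an edge is doubled only by a path
  within the length limit, which the edge alone cannot exceed.\<close>

definition winv where
  "winv Bw w lg cnt \<longleftrightarrow> (\<forall>e<m. w e = 2 ^ lg e \<and> real (cnt e) < \<kappa> \<and> real (w e) \<le> Bw)"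

definition bump where
  "bump w lg cnt e = (if real (Suc (cnt e)) < \<kappa> then (w, lg, cnt(e := Suc (cnt e)))
     else (w(e := 2 * w e), lg(e := Suc (lg e)), cnt(e := 0 :: nat)))"

text \<open>If only the counter advances, the potential gains exactly \<open>w e\<close>. If the
  edge doubles, it gains \<kappa> w and releases cnt w, and \<kappa> \<le> cnt + 1 leaves at most w.
  A doubling is reached after fewer than \<kappa> + 1 uses, hence \<kappa> + 1 per doubling in
  \<open>ub\<close>.\<close>

lemma bump_spec:
  fixes w lg cnt :: "nat \<Rightarrow> nat"
  assumes b: "bump w lg cnt e = (w', lg', cnt')" and e: "e < m" and inv: "winv Bw w lg cnt" "2 * real (w e) \<le> Bw"
  shows "winv Bw w' lg' cnt'" "zpot w' cnt' \<le> zpot w cnt + real (w e)" "\<And>i. w i \<le> w' i"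
    "ub lg cnt e + 1 \<le> ub lg' cnt' e" "\<And>i. i \<noteq> e \<Longrightarrow> w' i = w i \<and> lg' i = lg i \<and> cnt' i = cnt i"
proof -
  have i: "w e = 2 ^ lg e" "real (cnt e) < \<kappa>" using inv e unfolding winv_def by auto
  have zp: "zpot w'' c'' = zpot w cnt - ((real (w e) - 1) * \<kappa> + real (cnt e) * real (w e))
     + ((real (w'' e) - 1) * \<kappa> + real (c'' e) * real (w'' e))"
    if "\<And>i. i \<noteq> e \<Longrightarrow> w'' i = w i \<and> c'' i = cnt i" for w'' c'' :: "nat \<Rightarrow> nat"
  proof -
    have "sum f {..<m} = f e + sum f ({..<m} - {e})" for f :: "nat \<Rightarrow> real" using e by (simp add: sum.remove)
    moreover have "(\<Sum>i\<in>{..<m} - {e}. (real (w'' i) - 1) * \<kappa> + real (c'' i) * real (w'' i))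
      = (\<Sum>i\<in>{..<m} - {e}. (real (w i) - 1) * \<kappa> + real (cnt i) * real (w i))"
      by (intro sum.cong refl) (use that in auto)
    ultimately show ?thesis unfolding zpot_def by simp
  qed
  show 1: "\<And>i. i \<noteq> e \<Longrightarrow> w' i = w i \<and> lg' i = lg i \<and> cnt' i = cnt i"
    using b by (auto simp: bump_def split: if_splits)
  show "\<And>i. w i \<le> w' i" using b by (auto simp: bump_def split: if_splits)
  show "winv Bw w' lg' cnt'"
    using b inv kappa by (auto simp: bump_def winv_def split: if_splits)
  show "ub lg cnt e + 1 \<le> ub lg' cnt' e"
    using b i by (auto simp: bump_def ub_def algebra_simps split: if_splits)
  show "zpot w' cnt' \<le> zpot w cnt + real (w e)"
  proof (cases "real (Suc (cnt e)) < \<kappa>")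
    case True
    with b have "w' = w" "cnt' = cnt(e := Suc (cnt e))" by (auto simp: bump_def)
    thus ?thesis using zp[of w' cnt'] by (simp add: algebra_simps)
  next
    case False
    with b have w': "w' = w(e := 2 * w e)" "cnt' = cnt(e := 0)" by (auto simp: bump_def)
    have "\<kappa> * real (w e) \<le> (real (cnt e) + 1) * real (w e)" using False by (intro mult_right_mono) auto
    thus ?thesis using zp[of w' cnt'] w' by (simp add: algebra_simps)
  qed
qed

text \<open>Every unit of weight beyond the initial 1 is worth \<kappa> in the potential, so the
  weights grow by at most N in total.\<close>

lemma zpot_bound:
  assumes "winv Bw w lg cnt" "zpot w cnt \<le> \<kappa> * real N" "e < m"
  shows "w e \<le> N + 1" "sum w {..<m} \<le> m + N"
proof -
  have t: "(real (w e) - 1) * \<kappa> \<le> (real (w e) - 1) * \<kappa> + real (cnt e) * real (w e)" for e by simp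
  have w1: "1 \<le> real (w e)" if "e < m" for e using assms(1) that unfolding winv_def by simp
  have "(real (w e) - 1) * \<kappa> \<le> (\<Sum>e<m. (real (w e) - 1) * \<kappa>)"
    using assms(3) w1 kappa by (intro member_le_sum) auto
  also have "\<dots> \<le> zpot w cnt" unfolding zpot_def by (intro sum_mono t)
  also note assms(2)
  finally have "(real (w e) - 1) * \<kappa> \<le> real N * \<kappa>" by (simp add: mult.commute)
  hence "real (w e) - 1 \<le> real N" using kappa by (simp add: mult_le_cancel_right)
  thus "w e \<le> N + 1" by linarith
  have "(real (sum w {..<m}) - real m) * \<kappa> = (\<Sum>e<m. (real (w e) - 1) * \<kappa>)"
    by (simp add: sum_distrib_right[symmetric] sum_subtractf)
  also have "\<dots> \<le> zpot w cnt" unfolding zpot_def by (intro sum_mono t)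
  also note assms(2)
  finally have "(real (sum w {..<m}) - real m) * \<kappa> \<le> real N * \<kappa>" by (simp add: mult.commute)
  hence "real (sum w {..<m}) - real m \<le> real N" using kappa by (simp add: mult_le_cancel_right)
  thus "sum w {..<m} \<le> m + N" by linarith
qed

text \<open>Doubling is an increase by the present weight; different indices name different edges,
  so no other weight changes.\<close>

lemma dsok_increase:
  assumes ds: "dsok w (Some (g, h))" and e: "e < m" "{a, b} = {sv e, so e}" "1 \<le> w e"
  defines "op \<equiv> IncreaseEdgeWeight a b (real (w e))"
  shows "legal_op (current g h) op" "dsok (w(e := 2 * w e)) (Some (g, h @ [op]))"
proof -
  from ds have d: "wf_wgraph g" "legal g h" "nverts g = n" "nverts (current g h) = n" "edges (current g h) = E"
    "\<forall>e<m. wt (current g h) {sv e, so e} = real (w e)" unfolding dsok_def by auto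
  show lg: "legal_op (current g h) op" using d e E by (auto simp: op_def)
  have c: "current g (h @ [op]) = (current g h)\<lparr>wt := (wt (current g h))({a, b} := wt (current g h) {a, b} + real (w e))\<rparr>"
    by (simp add: current_append op_def)
  have "wt (current g (h @ [op])) {sv i, so i} = real ((w(e := 2 * w e)) i)" if i: "i < m" for i
  proof (cases "i = e")
    case True
    thus ?thesis using d(6) e by (simp add: c)
  next
    case False
    hence "{sv i, so i} \<noteq> {a, b}" using inj i e by (auto simp: inj_on_def)
    thus ?thesis using d(6) i False by (simp add: c)
  qed
  thus "dsok (w(e := 2 * w e)) (Some (g, h @ [op]))"
    unfolding dsok_def using d lg by (auto simp: legal_append c)
qed

lemma dsok_query:
  assumes "dsok w (Some (g, h))" "legal_op (current g h) op" "\<And>g. apply_op g op = g"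
  shows "dsok w (Some (g, h @ [op]))"
  using assms unfolding dsok_def by (auto simp: legal_append current_append)

end

locale routing_env = routing n m sv so eid E D Wd \<alpha> \<kappa> for n m sv so eid E D Wd \<alpha> \<kappa> +
  fixes N :: nat and \<phi> b Lb :: real and hd nx :: "nat \<Rightarrow> nat"
  assumes N: "N = 2 * m"
begin

definition renv :: "nat \<Rightarrow> mstate \<Rightarrow> bool" where
  "renv p s \<longleftrightarrow> ivar s 0 \<noteq> 0 \<and> ivar s 1 = m \<and> ivar s 2 = n \<and> ivar s 3 = N \<and> ivar s 8 = p \<and> ivar s 12 = 1 \<and>
     rvar s 0 = \<alpha> \<and> rvar s 1 = \<phi> \<and> rvar s 2 = b \<and> rvar s 3 = Lb \<and> rvar s 4 = \<kappa> \<and>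
     iarr s 2 = sv \<and> iarr s 3 = so \<and> iarr s 4 = hd \<and> iarr s 5 = nx \<and> iarr s 6 = eid \<and>
     iarr s 13 = (\<lambda>_. 0) \<and> iarr s 14 = (\<lambda>_. 0)"

definition wst :: "(nat \<Rightarrow> nat) \<Rightarrow> (nat \<Rightarrow> nat) \<Rightarrow> (nat \<Rightarrow> nat) \<Rightarrow> mstate \<Rightarrow> bool" where
  "wst w lg cnt s \<longleftrightarrow> iarr s 7 = w \<and> iarr s 8 = lg \<and> iarr s 9 = cnt \<and> dsok w (dstr s)"

definition dem :: "nat \<Rightarrow> nat \<Rightarrow> nat \<Rightarrow> (nat \<Rightarrow> nat) \<Rightarrow> (nat \<Rightarrow> nat) \<Rightarrow> mstate \<Rightarrow> bool" where
  "dem i j R du dv s \<longleftrightarrow> ivar s 4 = i \<and> ivar s 13 = j \<and> ivar s 11 = R \<and> iarr s 10 = du \<and> iarr s 11 = dv"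

lemma wp_edge:
  assumes pre: "renv p s" "wst w lg cnt s" "dem i j R du dv s" "iarr s 12 t = a" "iarr s 12 (Suc t) = b'" "ivar s 15 = t"
    and e: "e < m" "eid (a * n + b') = e" "{a, b'} = {sv e, so e}" and inv: "winv Bw w lg cnt"
    and bnd: "w e \<le> N + 1" "real (w e) * 2 \<le> real (2 * N + 2)" "t < 2 * n" "cnt e \<le> Wd - 1" "lg e < Wd"
    and T: "8 \<le> T" "0 \<le> q"
    and post: "\<And>s' T' w' lg' cnt'. \<lbrakk>bump w lg cnt e = (w', lg', cnt'); renv p s'; wst w' lg' cnt' s';
        dem i j R du dv s'; iarr s' 12 = iarr s 12; ivar s' 14 = ivar s 14; ivar s' 15 = Suc t; T - 8 \<le> T'\<rbrakk> \<Longrightarrow> Q s' T' q"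
  shows "wp D Wd edge_prog Q s T q"
proof -
  obtain g h where gh: "dstr s = Some (g, h)" using pre(2) unfolding wst_def dsok_def by auto
  have we: "1 \<le> w e" using inv e unfolding winv_def by simp
  have ds: "dsok w (Some (g, h))" using pre(2) gh by (simp add: wst_def)
  note inc = dsok_increase[OF ds e(1,3) we]
  have WW: "e \<le> Wd" "Suc t \<le> Wd" "Suc (cnt e) \<le> Wd" "2 * w e \<le> Wd" "Suc (lg e) \<le> Wd" "1 \<le> Wd"
    using bnd Wd e(1) N by linarith+
  let ?s1 = "set_iarr 9 e (Suc (cnt e)) (set_ivar 16 e s)"
  show ?thesis
  proof (cases "real (Suc (cnt e)) < \<kappa>")
    case True
    have "Q (set_ivar 15 (Suc t) ?s1) (T - 5) q"
      by (rule post[of w lg "cnt(e := Suc (cnt e))"])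
        (use pre True in \<open>auto simp: bump_def renv_def wst_def dem_def\<close>)
    thus ?thesis using pre e T True WW by (simp add: edge_prog_def wp_simps renv_def wst_def dem_def)
  next
    case False
    let ?op = "IncreaseEdgeWeight a b' (real (w e))"
    let ?s2 = "?s1\<lparr>dstr := Some (g, h @ [?op])\<rparr>"
    have "Q (set_ivar 15 (Suc t) (set_iarr 9 e 0 (set_iarr 8 e (Suc (lg e)) (set_iarr 7 e (2 * w e) ?s2)))) (T - 8) q"
      by (rule post[of "w(e := 2 * w e)" "lg(e := Suc (lg e))" "cnt(e := 0)"])
        (use pre False inc in \<open>auto simp: bump_def renv_def wst_def dem_def\<close>)
    hence "wp D Wd (DSIncrease (IGet 12 (V 15)) (IGet 12 (IAdd (V 15) (K 1))) (ROfInt (IGet 7 (V 16)));;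
        IPut 7 (V 16) (IMul (K 2) (IGet 7 (V 16)));;
        IPut 8 (V 16) (IAdd (IGet 8 (V 16)) (K 1));;
        IPut 9 (V 16) (K 0)) (wp D Wd (IAssign 15 (IAdd (V 15) (K 1))) Q) ?s1 (T - 3) q"
      unfolding wp_Seq
      by (intro wp_DSIncrease[of _ g h ?op])
        (use pre e T WW inc gh in \<open>simp_all add: wp_simps renv_def wst_def dem_def\<close>)
    thus ?thesis using pre e T False WW
      by (simp add: edge_prog_def wp_simps wp_Seq_fun renv_def wst_def dem_def)
  qed
qed

lemma wp_path:
  assumes pre: "renv p s" "wst w lg cnt s" "dem i j R du dv s"
    and P: "is_path gr u v P" "\<And>t. t < length P \<Longrightarrow> iarr s 12 t = P ! t" "ivar s 14 = length P"
    and inv: "winv Bw w lg cnt" "pathw w P \<le> X" "2 * X \<le> Bw" "zpot w cnt + X \<le> \<kappa> * real N"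
    and cntW: "\<And>e. cnt e < Wd"
    and T: "2 + 9 * real (length P) \<le> T" "0 \<le> q"
    and post: "\<And>s' T' w' lg' cnt'. \<lbrakk>renv p s'; wst w' lg' cnt' s'; dem i j R du dv s'; winv Bw w' lg' cnt';
        zpot w' cnt' \<le> zpot w cnt + X; \<And>e. w e \<le> w' e; \<And>e. e < m \<Longrightarrow> ub lg cnt e \<le> ub lg' cnt' e;
        \<And>t. Suc t < length P \<Longrightarrow> ub lg cnt (eix P t) + 1 \<le> ub lg' cnt' (eix P t);
        \<And>e. cnt' e \<le> cnt e + 1; T - (2 + 9 * real (length P)) \<le> T'\<rbrakk> \<Longrightarrow> Q s' T' q"
  shows "wp D Wd path_prog Q s T q"
proof -
  define Tf where "Tf = T - (2 + 9 * real (length P))"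
  define J where "J = (\<lambda>t s T' w' lg' cnt'. ivar s 15 = t \<and> t \<le> length P - 1 \<and> renv p s \<and> wst w' lg' cnt' s \<and>
     dem i j R du dv s \<and> (\<forall>t<length P. iarr s 12 t = P ! t) \<and> ivar s 14 = length P \<and> winv Bw w' lg' cnt' \<and>
     zpot w' cnt' \<le> zpot w cnt + (\<Sum>t'<t. real (w (eix P t'))) \<and> (\<forall>e. w e \<le> w' e) \<and>
     (\<forall>t'<t. ub lg cnt (eix P t') + 1 \<le> ub lg' cnt' (eix P t')) \<and> (\<forall>e. cnt' e \<le> cnt e + 1) \<and>
     (\<forall>e. e \<notin> eix P ` {..<t} \<longrightarrow> w' e = w e \<and> lg' e = lg e \<and> cnt' e = cnt e) \<and>
     Tf + 1 + 9 * (real (length P) - real t) \<le> T')"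
  define I where "I = (\<lambda>s T' q'. q' = q \<and> (\<exists>t w' lg' cnt'. J t s T' w' lg' cnt'))"
  have Pne: "P \<noteq> []" "distinct P" "set P \<subseteq> {..<n}" using P(1) by (simp_all add: is_path_def gr_def)
  have lP: "length P \<le> n"
    using distinct_card[OF Pne(2)] card_mono[OF _ Pne(3)] by simp
  have Tf: "0 \<le> Tf" using T by (simp add: Tf_def)
  have "wp D Wd (While (ILess (IAdd (V 15) (K 1)) (V 14)) edge_prog) Q (set_ivar 15 0 s) (T - 1) q"
  proof (rule wp_While[where I = I])
    have "J 0 (set_ivar 15 0 s) (T - 1) w lg cnt"
      using pre P inv by (simp add: J_def renv_def wst_def dem_def Tf_def)
    thus "I (set_ivar 15 0 s) (T - 1) q" unfolding I_def by blast
  next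
    fix s T' q' assume "I s T' q'" and b: "beval (ILess (IAdd (V 15) (K 1)) (V 14)) s"
    then obtain t w' lg' cnt' where q': "q' = q" and JJ: "J t s T' w' lg' cnt'" unfolding I_def by blast
    from JJ have j: "ivar s 15 = t" "renv p s" "wst w' lg' cnt' s"
     "dem i j R du dv s" "\<And>t. t < length P \<Longrightarrow> iarr s 12 t = P ! t" "ivar s 14 = length P" "winv Bw w' lg' cnt'"
     "zpot w' cnt' \<le> zpot w cnt + (\<Sum>t'<t. real (w (eix P t')))" "\<And>e. w e \<le> w' e"
     "\<And>t'. t' < t \<Longrightarrow> ub lg cnt (eix P t') + 1 \<le> ub lg' cnt' (eix P t')"
     "\<And>e. cnt' e \<le> cnt e + 1" "\<And>e. e \<notin> eix P ` {..<t} \<Longrightarrow> w' e = w e \<and> lg' e = lg e \<and> cnt' e = cnt e"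
     "Tf + 1 + 9 * (real (length P) - real t) \<le> T'" unfolding J_def by blast+
    have t: "Suc t < length P" using b j by simp
    let ?e = "eix P t"
    note pe = path_edge[OF P(1) t]
    \<comment> \<open>The edge has not been bumped by this path, so it still has the weight it had
      when the path was reported.\<close>
    have enew: "?e \<notin> eix P ` {..<t}"
    proof
      assume "?e \<in> eix P ` {..<t}"
      then obtain t' where "t' < t" "eix P t = eix P t'" by auto
      moreover from this t have "t \<in> {..<length P - 1}" "t' \<in> {..<length P - 1}" by auto
      ultimately show False using inj_onD[OF eix_inj[OF P(1)], of t t'] by simp
    qed
    have we: "w' ?e = w ?e" using j(12)[OF enew] by simp
    have sumle: "(\<Sum>t'<t. real (w (eix P t'))) + real (w ?e) \<le> pathw w P"
    proof -
      have "(\<Sum>t'<Suc t. real (w (eix P t'))) \<le> pathw w P"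
        unfolding pathw_def using t by (intro sum_mono2) auto
      thus ?thesis by simp
    qed
    have s0: "0 \<le> (\<Sum>t'<t. real (w (eix P t')))" by (intro sum_nonneg) auto
    have "zpot w' cnt' \<le> \<kappa> * real N" using j(8) sumle inv by simp
    note zb = zpot_bound[OF j(7) this pe(1)]
    have w2: "2 * real (w' ?e) \<le> Bw" using we sumle inv s0 by simp
    have iw: "w' ?e = 2 ^ lg' ?e" "real (cnt' ?e) < \<kappa>" using j(7) pe(1) unfolding winv_def by auto
    have lgW: "lg' ?e < Wd"
    proof -
      have "lg' ?e < 2 ^ lg' ?e" by (rule less_exp)
      also have "\<dots> \<le> N + 1" using iw zb by simp
      finally show ?thesis using Wd N by linarith
    qed
    have cW: "cnt' ?e \<le> Wd - 1" using j(12)[OF enew] cntW[of ?e] by simp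
    have T8: "10 + Tf + 9 * (real (length P) - real (Suc t)) \<le> T'" using j(13) by simp
    have lt: "real (Suc t) \<le> real (length P)" using t by simp
    have "wp D Wd edge_prog I s (T' - 1) q"
    proof (rule wp_edge[OF j(2,3,4) _ _ j(1) pe(1) _ pe(2)[symmetric] j(7) zb(1) _ _ cW lgW _ T(2)])
      show "iarr s 12 t = P ! t" "iarr s 12 (Suc t) = P ! Suc t" using j(5) t by simp_all
      show "eid (P ! t * n + P ! Suc t) = ?e" by (simp add: eix_def)
      show "t < 2 * n" using t lP by simp
      show "real (w' ?e) * 2 \<le> real (2 * N + 2)" using zb(1) by linarith
      show "8 \<le> T' - 1" using T8 Tf lt by (simp add: right_diff_distrib)
    next
      fix s' T'' w2 lg2 cnt2
      assume bp: "bump w' lg' cnt' ?e = (w2, lg2, cnt2)" and st: "renv p s'" "wst w2 lg2 cnt2 s'"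
        "dem i j R du dv s'" "iarr s' 12 = iarr s 12" "ivar s' 14 = ivar s 14" "ivar s' 15 = Suc t" and T'': "T' - 1 - 8 \<le> T''"
      note bs = bump_spec[OF bp pe(1) j(7) w2]
      have "J (Suc t) s' T'' w2 lg2 cnt2" unfolding J_def
      proof (intro conjI allI impI)
        fix t' assume t': "t' < Suc t"
        show "ub lg cnt (eix P t') + 1 \<le> ub lg2 cnt2 (eix P t')"
        proof (cases "t' = t")
          case True
          have "ub lg cnt ?e = ub lg' cnt' ?e" using j(12)[OF enew] by (simp add: ub_def)
          thus ?thesis using bs(4) True by simp
        next
          case False
          hence tt: "t' < t" using t' by simp
          have "eix P t' \<noteq> ?e" using enew tt by (metis imageI lessThan_iff)
          hence "ub lg2 cnt2 (eix P t') = ub lg' cnt' (eix P t')" using bs(5) by (simp add: ub_def)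
          thus ?thesis using j(10)[OF tt] by simp
        qed
      next
        fix e assume "e \<notin> eix P ` {..<Suc t}"
        hence "e \<noteq> ?e" "e \<notin> eix P ` {..<t}" by (auto simp: lessThan_Suc)
        thus "w2 e = w e" "lg2 e = lg e" "cnt2 e = cnt e" using bs(5) j(12) by auto
      next
        show "zpot w2 cnt2 \<le> zpot w cnt + (\<Sum>t'<Suc t. real (w (eix P t')))" using bs(2) j(8) we by simp
        fix e show "w e \<le> w2 e" using bs(3) j(9) order.trans by blast
        show "cnt2 e \<le> cnt e + 1"
        proof (cases "e = ?e")
          case True
          have "cnt2 ?e \<le> Suc (cnt' ?e)" using bp by (auto simp: bump_def split: if_splits)
          thus ?thesis using True j(12)[OF enew] by simp
        next
          case False
          thus ?thesis using bs(5)[of e] j(11)[of e] by simp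
        qed
      qed (use st t j(5,6) bs(1) T'' T8 in auto)
      thus "I s' T'' q" unfolding I_def by blast
    qed
    moreover have "0 \<le> T'" using T8 Tf lt by (simp add: right_diff_distrib)
    ultimately show "0 \<le> T' \<and> wp D Wd edge_prog I s (T' - 1) q'" using q' by simp
  next
    fix s T' q' assume "I s T' q'" and b: "\<not> beval (ILess (IAdd (V 15) (K 1)) (V 14)) s"
    then obtain t w' lg' cnt' where q': "q' = q" and JJ: "J t s T' w' lg' cnt'" unfolding I_def by blast
    from JJ have j: "ivar s 15 = t" "t \<le> length P - 1" "renv p s" "wst w' lg' cnt' s"
     "dem i j R du dv s" "ivar s 14 = length P" "winv Bw w' lg' cnt'"
     "zpot w' cnt' \<le> zpot w cnt + (\<Sum>t'<t. real (w (eix P t')))" "\<And>e. w e \<le> w' e"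
     "\<And>t'. t' < t \<Longrightarrow> ub lg cnt (eix P t') + 1 \<le> ub lg' cnt' (eix P t')"
     "\<And>e. cnt' e \<le> cnt e + 1" "\<And>e. e \<notin> eix P ` {..<t} \<Longrightarrow> w' e = w e \<and> lg' e = lg e \<and> cnt' e = cnt e"
     "Tf + 1 + 9 * (real (length P) - real t) \<le> T'" unfolding J_def by blast+
    have t: "t = length P - 1" using b j by simp
    have lt: "real t \<le> real (length P)" using t by simp
    have T1: "Tf + 1 \<le> T'" using j(13) lt by (simp add: right_diff_distrib)
    have "Q s (T' - 1) q"
    proof (rule post[OF j(3,4,5,7) _ j(9)])
      show "zpot w' cnt' \<le> zpot w cnt + X" using j(8) inv(2) unfolding pathw_def t by linarith
      show "ub lg cnt e \<le> ub lg' cnt' e" if "e < m" for e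
      proof (cases "e \<in> eix P ` {..<t}")
        case True
        then obtain t' where "t' < t" "e = eix P t'" by auto
        with j(10)[of t'] show ?thesis by simp
      next
        case False
        with j(12) show ?thesis by (simp add: ub_def)
      qed
      show "ub lg cnt (eix P t') + 1 \<le> ub lg' cnt' (eix P t')" if "Suc t' < length P" for t'
        using j(10)[of t'] that t by simp
      show "cnt' e \<le> cnt e + 1" for e by (rule j(11))
      show "T - (2 + 9 * real (length P)) \<le> T' - 1" using T1 by (simp add: Tf_def)
    qed
    thus "1 \<le> T' \<and> 0 \<le> q' \<and> Q s (T' - 1) q'" using q' T1 Tf T(2) by simp
  qed
  thus ?thesis using T by (simp add: path_prog_def wp_simps)
qed

end

section \<open>One level: routing under a limit on path lengths\<close>

context routing_env begin

definition sepc :: "nat set \<Rightarrow> (nat \<times> nat) list \<Rightarrow> nat" where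
  "sepc X L = length (filter (\<lambda>(u, v). u \<in> X \<longleftrightarrow> v \<notin> X) L)"

definition cutI :: "nat set \<Rightarrow> nat set" where
  "cutI X = {e. e < m \<and> (sv e \<in> X \<longleftrightarrow> so e \<notin> X)}"

definition lst :: "(nat \<times> nat) list \<Rightarrow> mstate \<Rightarrow> bool" where
  "lst L s \<longleftrightarrow> ivar s 11 = length L \<and> (\<forall>t<length L. (iarr s 10 t, iarr s 11 t) = L ! t)"

text \<open>Otherwise membership in X would be handed on along the path from u to v.\<close>

lemma path_crosses:
  assumes P: "is_path gr u v P" and X: "u \<in> X \<longleftrightarrow> v \<notin> X"
  shows "\<exists>t. Suc t < length P \<and> eix P t \<in> cutI X"
proof (rule ccontr)
  assume no: "\<not> ?thesis"
  have Pn: "P \<noteq> []" "List.hd P = u" "last P = v" using P by (auto simp: is_path_def)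
  have "P ! t \<in> X \<longleftrightarrow> u \<in> X" if "t < length P" for t
    using that
  proof (induction t)
    case 0
    thus ?case using Pn by (simp add: hd_conv_nth)
  next
    case (Suc t)
    have "eix P t \<notin> cutI X" using no Suc.prems by blast
    moreover note path_edge(1,2)[OF P Suc.prems]
    ultimately have "P ! t \<in> X \<longleftrightarrow> P ! Suc t \<in> X" unfolding cutI_def by (auto simp: doubleton_eq_iff)
    thus ?case using Suc by simp
  qed
  from this[of "length P - 1"] show False using Pn X by (simp add: last_conv_nth)
qed

text \<open>Weights are at least 1, so the limit on lengths also limits the number of vertices, and
  with it the time spent on a path.\<close>

lemma path_length:
  assumes "is_path gr u v P" "winv Bw w lg cnt" shows "real (length P) \<le> pathw w P + 1"
proof -
  have "(\<Sum>t<length P - 1. 1) \<le> pathw w P" unfolding pathw_def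
  proof (rule sum_mono)
    fix t assume "t \<in> {..<length P - 1}"
    hence "eix P t < m" using path_edge(1)[OF assms(1), of t] by simp
    thus "1 \<le> real (w (eix P t))" using assms(2) unfolding winv_def by simp
  qed
  thus ?thesis by simp
qed

text \<open>\<open>S0\<close> stands for the number of pairs that a set separated at the very
  beginning: each is still waiting or was routed over a crossing edge, where \<open>ub\<close>
  counts it. A path costs 10 per vertex, 9 in \<open>path_prog\<close> and 1 for the report, and has
  at most \<alpha> \<open>Lb\<close> p + 1 vertices. Routing a pair raises a counter by at most 1
  and shortens the list by 1, which bounds the counters by \<open>M\<close>.\<close>

lemma wp_level:
  assumes pre: "renv p s" "wst w lg cnt s" "lst L s" and inv: "winv Bw w lg cnt"
    and Ln: "\<And>u v. (u, v) \<in> set L \<Longrightarrow> u < n \<and> v < n"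
    and X: "X = \<alpha> * Lb * real p" "0 \<le> Lb" "2 * X \<le> Bw" "zpot w cnt + real (length L) * X \<le> \<kappa> * real N"
    and bnd: "\<And>e. cnt e + length L \<le> M" "M < Wd"
    and T: "4 + real (length L) * (17 + 10 * X) \<le> T" "2 * real (length L) \<le> q"
    and sep: "\<And>X. S0 X \<le> real (sepc X L) + (\<Sum>e\<in>cutI X. ub lg cnt e)"
    and post: "\<And>s' T' q' w' lg' cnt' L'. \<lbrakk>renv p s'; wst w' lg' cnt' s'; lst L' s'; winv Bw w' lg' cnt';
        zpot w' cnt' \<le> zpot w cnt + real (length L) * X;
        \<And>u v. (u, v) \<in> set L' \<Longrightarrow> u < n \<and> v < n \<and> farp w' u v (Lb * real p);
        \<And>P. length (filter P L') \<le> length (filter P L); \<And>e. cnt' e + length L' \<le> M;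
        \<And>X. S0 X \<le> real (sepc X L') + (\<Sum>e\<in>cutI X. ub lg' cnt' e);
        T - (4 + real (length L) * (17 + 10 * X)) \<le> T'; q - 2 * real (length L) \<le> q'\<rbrakk> \<Longrightarrow> Q s' T' q'"
  shows "wp D Wd level_prog Q s T q"
proof -
  define Tf where "Tf = T - (4 + real (length L) * (17 + 10 * X))"
  define qf where "qf = q - 2 * real (length L)"
  have Tf: "0 \<le> Tf" and qf: "0 \<le> qf" using T by (simp_all add: Tf_def qf_def)
  have X0: "0 \<le> X" using X alpha by simp
  define J where "J = (\<lambda>i Kp w' lg' cnt' (s :: mstate) T' q'. renv p s \<and> wst w' lg' cnt' s \<and> ivar s 4 = i \<and>
     ivar s 13 = length Kp \<and> ivar s 11 = length L \<and> i \<le> length L \<and> length Kp \<le> i \<and>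
     (\<forall>t<length Kp. (iarr s 10 t, iarr s 11 t) = Kp ! t) \<and>
     (\<forall>t. i \<le> t \<and> t < length L \<longrightarrow> (iarr s 10 t, iarr s 11 t) = L ! t) \<and> winv Bw w' lg' cnt' \<and>
     zpot w' cnt' \<le> zpot w cnt + real i * X \<and>
     (\<forall>u v. (u, v) \<in> set Kp \<longrightarrow> u < n \<and> v < n \<and> farp w' u v (Lb * real p)) \<and>
     (\<forall>P. length (filter P Kp) + length (filter P (drop i L)) \<le> length (filter P L)) \<and>
     (\<forall>e. cnt' e + length Kp + (length L - i) \<le> M) \<and>
     (\<forall>X. S0 X \<le> real (sepc X Kp) + real (sepc X (drop i L)) + (\<Sum>e\<in>cutI X. ub lg' cnt' e)) \<and>
     Tf + 2 + real (length L - i) * (17 + 10 * X) \<le> T' \<and> qf + 2 * real (length L - i) \<le> q')"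
  define I where "I = (\<lambda>s T' q'. \<exists>i Kp w' lg' cnt'. J i Kp w' lg' cnt' s T' q')"
  let ?cond = "BAnd (ILess (K 0) (V 14)) (BNot (RLess (RMul (RMul (RVar 0) (RVar 3)) (ROfInt (V 8))) (RVar 5)))"
  let ?yes = "DSPath 12 14 (IGet 10 (V 4)) (IGet 11 (V 4));; path_prog"
  let ?no = "IPut 10 (V 13) (IGet 10 (V 4));; IPut 11 (V 13) (IGet 11 (V 4));; IAssign 13 (IAdd (V 13) (K 1))"
  let ?inc = "IAssign 4 (IAdd (V 4) (K 1))"
  let ?body = "DSDist 5 14 (IGet 10 (V 4)) (IGet 11 (V 4));; Cond ?cond ?yes ?no;; ?inc"
  have "wp D Wd (While (ILess (V 4) (V 11)) ?body) (wp D Wd (IAssign 11 (V 13)) Q) (set_ivar 13 0 (set_ivar 4 0 s)) (T - 2) q"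
  proof (rule wp_While[where I = I])
    have "J 0 [] w lg cnt (set_ivar 13 0 (set_ivar 4 0 s)) (T - 2) q"
      using pre inv sep bnd by (simp add: J_def renv_def wst_def lst_def Tf_def qf_def sepc_def)
    thus "I (set_ivar 13 0 (set_ivar 4 0 s)) (T - 2) q" unfolding I_def by blast
  next
    fix s T' q' assume "I s T' q'" and b: "beval (ILess (V 4) (V 11)) s"
    then obtain i Kp w' lg' cnt' where JJ: "J i Kp w' lg' cnt' s T' q'" unfolding I_def by blast
    from JJ have j: "renv p s" "wst w' lg' cnt' s" "ivar s 4 = i" "ivar s 13 = length Kp" "ivar s 11 = length L"
      "length Kp \<le> i" "\<And>t. t < length Kp \<Longrightarrow> (iarr s 10 t, iarr s 11 t) = Kp ! t"
      "\<And>t. i \<le> t \<Longrightarrow> t < length L \<Longrightarrow> (iarr s 10 t, iarr s 11 t) = L ! t" "winv Bw w' lg' cnt'"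
      "zpot w' cnt' \<le> zpot w cnt + real i * X"
      "\<And>u v. (u, v) \<in> set Kp \<Longrightarrow> u < n \<and> v < n \<and> farp w' u v (Lb * real p)"
      "\<And>P. length (filter P Kp) + length (filter P (drop i L)) \<le> length (filter P L)"
      "\<And>e. cnt' e + length Kp + (length L - i) \<le> M"
      "\<And>X. S0 X \<le> real (sepc X Kp) + real (sepc X (drop i L)) + (\<Sum>e\<in>cutI X. ub lg' cnt' e)"
      "Tf + 2 + real (length L - i) * (17 + 10 * X) \<le> T'" "qf + 2 * real (length L - i) \<le> q'"
      unfolding J_def by blast+
    have iL: "i < length L" using b j by simp
    obtain u v where uv: "L ! i = (u, v)" by (cases "L ! i")
    have arr: "iarr s 10 i = u" "iarr s 11 i = v" using j(8)[of i] iL uv by auto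
    have uvn: "u < n" "v < n" using Ln[of u v] uv iL nth_mem[of i L] by auto
    have dr: "drop i L = (u, v) # drop (Suc i) L" using iL uv by (simp add: Cons_nth_drop_Suc[symmetric])
    have li: "real (length L - i) = real (length L - Suc i) + 1" using iL by simp
    have pos: "0 \<le> real (length L - Suc i) * (17 + 10 * X)" using X0 by simp
    have T1: "Tf + 2 + real (length L - Suc i) * (17 + 10 * X) + 17 + 10 * X \<le> T'"
      using j(15) unfolding li by (simp add: algebra_simps)
    have q1: "qf + 2 * real (length L - Suc i) + 2 \<le> q'" using j(16) unfolding li by simp
    have q2: "2 \<le> q'" using q1 qf by simp
    obtain g h where gh: "dstr s = Some (g, h)" using j(2) unfolding wst_def dsok_def by auto
    have ds: "dsok w' (Some (g, h))" using j(2) gh by (simp add: wst_def)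
    hence d: "wf_wgraph g" "legal g h" "nverts g = n" "nverts (current g h) = n" "edges (current g h) = E"
      "\<forall>e<m. wt (current g h) {sv e, so e} = real (w' e)" unfolding dsok_def by auto
    note dspec = dist_spec[OF d uvn]
    define dd where "dd = ds_dist D g h u v"
    let ?h1 = "h @ [QueryDistance u v]"
    have lg1: "legal_op (current g h) (QueryDistance u v)" using d uvn by simp
    note ds1 = dsok_query[OF ds lg1, simplified]
    let ?s1 = "set_rvar 5 (real_of_ereal dd) (set_ivar 14 (if dd = \<infinity> then 0 else 1) (s\<lparr>dstr := Some (g, ?h1)\<rparr>))"
    have s1: "renv p ?s1" "wst w' lg' cnt' ?s1" using j(1,2) ds1 by (simp_all add: renv_def wst_def)
    have iW: "Suc i \<le> Wd" "length Kp < Wd" using iL bnd(1)[of 0] bnd(2) j(6) by simp_all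
    have cnd: "beval ?cond ?s1 \<longleftrightarrow> dd \<noteq> \<infinity> \<and> real_of_ereal dd \<le> X"
      using j(1) X(1) by (auto simp: renv_def not_less)
    have "wp D Wd (Cond ?cond ?yes ?no;; ?inc) I ?s1 (T' - 2) (q' - 1)"
    proof (cases "dd \<noteq> \<infinity> \<and> real_of_ereal dd \<le> X")
      case False
      have far: "farp w' u v (Lb * real p)"
        using dspec(4)[of "Lb * real p"] False X(1) unfolding dd_def by (auto simp: mult.assoc not_le)
      let ?s2 = "set_ivar 4 (Suc i) (set_ivar 13 (Suc (length Kp)) (set_iarr 11 (length Kp) v (set_iarr 10 (length Kp) u ?s1)))"
      have "J (Suc i) (Kp @ [(u, v)]) w' lg' cnt' ?s2 (T' - 7) (q' - 1)" unfolding J_def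
      proof (intro conjI allI impI)
        show "renv p ?s2" "wst w' lg' cnt' ?s2" using s1 by (simp_all add: renv_def wst_def)
        fix t assume "t < length (Kp @ [(u, v)])"
        thus "(iarr ?s2 10 t, iarr ?s2 11 t) = (Kp @ [(u, v)]) ! t" using j(7)[of t] by (auto simp: nth_append)
      next
        fix t assume "Suc i \<le> t \<and> t < length L"
        thus "(iarr ?s2 10 t, iarr ?s2 11 t) = L ! t" using j(8)[of t] j(6) by auto
      next
        show "zpot w' cnt' \<le> zpot w cnt + real (Suc i) * X" using j(10) X0 by (simp add: algebra_simps)
        fix P show "length (filter P (Kp @ [(u, v)])) + length (filter P (drop (Suc i) L)) \<le> length (filter P L)"
          using j(12)[of P] unfolding dr by (simp split: if_splits)
        fix Y show "S0 Y \<le> real (sepc Y (Kp @ [(u, v)])) + real (sepc Y (drop (Suc i) L)) + (\<Sum>e\<in>cutI Y. ub lg' cnt' e)"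
          using j(14)[of Y] unfolding dr by (simp add: sepc_def split: if_splits)
        fix e show "cnt' e + length (Kp @ [(u, v)]) + (length L - Suc i) \<le> M" using j(13)[of e] iL by simp
      next
        fix u' v' assume "(u', v') \<in> set (Kp @ [(u, v)])"
        thus "u' < n" "v' < n" "farp w' u' v' (Lb * real p)" using j(11)[of u' v'] far uvn by auto
      next
        show "Tf + 2 + real (length L - Suc i) * (17 + 10 * X) \<le> T' - 7" using T1 X0 by simp
        show "qf + 2 * real (length L - Suc i) \<le> q' - 1" using q1 by simp
      qed (use iL j in auto)
      hence "I ?s2 (T' - 7) (q' - 1)" unfolding I_def by blast
      moreover have "8 \<le> T'" using T1 Tf X0 pos by linarith
      moreover have "u \<le> Wd" "v \<le> Wd" using uvn Wd by simp_all
      moreover have "\<not> beval ?cond ?s1" using cnd False by blast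
      ultimately show ?thesis using arr j(3,4) iW q2 by (simp add: wp_simps del: beval.simps)
    next
      case True
      define P where "P = ds_path D g ?h1 u v"
      have P: "is_path gr u v P" "pathw w' P \<le> X" using dspec(2,3) True unfolding dd_def P_def by auto
      have lg2: "legal_op (current g ?h1) (QueryPath u v)"
        using dspec(1) True d uvn unfolding dd_def by (simp add: current_append)
      note ds2 = dsok_query[OF ds1 lg2, simplified]
      let ?h2 = "?h1 @ [QueryPath u v]"
      let ?s2 = "write_list 12 P (set_ivar 14 (length P) (?s1\<lparr>dstr := Some (g, ?h2)\<rparr>))"
      have s2: "renv p ?s2" "wst w' lg' cnt' ?s2" "dem i (length Kp) (length L) (iarr s 10) (iarr s 11) ?s2"
        using j(1-5) ds2 by (simp_all add: renv_def wst_def dem_def)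
      have lP: "real (length P) \<le> X + 1" using path_length[OF P(1) j(9)] P(2) by simp
      have TP: "4 + real (length P) \<le> T'" using T1 lP Tf pos X0 by linarith
      have zp: "zpot w' cnt' + X \<le> \<kappa> * real N"
      proof -
        have "real (Suc i) * X \<le> real (length L) * X" using iL X0 by (intro mult_right_mono) auto
        thus ?thesis using j(10) X(4) by (simp add: algebra_simps)
      qed
      have "wp D Wd path_prog (wp D Wd ?inc I) ?s2 (T' - 3 - (1 + real (length P))) (q' - 2)"
      proof (rule wp_path[OF s2 P(1) _ _ j(9) P(2) X(3) zp])
        show "2 + 9 * real (length P) \<le> T' - 3 - (1 + real (length P))" using T1 lP Tf pos by linarith
        show "0 \<le> q' - 2" using q2 by simp
        show "cnt' e < Wd" for e using j(13)[of e] bnd(2) by linarith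
      next
        fix s3 T'' w3 lg3 cnt3
        assume s3: "renv p s3" "wst w3 lg3 cnt3 s3" "dem i (length Kp) (length L) (iarr s 10) (iarr s 11) s3"
          "winv Bw w3 lg3 cnt3" "zpot w3 cnt3 \<le> zpot w' cnt' + X" "\<And>e. w' e \<le> w3 e"
          "\<And>e. e < m \<Longrightarrow> ub lg' cnt' e \<le> ub lg3 cnt3 e"
          "\<And>t. Suc t < length P \<Longrightarrow> ub lg' cnt' (eix P t) + 1 \<le> ub lg3 cnt3 (eix P t)"
          "\<And>e. cnt3 e \<le> cnt' e + 1"
          and T'': "T' - 3 - (1 + real (length P)) - (2 + 9 * real (length P)) \<le> T''"
        let ?s4 = "set_ivar 4 (Suc i) s3"
        have "J (Suc i) Kp w3 lg3 cnt3 ?s4 (T'' - 1) (q' - 2)" unfolding J_def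
        proof (intro conjI allI impI)
          show "renv p ?s4" "wst w3 lg3 cnt3 ?s4" using s3 by (simp_all add: renv_def wst_def)
          fix t assume "t < length Kp"
          thus "(iarr ?s4 10 t, iarr ?s4 11 t) = Kp ! t" using j(7)[of t] s3(3) by (auto simp: dem_def)
        next
          fix t assume "Suc i \<le> t \<and> t < length L"
          thus "(iarr ?s4 10 t, iarr ?s4 11 t) = L ! t" using j(8)[of t] s3(3) by (auto simp: dem_def)
        next
          show "zpot w3 cnt3 \<le> zpot w cnt + real (Suc i) * X" using j(10) s3(5) by (simp add: algebra_simps)
          fix P show "length (filter P Kp) + length (filter P (drop (Suc i) L)) \<le> length (filter P L)"
            using j(12)[of P] unfolding dr by (simp split: if_splits)
          fix e show "cnt3 e + length Kp + (length L - Suc i) \<le> M" using j(13)[of e] s3(9)[of e] iL by linarith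
        next
          fix Y
          have fin: "finite (cutI Y)" by (simp add: cutI_def)
          have mono: "(\<Sum>e\<in>cutI Y. ub lg' cnt' e) \<le> (\<Sum>e\<in>cutI Y. ub lg3 cnt3 e)"
            by (intro sum_mono s3(7)) (simp add: cutI_def)
          show "S0 Y \<le> real (sepc Y Kp) + real (sepc Y (drop (Suc i) L)) + (\<Sum>e\<in>cutI Y. ub lg3 cnt3 e)"
          proof (cases "u \<in> Y \<longleftrightarrow> v \<notin> Y")
            case True
            from path_crosses[OF P(1) True] obtain t where t: "Suc t < length P" "eix P t \<in> cutI Y" by blast
            \<comment> \<open>The pair disappears from the waiting ones, and in exchange
              \<open>ub\<close> rises by 1 on a crossing edge of its path.\<close>
            have "(\<Sum>e\<in>cutI Y. ub lg' cnt' e) + 1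
              = ub lg' cnt' (eix P t) + 1 + (\<Sum>e\<in>cutI Y - {eix P t}. ub lg' cnt' e)"
              using fin t by (simp add: sum.remove)
            also have "\<dots> \<le> ub lg3 cnt3 (eix P t) + (\<Sum>e\<in>cutI Y - {eix P t}. ub lg3 cnt3 e)"
              by (intro add_mono s3(8)[OF t(1)] sum_mono s3(7)) (simp add: cutI_def)
            also have "\<dots> = (\<Sum>e\<in>cutI Y. ub lg3 cnt3 e)" using fin t by (simp add: sum.remove)
            finally show ?thesis using j(14)[of Y] True unfolding dr by (simp add: sepc_def)
          next
            case False
            thus ?thesis using j(14)[of Y] mono unfolding dr by (simp add: sepc_def)
          qed
        next
          fix u' v' assume "(u', v') \<in> set Kp"
          thus "u' < n" "v' < n" "farp w3 u' v' (Lb * real p)" using j(11)[of u' v'] farp_mono[OF _ s3(6)] by auto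
        next
          show "Tf + 2 + real (length L - Suc i) * (17 + 10 * X) \<le> T'' - 1" using T'' T1 lP by simp
          show "qf + 2 * real (length L - Suc i) \<le> q' - 2" using q1 by simp
        qed (use iL j(6) s3 in \<open>auto simp: dem_def\<close>)
        hence "I ?s4 (T'' - 1) (q' - 2)" unfolding I_def by blast
        moreover have "1 \<le> T''" using T'' T1 lP Tf pos by linarith
        ultimately show "wp D Wd ?inc I s3 T'' (q' - 2)"
          using s3(3) iW q2 by (simp add: wp_simps dem_def)
      qed (simp_all)
      hence "wp D Wd ?yes (wp D Wd ?inc I) ?s1 (T' - 3) (q' - 1)"
        unfolding wp_Seq using arr j(3) lg2 TP q2
        by (intro wp_DSPath[of _ g ?h1 "QueryPath u v" _ _ P]) (simp_all add: P_def)
      moreover have "beval ?cond ?s1" using cnd True by blast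
      ultimately show ?thesis by (simp add: wp_Seq_fun wp_Cond del: beval.simps)
    qed
    moreover have "3 \<le> T'" using T1 Tf X0 pos by linarith
    ultimately show "0 \<le> T' \<and> wp D Wd ?body I s (T' - 1) q'"
      unfolding wp_Seq_fun[of _ _ "DSDist 5 14 (IGet 10 (V 4)) (IGet 11 (V 4))"] using arr j(3) lg1 q2 gh
      by (intro conjI wp_DSDist[of _ g h "QueryDistance u v" _ _ dd]) (simp_all add: dd_def)
  next
    fix s T' q' assume "I s T' q'" and b: "\<not> beval (ILess (V 4) (V 11)) s"
    then obtain i Kp w' lg' cnt' where JJ: "J i Kp w' lg' cnt' s T' q'" unfolding I_def by blast
    from JJ have j: "renv p s" "wst w' lg' cnt' s" "ivar s 4 = i" "ivar s 13 = length Kp" "ivar s 11 = length L" "i \<le> length L"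
      "length Kp \<le> i" "\<And>t. t < length Kp \<Longrightarrow> (iarr s 10 t, iarr s 11 t) = Kp ! t" "winv Bw w' lg' cnt'"
      "zpot w' cnt' \<le> zpot w cnt + real i * X"
      "\<And>u v. (u, v) \<in> set Kp \<Longrightarrow> u < n \<and> v < n \<and> farp w' u v (Lb * real p)"
      "\<And>P. length (filter P Kp) + length (filter P (drop i L)) \<le> length (filter P L)"
      "\<And>e. cnt' e + length Kp + (length L - i) \<le> M"
      "\<And>X. S0 X \<le> real (sepc X Kp) + real (sepc X (drop i L)) + (\<Sum>e\<in>cutI X. ub lg' cnt' e)"
      "Tf + 2 + real (length L - i) * (17 + 10 * X) \<le> T'" "qf + 2 * real (length L - i) \<le> q'"
      unfolding J_def by blast+
    have i: "i = length L" using b j by simp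
    have "Q (set_ivar 11 (length Kp) s) (T' - 2) q'"
    proof (rule post[OF _ _ _ j(9) _ j(11)])
      show "renv p (set_ivar 11 (length Kp) s)" "wst w' lg' cnt' (set_ivar 11 (length Kp) s)"
        using j(1,2) by (simp_all add: renv_def wst_def)
      show "lst Kp (set_ivar 11 (length Kp) s)" using j(8) by (simp add: lst_def)
      show "zpot w' cnt' \<le> zpot w cnt + real (length L) * X" using j(10) i by simp
      show "length (filter P Kp) \<le> length (filter P L)" for P using j(12)[of P] by simp
      show "cnt' e + length Kp \<le> M" for e using j(13)[of e] by simp
      show "S0 Y \<le> real (sepc Y Kp) + (\<Sum>e\<in>cutI Y. ub lg' cnt' e)" for Y using j(14)[of Y] i by (simp add: sepc_def)
      show "T - (4 + real (length L) * (17 + 10 * X)) \<le> T' - 2" using j(15) i by (simp add: Tf_def)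
      show "q - 2 * real (length L) \<le> q'" using j(16) i by (simp add: qf_def)
    qed
    moreover have "length Kp \<le> Wd" using j(7) i bnd(1)[of 0] bnd(2) by simp
    ultimately show "1 \<le> T' \<and> 0 \<le> q' \<and> wp D Wd (IAssign 11 (V 13)) Q s (T' - 1) q'"
      using j(4,15,16) i Tf qf by (simp add: wp_simps)
  qed
  moreover have "4 \<le> T" "0 \<le> q"
  proof -
    have "0 \<le> real (length L) * (17 + 10 * X)" using X0 by simp
    thus "4 \<le> T" using T by linarith
    show "0 \<le> q" using T(2) by (rule order.trans[rotated]) simp
  qed
  ultimately show ?thesis by (simp add: level_prog_def wp_simps)
qed

end

section \<open>Demands from the expander\<close>

text \<open>The four maps of \<open>torus_expansion\<close>, with the point (x, y) coded as x * k +
  y.\<close>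

definition gen :: "nat \<Rightarrow> nat \<Rightarrow> nat \<Rightarrow> nat" where
  "gen k r z = (if r = 0 then (z div k + z mod k) mod k * k + z mod k
     else if r = 1 then z div k * k + (z div k + z mod k) mod k
     else if r = 2 then (z div k + 1) mod k * k + z mod k
     else z div k * k + (z mod k + 1) mod k)"

lemma grid_bij:
  assumes "0 < k"
  shows "bij_betw (\<lambda>(x, y). x * k + y) ({..<k} \<times> {..<k}) {..<k * k :: nat}"
proof (rule bij_betw_byWitness[where f' = "\<lambda>z. (z div k, z mod k)"])
  show "(\<lambda>(x, y). x * k + y) ` ({..<k} \<times> {..<k}) \<subseteq> {..<k * k}"
  proof clarsimp
    fix x y assume "x < k" "y < k"
    have "x * k + y < x * k + k" using \<open>y < k\<close> by simp
    also have "\<dots> = Suc x * k" by simp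
    also have "\<dots> \<le> k * k" using \<open>x < k\<close> by (intro mult_right_mono) auto
    finally show "x * k + y < k * k" .
  qed
qed (use assms in \<open>auto simp: less_mult_imp_div_less\<close>)

lemma grid_expansion:
  assumes k: "0 < k" and A: "A \<subseteq> {..<k * k}"
  shows "real (min (card A) (card ({..<k * k} - A))) \<le> 132 * (\<Sum>r<4. real (card {z \<in> A. gen k r z \<notin> A}))"
proof -
  let ?f = "\<lambda>(x :: int, y :: int). nat x * k + nat y"
  define K where "K = int k"
  define Z where "Z = {0..<K} \<times> {0..<K}"
  have K: "0 < K" using k by (simp add: K_def)
  have f1: "bij_betw (\<lambda>(x :: int, y :: int). (nat x, nat y)) Z ({..<k} \<times> {..<k})"
    by (rule bij_betw_byWitness[where f' = "\<lambda>(x, y). (int x, int y)"]) (auto simp: Z_def K_def)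
  have f: "bij_betw ?f Z {..<k * k}"
    using bij_betw_trans[OF f1 grid_bij[OF k]] by (simp add: comp_def case_prod_unfold)
  define B where "B = {z \<in> Z. ?f z \<in> A}"
  have Bsub: "B \<subseteq> {0..<K} \<times> {0..<K}" by (auto simp: B_def Z_def)
  have inj: "inj_on ?f Z" and img: "?f ` Z = {..<k * k}" using f by (auto simp: bij_betw_def)
  have card_pre: "card {z \<in> Z. ?f z \<in> C} = card C" if "C \<subseteq> {..<k * k}" for C
  proof -
    have "g ` {z \<in> Z. g z \<in> C} = C" if "C \<subseteq> g ` Z" for g :: "int \<times> int \<Rightarrow> nat" using that by auto
    from this[of ?f] have "?f ` {z \<in> Z. ?f z \<in> C} = C" using that img by simp
    moreover have "card (?f ` {z \<in> Z. ?f z \<in> C}) = card {z \<in> Z. ?f z \<in> C}"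
      by (rule card_image, rule inj_on_subset[OF inj]) auto
    ultimately show ?thesis by simp
  qed
  have cB: "card B = card A" unfolding B_def by (rule card_pre[OF A])
  have "{0..<K} \<times> {0..<K} - B = {z \<in> Z. ?f z \<in> {..<k * k} - A}"
    using img unfolding B_def Z_def by blast
  hence cC: "card ({0..<K} \<times> {0..<K} - B) = card ({..<k * k} - A)" using card_pre[of "{..<k * k} - A"] by simp
  have bd: "card {(x, y) \<in> B. (p x y, q x y) \<notin> B} = card {z \<in> A. gen k r z \<notin> A}"
    if pq: "\<And>x y. 0 \<le> x \<Longrightarrow> x < K \<Longrightarrow> 0 \<le> y \<Longrightarrow> y < K \<Longrightarrow>
       0 \<le> p x y \<and> p x y < K \<and> 0 \<le> q x y \<and> q x y < K \<and> ?f (p x y, q x y) = gen k r (?f (x, y))" for p q r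
  proof -
    have "{(x, y) \<in> B. (p x y, q x y) \<notin> B} = {z \<in> Z. ?f z \<in> {z \<in> A. gen k r z \<notin> A}}"
    proof (rule set_eqI, rule prod.induct)
      fix x y
      show "(x, y) \<in> {(x, y) \<in> B. (p x y, q x y) \<notin> B} \<longleftrightarrow> (x, y) \<in> {z \<in> Z. ?f z \<in> {z \<in> A. gen k r z \<notin> A}}"
      proof (cases "(x, y) \<in> Z")
        case True
        with pq[of x y] have "(p x y, q x y) \<in> Z" "?f (p x y, q x y) = gen k r (?f (x, y))" by (auto simp: Z_def)
        thus ?thesis using True by (auto simp: B_def)
      qed (auto simp: B_def)
    qed
    thus ?thesis using card_pre[of "{z \<in> A. gen k r z \<notin> A}"] A by auto
  qed
  have dm: "?f (x, y) div k = nat x \<and> ?f (x, y) mod k = nat y" if "0 \<le> x" "x < K" "0 \<le> y" "y < K" for x y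
    using that by (simp add: K_def nat_less_iff)
  have md: "nat (z mod K) = nat z mod k" if "0 \<le> z" for z using that by (simp add: K_def nat_mod_distrib)
  have "card {(x, y) \<in> B. ((x + y) mod K, y) \<notin> B} = card {z \<in> A. gen k 0 z \<notin> A}"
    by (rule bd) (use dm md K in \<open>auto simp: gen_def nat_add_distrib\<close>)
  moreover have "card {(x, y) \<in> B. (x, (x + y) mod K) \<notin> B} = card {z \<in> A. gen k 1 z \<notin> A}"
    by (rule bd) (use dm md K in \<open>auto simp: gen_def nat_add_distrib\<close>)
  moreover have "card {(x, y) \<in> B. ((x + 1) mod K, y) \<notin> B} = card {z \<in> A. gen k 2 z \<notin> A}"
    by (rule bd) (use dm md K in \<open>auto simp: gen_def nat_add_distrib\<close>)
  moreover have "card {(x, y) \<in> B. (x, (y + 1) mod K) \<notin> B} = card {z \<in> A. gen k 3 z \<notin> A}"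
    by (rule bd) (use dm md K in \<open>auto simp: gen_def nat_add_distrib\<close>)
  ultimately show ?thesis using torus_expansion[OF K Bsub] unfolding cB cC
    by (simp add: numeral_eq_Suc)
qed

text \<open>The inverse maps add k - c instead of subtracting c, as subtraction of natural numbers
  is truncated.\<close>

lemma gen_bij:
  assumes k: "0 < k" shows "bij_betw (gen k r) {..<k * k} {..<k * k}"
proof -
  let ?h = "\<lambda>z. if r = 0 then (z div k + (k - z mod k)) mod k * k + z mod k
     else if r = 1 then z div k * k + (z mod k + (k - z div k)) mod k
     else if r = 2 then (z div k + (k - 1)) mod k * k + z mod k
     else z div k * k + (z mod k + (k - 1)) mod k"
  show ?thesis
  proof (rule bij_betw_finite_inv[where h = ?h])
    fix z assume z: "z \<in> {..<k * k}"
    have xy: "z div k < k" "z mod k < k" using z k by (auto simp: less_mult_imp_div_less)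
    have lt: "a * k + b < k * k" if "a < k" "b < k" for a b
      using bij_betw_apply[OF grid_bij[OF k], of "(a, b)"] that by simp
    show "gen k r z \<in> {..<k * k}" using lt xy k by (simp add: gen_def)
    have m: "(a + c + (k - c)) mod k = a" if "a < k" "c \<le> k" for a c
      using that by simp
    have m': "((a + c) mod k + (k - c)) mod k = a" if "a < k" "c \<le> k" for a c
      using m[OF that] by (simp add: mod_add_left_eq)
    have m1: "((a + 1) mod k + (k - 1)) mod k = a" if "a < k" for a using m'[of a 1] that by simp
    show "?h (gen k r z) = z"
      using m'[of "z div k" "z mod k"] m'[of "z mod k" "z div k"] m1 xy k
      by (simp add: gen_def add.commute)
  qed simp
qed

text \<open>The torus is folded onto the slots by \<open>mod N\<close>. With N \<le> k * k \<le> 2 N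
  each slot receives one or two points, so volumes change by a factor of at most 2.\<close>

definition demands :: "nat \<Rightarrow> nat \<Rightarrow> (nat \<Rightarrow> nat) \<Rightarrow> (nat \<times> nat) list" where
  "demands N k sv = map (\<lambda>t. (sv (t div 4 mod N), sv (gen k (t mod 4) (t div 4) mod N))) [0..<4 * (k * k)]"

lemma sum_upt_four:
  fixes f :: "nat \<Rightarrow> nat"
  shows "(\<Sum>t<4 * q. f t) = (\<Sum>r<4. \<Sum>z<q. f (4 * z + r))"
  by (induction q) (simp_all add: numeral_eq_Suc sum.distrib)

lemma length_filter_demands:
  "length (filter P (demands N k sv)) =
     (\<Sum>r<4. card {z. z < k * k \<and> P (sv (z mod N), sv (gen k r z mod N))})"
proof -
  let ?f = "\<lambda>t. (sv (t div 4 mod N), sv (gen k (t mod 4) (t div 4) mod N))"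
  have "length (filter P (demands N k sv)) = length (filter (\<lambda>t. P (?f t)) [0..<4 * (k * k)])"
    by (simp add: demands_def filter_map comp_def)
  also have "\<dots> = card {t. t < 4 * (k * k) \<and> P (?f t)}"
    by (subst distinct_card[symmetric]) (auto intro: arg_cong[where f = card])
  also have "\<dots> = (\<Sum>t<4 * (k * k). of_bool (P (?f t)))"
    by (simp add: sum_of_bool_eq Int_def)
  also have "\<dots> = (\<Sum>r<4. \<Sum>z<k * k. of_bool (P (?f (4 * z + r))))" by (rule sum_upt_four)
  also have "\<dots> = (\<Sum>r<4. card {z. z < k * k \<and> P (sv (z mod N), sv (gen k r z mod N))})"
    by (intro sum.cong refl) (simp add: sum_of_bool_eq Int_def)
  finally show ?thesis .
qed

context slot_graph begin

lemma card_lift: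
  assumes N: "0 < N" and k: "N \<le> kk" "kk \<le> 2 * N"
  shows "volc Y \<le> card {z. z < kk \<and> sv (z mod N) \<in> Y}" "card {z. z < kk \<and> sv (z mod N) \<in> Y} \<le> 2 * volc Y"
proof -
  have "{s. s < N \<and> sv s \<in> Y} \<subseteq> {z. z < kk \<and> sv (z mod N) \<in> Y}" using k by auto
  thus "volc Y \<le> card {z. z < kk \<and> sv (z mod N) \<in> Y}" unfolding volc_def by (intro card_mono) auto
  let ?S = "{s. s < N \<and> sv s \<in> Y}"
  have "{z. z < kk \<and> sv (z mod N) \<in> Y} \<subseteq> ?S \<union> (\<lambda>s. s + N) ` ?S"
  proof
    fix z assume z: "z \<in> {z. z < kk \<and> sv (z mod N) \<in> Y}"
    show "z \<in> ?S \<union> (\<lambda>s. s + N) ` ?S"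
    proof (cases "z < N")
      case False
      hence "z mod N = z - N" "z - N < N" using z k by (auto simp: mod_if)
      moreover have "z = (z - N) + N" using False by simp
      ultimately show ?thesis using z by (intro UnI2 image_eqI[of _ _ "z - N"]) auto
    qed (use z in simp)
  qed
  hence "card {z. z < kk \<and> sv (z mod N) \<in> Y} \<le> card (?S \<union> (\<lambda>s. s + N) ` ?S)" by (intro card_mono) auto
  also have "\<dots> \<le> card ?S + card ((\<lambda>s. s + N) ` ?S)" by (rule card_Un_le)
  also have "\<dots> \<le> 2 * volc Y" using card_image_le[of ?S "\<lambda>s. s + N"] by (simp add: volc_def)
  finally show "card {z. z < kk \<and> sv (z mod N) \<in> Y} \<le> 2 * volc Y" .
qed

text \<open>The factor 16 is 4 maps times 2 ends times at most 2 points per slot, and each map is a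
  bijection.\<close>

lemma demands_touch:
  assumes "0 < N" "N \<le> k * k" "k * k \<le> 2 * N" "0 < k"
  shows "length (filter (\<lambda>(u, v). u \<in> Y \<or> v \<in> Y) (demands N k sv)) \<le> 16 * volc Y"
proof -
  let ?C = "{z. z < k * k \<and> sv (z mod N) \<in> Y}"
  have "card {z. z < k * k \<and> (sv (z mod N) \<in> Y \<or> sv (gen k r z mod N) \<in> Y)} \<le> 4 * volc Y" for r
  proof -
    have b: "gen k r ` {..<k * k} = {..<k * k}" "inj_on (gen k r) {..<k * k}"
      using gen_bij[OF assms(4)] by (auto simp: bij_betw_def)
    have "card {z. z < k * k \<and> sv (gen k r z mod N) \<in> Y} = card (gen k r ` {z. z < k * k \<and> sv (gen k r z mod N) \<in> Y})"
      by (rule card_image[symmetric], rule inj_on_subset[OF b(2)]) auto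
    also have "\<dots> \<le> card ?C" using b(1) by (intro card_mono) auto
    finally have 1: "card {z. z < k * k \<and> sv (gen k r z mod N) \<in> Y} \<le> card ?C" .
    have "{z. z < k * k \<and> (sv (z mod N) \<in> Y \<or> sv (gen k r z mod N) \<in> Y)}
       = ?C \<union> {z. z < k * k \<and> sv (gen k r z mod N) \<in> Y}" by auto
    with card_Un_le[of ?C "{z. z < k * k \<and> sv (gen k r z mod N) \<in> Y}"] 1 card_lift(2)[OF assms(1-3), of Y]
    show ?thesis by simp
  qed
  hence "(\<Sum>r<4. card {z. z < k * k \<and> (sv (z mod N) \<in> Y \<or> sv (gen k r z mod N) \<in> Y)}) \<le> (\<Sum>r<4::nat. 4 * volc Y)"
    by (intro sum_mono)
  thus ?thesis unfolding length_filter_demands by simp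
qed

text \<open>Pulled back to the torus, neither side of X gets smaller, so the expansion of the torus
  carries over with the same constant.\<close>

lemma demands_expansion:
  assumes "0 < N" "N \<le> k * k" "k * k \<le> 2 * N" "0 < k"
  shows "real (min (volc X) (volc (- X))) \<le> 132 * real (length (filter (\<lambda>(u, v). u \<in> X \<longleftrightarrow> v \<notin> X) (demands N k sv)))"
proof -
  define A where "A = {z. z < k * k \<and> sv (z mod N) \<in> X}"
  have A: "A \<subseteq> {..<k * k}" by (auto simp: A_def)
  have e: "{..<k * k} - A = {z. z < k * k \<and> sv (z mod N) \<in> - X}" by (auto simp: A_def)
  have "volc X \<le> card A" unfolding A_def by (rule card_lift(1)[OF assms(1-3)])
  moreover have "volc (- X) \<le> card ({..<k * k} - A)" unfolding e by (rule card_lift(1)[OF assms(1-3)])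
  ultimately have "min (volc X) (volc (- X)) \<le> min (card A) (card ({..<k * k} - A))" by (rule min.mono)
  hence "real (min (volc X) (volc (- X))) \<le> real (min (card A) (card ({..<k * k} - A)))" by (rule of_nat_mono)
  also have "\<dots> \<le> 132 * (\<Sum>r<4. real (card {z \<in> A. gen k r z \<notin> A}))" by (rule grid_expansion[OF assms(4) A])
  also have "\<dots> \<le> 132 * real (\<Sum>r<4. card {z. z < k * k \<and> (sv (z mod N) \<in> X \<longleftrightarrow> sv (gen k r z mod N) \<notin> X)})"
  proof -
    have "card {z \<in> A. gen k r z \<notin> A} \<le> card {z. z < k * k \<and> (sv (z mod N) \<in> X \<longleftrightarrow> sv (gen k r z mod N) \<notin> X)}" for r
      using bij_betw_apply[OF gen_bij[OF assms(4)], of _ r] by (intro card_mono) (auto simp: A_def)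
    hence "(\<Sum>r<4. card {z \<in> A. gen k r z \<notin> A})
      \<le> (\<Sum>r<4. card {z. z < k * k \<and> (sv (z mod N) \<in> X \<longleftrightarrow> sv (gen k r z mod N) \<notin> X)})" by (intro sum_mono)
    hence "real (\<Sum>r<4. card {z \<in> A. gen k r z \<notin> A})
      \<le> real (\<Sum>r<4. card {z. z < k * k \<and> (sv (z mod N) \<in> X \<longleftrightarrow> sv (gen k r z mod N) \<notin> X)})" by (rule of_nat_mono)
    thus ?thesis by simp
  qed
  also have "(\<Sum>r<4. card {z. z < k * k \<and> (sv (z mod N) \<in> X \<longleftrightarrow> sv (gen k r z mod N) \<notin> X)})
    = length (filter (\<lambda>(u, v). u \<in> X \<longleftrightarrow> v \<notin> X) (demands N k sv))" by (simp add: length_filter_demands)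
  finally show ?thesis .
qed

end

section \<open>The levels\<close>

text \<open>The levels end with the first p for which 8 p b > 1. This p is still at most 1 / (4 b),
  so a side of volume N / (4 p) is balanced enough.\<close>

definition loop_prog :: com where
  "loop_prog =
     While (ILess (K 0) (V 12))
       (level_prog;;
        Cond (ILess (IMul (K 4) (V 3)) (IMul (V 11) (V 8)))
          (cut_prog;; IAssign 12 (K 0))
          (Cond (RLess (ROfInt (K 1)) (RMul (ROfInt (IMul (K 8) (V 8))) (RVar 2)))
             (IAssign 12 (K 0);; IAssign 0 (K 0))
             (IAssign 8 (IMul (K 2) (V 8)))))"

lemma sum_lessThan_add:
  fixes f :: "nat \<Rightarrow> 'a::comm_monoid_add"
  shows "(\<Sum>s<m + q. f s) = (\<Sum>s<m. f s) + (\<Sum>e<q. f (m + e))"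
  by (induction q) (simp_all add: add.assoc)

text \<open>\<open>Jm\<close> is the number of levels. A level routes at most 8 N / p pairs at a
  price of at most \<alpha> \<open>Lb\<close> p each; \<open>kap\<close> is chosen such that all
  levels together pay at most \<kappa> N.\<close>

locale run = routing_env n m sv so eid E D Wd \<alpha> \<kappa> N \<phi> b Lb hd nx
  for n m sv so eid E D Wd \<alpha> \<kappa> N \<phi> b Lb hd nx +
  fixes adj :: "nat \<Rightarrow> nat list" and k l Jm :: nat
  assumes m1: "1 \<le> m"
    and slots: "e < m \<Longrightarrow> sv (m + e) = so e" "e < m \<Longrightarrow> so (m + e) = sv e"
    and adj: "chain nx (hd v) (adj v)" "set (adj v) = {s. s < N \<and> sv s = v}" "distinct (adj v)"
    and k: "0 < k" "N \<le> k * k" "k * k \<le> 2 * N"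
    and l: "4 * N \<le> 2 ^ l" and phi: "0 < \<phi>" "\<phi> \<le> 1"
    and Lb: "Lb = 126 * real l / \<phi>" and kap: "\<kappa> = 8 * \<alpha> * Lb * real Jm"
    and b: "0 < b" "4 * 2 ^ (Jm - 1) * b \<le> 1" "1 < 8 * 2 ^ (Jm - 1) * b" "1 \<le> Jm"
    and big: "8 * (N + 1) * (2 ^ (Jm - 1) + 1) \<le> Wd"
begin

definition pt :: "nat \<Rightarrow> nat" where "pt s = (if s < m then m + s else s - m)"

lemma slot_cases:
  assumes "s < N" obtains e where "e < m" "s = e" "pt s = m + e" | e where "e < m" "s = m + e" "pt s = e"
proof (cases "s < m")
  case False
  with assms that(2)[of "s - m"] show ?thesis by (simp add: pt_def N)
qed (use that(1) in \<open>simp add: pt_def\<close>)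

lemma slot_graph_w:
  assumes "\<And>e. e < m \<Longrightarrow> 1 \<le> w e" shows "slot_graph N sv so (\<lambda>s. w (s mod m)) pt"
proof
  fix s assume s: "s < N"
  have "pt s < N \<and> pt (pt s) = s \<and> pt s \<noteq> s \<and> sv (pt s) = so s \<and> so (pt s) = sv s \<and>
    w (pt s mod m) = w (s mod m) \<and> so s \<noteq> sv s \<and> 1 \<le> w (s mod m)"
    using s
  proof (cases rule: slot_cases)
    case (1 e)
    thus ?thesis using assms slots ends(3)[of e] m1 by (auto simp: N pt_def)
  next
    case (2 e)
    thus ?thesis using assms slots ends(3)[of e] m1 by (auto simp: N pt_def)
  qed
  thus "pt s < N" "pt (pt s) = s" "pt s \<noteq> s" "sv (pt s) = so s" "so (pt s) = sv s"
    "w (pt s mod m) = w (s mod m)" "so s \<noteq> sv s" "1 \<le> w (s mod m)" by auto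
qed

text \<open>Volumes and cuts do not depend on the weights, so unit weights serve for stating results
  while the weights evolve.\<close>

sublocale sg: slot_graph N sv so "\<lambda>s. (\<lambda>_. 1) (s mod m)" pt
  by (rule slot_graph_w) simp

lemma sum_slots: "(\<Sum>s<N. w (s mod m)) = 2 * (\<Sum>e<m. w e)" for w :: "nat \<Rightarrow> nat"
proof -
  have "(\<Sum>s<m + m. w (s mod m)) = (\<Sum>s<m. w (s mod m)) + (\<Sum>e<m. w ((m + e) mod m))" by (rule sum_lessThan_add)
  also have "(\<Sum>s<m. w (s mod m)) = (\<Sum>e<m. w e)" by (intro sum.cong) auto
  also have "(\<Sum>e<m. w ((m + e) mod m)) = (\<Sum>e<m. w e)" by (intro sum.cong) auto
  finally show ?thesis by (simp add: N mult_2)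
qed

text \<open>A crossing edge has exactly one of its two slots on the side of X.\<close>

lemma cutc_cutI: "sg.cutc X = card (cutI X)"
proof -
  have "bij_betw (\<lambda>s. s mod m) {s. s < N \<and> sv s \<in> X \<and> so s \<notin> X} (cutI X)"
  proof (rule bij_betw_byWitness[where f' = "\<lambda>e. if sv e \<in> X then e else m + e"])
    show "\<forall>s\<in>{s. s < N \<and> sv s \<in> X \<and> so s \<notin> X}. (if sv (s mod m) \<in> X then s mod m else m + s mod m) = s"
    proof
      fix s assume s: "s \<in> {s. s < N \<and> sv s \<in> X \<and> so s \<notin> X}"
      hence "s < N" by simp
      thus "(if sv (s mod m) \<in> X then s mod m else m + s mod m) = s"
        by (cases rule: slot_cases) (use s slots in auto)
    qed
    show "(\<lambda>s. s mod m) ` {s. s < N \<and> sv s \<in> X \<and> so s \<notin> X} \<subseteq> cutI X"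
    proof (rule image_subsetI)
      fix s assume s: "s \<in> {s. s < N \<and> sv s \<in> X \<and> so s \<notin> X}"
      hence "s < N" by simp
      thus "s mod m \<in> cutI X" by (cases rule: slot_cases) (use s slots in \<open>auto simp: cutI_def\<close>)
    qed
  qed (auto simp: cutI_def N slots)
  thus ?thesis unfolding sg.cutc_def by (rule bij_betw_same_card)
qed

lemma sv_n: "s < N \<Longrightarrow> sv s < n"
  by (erule slot_cases) (use ends slots in auto)

lemma pathw_append:
  assumes "P \<noteq> []" shows "pathw w (P @ [y]) = pathw w P + real (w (eid (last P * n + y)))"
proof -
  obtain q where q: "length P = Suc q" using assms by (cases P) auto
  have "eix (P @ [y]) t = eix P t" if "t < q" for t using that q by (simp add: eix_def nth_append)
  moreover have "eix (P @ [y]) q = eid (last P * n + y)"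
    using q assms by (simp add: eix_def nth_append last_conv_nth)
  ultimately show ?thesis by (simp add: pathw_def q)
qed

lemma pathw_take: "pathw w (take j P) \<le> pathw w P"
proof -
  have "pathw w (take j P) = (\<Sum>t<length (take j P) - 1. real (w (eix P t)))"
    unfolding pathw_def by (intro sum.cong refl) (auto simp: eix_def)
  also have "\<dots> \<le> pathw w P" unfolding pathw_def by (intro sum_mono2) auto
  finally show ?thesis .
qed

text \<open>Paths need distinct vertices. When the walk returns to the path, the path is cut back to
  that vertex, which can only lower its weight.\<close>

lemma reach_path:
  assumes "reach N sv so (\<lambda>s. w (s mod m)) u x d" "u < n"
  shows "\<exists>P. is_path gr u x P \<and> pathw w P \<le> real d"
  using assms(1)
proof induction
  case (start d)
  have "is_path gr u u [u]" using assms(2) by (simp add: is_path_def gr_def)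
  moreover have "pathw w [u] \<le> real d" by (simp add: pathw_def)
  ultimately show ?case by blast
next
  case (step s d d')
  then obtain P where P: "is_path gr u (sv s) P" "pathw w P \<le> real d" by blast
  have Pn: "P \<noteq> []" "list.hd P = u" "last P = sv s" "distinct P" "set P \<subseteq> {..<n}"
    "\<And>i. Suc i < length P \<Longrightarrow> {P ! i, P ! Suc i} \<in> E" using P(1) by (simp_all add: is_path_def gr_def)
  show ?case
  proof (cases "so s \<in> set P")
    case True
    then obtain j where j: "j < length P" "P ! j = so s" by (auto simp: in_set_conv_nth)
    have "last (take (Suc j) P) = so s" using j by (simp add: take_Suc_conv_app_nth)
    moreover have "list.hd (take (Suc j) P) = u" using Pn by (cases P) auto
    ultimately have "is_path gr u (so s) (take (Suc j) P)"
      unfolding is_path_def gr_def using Pn by (auto dest: in_set_takeD)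
    moreover have "pathw w (take (Suc j) P) \<le> real d'"
      using pathw_take[of w "Suc j" P] P(2) step.hyps by linarith
    ultimately show ?thesis by blast
  next
    case False
    have e: "{sv s, so s} \<in> E \<and> eid (sv s * n + so s) = s mod m \<and> so s < n"
      using step.hyps(2) by (cases rule: slot_cases) (use E eid ends slots in \<open>auto simp: insert_commute\<close>)
    have edges: "{(P @ [so s]) ! i, (P @ [so s]) ! Suc i} \<in> E" if i: "Suc i < length (P @ [so s])" for i
    proof (cases "Suc i < length P")
      case True
      thus ?thesis using Pn(6) by (simp add: nth_append)
    next
      case False
      hence "i = length P - 1" using i by simp
      moreover have "P ! (length P - 1) = sv s" using Pn(1,3) by (simp add: last_conv_nth)
      ultimately show ?thesis using Pn(1) e by (simp add: nth_append)
    qed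
    have "is_path gr u (so s) (P @ [so s])"
      unfolding is_path_def gr_def
    proof (intro conjI allI impI)
      fix i assume "Suc i < length (P @ [so s])"
      thus "{(P @ [so s]) ! i, (P @ [so s]) ! Suc i} \<in> edges \<lparr>nverts = n, edges = E, wt = \<lambda>_. 0\<rparr>"
        using edges by simp
    qed (use Pn False e in simp_all)
    moreover have "pathw w (P @ [so s]) \<le> real d'"
      using pathw_append[OF Pn(1), of w "so s"] e P(2) step.hyps(3) Pn(3) by simp
    ultimately show ?thesis by blast
  qed
qed

section \<open>What the certificate asserts and why it is correct\<close>

abbreviation "L0 \<equiv> demands N k sv"

lemma N_pos: "2 \<le> N" using m1 N by simp

lemma length_L0: "length L0 = 4 * (k * k)" by (simp add: demands_def)

lemma L0_n: "(u, v) \<in> set L0 \<Longrightarrow> u < n \<and> v < n"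
  using N_pos by (auto simp: demands_def intro!: sv_n)

text \<open>A path of the last level weighs at most \<alpha> \<open>Lb\<close> 2^(\<open>Jm\<close>
  - 1), and an edge that it doubles ends up with at most twice this weight.\<close>

definition Bw :: real where "Bw = 2 * (\<alpha> * Lb * 2 ^ (Jm - 1))"

text \<open>\<Lambda> is any bound for the logarithm of a possible weight plus 1. Weights obey the
  two limits \<open>Bw\<close> and N + 1, from which the two forms of the conductance bound in the
  theorem arise.\<close>

definition cert :: bool where
  "cert \<longleftrightarrow> (\<forall>X \<Lambda>. 8448 * b * real N \<le> real (sg.volc X) \<and> 8448 * b * real N \<le> real (sg.volc (- X)) \<and>
     (\<forall>g. 2 ^ g \<le> Bw \<and> 2 ^ g \<le> N + 1 \<longrightarrow> real g + 1 \<le> \<Lambda>) \<longrightarrow>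
     real (min (sg.volc X) (sg.volc (- X))) \<le> 528 * \<kappa> * \<Lambda> * real (sg.cutc X))"

definition sgood :: "nat set \<Rightarrow> bool" where
  "sgood S \<longleftrightarrow> b * real N \<le> real (sg.volc S) \<and> b * real N \<le> real (sg.volc (- S)) \<and>
     real (sg.cutc S) \<le> \<phi> * real (sg.volc S) \<and> real (sg.cutc S) \<le> \<phi> * real (sg.volc (- S))"

definition res :: "mstate \<Rightarrow> bool" where
  "res s \<longleftrightarrow> (if ivar s 0 = 0 then cert
     else \<exists>S. sgood S \<and> (\<forall>s'<N. iarr s 0 (sv s') = 1 \<longleftrightarrow> sv s' \<in> S))"

lemma l1: "1 \<le> l" using l N_pos by (cases l) auto

lemma Lb_ge: "126 \<le> Lb"
proof -
  have "126 * 1 \<le> 126 * real l" using l1 by simp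
  also have "\<dots> \<le> Lb" unfolding Lb using phi l1 by (simp add: field_simps mult_le_cancel_left1)
  finally show ?thesis by simp
qed

lemma aLb: "126 \<le> \<alpha> * Lb"
proof -
  have "1 * 126 \<le> \<alpha> * Lb" using alpha Lb_ge by (intro mult_mono) auto
  thus ?thesis by simp
qed

text \<open>Let M be the smaller volume. X separates at least M / 132 pairs, and at most 32 b N
  pairs are unrouted. As M \<ge> 8448 b N with 8448 = 2 * 132 * 32, at least half of the separated
  pairs were routed across the cut, and each edge carries at most 2 \<kappa> \<Lambda> of
  them.\<close>

lemma certI:
  assumes inv: "winv Bw w lg cnt" "zpot w cnt \<le> \<kappa> * real N"
    and sep: "\<And>X. real (sepc X L0) \<le> real (sepc X L) + (\<Sum>e\<in>cutI X. ub lg cnt e)"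
    and R: "length L * p \<le> 4 * N" "1 < 8 * real p * b"
  shows cert
  unfolding cert_def
proof (intro allI impI, elim conjE)
  fix X \<Lambda>
  assume v: "8448 * b * real N \<le> real (sg.volc X)" "8448 * b * real N \<le> real (sg.volc (- X))"
    and \<Lambda>: "\<forall>g. 2 ^ g \<le> Bw \<and> 2 ^ g \<le> N + 1 \<longrightarrow> real g + 1 \<le> \<Lambda>"
  let ?M = "real (min (sg.volc X) (sg.volc (- X)))"
  have M: "8448 * (b * real N) \<le> ?M" using v by (simp add: mult.assoc)
  have h: "?M \<le> 132 * real (sepc X L0)"
    unfolding sepc_def by (rule sg.demands_expansion) (use N_pos k in auto)
  have p: "0 < real p" using R(2) b(1) by (simp add: zero_less_mult_iff) (metis gr0I mult_eq_0_iff of_nat_0 not_one_less_zero)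
  have "real (length L) \<le> 32 * (b * real N)"
  proof -
    have "real (length L * p) \<le> real (4 * N)" using R(1) by (rule of_nat_mono)
    also have "\<dots> = 4 * real N * 1" by simp
    also have "\<dots> \<le> 4 * real N * (8 * real p * b)" using R(2) by (intro mult_left_mono) auto
    finally have "real p * real (length L) \<le> real p * (32 * (b * real N))" by (simp add: mult_ac)
    thus ?thesis using p by (simp add: mult_le_cancel_left)
  qed
  moreover have "sepc X L \<le> length L" unfolding sepc_def by (rule length_filter_le)
  ultimately have sL: "real (sepc X L) \<le> 32 * (b * real N)" by linarith
  have "(\<Sum>e\<in>cutI X. ub lg cnt e) \<le> (\<Sum>e\<in>cutI X. 2 * \<kappa> * \<Lambda>)"
  proof (rule sum_mono)
    fix e assume "e \<in> cutI X"
    hence e: "e < m" by (simp add: cutI_def)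
    have w: "w e = 2 ^ lg e" "real (cnt e) < \<kappa>" "real (w e) \<le> Bw" using inv(1) e unfolding winv_def by auto
    have "w e \<le> N + 1" by (rule zpot_bound(1)[OF inv e])
    hence "real (lg e) + 1 \<le> \<Lambda>" using \<Lambda> w by simp
    moreover have "ub lg cnt e \<le> 2 * \<kappa> * (real (lg e) + 1)"
    proof -
      have "(\<kappa> + 1) * real (lg e) \<le> (2 * \<kappa>) * real (lg e)" using kappa by (intro mult_right_mono) auto
      thus ?thesis using w(2) kappa unfolding ub_def by (simp add: algebra_simps)
    qed
    moreover have "2 * \<kappa> * (real (lg e) + 1) \<le> 2 * \<kappa> * \<Lambda>" using calculation(1) kappa by (intro mult_left_mono) auto
    ultimately show "ub lg cnt e \<le> 2 * \<kappa> * \<Lambda>" by simp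
  qed
  also have "\<dots> = real (sg.cutc X) * (2 * \<kappa> * \<Lambda>)" by (simp add: cutc_cutI)
  finally have "real (sepc X L0) \<le> 32 * (b * real N) + real (sg.cutc X) * (2 * \<kappa> * \<Lambda>)"
    using sep[of X] sL by linarith
  with h M have "?M \<le> 264 * (real (sg.cutc X) * (2 * \<kappa> * \<Lambda>))" by linarith
  thus "?M \<le> 528 * \<kappa> * \<Lambda> * real (sg.cutc X)" by (simp add: mult_ac)
qed

text \<open>Supplies \<open>far\<close>. A set of small diameter contains both ends of no remaining
  pair, so all of these more than 4 N / p pairs touch its complement, where every slot accounts for
  at most 16 pairs.\<close>

lemma wp_cut_level:
  assumes pre: "renv p s" "wst w lg cnt s" and inv: "winv Bw w lg cnt" "zpot w cnt \<le> \<kappa> * real N"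
    and p: "p = 2 ^ j" "j \<le> Jm - 1" and R: "4 * N < length L * p"
    and far: "\<And>u v. (u, v) \<in> set L \<Longrightarrow> u < n \<and> v < n \<and> farp w u v (Lb * real p)"
    and sub: "\<And>P. length (filter P L) \<le> length (filter P L0)"
    and T: "135 * real N \<le> T" "0 \<le> q"
    and post: "\<And>s' T' S. \<lbrakk>ivar s' 0 \<noteq> 0; sgood S; \<And>s. s < N \<Longrightarrow> iarr s' 0 (sv s) = 1 \<longleftrightarrow> sv s \<in> S; T - 135 * real N \<le> T'\<rbrakk> \<Longrightarrow> Q s' T' q"
  shows "wp D Wd cut_prog Q s T q"
proof -
  have w1: "1 \<le> w e" if "e < m" for e using inv(1) that unfolding winv_def by simp
  interpret g: slot_graph N sv so "\<lambda>s. w (s mod m)" pt by (rule slot_graph_w[OF w1])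
  have pJ: "p \<le> 2 ^ (Jm - 1)" unfolding p(1) using p(2) by (intro power_increasing) auto
  have W: "8 * (N + 1) * (p + 1) \<le> Wd"
  proof -
    have "8 * (N + 1) * (p + 1) \<le> 8 * (N + 1) * (2 ^ (Jm - 1) + 1)" using pJ by (intro mult_left_mono) auto
    thus ?thesis using big by (rule order.trans)
  qed
  interpret c: cut_phase_goal N sv so "\<lambda>s. w (s mod m)" pt D Wd m p hd nx w adj \<phi> l b
  proof
    show "sv s \<le> Wd" if "s < N" for s using sv_n[OF that] Wd by simp
    show "(\<Sum>s<N. w (s mod m)) \<le> 3 * N" using zpot_bound(2)[OF inv, of 0] m1 N unfolding sum_slots by simp
    show "b * (4 * real p) \<le> 1"
    proof -
      have "4 * real p * b \<le> 4 * 2 ^ (Jm - 1) * b"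
      proof (intro mult_right_mono mult_left_mono)
        have "real p \<le> real (2 ^ (Jm - 1))" using pJ by (rule of_nat_mono)
        thus "real p \<le> 2 ^ (Jm - 1)" by simp
      qed (use b in auto)
      thus ?thesis using b(2) by (simp add: mult_ac)
    qed
    fix B d
    assume B: "\<And>x y. x \<in> B \<Longrightarrow> y \<in> B \<Longrightarrow> g.rch x y d" and d: "real d \<le> 126 * real l * real p / \<phi>"
    have dL: "real d \<le> Lb * real p" using d by (simp add: Lb)
    have "u \<in> - B \<or> v \<in> - B" if "(u, v) \<in> set L" for u v
    proof (rule ccontr)
      assume "\<not> (u \<in> - B \<or> v \<in> - B)"
      hence "g.rch u v d" using B by simp
      from reach_path[OF this] far[OF that] obtain P where "is_path gr u v P" "pathw w P \<le> real d" by blast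
      with far[OF that] dL show False unfolding farp_def by fastforce
    qed
    hence "filter (\<lambda>(u, v). u \<in> - B \<or> v \<in> - B) L = L" by (intro filter_True) auto
    hence "length L \<le> length (filter (\<lambda>(u, v). u \<in> - B \<or> v \<in> - B) L0)" using sub by metis
    also have "\<dots> \<le> 16 * g.volc (- B)" by (rule g.demands_touch) (use N_pos k in auto)
    finally have "length L * p \<le> 16 * g.volc (- B) * p" by (intro mult_right_mono) auto
    moreover have "16 * g.volc (- B) * p = 4 * (4 * p * g.volc (- B))" by simp
    ultimately show "N \<le> 4 * p * g.volc (- B)" using R by linarith
  qed (use adj W phi l b N_pos p in auto)
  show ?thesis
  proof (rule c.wp_cut[OF _ _ _ T])
    show "c.env s" "iarr s 13 = (\<lambda>_. 0)" "iarr s 14 = (\<lambda>_. 0)"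
      using pre by (simp_all add: c.env_def renv_def wst_def)
  next
    fix s' :: mstate and T' S
    assume "ivar s' 0 \<noteq> 0" "c.good S" "\<And>s. s < N \<Longrightarrow> (iarr s' 0 (sv s) = 1) = (sv s \<in> S)" "T - 135 * real N \<le> T'"
    thus "Q s' T' q" by (intro post[of s' S]) (auto simp: c.good_def sgood_def)
  qed
qed

text \<open>At most 8 N / p pairs take at most 17 + 10 X \<le> 11 X time each, where X is the length
  limit \<alpha> \<open>Lb\<close> p; 88 = 8 * 11.\<close>

definition level_cost :: real where "level_cost = 10 + 88 * real N * (\<alpha> * Lb)"

text \<open>A level makes two queries for each of at most 8 N / p pairs. The invariant 32 N \<le> q
  2^j keeps the rest of the series 16 N + 8 N + ... available.\<close>

lemma wp_loop:
  assumes pre: "renv 1 s" "wst w0 (\<lambda>_. 0) (\<lambda>_. 0) s" "lst L0 s" and w0: "\<And>e. e < m \<Longrightarrow> w0 e = 1"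
    and T: "3 + real Jm * level_cost + 135 * real N \<le> T" "32 * real N \<le> q"
    and post: "\<And>s' T' q'. res s' \<Longrightarrow> Q s' T' q'"
  shows "wp D Wd loop_prog Q s T q"
proof -
  define J where "J = (\<lambda>j L w lg cnt (s :: mstate) T' q'. j \<le> Jm - 1 \<and> renv (2 ^ j) s \<and> wst w lg cnt s \<and> lst L s \<and> winv Bw w lg cnt \<and>
     length L * 2 ^ j \<le> 8 * N \<and> zpot w cnt \<le> real j * (8 * real N * (\<alpha> * Lb)) \<and> (\<forall>e. cnt e + length L \<le> 8 * N) \<and>
     (\<forall>P. length (filter P L) \<le> length (filter P L0)) \<and> (\<forall>u v. (u, v) \<in> set L \<longrightarrow> u < n \<and> v < n) \<and>
     (\<forall>X. real (sepc X L0) \<le> real (sepc X L) + (\<Sum>e\<in>cutI X. ub lg cnt e)) \<and>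
     3 + real (Jm - j) * level_cost + 135 * real N \<le> T' \<and> 32 * real N \<le> q' * 2 ^ j)"
  define I where "I = (\<lambda>s T' q'. (\<exists>j L w lg cnt. J j L w lg cnt s T' q') \<or> ivar s 12 = 0 \<and> res s \<and> 1 \<le> T' \<and> 0 \<le> q')"
  have lc: "0 \<le> level_cost" using aLb by (simp add: level_cost_def)
  have aL0: "0 \<le> 8 * real N * (\<alpha> * Lb)" using aLb by simp
  have WN: "8 * N < Wd"
  proof -
    have "8 * (N + 1) * 1 \<le> 8 * (N + 1) * (2 ^ (Jm - 1) + 1)" by (intro mult_left_mono) auto
    thus ?thesis using big by simp
  qed
  have BwX: "2 * (\<alpha> * Lb * real (2 ^ j)) \<le> Bw" if "j \<le> Jm - 1" for j
  proof -
    have "(2::real) ^ j \<le> 2 ^ (Jm - 1)" using that by (intro power_increasing) auto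
    thus ?thesis unfolding Bw_def using aLb by (intro mult_left_mono) auto
  qed
  show ?thesis unfolding loop_prog_def
  proof (rule wp_While[where I = I])
    have "1 \<le> Bw" using BwX[of 0] aLb by simp
    hence "winv Bw w0 (\<lambda>_. 0) (\<lambda>_. 0)" using kappa w0 by (simp add: winv_def)
    moreover have "length L0 \<le> 8 * N" using k by (simp add: length_L0)
    moreover have "zpot w0 (\<lambda>_. 0) = 0" using w0 by (simp add: zpot_def)
    moreover have "(\<Sum>e\<in>cutI X. ub (\<lambda>_. 0) (\<lambda>_. 0) e) = 0" for X by (simp add: ub_def)
    ultimately have "J 0 L0 w0 (\<lambda>_. 0) (\<lambda>_. 0) s T q" unfolding J_def using pre T L0_n by simp
    thus "I s T q" unfolding I_def by blast
  next
    fix s T' q' assume "I s T' q'" and b12: "beval (ILess (K 0) (V 12)) s"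
    then obtain j L w lg cnt where JJ: "J j L w lg cnt s T' q'" unfolding I_def by auto
    from JJ have j: "j \<le> Jm - 1" "renv (2 ^ j) s" "wst w lg cnt s" "lst L s" "winv Bw w lg cnt"
      "length L * 2 ^ j \<le> 8 * N" "zpot w cnt \<le> real j * (8 * real N * (\<alpha> * Lb))" "\<And>e. cnt e + length L \<le> 8 * N"
      "\<And>P. length (filter P L) \<le> length (filter P L0)" "\<And>u v. (u, v) \<in> set L \<Longrightarrow> u < n \<and> v < n"
      "\<And>X. real (sepc X L0) \<le> real (sepc X L) + (\<Sum>e\<in>cutI X. ub lg cnt e)"
      "3 + real (Jm - j) * level_cost + 135 * real N \<le> T'" "32 * real N \<le> q' * 2 ^ j"
      unfolding J_def by blast+
    define X where "X = \<alpha> * Lb * real (2 ^ j)"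
    have lX: "real (length L) * X \<le> 8 * real N * (\<alpha> * Lb)"
    proof -
      have "real (length L * 2 ^ j) \<le> real (8 * N)" using j(6) by (rule of_nat_mono)
      hence "real (length L * 2 ^ j) * (\<alpha> * Lb) \<le> 8 * real N * (\<alpha> * Lb)" using aLb by (intro mult_right_mono) auto
      thus ?thesis by (simp add: X_def mult_ac)
    qed
    have X17: "17 \<le> X"
    proof -
      have "(\<alpha> * Lb) * 1 \<le> \<alpha> * Lb * real (2 ^ j)" using aLb by (intro mult_left_mono) auto
      thus ?thesis using aLb by (simp add: X_def)
    qed
    have cost: "4 + real (length L) * (17 + 10 * X) + 6 \<le> level_cost"
    proof -
      have "real (length L) * (17 + 10 * X) \<le> real (length L) * (11 * X)" using X17 by (intro mult_left_mono) auto
      thus ?thesis using lX by (simp add: level_cost_def)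
    qed
    have zN: "real (Suc j) * (8 * real N * (\<alpha> * Lb)) \<le> \<kappa> * real N"
    proof -
      have "real (Suc j) \<le> real Jm" using j(1) b(4) by linarith
      hence "real (Suc j) * (8 * real N * (\<alpha> * Lb)) \<le> real Jm * (8 * real N * (\<alpha> * Lb))"
        using aL0 by (intro mult_right_mono) auto
      thus ?thesis by (simp add: kap mult_ac)
    qed
    have q2: "2 * real (length L) + 16 * real N / 2 ^ j \<le> q'"
    proof -
      have "real (length L * 2 ^ j) \<le> real (8 * N)" using j(6) by (rule of_nat_mono)
      hence "real (length L) \<le> 8 * real N / 2 ^ j" by (simp add: field_simps)
      moreover have "32 * real N / 2 ^ j \<le> q'" using j(13) by (simp add: field_simps)
      moreover have "32 * real N / 2 ^ j = 2 * (8 * real N / 2 ^ j) + 16 * real N / 2 ^ j" by simp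
      ultimately show ?thesis by linarith
    qed
    have Jj: "real (Jm - j) = real (Jm - Suc j) + 1" using j(1) b(4) by linarith
    have T1: "3 + real (Jm - Suc j) * level_cost + 135 * real N + level_cost \<le> T'"
      using j(12) unfolding Jj by (simp add: algebra_simps)
    have p0: "0 \<le> real (Jm - Suc j) * level_cost" using lc by simp
    let ?c1 = "cut_prog;; IAssign 12 (K 0)"
    let ?c2 = "Cond (RLess (ROfInt (K 1)) (RMul (ROfInt (IMul (K 8) (V 8))) (RVar 2)))
             (IAssign 12 (K 0);; IAssign 0 (K 0)) (IAssign 8 (IMul (K 2) (V 8)))"
    let ?c = "Cond (ILess (IMul (K 4) (V 3)) (IMul (V 11) (V 8))) ?c1 ?c2"
    have "wp D Wd (level_prog;; ?c) I s (T' - 1) q'" unfolding wp_Seq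
    proof (rule wp_level[OF j(2,3,4,5) j(10) _ _ _ _ j(8) WN _ _ j(11)])
      show "X = \<alpha> * Lb * real (2 ^ j)" by (simp add: X_def)
      show "0 \<le> Lb" using Lb_ge by simp
      show "2 * X \<le> Bw" unfolding X_def by (rule BwX[OF j(1)])
      show "zpot w cnt + real (length L) * X \<le> \<kappa> * real N" using j(7) lX zN by (simp add: algebra_simps)
      show "4 + real (length L) * (17 + 10 * X) \<le> T' - 1" using T1 cost p0 by simp
      have "0 \<le> 16 * real N / 2 ^ j" by simp
      thus "2 * real (length L) \<le> q'" using q2 by linarith
    next
      fix s' T'' q'' w' lg' cnt' L'
      assume r: "renv (2 ^ j) s'" "wst w' lg' cnt' s'" "lst L' s'" "winv Bw w' lg' cnt'"
        "zpot w' cnt' \<le> zpot w cnt + real (length L) * X"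
        "\<And>u v. (u, v) \<in> set L' \<Longrightarrow> u < n \<and> v < n \<and> farp w' u v (Lb * real (2 ^ j))"
        "\<And>P. length (filter P L') \<le> length (filter P L)" "\<And>e. cnt' e + length L' \<le> 8 * N"
        "\<And>X. real (sepc X L0) \<le> real (sepc X L') + (\<Sum>e\<in>cutI X. ub lg' cnt' e)"
        "T' - 1 - (4 + real (length L) * (17 + 10 * X)) \<le> T''" "q' - 2 * real (length L) \<le> q''"
      have sub: "length (filter P L') \<le> length (filter P L0)" for P using r(7)[of P] j(9)[of P] by simp
      have z': "zpot w' cnt' \<le> real (Suc j) * (8 * real N * (\<alpha> * Lb))" using r(5) j(7) lX by (simp add: algebra_simps)
      hence z2: "zpot w' cnt' \<le> \<kappa> * real N" using zN by linarith
      have T2: "8 + real (Jm - Suc j) * level_cost + 135 * real N \<le> T''" using r(10) T1 cost by linarith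
      have q3: "16 * real N / 2 ^ j \<le> q''" using r(11) q2 by linarith
      have q0: "0 \<le> q''" using q3 by (rule order.trans[rotated]) simp
      have st: "ivar s' 3 = N" "ivar s' 11 = length L'" "ivar s' 8 = 2 ^ j" "rvar s' 2 = b"
        using r(1,3) by (simp_all add: renv_def lst_def)
      show "wp D Wd ?c I s' T'' q''"
      proof (cases "4 * N < length L' * 2 ^ j")
        case True
        have "wp D Wd cut_prog (wp D Wd (IAssign 12 (K 0)) I) s' (T'' - 1) q''"
        proof (rule wp_cut_level[OF r(1,2,4) z2 refl j(1) True r(6) sub _ q0])
          show "135 * real N \<le> T'' - 1" using T2 p0 by linarith
        next
          fix s3 :: mstate and T3 S
          assume "ivar s3 0 \<noteq> 0" "sgood S" "\<And>s. s < N \<Longrightarrow> (iarr s3 0 (sv s) = 1) = (sv s \<in> S)"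
            and T3: "T'' - 1 - 135 * real N \<le> T3"
          hence "res (set_ivar 12 0 s3)" by (auto simp: res_def)
          hence "I (set_ivar 12 0 s3) (T3 - 1) q''" unfolding I_def using T3 T2 p0 q0 by simp
          thus "wp D Wd (IAssign 12 (K 0)) I s3 T3 q''" using T3 T2 p0 q0 by (simp add: wp_simps)
        qed
        thus ?thesis using st True by (simp add: wp_Cond wp_Seq)
      next
        case False
        show ?thesis
        proof (cases "1 < 8 * real (2 ^ j) * b")
          case True
          have cert by (rule certI[OF r(4) z2 r(9) _ True]) (use False in simp)
          hence "res (set_ivar 0 0 (set_ivar 12 0 s'))" by (simp add: res_def)
          hence "I (set_ivar 0 0 (set_ivar 12 0 s')) (T'' - 4) q''"
            unfolding I_def using T2 p0 q0 by simp
          thus ?thesis using st False True T2 p0 q0 by (simp add: wp_simps mult_ac)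
        next
          case no: False
          \<comment> \<open>By the choice of \<open>Jm\<close> the test 8 p b > 1 succeeds at the
            last level, so a failure leaves room for another one.\<close>
          have jJ: "Suc j \<le> Jm - 1"
          proof (rule ccontr)
            assume "\<not> Suc j \<le> Jm - 1"
            hence "j = Jm - 1" using j(1) by simp
            thus False using no b(3) by simp
          qed
          have pW: "2 * 2 ^ j \<le> Wd"
          proof -
            have "(2::nat) ^ Suc j \<le> 2 ^ (Jm - 1)" using jJ by (intro power_increasing) auto
            moreover have "1 * (2 ^ (Jm - 1) + 1) \<le> 8 * (N + 1) * (2 ^ (Jm - 1) + 1 :: nat)" by (intro mult_right_mono) auto
            ultimately show ?thesis using big by simp
          qed
          have "J (Suc j) L' w' lg' cnt' (set_ivar 8 (2 ^ Suc j) s') (T'' - 3) q''" unfolding J_def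
          proof (intro conjI allI impI)
            show "renv (2 ^ Suc j) (set_ivar 8 (2 ^ Suc j) s')" "wst w' lg' cnt' (set_ivar 8 (2 ^ Suc j) s')"
              "lst L' (set_ivar 8 (2 ^ Suc j) s')" using r(1-3) by (simp_all add: renv_def wst_def lst_def)
            show "length L' * 2 ^ Suc j \<le> 8 * N" using False by simp
            show "3 + real (Jm - Suc j) * level_cost + 135 * real N \<le> T'' - 3" using T2 by simp
            show "32 * real N \<le> q'' * 2 ^ Suc j" using q3 by (simp add: field_simps)
          qed (use jJ r z' sub in auto)
          hence "I (set_ivar 8 (2 ^ Suc j) s') (T'' - 3) q''" unfolding I_def by blast
          thus ?thesis using st False no pW T2 p0 q0 by (simp add: wp_simps mult_ac)
        qed
      qed
    qed
    moreover have "0 \<le> T'" using T1 p0 lc by linarith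
    ultimately show "0 \<le> T' \<and> wp D Wd (level_prog;; ?c) I s (T' - 1) q'" by blast
  next
    fix s T' q' assume I: "I s T' q'" and b12: "\<not> beval (ILess (K 0) (V 12)) s"
    hence "\<not> (\<exists>j L w lg cnt. J j L w lg cnt s T' q')" unfolding J_def renv_def by auto
    with I have "res s \<and> 1 \<le> T' \<and> 0 \<le> q'" unfolding I_def by blast
    thus "1 \<le> T' \<and> 0 \<le> q' \<and> Q s (T' - 1) q'" using post by simp
  qed
qed

end

section \<open>Setting up the instance\<close>

text \<open>Edge e owns the slots e and m + e, one for each end, so that \<open>s mod m\<close>
  recovers the edge of slot s.\<close>

definition slots_body :: com where
  "slots_body =
     IAssign 26 (IGet 0 (V 4));; IAssign 30 (IGet 1 (V 4));;
     IPut 2 (V 4) (V 26);; IPut 3 (V 4) (V 30);;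
     IPut 2 (IAdd (V 1) (V 4)) (V 30);; IPut 3 (IAdd (V 1) (V 4)) (V 26);;
     IPut 6 (IAdd (IMul (V 26) (V 2)) (V 30)) (V 4);; IPut 6 (IAdd (IMul (V 30) (V 2)) (V 26)) (V 4);;
     IPut 7 (V 4) (K 1);; RPut 0 (V 4) (ROfInt (K 1));;
     IPut 5 (V 4) (IGet 4 (V 26));; IPut 4 (V 26) (IAdd (V 4) (K 1));;
     IPut 5 (IAdd (V 1) (V 4)) (IGet 4 (V 30));; IPut 4 (V 30) (IAdd (IAdd (V 1) (V 4)) (K 1));;
     IAssign 4 (IAdd (V 4) (K 1))"

definition slots_prog :: com where
  "slots_prog = IAssign 2 (V 0);; IAssign 3 (IMul (K 2) (V 1));; IAssign 4 (K 0);; While (ILess (V 4) (V 1)) slots_body"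

definition side_prog :: com where
  "side_prog = IAssign 5 (K 1);; While (ILess (IMul (V 5) (V 5)) (V 3)) (IAssign 5 (IAdd (V 5) (K 1)))"

definition log_prog :: com where
  "log_prog = IAssign 6 (K 0);; IAssign 7 (K 1);;
     While (ILess (V 7) (IMul (K 4) (V 3))) (IAssign 7 (IMul (K 2) (V 7));; IAssign 6 (IAdd (V 6) (K 1)))"

definition levels_prog :: com where
  "levels_prog = IAssign 8 (K 1);; IAssign 9 (K 1);;
     While (BNot (RLess (ROfInt (K 1)) (RMul (ROfInt (IMul (K 8) (V 8))) (RVar 2))))
       (IAssign 8 (IMul (K 2) (V 8));; IAssign 9 (IAdd (V 9) (K 1)))"

definition param_prog :: com where
  "param_prog =
     RAssign 3 (RDiv (RMul (ROfInt (K 126)) (ROfInt (V 6))) (RVar 1));;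
     IAssign 8 (K 1);;
     RAssign 4 (RMul (RMul (RMul (ROfInt (K 8)) (RVar 0)) (RVar 3)) (ROfInt (V 9)));;
     IAssign 12 (K 1);; DSInit (V 2) (V 1) 2 3 0"

definition demands_prog :: com where
  "demands_prog = IAssign 10 (K 0);;
     While (ILess (V 10) (IMul (V 5) (V 5)))
       (IAssign 33 (IDiv (V 10) (V 5));; IAssign 34 (IMod (V 10) (V 5));; IAssign 35 (IGet 2 (IMod (V 10) (V 3)));;
        IPut 10 (IMul (K 4) (V 10)) (V 35);;
        IPut 11 (IMul (K 4) (V 10))
          (IGet 2 (IMod (IAdd (IMul (IMod (IAdd (V 33) (V 34)) (V 5)) (V 5)) (V 34)) (V 3)));;
        IPut 10 (IAdd (IMul (K 4) (V 10)) (K 1)) (V 35);;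
        IPut 11 (IAdd (IMul (K 4) (V 10)) (K 1))
          (IGet 2 (IMod (IAdd (IMul (V 33) (V 5)) (IMod (IAdd (V 33) (V 34)) (V 5))) (V 3)));;
        IPut 10 (IAdd (IMul (K 4) (V 10)) (K 2)) (V 35);;
        IPut 11 (IAdd (IMul (K 4) (V 10)) (K 2))
          (IGet 2 (IMod (IAdd (IMul (IMod (IAdd (V 33) (K 1)) (V 5)) (V 5)) (V 34)) (V 3)));;
        IPut 10 (IAdd (IMul (K 4) (V 10)) (K 3)) (V 35);;
        IPut 11 (IAdd (IMul (K 4) (V 10)) (K 3))
          (IGet 2 (IMod (IAdd (IMul (V 33) (V 5)) (IMod (IAdd (V 34) (K 1)) (V 5))) (V 3)));;
        IAssign 10 (IAdd (V 10) (K 1)));;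
     IAssign 11 (IMul (K 4) (IMul (V 5) (V 5)))"

definition main_prog :: com where
  "main_prog = Cond (ILess (K 0) (V 1))
     (slots_prog;; side_prog;; log_prog;; levels_prog;; param_prog;; demands_prog;; loop_prog)
     (IPut 0 (K 0) (K 1))"

section \<open>Correctness of the preprocessing\<close>

definition agree :: "nat set \<Rightarrow> mstate \<Rightarrow> mstate \<Rightarrow> bool" where
  "agree A s s' \<longleftrightarrow> (\<forall>x. x \<notin> A \<longrightarrow> ivar s' x = ivar s x) \<and> rvar s' = rvar s \<and> iarr s' = iarr s \<and>
     rarr s' = rarr s \<and> dstr s' = dstr s"

text \<open>For the least k = j + 1 with N \<le> k * k one has j^2 + 1 \<le> N, and 2 j \<le> j^2 +
  1 gives k * k \<le> 2 N.\<close>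

lemma wp_side:
  assumes pre: "ivar s 3 = N" "2 \<le> N" "N \<le> W" and T: "4 + 2 * real N \<le> T" "0 \<le> q"
    and post: "\<And>s' T' k. \<lbrakk>agree {5} s s'; ivar s' 5 = k; 0 < k; N \<le> k * k; k * k \<le> 2 * N; T - (4 + 2 * real N) \<le> T'\<rbrakk> \<Longrightarrow> Q s' T' q"
  shows "wp D W side_prog Q s T q"
proof -
  define Tf where "Tf = T - (4 + 2 * real N)"
  have Tf: "0 \<le> Tf" using T by (simp add: Tf_def)
  define I where "I = (\<lambda>s' T' q'. q' = q \<and> agree {5} s s' \<and> 0 < ivar s' 5 \<and> (ivar s' 5 - 1) * (ivar s' 5 - 1) < N \<and>
     ivar s' 5 \<le> N \<and> Tf + 1 + 2 * real (N - ivar s' 5) \<le> T')"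
  have "wp D W (While (ILess (IMul (V 5) (V 5)) (V 3)) (IAssign 5 (IAdd (V 5) (K 1)))) Q (set_ivar 5 1 s) (T - 1) q"
  proof (rule wp_While[where I = I])
    show "I (set_ivar 5 1 s) (T - 1) q" using pre T by (simp add: I_def agree_def Tf_def)
  next
    fix s' T' q' assume I: "I s' T' q'" and b: "beval (ILess (IMul (V 5) (V 5)) (V 3)) s'"
    define k where "k = ivar s' 5"
    have i: "q' = q" "agree {5} s s'" "0 < k" "Tf + 1 + 2 * real (N - k) \<le> T'"
      using I unfolding I_def k_def by blast+
    have kk: "k * k < N" using b i(2) pre by (simp add: agree_def k_def)
    have "k * 1 \<le> k * k" using i(3) by (intro mult_left_mono) auto
    hence kN: "k < N" using kk by linarith
    have Nk: "real (N - k) = real (N - Suc k) + 1" using kN by simp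
    have "I (set_ivar 5 (Suc k) s') (T' - 2) q"
      using i kk kN Nk by (simp add: I_def agree_def)
    thus "0 \<le> T' \<and> wp D W (IAssign 5 (IAdd (V 5) (K 1))) I s' (T' - 1) q'"
      using i kN pre T(2) Tf Nk by (simp add: wp_simps k_def[symmetric])
  next
    fix s' T' q' assume I: "I s' T' q'" and b: "\<not> beval (ILess (IMul (V 5) (V 5)) (V 3)) s'"
    define k where "k = ivar s' 5"
    have i: "q' = q" "agree {5} s s'" "0 < k" "(k - 1) * (k - 1) < N"
      "Tf + 1 + 2 * real (N - k) \<le> T'" using I unfolding I_def k_def by blast+
    have T1: "Tf + 1 \<le> T'" using i(5) by (rule order.trans[rotated]) simp
    have kk: "N \<le> k * k" using b i(2) pre by (simp add: agree_def k_def)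
    have "k * k \<le> 2 * N"
    proof -
      obtain j where j: "k = Suc j" using i(3) by (cases k) auto
      have "j * j + 1 \<le> N" using i(4) j by simp
      moreover have "2 * j \<le> j * j + 1"
        by (cases j) simp_all
      ultimately show ?thesis using j by simp
    qed
    hence "Q s' (T' - 1) q" using i(2,3) kk T1 by (intro post[of s' k]) (auto simp: k_def Tf_def)
    thus "1 \<le> T' \<and> 0 \<le> q' \<and> Q s' (T' - 1) q'" using i(1) T1 Tf T(2) by simp
  qed
  thus ?thesis using T pre by (simp add: side_prog_def wp_simps)
qed

lemma wp_log:
  assumes pre: "ivar s 3 = N" "1 \<le> N" "8 * N \<le> W" and T: "6 + 24 * real N \<le> T" "0 \<le> q"
    and post: "\<And>s' T' l. \<lbrakk>agree {6, 7} s s'; ivar s' 6 = l; 4 * N \<le> 2 ^ l; 2 ^ l \<le> 8 * N; T - (6 + 24 * real N) \<le> T'\<rbrakk> \<Longrightarrow> Q s' T' q"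
  shows "wp D W log_prog Q s T q"
proof -
  define Tf where "Tf = T - (6 + 24 * real N)"
  have Tf: "0 \<le> Tf" using T by (simp add: Tf_def)
  define I where "I = (\<lambda>s' T' q'. q' = q \<and> agree {6, 7} s s' \<and> ivar s' 7 = 2 ^ ivar s' 6 \<and> ivar s' 7 \<le> 8 * N \<and>
     Tf + 1 + 3 * (8 * real N - real (ivar s' 6)) \<le> T')"
  let ?body = "IAssign 7 (IMul (K 2) (V 7));; IAssign 6 (IAdd (V 6) (K 1))"
  have "wp D W (While (ILess (V 7) (IMul (K 4) (V 3))) ?body) Q (set_ivar 7 1 (set_ivar 6 0 s)) (T - 2) q"
  proof (rule wp_While[where I = I])
    show "I (set_ivar 7 1 (set_ivar 6 0 s)) (T - 2) q" using pre T by (simp add: I_def agree_def Tf_def)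
  next
    fix s' T' q' assume I: "I s' T' q'" and b: "beval (ILess (V 7) (IMul (K 4) (V 3))) s'"
    define l where "l = ivar s' 6"
    have i: "q' = q" "agree {6, 7} s s'" "ivar s' 7 = 2 ^ l" "Tf + 1 + 3 * (8 * real N - real l) \<le> T'"
      using I unfolding I_def l_def by blast+
    have lt: "2 ^ l < 4 * N" using b i pre by (simp add: agree_def)
    have l: "l < 4 * N" using less_exp[of l] lt by linarith
    have "I (set_ivar 6 (Suc l) (set_ivar 7 (2 * 2 ^ l) s')) (T' - 3) q"
      using i lt by (simp add: I_def agree_def)
    moreover have "12 * real N \<le> 3 * (8 * real N - real l)" using l by simp
    hence "4 \<le> T'" using i(4) pre(2) Tf by linarith
    ultimately show "0 \<le> T' \<and> wp D W ?body I s' (T' - 1) q'"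
      using i l lt pre T(2) by (simp add: wp_simps l_def[symmetric])
  next
    fix s' T' q' assume I: "I s' T' q'" and b: "\<not> beval (ILess (V 7) (IMul (K 4) (V 3))) s'"
    define l where "l = ivar s' 6"
    have i: "q' = q" "agree {6, 7} s s'" "ivar s' 7 = 2 ^ l" "2 ^ l \<le> 8 * N" "Tf + 1 + 3 * (8 * real N - real l) \<le> T'"
      using I unfolding I_def l_def by (blast, blast, blast, metis, blast)
    have ge: "4 * N \<le> 2 ^ l" using b i pre by (simp add: agree_def)
    have "l < 8 * N" using less_exp[of l] i(4) by linarith
    hence "0 \<le> 3 * (8 * real N - real l)" by simp
    hence T1: "Tf + 1 \<le> T'" using i(5) by linarith
    have "Q s' (T' - 1) q" using i ge T1 by (intro post[of s' l]) (auto simp: l_def Tf_def)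
    thus "1 \<le> T' \<and> 0 \<le> q' \<and> Q s' (T' - 1) q'" using i(1) T1 Tf T(2) by simp
  qed
  thus ?thesis using T pre by (simp add: log_prog_def wp_simps)
qed

text \<open>Comparing 8 p b with 1 over the reals and counting the doublings of p replaces rounding
  log(1 / b).\<close>

lemma wp_levels:
  assumes pre: "rvar s 2 = b" "0 < b" "1 \<le> Jm" "4 * 2 ^ (Jm - 1) * b \<le> 1" "1 < 8 * 2 ^ (Jm - 1) * b" "2 ^ Jm \<le> W"
    and T: "3 + 3 * real Jm \<le> T" "0 \<le> q"
    and post: "\<And>s' T'. \<lbrakk>agree {8, 9} s s'; ivar s' 9 = Jm; T - (3 + 3 * real Jm) \<le> T'\<rbrakk> \<Longrightarrow> Q s' T' q"
  shows "wp D W levels_prog Q s T q"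
proof -
  define Tf where "Tf = T - (3 + 3 * real Jm)"
  have Tf: "0 \<le> Tf" using T by (simp add: Tf_def)
  define I where "I = (\<lambda>s' T' q'. q' = q \<and> agree {8, 9} s s' \<and> (\<exists>j. ivar s' 8 = 2 ^ j \<and> ivar s' 9 = Suc j \<and> j \<le> Jm - 1 \<and>
     Tf + 1 + 3 * real (Jm - j) \<le> T'))"
  let ?b = "BNot (RLess (ROfInt (K 1)) (RMul (ROfInt (IMul (K 8) (V 8))) (RVar 2)))"
  let ?body = "IAssign 8 (IMul (K 2) (V 8));; IAssign 9 (IAdd (V 9) (K 1))"
  have W1: "Jm < W" using less_exp[of Jm] pre(6) by linarith
  have "wp D W (While ?b ?body) Q (set_ivar 9 1 (set_ivar 8 1 s)) (T - 2) q"
  proof (rule wp_While[where I = I])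
    show "I (set_ivar 9 1 (set_ivar 8 1 s)) (T - 2) q" using T by (simp add: I_def agree_def Tf_def)
  next
    fix s' T' q' assume I: "I s' T' q'" and b: "beval ?b s'"
    then obtain j where i: "q' = q" "agree {8, 9} s s'" "ivar s' 8 = 2 ^ j" "ivar s' 9 = Suc j" "j \<le> Jm - 1"
      "Tf + 1 + 3 * real (Jm - j) \<le> T'" by (auto simp: I_def)
    have r: "rvar s' 2 = b" using i(2) pre(1) by (simp add: agree_def)
    have "j \<noteq> Jm - 1"
    proof
      assume "j = Jm - 1"
      thus False using b pre(5) i(3) r by simp
    qed
    hence j: "Suc j \<le> Jm - 1" using i(5) by simp
    have Jj: "real (Jm - j) = real (Jm - Suc j) + 1" using j by linarith
    have pw: "2 * 2 ^ j \<le> W"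
    proof -
      have "(2::nat) ^ Suc j \<le> 2 ^ Jm" using j by (intro power_increasing) auto
      thus ?thesis using pre(6) by simp
    qed
    have "I (set_ivar 9 (Suc (Suc j)) (set_ivar 8 (2 * 2 ^ j) s')) (T' - 3) q"
      unfolding I_def using i j Jj by (auto simp: agree_def intro!: exI[of _ "Suc j"])
    moreover have "3 \<le> T'" using i(6) Jj Tf by linarith
    ultimately show "0 \<le> T' \<and> wp D W ?body I s' (T' - 1) q'"
      using i j pw W1 T(2) by (simp add: wp_simps)
  next
    fix s' T' q' assume I: "I s' T' q'" and b: "\<not> beval ?b s'"
    then obtain j where i: "q' = q" "agree {8, 9} s s'" "ivar s' 8 = 2 ^ j" "ivar s' 9 = Suc j" "j \<le> Jm - 1"
      "Tf + 1 + 3 * real (Jm - j) \<le> T'" by (auto simp: I_def)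
    have r: "rvar s' 2 = b" using i(2) pre(1) by (simp add: agree_def)
    have gt: "1 < 8 * 2 ^ j * b" using b i(3) r by simp
    have "j = Jm - 1"
    proof (rule ccontr)
      assume "j \<noteq> Jm - 1"
      hence "Suc j \<le> Jm - 1" using i(5) by simp
      hence "(2::real) ^ Suc j \<le> 2 ^ (Jm - 1)" by (intro power_increasing) auto
      hence "4 * 2 ^ Suc j * b \<le> 4 * 2 ^ (Jm - 1) * b" using pre(2) by (intro mult_right_mono) auto
      moreover have "4 * 2 ^ Suc j * b = 8 * 2 ^ j * b" by simp
      ultimately show False using gt pre(4) by linarith
    qed
    hence "ivar s' 9 = Jm" using i(4) pre(3) by simp
    moreover have T1: "Tf + 1 \<le> T'" using i(6) by (rule order.trans[rotated]) simp
    ultimately have "Q s' (T' - 1) q" using i(2) by (intro post) (auto simp: Tf_def)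
    thus "1 \<le> T' \<and> 0 \<le> q' \<and> Q s' (T' - 1) q'" using i(1) T1 Tf T(2) by simp
  qed
  thus ?thesis using T W1 by (simp add: levels_prog_def wp_simps)
qed

lemma chain_upd: "s \<notin> set l \<Longrightarrow> chain (nx(s := y)) h l = chain nx h l"
  by (induction l arbitrary: h) auto

locale input =
  fixes n m :: nat and fu fv :: "nat \<Rightarrow> nat" and W :: nat
  assumes ends: "e < m \<Longrightarrow> fu e < n" "e < m \<Longrightarrow> fv e < n" "e < m \<Longrightarrow> fu e \<noteq> fv e"
    and inj: "inj_on (\<lambda>e. {fu e, fv e}) {..<m}"
    and W: "2 * m + 1 \<le> W" "n \<le> W"
begin

definition slot_vertex :: "nat \<Rightarrow> nat" where
  "slot_vertex s = (if s < m then fu s else fv (s - m))"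

definition filled :: "nat \<Rightarrow> mstate \<Rightarrow> bool" where
  "filled i s \<longleftrightarrow> (\<forall>e<i. iarr s 2 e = fu e \<and> iarr s 3 e = fv e \<and> iarr s 2 (m + e) = fv e \<and> iarr s 3 (m + e) = fu e \<and>
       iarr s 6 (fu e * n + fv e) = e \<and> iarr s 6 (fv e * n + fu e) = e \<and> iarr s 7 e = 1 \<and> rarr s 0 e = 1) \<and>
     (\<exists>adj. \<forall>v. chain (iarr s 5) (iarr s 4 v) (adj v) \<and> distinct (adj v) \<and>
        set (adj v) = {s. (s < i \<or> m \<le> s \<and> s < m + i) \<and> slot_vertex s = v})"

definition frame :: "mstate \<Rightarrow> mstate \<Rightarrow> bool" where
  "frame s s' \<longleftrightarrow> ivar s' 0 = ivar s 0 \<and> ivar s' 1 = ivar s 1 \<and> ivar s' 2 = ivar s 2 \<and> ivar s' 3 = ivar s 3 \<and> rvar s' = rvar s \<and>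
     iarr s' 0 = iarr s 0 \<and> iarr s' 1 = iarr s 1 \<and> iarr s' 8 = iarr s 8 \<and> iarr s' 9 = iarr s 9 \<and> iarr s' 13 = iarr s 13 \<and>
     iarr s' 14 = iarr s 14 \<and> dstr s' = dstr s"

lemma code_inj: "a * n + b = c * n + d \<Longrightarrow> b < n \<Longrightarrow> d < n \<Longrightarrow> a = c \<and> b = d"
  by (metis div_mult_self3 mod_mult_self3 div_less mod_less add.right_neutral add.commute gr_implies_not0)

text \<open>Codes determine ordered pairs, and different edges differ as unordered pairs, so the new
  entries of array 6 overwrite nothing. The new slots occur in no list yet, so pushing them leaves
  the older chains intact.\<close>

lemma filled_step:
  assumes f: "filled i s" and i: "i < m"
    and s': "iarr s' 2 = ((iarr s 2)(i := fu i))(m + i := fv i)" "iarr s' 3 = ((iarr s 3)(i := fv i))(m + i := fu i)"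
      "iarr s' 6 = ((iarr s 6)(fu i * n + fv i := i))(fv i * n + fu i := i)"
      "iarr s' 7 = (iarr s 7)(i := 1)" "rarr s' 0 = (rarr s 0)(i := 1)"
      "iarr s' 5 = ((iarr s 5)(i := iarr s 4 (fu i)))(m + i := iarr s 4 (fv i))"
      "iarr s' 4 = ((iarr s 4)(fu i := Suc i))(fv i := Suc (m + i))"
  shows "filled (Suc i) s'"
proof -
  from f obtain adj where adj: "\<And>v. chain (iarr s 5) (iarr s 4 v) (adj v)" "\<And>v. distinct (adj v)"
    "\<And>v. set (adj v) = {s. (s < i \<or> m \<le> s \<and> s < m + i) \<and> slot_vertex s = v}" unfolding filled_def by blast
  define adj' where "adj' = (adj(fu i := i # adj (fu i)))(fv i := (m + i) # adj (fv i))"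
  have sv: "slot_vertex i = fu i" "slot_vertex (m + i) = fv i" using i by (simp_all add: slot_vertex_def)
  have nin: "i \<notin> set (adj v)" "m + i \<notin> set (adj v)" for v using i by (auto simp: adj(3))
  have ne: "fu i \<noteq> fv i" using ends i by simp
  have "chain (iarr s' 5) (iarr s' 4 v) (adj' v) \<and> distinct (adj' v) \<and>
        set (adj' v) = {s. (s < Suc i \<or> m \<le> s \<and> s < m + Suc i) \<and> slot_vertex s = v}" for v
  proof (intro conjI)
    show "chain (iarr s' 5) (iarr s' 4 v) (adj' v)"
      using adj(1)[of v] adj(1)[of "fu i"] adj(1)[of "fv i"] nin ne i
      by (auto simp: s' adj'_def chain_upd)
    show "distinct (adj' v)" using adj(2) nin ne by (auto simp: adj'_def)
    show "set (adj' v) = {s. (s < Suc i \<or> m \<le> s \<and> s < m + Suc i) \<and> slot_vertex s = v}"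
      using sv ne by (auto simp: adj'_def adj(3) less_Suc_eq)
  qed
  moreover have "iarr s' 2 e = fu e \<and> iarr s' 3 e = fv e \<and> iarr s' 2 (m + e) = fv e \<and> iarr s' 3 (m + e) = fu e \<and>
       iarr s' 6 (fu e * n + fv e) = e \<and> iarr s' 6 (fv e * n + fu e) = e \<and> iarr s' 7 e = 1 \<and> rarr s' 0 e = 1"
    if e: "e < Suc i" for e
  proof (cases "e = i")
    case True
    have "fu i * n + fv i \<noteq> fv i * n + fu i" using code_inj[of "fu i" "fv i" "fv i" "fu i"] ends[OF i] by auto
    thus ?thesis using True i by (simp add: s')
  next
    case False
    hence ei: "e < i" using e by simp
    have em: "e < m" using ei i by simp
    have ne: "{fu e, fv e} \<noteq> {fu i, fv i}" using inj em i False by (auto simp: inj_on_def)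
    hence nn: "\<not> (fu e = fu i \<and> fv e = fv i)" "\<not> (fu e = fv i \<and> fv e = fu i)" by (auto simp: insert_commute)
    have "fu e * n + fv e \<noteq> fu i * n + fv i"
      using code_inj[of "fu e" "fv e" "fu i" "fv i"] ends(2)[OF i] ends(2)[OF em] nn by blast
    moreover have "fu e * n + fv e \<noteq> fv i * n + fu i"
      using code_inj[of "fu e" "fv e" "fv i" "fu i"] ends(1)[OF i] ends(2)[OF em] nn by blast
    moreover have "fv e * n + fu e \<noteq> fu i * n + fv i"
      using code_inj[of "fv e" "fu e" "fu i" "fv i"] ends(2)[OF i] ends(1)[OF em] nn by blast
    moreover have "fv e * n + fu e \<noteq> fv i * n + fu i"
      using code_inj[of "fv e" "fu e" "fv i" "fu i"] ends(1)[OF i] ends(1)[OF em] nn by blast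
    moreover have "iarr s 2 e = fu e \<and> iarr s 3 e = fv e \<and> iarr s 2 (m + e) = fv e \<and> iarr s 3 (m + e) = fu e \<and>
       iarr s 6 (fu e * n + fv e) = e \<and> iarr s 6 (fv e * n + fu e) = e \<and> iarr s 7 e = 1 \<and> rarr s 0 e = 1"
      using f ei unfolding filled_def by blast
    ultimately show ?thesis using ei i em by (simp add: s')
  qed
  ultimately show ?thesis unfolding filled_def by blast
qed

lemma filled_le:
  assumes "filled i s" "i \<le> m" shows "iarr s 4 v \<le> 2 * m"
proof -
  from assms(1) obtain adj where adj: "chain (iarr s 5) (iarr s 4 v) (adj v)"
    "set (adj v) = {s. (s < i \<or> m \<le> s \<and> s < m + i) \<and> slot_vertex s = v}" unfolding filled_def by blast
  show ?thesis
  proof (cases "adj v")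
    case (Cons a l)
    have "a \<in> {s. (s < i \<or> m \<le> s \<and> s < m + i) \<and> slot_vertex s = v}" unfolding adj(2)[symmetric] Cons by simp
    thus ?thesis using adj(1) Cons assms(2) by auto
  qed (use adj in simp)
qed

lemma wp_slots:
  assumes pre: "ivar s 0 = n" "ivar s 1 = m" "\<And>e. e < m \<Longrightarrow> iarr s 0 e = fu e \<and> iarr s 1 e = fv e"
      "iarr s 4 = (\<lambda>_. 0)"
    and T: "4 + 16 * real m \<le> T" "0 \<le> q"
    and post: "\<And>s' T'. \<lbrakk>ivar s' 2 = n; ivar s' 3 = 2 * m; frame (set_ivar 3 (2 * m) (set_ivar 2 n s)) s'; filled m s';
       T - (4 + 16 * real m) \<le> T'\<rbrakk> \<Longrightarrow> Q s' T' q"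
  shows "wp D W slots_prog Q s T q"
proof -
  define Tf where "Tf = T - (4 + 16 * real m)"
  have Tf: "0 \<le> Tf" using T by (simp add: Tf_def)
  let ?s = "set_ivar 3 (2 * m) (set_ivar 2 n s)"
  define I where "I = (\<lambda>s' T' q'. q' = q \<and> frame ?s s' \<and> ivar s' 4 \<le> m \<and> filled (ivar s' 4) s' \<and>
     Tf + 1 + 16 * real (m - ivar s' 4) \<le> T')"
  have "wp D W (While (ILess (V 4) (V 1)) slots_body) Q (set_ivar 4 0 ?s) (T - 3) q"
  proof (rule wp_While[where I = I])
    have "filled 0 (set_ivar 4 0 ?s)" unfolding filled_def
      using pre(4) by (auto intro!: exI[of _ "\<lambda>_. []"])
    thus "I (set_ivar 4 0 ?s) (T - 3) q" using T by (simp add: I_def frame_def Tf_def)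
  next
    fix s' T' q' assume I: "I s' T' q'" and b: "beval (ILess (V 4) (V 1)) s'"
    define i where "i = ivar s' 4"
    have i: "q' = q" "frame ?s s'" "filled i s'" "Tf + 1 + 16 * real (m - i) \<le> T'"
      using I unfolding I_def i_def by blast+
    have st: "ivar s' 1 = m" "ivar s' 2 = n" "iarr s' 0 = iarr s 0" "iarr s' 1 = iarr s 1"
      using i(2) pre by (simp_all add: frame_def)
    have im: "i < m" using b st by (simp add: i_def)
    have mi: "real (m - i) = real (m - Suc i) + 1" using im by simp
    have a01: "iarr s 0 i = fu i" "iarr s 1 i = fv i" using pre(3)[OF im] by auto
    have bnd: "fu i \<le> W" "fv i \<le> W" "iarr s' 4 v \<le> W" "Suc (m + i) \<le> W" for v
      using ends(1,2)[OF im] W filled_le[OF i(3), of v] im by simp_all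
    have ne: "fu i \<noteq> fv i" using ends im by simp
    let ?s' = "set_ivar 4 (Suc i) (set_iarr 4 (fv i) (Suc (m + i)) (set_iarr 5 (m + i) (iarr s' 4 (fv i))
       (set_iarr 4 (fu i) (Suc i) (set_iarr 5 i (iarr s' 4 (fu i)) (set_rarr 0 i 1 (set_iarr 7 i 1
       (set_iarr 6 (fv i * n + fu i) i (set_iarr 6 (fu i * n + fv i) i (set_iarr 3 (m + i) (fu i) (set_iarr 2 (m + i) (fv i)
       (set_iarr 3 i (fv i) (set_iarr 2 i (fu i) (set_ivar 30 (fv i) (set_ivar 26 (fu i) s'))))))))))))))"
    have "filled (Suc i) ?s'" by (rule filled_step[OF i(3) im]) simp_all
    moreover have "frame ?s ?s'" using i(2) by (simp add: frame_def)
    ultimately have "I ?s' (T' - 16) q" using im i mi by (simp add: I_def)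
    moreover have "17 \<le> T'" using i(4) mi Tf by linarith
    ultimately show "0 \<le> T' \<and> wp D W slots_body I s' (T' - 1) q'"
      using i(1) st a01 bnd ne im T(2) by (simp add: slots_body_def wp_simps i_def[symmetric])
  next
    fix s' T' q' assume I: "I s' T' q'" and b: "\<not> beval (ILess (V 4) (V 1)) s'"
    have i: "q' = q" "frame ?s s'" "ivar s' 4 \<le> m" "filled (ivar s' 4) s'"
      "Tf + 1 + 16 * real (m - ivar s' 4) \<le> T'" using I unfolding I_def by blast+
    have T1: "Tf + 1 \<le> T'" using i(5) by (rule order.trans[rotated]) simp
    have "ivar s' 4 = m" using b i(2,3) pre by (simp add: frame_def)
    hence "Q s' (T' - 1) q" using i(2,4) T1 pre by (intro post) (auto simp: frame_def Tf_def)
    thus "1 \<le> T' \<and> 0 \<le> q' \<and> Q s' (T' - 1) q'" using i(1) T1 Tf T(2) by simp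
  qed
  thus ?thesis using T pre W by (simp add: slots_prog_def wp_simps)
qed

end

context run begin

lemma wp_demands:
  assumes pre: "renv 1 s" "wst w0 (\<lambda>_. 0) (\<lambda>_. 0) s" "ivar s 5 = k"
    and T: "3 + 26 * real N \<le> T" "0 \<le> q"
    and post: "\<And>s' T'. \<lbrakk>renv 1 s'; wst w0 (\<lambda>_. 0) (\<lambda>_. 0) s'; lst L0 s'; T - (3 + 26 * real N) \<le> T'\<rbrakk> \<Longrightarrow> Q s' T' q"
  shows "wp D Wd demands_prog Q s T q"
proof -
  define Tf where "Tf = T - (3 + 26 * real N)"
  have Tf: "0 \<le> Tf" using T by (simp add: Tf_def)
  have WN: "8 * N + 8 \<le> Wd"
  proof -
    have "8 * (N + 1) * 1 \<le> 8 * (N + 1) * (2 ^ (Jm - 1) + 1)" by (intro mult_left_mono) auto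
    thus ?thesis using big by simp
  qed
  define val where "val = (\<lambda>r z. sv (gen k r z mod N))"
  define I where "I = (\<lambda>s T' q'. q' = q \<and> renv 1 s \<and> wst w0 (\<lambda>_. 0) (\<lambda>_. 0) s \<and> ivar s 5 = k \<and> ivar s 10 \<le> k * k \<and>
     (\<forall>t<4 * ivar s 10. (iarr s 10 t, iarr s 11 t) = L0 ! t) \<and> Tf + 2 + 13 * real (k * k - ivar s 10) \<le> T')"
  let ?body = "IAssign 33 (IDiv (V 10) (V 5));; IAssign 34 (IMod (V 10) (V 5));; IAssign 35 (IGet 2 (IMod (V 10) (V 3)));;
        IPut 10 (IMul (K 4) (V 10)) (V 35);;
        IPut 11 (IMul (K 4) (V 10))
          (IGet 2 (IMod (IAdd (IMul (IMod (IAdd (V 33) (V 34)) (V 5)) (V 5)) (V 34)) (V 3)));;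
        IPut 10 (IAdd (IMul (K 4) (V 10)) (K 1)) (V 35);;
        IPut 11 (IAdd (IMul (K 4) (V 10)) (K 1))
          (IGet 2 (IMod (IAdd (IMul (V 33) (V 5)) (IMod (IAdd (V 33) (V 34)) (V 5))) (V 3)));;
        IPut 10 (IAdd (IMul (K 4) (V 10)) (K 2)) (V 35);;
        IPut 11 (IAdd (IMul (K 4) (V 10)) (K 2))
          (IGet 2 (IMod (IAdd (IMul (IMod (IAdd (V 33) (K 1)) (V 5)) (V 5)) (V 34)) (V 3)));;
        IPut 10 (IAdd (IMul (K 4) (V 10)) (K 3)) (V 35);;
        IPut 11 (IAdd (IMul (K 4) (V 10)) (K 3))
          (IGet 2 (IMod (IAdd (IMul (V 33) (V 5)) (IMod (IAdd (V 34) (K 1)) (V 5))) (V 3)));;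
        IAssign 10 (IAdd (V 10) (K 1))"
  have "wp D Wd (While (ILess (V 10) (IMul (V 5) (V 5))) ?body) (wp D Wd (IAssign 11 (IMul (K 4) (IMul (V 5) (V 5)))) Q)
     (set_ivar 10 0 s) (T - 1) q"
  proof (rule wp_While[where I = I])
    have "13 * real (k * k) \<le> 26 * real N" using k(3) by linarith
    thus "I (set_ivar 10 0 s) (T - 1) q"
      using pre by (simp add: I_def renv_def wst_def Tf_def)
  next
    fix s T' q' assume I: "I s T' q'" and b: "beval (ILess (V 10) (IMul (V 5) (V 5))) s"
    define z where "z = ivar s 10"
    have i: "q' = q" "renv 1 s" "wst w0 (\<lambda>_. 0) (\<lambda>_. 0) s" "ivar s 5 = k"
      "\<And>t. t < 4 * z \<Longrightarrow> (iarr s 10 t, iarr s 11 t) = L0 ! t" "Tf + 2 + 13 * real (k * k - z) \<le> T'"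
      using I unfolding I_def z_def by blast+
    have z: "z < k * k" using b i(4) by (simp add: z_def)
    have zk: "real (k * k - z) = real (k * k - Suc z) + 1" using z by linarith
    have e: "iarr s 2 = sv" "ivar s 3 = N" using i(2) by (simp_all add: renv_def)
    have svW: "sv (x mod N) \<le> Wd" for x using sv_n[of "x mod N"] N_pos Wd by simp
    have zW: "z div k \<le> Wd" "z mod k \<le> Wd" "Suc z \<le> Wd"
      using z k WN div_le_dividend[of z k] mod_less_eq_dividend[of z k] by linarith+
    let ?a = "sv (z mod N)"
    let ?s' = "set_ivar 10 (Suc z) (set_iarr 11 (4 * z + 3) (val 3 z) (set_iarr 10 (4 * z + 3) ?a
       (set_iarr 11 (4 * z + 2) (val 2 z) (set_iarr 10 (4 * z + 2) ?a
       (set_iarr 11 (4 * z + 1) (val 1 z) (set_iarr 10 (4 * z + 1) ?a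
       (set_iarr 11 (4 * z) (val 0 z) (set_iarr 10 (4 * z) ?a
       (set_ivar 35 ?a (set_ivar 34 (z mod k) (set_ivar 33 (z div k) s)))))))))))"
    have nthL: "L0 ! (4 * z + r) = (?a, val r z)" if "r < 4" for r
      using that z by (simp add: demands_def val_def)
    have "(iarr ?s' 10 t, iarr ?s' 11 t) = L0 ! t" if t: "t < 4 * Suc z" for t
    proof (cases "t < 4 * z")
      case True
      thus ?thesis using i(5)[OF True] by simp
    next
      case False
      then obtain r where r: "t = 4 * z + r" "r < 4" using t by (metis add_less_cancel_left le_add_diff_inverse mult_Suc_right not_less add.commute)
      hence "r = 0 \<or> r = 1 \<or> r = 2 \<or> r = 3" by linarith
      thus ?thesis using r nthL[OF r(2)] by auto
    qed
    moreover have "renv 1 ?s'" "wst w0 (\<lambda>_. 0) (\<lambda>_. 0) ?s'" using i(2,3) by (simp_all add: renv_def wst_def)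
    moreover have "Tf + 2 + 13 * real (k * k - Suc z) \<le> T' - 13" using i(6) zk by simp
    ultimately have I': "I ?s' (T' - 13) q" unfolding I_def using z i(4) by simp
    have v: "val 0 z = sv (((z div k + z mod k) mod k * k + z mod k) mod N)"
      "val 1 z = sv ((z div k * k + (z div k + z mod k) mod k) mod N)"
      "val 2 z = sv (((z div k + 1) mod k * k + z mod k) mod N)"
      "val 3 z = sv ((z div k * k + (z mod k + 1) mod k) mod N)"
      by (simp_all add: val_def gen_def)
    have "0 \<le> 13 * real (k * k - Suc z)" by simp
    hence T15: "15 \<le> T'" using i(6) zk Tf by linarith
    show "0 \<le> T' \<and> wp D Wd ?body I s (T' - 1) q'"
      using I'[unfolded v] i(1,4) e svW zW T15 T(2) by (simp add: wp_simps z_def[symmetric])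
  next
    fix s T' q' assume I: "I s T' q'" and b: "\<not> beval (ILess (V 10) (IMul (V 5) (V 5))) s"
    have i: "q' = q" "renv 1 s" "wst w0 (\<lambda>_. 0) (\<lambda>_. 0) s" "ivar s 5 = k" "ivar s 10 \<le> k * k"
      "\<And>t. t < 4 * ivar s 10 \<Longrightarrow> (iarr s 10 t, iarr s 11 t) = L0 ! t" "Tf + 2 + 13 * real (k * k - ivar s 10) \<le> T'"
      using I unfolding I_def by blast+
    have z: "ivar s 10 = k * k" using b i(4,5) by simp
    have "Q (set_ivar 11 (4 * (k * k)) s) (T' - 2) q"
      by (rule post) (use i z length_L0 in \<open>auto simp: renv_def wst_def lst_def Tf_def\<close>)
    moreover have "4 * (k * k) \<le> Wd" using k WN by linarith
    moreover have "2 \<le> T'" using i(7) Tf z by simp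
    ultimately show "1 \<le> T' \<and> 0 \<le> q' \<and> wp D Wd (IAssign 11 (IMul (K 4) (IMul (V 5) (V 5)))) Q s (T' - 1) q'"
      using i(1,4) T(2) by (simp add: wp_simps)
  qed
  thus ?thesis using T by (simp add: demands_prog_def wp_simps)
qed

section \<open>Slot counts and the volumes, cuts and conductances of the given graph\<close>

lemma slot_edge: "s < N \<Longrightarrow> {sv s, so s} = {sv (s mod m), so (s mod m)}"
  by (erule slot_cases) (use slots m1 in auto)

text \<open>There are no loops, so exactly one of the two slots of an edge at v is located at
  v.\<close>

lemma degree_eq: "degree E v = card {s. s < N \<and> sv s = v}"
proof -
  have "bij_betw (\<lambda>s. {sv s, so s}) {s. s < N \<and> sv s = v} {e \<in> E. v \<in> e}"
    unfolding bij_betw_def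
  proof
    show "inj_on (\<lambda>s. {sv s, so s}) {s. s < N \<and> sv s = v}"
    proof (rule inj_onI)
      fix s t assume s: "s \<in> {s. s < N \<and> sv s = v}" and t: "t \<in> {s. s < N \<and> sv s = v}"
        and eq: "{sv s, so s} = {sv t, so t}"
      have "s mod m < m" "t mod m < m" using m1 by simp_all
      moreover have "{sv (s mod m), so (s mod m)} = {sv (t mod m), so (t mod m)}"
        using eq slot_edge[of s] slot_edge[of t] s t by (metis (lifting) mem_Collect_eq)
      ultimately have st: "s mod m = t mod m" using inj by (auto simp: inj_on_def)
      from s have sN: "s < N" and sv: "sv s = v" by auto
      from t have tN: "t < N" and tv: "sv t = v" by auto
      have ne: "so s \<noteq> sv s" using sg.no_loop[OF sN] .
      from sN show "s = t"
      proof (cases rule: slot_cases)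
        case (1 e)
        note s1 = this
        from tN show ?thesis
        proof (cases rule: slot_cases)
          case (2 e')
          hence "e' = e" using st s1 by simp
          hence "t = m + e" using 2 by simp
          thus ?thesis using slots(1)[OF s1(1)] sv tv ne s1(2) by simp
        qed (use st s1 in simp)
      next
        case (2 e)
        note s2 = this
        from tN show ?thesis
        proof (cases rule: slot_cases)
          case (1 e')
          hence "e' = e" using st s2 by simp
          hence "t = e" using 1 by simp
          thus ?thesis using slots(2)[OF s2(1)] sv tv ne s2(2) by simp
        qed (use st s2 in simp)
      qed
    qed
    show "(\<lambda>s. {sv s, so s}) ` {s. s < N \<and> sv s = v} = {e \<in> E. v \<in> e}"
    proof (intro equalityI subsetI)
      fix x assume "x \<in> (\<lambda>s. {sv s, so s}) ` {s. s < N \<and> sv s = v}"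
      then obtain s where s: "s < N" "sv s = v" "x = {sv s, so s}" by auto
      have "s mod m < m" using m1 by simp
      thus "x \<in> {e \<in> E. v \<in> e}" using s slot_edge[OF s(1)] E by auto
    next
      fix x assume "x \<in> {e \<in> E. v \<in> e}"
      then obtain e where e: "e < m" "x = {sv e, so e}" "v \<in> x" using E by auto
      show "x \<in> (\<lambda>s. {sv s, so s}) ` {s. s < N \<and> sv s = v}"
      proof (cases "v = sv e")
        case True
        thus ?thesis using e N by (intro image_eqI[of _ _ e]) auto
      next
        case False
        thus ?thesis using e N slots by (intro image_eqI[of _ _ "m + e"]) auto
      qed
    qed
  qed
  thus ?thesis unfolding degree_def by (rule bij_betw_same_card[symmetric])
qed

lemma vol_eq: "finite S \<Longrightarrow> vol E S = sg.volc S"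
proof (induction rule: finite_induct)
  case empty
  show ?case by (simp add: vol_def sg.volc_def)
next
  case (insert v S)
  have "{s. s < N \<and> sv s \<in> insert v S} = {s. s < N \<and> sv s = v} \<union> {s. s < N \<and> sv s \<in> S}" by auto
  moreover have "card ({s. s < N \<and> sv s = v} \<union> {s. s < N \<and> sv s \<in> S})
     = card {s. s < N \<and> sv s = v} + card {s. s < N \<and> sv s \<in> S}"
    using insert.hyps by (intro card_Un_disjoint) auto
  ultimately show ?case using insert by (simp add: vol_def sg.volc_def degree_eq)
qed

lemma volc_restrict: "sg.volc (S \<inter> {..<n}) = sg.volc S"
  unfolding sg.volc_def using sv_n by (intro arg_cong[where f = card]) auto

lemma vol_compl: "vol E ({..<n} - S) = sg.volc (- S)"
proof -
  have "{..<n} - S = - S \<inter> {..<n}" by auto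
  thus ?thesis using vol_eq[of "{..<n} - S"] volc_restrict[of "- S"] by simp
qed

lemma vol_all: "vol E {..<n} = N"
  using vol_eq[of "{..<n}"] volc_restrict[of UNIV] sg.volc_compl[of UNIV] by (simp add: sg.volc_def)

lemma cut_edges_eq: "card (cut_edges E S) = sg.cutc S"
proof -
  have "inj_on (\<lambda>e. {sv e, so e}) (cutI S)" using inj by (rule inj_on_subset) (auto simp: cutI_def)
  moreover have "(\<lambda>e. {sv e, so e}) ` cutI S = cut_edges E S"
  proof (intro equalityI subsetI)
    fix x assume "x \<in> (\<lambda>e. {sv e, so e}) ` cutI S"
    then obtain e where e: "e < m" "sv e \<in> S \<longleftrightarrow> so e \<notin> S" "x = {sv e, so e}" by (auto simp: cutI_def)
    have "\<exists>u v. x = {u, v} \<and> u \<in> S \<and> v \<notin> S"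
    proof (cases "sv e \<in> S")
      case True
      thus ?thesis using e by blast
    next
      case False
      thus ?thesis using e by (intro exI[of _ "so e"] exI[of _ "sv e"]) auto
    qed
    thus "x \<in> cut_edges E S" using e E by (auto simp: cut_edges_def)
  next
    fix x assume "x \<in> cut_edges E S"
    then obtain e u v where e: "e < m" "x = {sv e, so e}" "x = {u, v}" "u \<in> S" "v \<notin> S"
      using E by (auto simp: cut_edges_def)
    hence "e \<in> cutI S" by (auto simp: cutI_def doubleton_eq_iff)
    thus "x \<in> (\<lambda>e. {sv e, so e}) ` cutI S" using e by auto
  qed
  ultimately show ?thesis unfolding cutc_cutI by (metis card_image)
qed

lemma conductance_eq:
  assumes "S \<subseteq> {..<n}"
  shows "conductance {..<n} E S = real (sg.cutc S) / real (min (sg.volc S) (sg.volc (- S)))"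
  unfolding conductance_def using vol_eq[OF finite_subset[OF assms]] by (simp add: vol_compl cut_edges_eq)

text \<open>The cut is written only at vertices that occur in slots; elsewhere array 0 may still
  contain input data. The remaining vertices are isolated and affect neither volumes nor cut edges,
  so their side is immaterial.\<close>

lemma good_returned:
  assumes S: "sgood S" and r: "\<And>s'. s' < N \<Longrightarrow> iarr s 0 (sv s') = 1 \<longleftrightarrow> sv s' \<in> S" and nz: "ivar s 0 \<noteq> 0"
  shows "case returned n s of Some S \<Rightarrow>
                is_cut {..<n} S \<and> b * real (vol E {..<n}) \<le> real (vol E S) \<and>
                b * real (vol E {..<n}) \<le> real (vol E ({..<n} - S)) \<and> conductance {..<n} E S \<le> \<phi>
            | None \<Rightarrow> R"
proof -
  define S' where "S' = {v. v < n \<and> iarr s 0 v = 1}"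
  have ret: "returned n s = Some S'" using nz by (simp add: returned_def S'_def)
  have sub: "S' \<subseteq> {..<n}" by (auto simp: S'_def)
  have iff: "sv s' \<in> S' \<longleftrightarrow> sv s' \<in> S" if "s' < N" for s'
    using r[OF that] sv_n[OF that] by (simp add: S'_def)
  have v: "sg.volc S' = sg.volc S" "sg.volc (- S') = sg.volc (- S)"
    unfolding sg.volc_def using iff by (auto intro!: arg_cong[where f = card])
  have "so s' \<in> S' \<longleftrightarrow> so s' \<in> S" if "s' < N" for s'
    using iff[OF sg.pt_less[OF that]] sg.sv_pt[OF that] by simp
  hence c: "sg.cutc S' = sg.cutc S"
    unfolding sg.cutc_def using iff by (intro arg_cong[where f = card]) auto
  have g: "b * real N \<le> real (sg.volc S)" "b * real N \<le> real (sg.volc (- S))"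
     "real (sg.cutc S) \<le> \<phi> * real (sg.volc S)" "real (sg.cutc S) \<le> \<phi> * real (sg.volc (- S))"
    using S by (auto simp: sgood_def)
  have bN: "0 < b * real N" using b(1) N_pos by simp
  have pos: "0 < sg.volc S" "0 < sg.volc (- S)" using g(1,2) bN by (auto intro: gr0I)
  have "S' \<noteq> {}" using pos(1) unfolding v(1)[symmetric] by (auto simp: sg.volc_def)
  moreover have "S' \<noteq> {..<n}"
  proof
    assume "S' = {..<n}"
    hence "{s. s < N \<and> sv s \<in> - S'} = {}" by (auto dest!: sv_n)
    hence "sg.volc (- S') = 0" unfolding sg.volc_def by (simp only: card.empty)
    thus False using pos(2) v by simp
  qed
  ultimately have "is_cut {..<n} S'" using sub by (auto simp: is_cut_def)
  moreover have "conductance {..<n} E S' \<le> \<phi>"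
    unfolding conductance_eq[OF sub] v c using g(3,4) pos by (auto simp: min_def field_simps)
  ultimately show ?thesis
    using ret g vol_eq[OF finite_subset[OF sub]] vol_compl[of S'] v by (simp add: vol_all)
qed

lemma cert_conductance:
  assumes c: cert and X: "is_cut {..<n} X"
    and v: "8448 * b * real (vol E {..<n}) \<le> real (vol E X)" "8448 * b * real (vol E {..<n}) \<le> real (vol E ({..<n} - X))"
    and \<Lambda>: "\<And>g. 2 ^ g \<le> Bw \<Longrightarrow> 2 ^ g \<le> N + 1 \<Longrightarrow> real g + 1 \<le> \<Lambda>"
    and B: "528 * \<kappa> * \<Lambda> \<le> 1 / B" "0 < B"
  shows "B \<le> conductance {..<n} E X"
proof -
  have sub: "X \<subseteq> {..<n}" using X by (auto simp: is_cut_def)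
  have ve: "vol E X = sg.volc X" using vol_eq[OF finite_subset[OF sub]] by simp
  have v': "8448 * b * real N \<le> real (sg.volc X)" "8448 * b * real N \<le> real (sg.volc (- X))"
    using v by (simp_all add: vol_all ve vol_compl)
  have bN: "0 < 8448 * b * real N" using b(1) N_pos by simp
  have pos: "0 < sg.volc X" "0 < sg.volc (- X)" using v' bN by (auto intro: gr0I)
  let ?M = "real (min (sg.volc X) (sg.volc (- X)))"
  have M: "0 < ?M" using pos by simp
  have "?M \<le> 528 * \<kappa> * \<Lambda> * real (sg.cutc X)" using c v' \<Lambda> unfolding cert_def by blast
  also have "\<dots> \<le> 1 / B * real (sg.cutc X)" using B(1) by (intro mult_right_mono) auto
  finally have "B * ?M \<le> real (sg.cutc X)" using B(2) by (simp add: field_simps)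
  thus ?thesis unfolding conductance_eq[OF sub] using M by (simp add: field_simps)
qed

end

text \<open>Quantifying over \<Lambda> and B keeps the numerical estimates apart from the run: the
  two bounds on conductance are two instances of the same statement.\<close>

definition outcome :: "nat \<Rightarrow> nat set set \<Rightarrow> real \<Rightarrow> real \<Rightarrow> real \<Rightarrow> real \<Rightarrow> mstate \<Rightarrow> bool" where
  "outcome n E \<phi> b \<kappa> M s \<longleftrightarrow>
     (case returned n s of Some S \<Rightarrow>
        is_cut {..<n} S \<and> b * real (vol E {..<n}) \<le> real (vol E S) \<and>
        b * real (vol E {..<n}) \<le> real (vol E ({..<n} - S)) \<and> conductance {..<n} E S \<le> \<phi>
      | None \<Rightarrow> \<forall>X \<Lambda> B. is_cut {..<n} X \<and> 8448 * b * real (vol E {..<n}) \<le> real (vol E X) \<and>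
          8448 * b * real (vol E {..<n}) \<le> real (vol E ({..<n} - X)) \<and>
          (\<forall>g. 2 ^ g \<le> M \<and> 2 ^ g \<le> 2 * real (card E) + 1 \<longrightarrow> real g + 1 \<le> \<Lambda>) \<and>
          528 * \<kappa> * \<Lambda> \<le> 1 / B \<and> 0 < B \<longrightarrow> B \<le> conductance {..<n} E X)"

context run begin

lemma res_outcome:
  assumes "res s" shows "outcome n E \<phi> b \<kappa> Bw s"
proof (cases "ivar s 0 = 0")
  case True
  have "B \<le> conductance {..<n} E X" if "is_cut {..<n} X" "8448 * b * real (vol E {..<n}) \<le> real (vol E X)"
    "8448 * b * real (vol E {..<n}) \<le> real (vol E ({..<n} - X))"
    "\<forall>g. 2 ^ g \<le> Bw \<and> 2 ^ g \<le> 2 * real (card E) + 1 \<longrightarrow> real g + 1 \<le> \<Lambda>"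
    "528 * \<kappa> * \<Lambda> \<le> 1 / B" "0 < B" for X \<Lambda> B
  proof (rule cert_conductance[OF _ that(1-3) _ that(5,6)])
    show cert using assms True by (simp add: res_def)
    fix g :: nat assume g: "2 ^ g \<le> Bw" "2 ^ g \<le> N + 1"
    have "card E = m" unfolding E using inj by (simp add: card_image)
    moreover have "real (2 ^ g) \<le> real (N + 1)" using g(2) by (rule of_nat_mono)
    ultimately have "2 ^ g \<le> 2 * real (card E) + 1" by (simp add: N)
    thus "real g + 1 \<le> \<Lambda>" using that(4) g(1) by simp
  qed
  thus ?thesis using True by (auto simp: outcome_def returned_def)
next
  case False
  then obtain S where "sgood S" "\<forall>s'<N. iarr s 0 (sv s') = 1 \<longleftrightarrow> sv s' \<in> S" using assms by (auto simp: res_def)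
  thus ?thesis unfolding outcome_def using good_returned[of S s] False by blast
qed

lemma wp_param:
  assumes pre: "ivar s 0 \<noteq> 0" "ivar s 1 = m" "ivar s 2 = n" "ivar s 3 = N" "ivar s 6 = l" "ivar s 9 = Jm"
      "rvar s 0 = \<alpha>" "rvar s 1 = \<phi>" "rvar s 2 = b"
      "iarr s 2 = sv" "iarr s 3 = so" "iarr s 4 = hd" "iarr s 5 = nx" "iarr s 6 = eid"
      "iarr s 13 = (\<lambda>_. 0)" "iarr s 14 = (\<lambda>_. 0)" "iarr s 8 = (\<lambda>_. 0)" "iarr s 9 = (\<lambda>_. 0)"
      "\<And>e. e < m \<Longrightarrow> iarr s 7 e = 1" "\<And>e. e < m \<Longrightarrow> rarr s 0 e = 1" "dstr s = None"
    and T: "5 + real m \<le> T" "0 \<le> q"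
    and post: "\<And>s'. \<lbrakk>renv 1 s'; wst (iarr s 7) (\<lambda>_. 0) (\<lambda>_. 0) s'; ivar s' 5 = ivar s 5\<rbrakk> \<Longrightarrow> Q s' (T - (5 + real m)) q"
  shows "wp D Wd param_prog Q s T q"
proof -
  let ?s = "set_ivar 12 1 (set_rvar 4 \<kappa> (set_ivar 8 1 (set_rvar 3 Lb s)))"
  define g where "g = array_graph ?s n m 2 3 0"
  have gE: "nverts g = n" "edges g = E" using pre by (simp_all add: g_def array_graph_def E)
  have gw: "wt g {sv e, so e} = 1" if "e < m" for e
  proof -
    \<comment> \<open>\<open>array_graph\<close> adds up the weights of all entries that name the
      same edge; by injectivity there is only one.\<close>
    have "{i. i < m \<and> {sv i, so i} = {sv e, so e}} = {e}" using inj that by (auto simp: inj_on_def)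
    thus ?thesis using pre that by (simp add: g_def array_graph_def)
  qed
  have "simple_graph {..<n} E" using ends unfolding simple_graph_def E by fastforce
  hence wf: "wf_wgraph g" unfolding wf_wgraph_def gE using gw by (auto simp: E)
  have ds: "dsok (iarr s 7) (Some (g, []))"
    unfolding dsok_def using wf gE gw pre(19) by (auto simp: current_def)
  let ?s' = "?s\<lparr>dstr := Some (g, [])\<rparr>"
  have "renv 1 ?s'" "wst (iarr s 7) (\<lambda>_. 0) (\<lambda>_. 0) ?s'" using pre ds by (simp_all add: renv_def wst_def)
  hence Q: "Q ?s' (T - 4 - (1 + real m)) q" using post[of ?s'] by (simp add: algebra_simps)
  have "wp D Wd (DSInit (V 2) (V 1) 2 3 0) Q ?s (T - 4) q"
    by (rule wp_DSInit[where g = g]) (use Q pre Wd wf inj T in \<open>auto simp: g_def\<close>)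
  moreover have "126 * real l / \<phi> = Lb" "8 * \<alpha> * Lb * real Jm = \<kappa>" using Lb kap by simp_all
  moreover have "1 \<le> Wd" using Wd by simp
  ultimately show ?thesis unfolding param_prog_def using pre T by (simp add: wp_simps)
qed

end

section \<open>The complete run on a graph with edges\<close>

context input begin

text \<open>The bound \<open>lm\<close> on the logarithm l makes it possible to state the time
  allowance before the program has computed l.\<close>

lemma wp_main:
  assumes pre: "s = \<lparr>ivar = (\<lambda>_. 0)(0 := n, 1 := m), rvar = (\<lambda>_. 0)(0 := \<alpha>, 1 := \<phi>, 2 := b),
        iarr = (\<lambda>_ _. 0)(0 := a0, 1 := a1), rarr = (\<lambda>_ _. 0), dstr = None\<rparr>"
      "\<And>e. e < m \<Longrightarrow> a0 e = fu e \<and> a1 e = fv e"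
    and G: "1 \<le> m" "E = (\<lambda>e. {fu e, fv e}) ` {..<m}" and D: "approx_apsp \<alpha> D" "1 \<le> \<alpha>" and phi: "0 < \<phi>" "\<phi> \<le> 1"
    and J: "0 < b" "1 \<le> Jm" "4 * 2 ^ (Jm - 1) * b \<le> 1" "1 < 8 * 2 ^ (Jm - 1) * b"
    and big: "2 * n + 1 \<le> W" "16 * m + 16 \<le> W" "2 ^ Jm \<le> W" "8 * (2 * m + 1) * (2 ^ (Jm - 1) + 1) \<le> W"
    and lm: "\<And>l. 2 ^ l \<le> 8 * (2 * m) \<Longrightarrow> real l \<le> lm"
    and T: "30 + 392 * real m + 3 * real Jm + real Jm * (10 + 176 * real m * (\<alpha> * (126 * lm / \<phi>))) \<le> T" "64 * real m \<le> q"
    and post: "\<And>s' T' q' l. \<lbrakk>1 \<le> l; real l \<le> lm;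
       outcome n E \<phi> b (8 * \<alpha> * (126 * real l / \<phi>) * real Jm) (2 * (\<alpha> * (126 * real l / \<phi>) * 2 ^ (Jm - 1))) s'\<rbrakk> \<Longrightarrow> Q s' T' q'"
  shows "wp D W main_prog Q s T q"
proof -
  have lm0: "0 \<le> lm" using lm[of 0] G(1) by simp
  have "0 \<le> real Jm * (10 + 176 * real m * (\<alpha> * (126 * lm / \<phi>)))" using lm0 D phi by simp
  hence Tm: "30 + 392 * real m + 3 * real Jm \<le> T" using T(1) by linarith
  have q0: "0 \<le> q" using T(2) by (rule order.trans[rotated]) simp
  have n0: "n \<noteq> 0" using ends(1)[of 0] G(1) by auto
  have "wp D W (slots_prog;; side_prog;; log_prog;; levels_prog;; param_prog;; demands_prog;; loop_prog) Q s (T - 1) q"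
    unfolding wp_Seq wp_Seq_fun
  proof (rule wp_slots)
    fix s1 T1 assume s1: "ivar s1 2 = n" "ivar s1 3 = 2 * m" "frame (set_ivar 3 (2 * m) (set_ivar 2 n s)) s1"
      "filled m s1" "T - 1 - (4 + 16 * real m) \<le> T1"
    have fr: "ivar s1 0 = n" "ivar s1 1 = m" "rvar s1 0 = \<alpha>" "rvar s1 1 = \<phi>" "rvar s1 2 = b" "iarr s1 8 = (\<lambda>_. 0)"
      "iarr s1 9 = (\<lambda>_. 0)" "iarr s1 13 = (\<lambda>_. 0)" "iarr s1 14 = (\<lambda>_. 0)" "dstr s1 = None"
      using s1(3) by (simp_all add: frame_def pre(1))
    show "wp D W side_prog (wp D W log_prog (wp D W levels_prog (wp D W param_prog (wp D W demands_prog
        (wp D W loop_prog Q))))) s1 T1 q"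
    proof (rule wp_side[OF s1(2)])
      fix s2 T2 k assume s2: "agree {5} s1 s2" "ivar s2 5 = k" "0 < k" "2 * m \<le> k * k" "k * k \<le> 2 * (2 * m)"
        "T1 - (4 + 2 * real (2 * m)) \<le> T2"
      show "wp D W log_prog (wp D W levels_prog (wp D W param_prog (wp D W demands_prog (wp D W loop_prog Q)))) s2 T2 q"
      proof (rule wp_log[where N = "2 * m"])
        fix s3 T3 l assume s3: "agree {6, 7} s2 s3" "ivar s3 6 = l" "4 * (2 * m) \<le> 2 ^ l" "2 ^ l \<le> 8 * (2 * m)"
          "T2 - (6 + 24 * real (2 * m)) \<le> T3"
        show "wp D W levels_prog (wp D W param_prog (wp D W demands_prog (wp D W loop_prog Q))) s3 T3 q"
        proof (rule wp_levels[OF _ J(1,2,3,4) big(3)])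
          fix s4 T4 assume s4: "agree {8, 9} s3 s4" "ivar s4 9 = Jm" "T3 - (3 + 3 * real Jm) \<le> T4"
          have ag: "ivar s4 x = ivar s1 x" if "x < 5" for x
            using s2(1) s3(1) s4(1) that by (simp add: agree_def)
          have ag': "rvar s4 = rvar s1" "iarr s4 = iarr s1" "rarr s4 = rarr s1" "dstr s4 = dstr s1" "ivar s4 5 = k" "ivar s4 6 = l"
            using s2(1,2) s3(1,2) s4(1) by (simp_all add: agree_def)
          let ?sv = "iarr s1 2" and ?so = "iarr s1 3"
          obtain adj where adj: "\<And>v. chain (iarr s1 5) (iarr s1 4 v) (adj v)" "\<And>v. distinct (adj v)"
            "\<And>v. set (adj v) = {s. (s < m \<or> m \<le> s \<and> s < m + m) \<and> slot_vertex s = v}"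
            using s1(4) unfolding filled_def by blast
          have fl: "?sv e = fu e" "?so e = fv e" "?sv (m + e) = fv e" "?so (m + e) = fu e"
             "iarr s1 6 (fu e * n + fv e) = e" "iarr s1 6 (fv e * n + fu e) = e" "iarr s1 7 e = 1" "rarr s1 0 e = 1"
            if "e < m" for e using s1(4) that unfolding filled_def by blast+
          have svs: "?sv t = slot_vertex t" if "t < 2 * m" for t
          proof (cases "t < m")
            case True
            thus ?thesis using fl(1) by (simp add: slot_vertex_def)
          next
            case False
            thus ?thesis using fl(3)[of "t - m"] that by (simp add: slot_vertex_def)
          qed
          have l1: "1 \<le> l" using s3(3) G(1) by (cases l) auto
          have ll: "real l \<le> lm" using lm s3(4) by simp
          define Lb where "Lb = 126 * real l / \<phi>"
          have "126 * 1 \<le> 126 * real l" using l1 by simp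
          hence "1 * \<phi> \<le> 126 * real l" using phi by linarith
          hence Lb1: "1 \<le> Lb" unfolding Lb_def using phi(1) by (simp add: field_simps)
          \<comment> \<open>Only at this state are k, l and the adjacency lists known; the arrays
            filled by \<open>slots_prog\<close> become the parameters of the locale.\<close>
          interpret run n m ?sv ?so "iarr s1 6" E D W \<alpha> "8 * \<alpha> * Lb * real Jm" "2 * m" \<phi> b Lb "iarr s1 4" "iarr s1 5" adj k l Jm
          proof
            show "E = (\<lambda>e. {?sv e, ?so e}) ` {..<m}" unfolding G(2) using fl by (intro image_cong) auto
            show "inj_on (\<lambda>e. {?sv e, ?so e}) {..<m}" using inj fl by (simp add: inj_on_def)
            have "1 * 1 * 1 * 1 \<le> 8 * \<alpha> * Lb * real Jm" using D Lb1 J(2) by (intro mult_mono) auto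
            thus "1 \<le> 8 * \<alpha> * Lb * real Jm" by simp
            show "set (adj v) = {s. s < 2 * m \<and> ?sv s = v}" for v using svs by (auto simp: adj(3))
          qed (use G D phi J big adj s2 s3 fl ends Lb_def in auto)
          have T4: "T - (18 + 68 * real m + 3 * real Jm) \<le> T4"
            using s1(5) s2(6) s3(5) s4(3) by simp
          show "wp D W param_prog (wp D W demands_prog (wp D W loop_prog Q)) s4 T4 q"
          proof (rule wp_param)
            fix s5 assume s5: "renv 1 s5" "wst (iarr s4 7) (\<lambda>_. 0) (\<lambda>_. 0) s5" "ivar s5 5 = ivar s4 5"
            show "wp D W demands_prog (wp D W loop_prog Q) s5 (T4 - (5 + real m)) q"
            proof (rule wp_demands[OF s5(1,2)])
              fix s6 T6 assume s6: "renv 1 s6" "wst (iarr s4 7) (\<lambda>_. 0) (\<lambda>_. 0) s6" "lst L0 s6"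
                "T4 - (5 + real m) - (3 + 26 * real (2 * m)) \<le> T6"
              show "wp D W loop_prog Q s6 T6 q"
              proof (rule wp_loop[OF s6(1-3)])
                show "iarr s4 7 e = 1" if "e < m" for e using fl(7)[OF that] ag' by simp
                have "Lb \<le> 126 * lm / \<phi>" unfolding Lb_def using ll phi by (intro divide_right_mono) auto
                hence "\<alpha> * Lb \<le> \<alpha> * (126 * lm / \<phi>)" using D by (intro mult_left_mono) auto
                hence "176 * real m * (\<alpha> * Lb) \<le> 176 * real m * (\<alpha> * (126 * lm / \<phi>))" by (rule mult_left_mono) simp
                moreover have "level_cost = 10 + 176 * real m * (\<alpha> * Lb)" by (simp add: level_cost_def)
                ultimately have "level_cost \<le> 10 + 176 * real m * (\<alpha> * (126 * lm / \<phi>))" by linarith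
                hence "real Jm * level_cost \<le> real Jm * (10 + 176 * real m * (\<alpha> * (126 * lm / \<phi>)))"
                  by (rule mult_left_mono) simp
                thus "3 + real Jm * level_cost + 135 * real (2 * m) \<le> T6" using T(1) T4 s6(4) by simp
                show "32 * real (2 * m) \<le> q" using T(2) by simp
                fix s' T' q' assume "res s'"
                from res_outcome[OF this, unfolded Bw_def, unfolded Lb_def] show "Q s' T' q'"
                  by (rule post[OF l1 ll])
              qed
            qed (use T4 Tm q0 s5 ag' in auto)
          qed (use fr ag ag' s1(1,2) s4(2) n0 fl T4 Tm q0 in auto)
        qed (use fr s2 s3 s1 Tm q0 in \<open>auto simp: agree_def\<close>)
      qed (use s1 s2 Tm q0 big G in \<open>auto simp: agree_def\<close>)
    qed (use s1 Tm q0 big G in auto)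
  qed (use pre Tm q0 in auto)
  thus ?thesis unfolding main_prog_def using G Tm by (simp add: wp_Cond pre(1))
qed

end

section \<open>Numerical bounds\<close>

lemma ln2_ge_half: "1 / 2 \<le> ln (2::real)"
proof -
  have "exp (1 / 2 :: real) ^ 2 = exp 1" by (simp flip: exp_of_nat_mult)
  also have "\<dots> \<le> 2 ^ 2" using exp_le by simp
  finally have "exp (1 / 2 :: real) \<le> 2" by (rule power2_le_imp_le) simp
  thus ?thesis by (subst ln_ge_iff) simp_all
qed

text \<open>Passing from binary to natural logarithms costs a factor 2, since ln 2 \<ge>
  1/2.\<close>

lemma power2_log_bound:
  fixes x :: real
  assumes "2 ^ g \<le> x ^ k" "1 \<le> x" shows "real g \<le> 2 * real k * ln x"
proof -
  have "real g * ln 2 = ln (2 ^ g)" by (simp add: ln_realpow)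
  also have "\<dots> \<le> ln (x ^ k)" using assms(1) by (rule ln_mono) simp_all
  also have "\<dots> = real k * ln x" using assms(2) by (simp add: ln_realpow)
  finally have "real g * ln 2 \<le> real k * ln x" .
  moreover have "real g * (1 / 2) \<le> real g * ln 2" using ln2_ge_half by (intro mult_left_mono) auto
  ultimately show ?thesis by simp
qed

lemma ln_ge_1: "4 \<le> x \<Longrightarrow> 1 \<le> ln x" for x :: real
proof -
  assume x: "4 \<le> x"
  have "ln (4::real) = 2 * ln 2" using ln_realpow[of "2::real" 2] by simp
  moreover have "ln 4 \<le> ln x" using x by simp
  ultimately show ?thesis using ln2_ge_half by linarith
qed

text \<open>A nonempty range for b forces n \<ge> 4, so that ln n, ln (1 / b) and the innermost
  logarithm are all at least 1 and constants can be absorbed.\<close>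

locale params =
  fixes n m :: nat and \<alpha> \<phi> b :: real and Jm :: nat
  assumes m: "1 \<le> m" "m \<le> n * n" and alpha: "1 \<le> \<alpha>" and phi: "0 < \<phi>" "\<phi> \<le> 1"
    and b: "0 < n" "1 / real n \<le> b" "b \<le> 1 / 4" and Jm: "1 \<le> Jm" "4 * 2 ^ (Jm - 1) * b \<le> 1"
begin

lemma n4: "4 \<le> n"
proof -
  have "1 / real n \<le> 1 / 4" using b by linarith
  hence "4 \<le> real n" using b(1) by (simp add: field_simps)
  thus ?thesis by simp
qed

lemma b0: "0 < b" using b by (meson divide_pos_pos less_le_trans of_nat_0_less_iff zero_less_one)

lemma L1: "1 \<le> ln (real n)" using n4 by (intro ln_ge_1) simp

lemma lb: "1 \<le> ln (1 / b)" "ln (1 / b) \<le> ln (real n)"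
proof -
  show "1 \<le> ln (1 / b)" using b b0 by (intro ln_ge_1) (simp add: field_simps)
  have "1 / b \<le> real n" using b b0 by (simp add: field_simps)
  thus "ln (1 / b) \<le> ln (real n)" using b0 by (intro ln_mono) auto
qed

lemma Jm_le: "real Jm \<le> 2 * ln (1 / b)"
proof -
  have "(2::real) ^ Jm = 2 * 2 ^ (Jm - 1)" using Jm(1) by (cases Jm) auto
  moreover have "0 < 2 ^ (Jm - 1) * b" using b0 by simp
  ultimately have "2 ^ Jm * b \<le> 1" using Jm(2) by simp
  hence "2 ^ Jm \<le> (1 / b) ^ 1" using b0 by (simp add: field_simps)
  from power2_log_bound[OF this] show ?thesis using b b0 by (simp add: field_simps)
qed

lemma sq: "4 * real n \<le> real n * real n" "16 \<le> real n * real n"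
  using n4 mult_mono[of 4 "real n" 4 "real n"] by (simp_all add: mult_right_mono)

lemma m_sq: "real m \<le> real n * real n" using m(2) by (metis of_nat_le_iff of_nat_mult)

lemma l_le: assumes "2 ^ l \<le> 8 * (2 * m)" shows "real l \<le> 8 * ln (real n)"
proof -
  have "real (2 ^ l) \<le> real (8 * (2 * m))" using assms by (rule of_nat_mono)
  hence "2 ^ l \<le> 16 * (real n * real n)" using m_sq by simp
  also have "\<dots> \<le> (real n * real n) * (real n * real n)" using sq by (intro mult_right_mono) auto
  also have "\<dots> = real n ^ 4" by (simp add: power4_eq_xxxx mult.assoc)
  finally show ?thesis using power2_log_bound[of l "real n" 4] n4 by simp
qed

text \<open>With m \<le> n^2 and 4 * 2^(\<open>Jm\<close> - 1) \<le> n the quantities are O(n^3),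
  and n^3 \<ge> 64 lets n^6 absorb the constants.\<close>

lemma big: "2 * n + 1 \<le> n ^ 6" "16 * m + 16 \<le> n ^ 6" "2 ^ Jm \<le> n ^ 6" "8 * (2 * m + 1) * (2 ^ (Jm - 1) + 1) \<le> n ^ 6"
proof -
  define P :: nat where "P = 2 ^ (Jm - 1)"
  have "4 * 2 ^ (Jm - 1) * (1 / real n) \<le> 4 * 2 ^ (Jm - 1) * b" using b by (intro mult_left_mono) auto
  hence "4 * 2 ^ (Jm - 1) * (1 / real n) \<le> 1" using Jm(2) by linarith
  hence "4 * 2 ^ (Jm - 1) \<le> real n" using b(1) by (simp add: field_simps)
  hence "real (4 * P) \<le> real n" by (simp add: P_def)
  hence P: "4 * P \<le> n" by (simp only: of_nat_le_iff)
  have 3: "64 \<le> n * n * n" using mult_mono[OF mult_mono[OF n4 n4] n4] by simp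
  have 6: "n ^ 6 = (n * n * n) * (n * n * n)" by (simp add: power_def numeral_eq_Suc)
  have "64 * (n * n * n) \<le> n ^ 6" unfolding 6 using 3 by (rule mult_right_mono) simp
  moreover have nn: "4 * n \<le> n * n" "4 * (n * n) \<le> n * n * n" using n4 by (simp_all add: mult_right_mono)
  ultimately show "2 * n + 1 \<le> n ^ 6" "16 * m + 16 \<le> n ^ 6" using m n4 by linarith+
  have "2 ^ Jm = 2 * P" unfolding P_def using Jm(1) by (cases Jm) auto
  thus "2 ^ Jm \<le> n ^ 6" using P nn \<open>64 * (n * n * n) \<le> n ^ 6\<close> by linarith
  have "2 * m + 1 \<le> 3 * (n * n)" using m by linarith
  hence "8 * (2 * m + 1) \<le> 8 * (3 * (n * n))" by (rule mult_left_mono) simp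
  hence "8 * (2 * m + 1) \<le> 24 * (n * n)" by simp
  moreover have "P + 1 \<le> n" using P n4 by linarith
  ultimately have "8 * (2 * m + 1) * (P + 1) \<le> 24 * (n * n) * n" by (rule mult_mono) simp_all
  also have "\<dots> \<le> n ^ 6" using \<open>64 * (n * n * n) \<le> n ^ 6\<close> by (simp add: mult.assoc)
  finally show "8 * (2 * m + 1) * (2 ^ (Jm - 1) + 1) \<le> n ^ 6" by (simp add: P_def)
qed

lemma kappa_le:
  assumes "real l \<le> 8 * ln (real n)"
  shows "8 * \<alpha> * (126 * real l / \<phi>) * real Jm \<le> 16128 * (\<alpha> * ln (real n) * ln (1 / b) / \<phi>)"
proof -
  have "real l * real Jm \<le> (8 * ln (real n)) * (2 * ln (1 / b))"
    using assms Jm_le L1 lb by (intro mult_mono) auto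
  hence "1008 * \<alpha> / \<phi> * (real l * real Jm) \<le> 1008 * \<alpha> / \<phi> * ((8 * ln (real n)) * (2 * ln (1 / b)))"
    using alpha phi by (intro mult_left_mono) auto
  thus ?thesis by (simp add: mult_ac)
qed

lemma x_ge: "4 \<le> ln (real n) * \<alpha> / (b * \<phi>)"
proof -
  have "b * \<phi> \<le> 1 / 4 * 1" using b phi b0 by (intro mult_mono) auto
  moreover have "1 * 1 \<le> ln (real n) * \<alpha>" using L1 alpha by (intro mult_mono) auto
  ultimately have "4 * (b * \<phi>) \<le> ln (real n) * \<alpha>" by linarith
  thus ?thesis using b0 phi by (simp add: le_divide_eq)
qed

text \<open>With x for the argument of the outer logarithm, the weight limit is at most 504 x, and
  504 \<le> 4^5 \<le> x^5. So 2^g \<le> x^6, hence g \<le> 12 ln x.\<close>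

lemma levels_le:
  assumes l: "real l \<le> 8 * ln (real n)" and g: "2 ^ g \<le> 2 * (\<alpha> * (126 * real l / \<phi>) * 2 ^ (Jm - 1))"
  shows "real g + 1 \<le> 13 * ln (ln (real n) * \<alpha> / (b * \<phi>))"
proof -
  define x where "x = ln (real n) * \<alpha> / (b * \<phi>)"
  have x: "4 \<le> x" using x_ge by (simp add: x_def)
  have P: "2 ^ (Jm - 1) \<le> 1 / (4 * b)" using Jm(2) b0 by (simp add: field_simps)
  have "252 * \<alpha> / \<phi> * (real l * 2 ^ (Jm - 1)) \<le> 252 * \<alpha> / \<phi> * ((8 * ln (real n)) * (1 / (4 * b)))"
    using l P alpha phi L1 by (intro mult_left_mono mult_mono) auto
  also have "\<dots> = 504 * x" using b0 phi by (simp add: x_def field_simps)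
  finally have "2 ^ g \<le> 504 * x" using g by (simp add: mult_ac)
  also have "\<dots> \<le> x ^ 5 * x" 
  proof (rule mult_right_mono)
    have "(4::real) ^ 5 \<le> x ^ 5" using x by (intro power_mono) auto
    thus "504 \<le> x ^ 5" by simp
  qed (use x in simp)
  also have "\<dots> = x ^ 6" by (simp add: numeral_eq_Suc)
  finally have "real g \<le> 2 * real 6 * ln x" using x by (intro power2_log_bound) auto
  moreover have "1 \<le> ln x" using x by (rule ln_ge_1)
  ultimately show ?thesis unfolding x_def by simp
qed

text \<open>This is the limit from the total weight: 2 m + 1 \<le> 4 n^2 \<le> n^3.\<close>

lemma levels_le':
  assumes g: "2 ^ g \<le> 2 * real m + 1" shows "real g + 1 \<le> 7 * ln (real n)"
proof -
  have "2 ^ g \<le> 4 * (real n * real n)" using g m_sq sq by linarith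
  also have "\<dots> \<le> real n * (real n * real n)" using n4 by (intro mult_right_mono) auto
  also have "\<dots> = real n ^ 3" by (simp add: power3_eq_cube)
  finally have "real g \<le> 2 * real 3 * ln (real n)" using n4 by (intro power2_log_bound) auto
  thus ?thesis using L1 by simp
qed

text \<open>528 * 16128 * 13 = 110702592 is below 2 * 10^8. For the cubic form 7 ln n takes the
  place of 13 ln x, ln (1 / b) is bounded by ln n, and the same constant suffices.\<close>

lemma conductance_const:
  fixes c2 :: real and l :: nat
  assumes l: "real l \<le> 8 * ln (real n)" and c2: "0 < c2" "c2 * 200000000 \<le> 1"
  defines "\<kappa> \<equiv> 8 * \<alpha> * (126 * real l / \<phi>) * real Jm"
  shows "528 * \<kappa> * (13 * ln (ln (real n) * \<alpha> / (b * \<phi>)))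
       \<le> 1 / (\<phi> * (c2 / (\<alpha> * ln (real n) * ln (1 / b) * ln (ln (real n) * \<alpha> / (b * \<phi>)))))" (is ?A)
    and "528 * \<kappa> * (7 * ln (real n)) \<le> 1 / (\<phi> * (c2 / (\<alpha> * ln (real n) ^ 3)))" (is ?B)
    and "0 < \<phi> * (c2 / (\<alpha> * ln (real n) * ln (1 / b) * ln (ln (real n) * \<alpha> / (b * \<phi>))))" (is ?C)
    and "0 < \<phi> * (c2 / (\<alpha> * ln (real n) ^ 3))" (is ?D)
proof -
  define y where "y = ln (ln (real n) * \<alpha> / (b * \<phi>))"
  have y: "1 \<le> y" unfolding y_def by (rule ln_ge_1[OF x_ge])
  have k: "\<kappa> \<le> 16128 * (\<alpha> * ln (real n) * ln (1 / b) / \<phi>)" unfolding \<kappa>_def by (rule kappa_le[OF l])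
  have c: "200000000 \<le> 1 / c2" using c2 by (simp add: le_divide_eq mult.commute)
  hence c': "110702592 \<le> 1 / c2" by linarith
  let ?a = "\<alpha> * ln (real n) * ln (1 / b) / \<phi>"
  have a0: "0 \<le> ?a" using alpha L1 lb phi by simp
  have "528 * \<kappa> * (13 * y) \<le> 528 * (16128 * ?a) * (13 * y)" using k y by (intro mult_right_mono mult_left_mono) auto
  also have "\<dots> = 110702592 * (?a * y)" by simp
  also have "\<dots> \<le> 1 / c2 * (?a * y)" using y by (intro mult_right_mono[OF c'] mult_nonneg_nonneg[OF a0]) simp
  also have "\<dots> = 1 / (\<phi> * (c2 / (\<alpha> * ln (real n) * ln (1 / b) * y)))" by simp
  finally show ?A by (simp add: y_def)
  have "528 * \<kappa> * (7 * ln (real n)) \<le> 528 * (16128 * ?a) * (7 * ln (real n))"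
    using k L1 by (intro mult_right_mono mult_left_mono) auto
  also have "\<dots> = 59609088 * (\<alpha> * ln (real n) * ln (real n) / \<phi>) * ln (1 / b)" by simp
  also have "\<dots> \<le> 1 / c2 * (\<alpha> * ln (real n) * ln (real n) / \<phi>) * ln (real n)"
  proof (rule mult_mono)
    have "0 \<le> \<alpha> * ln (real n) * ln (real n) / \<phi>" using alpha phi L1 by simp
    thus "59609088 * (\<alpha> * ln (real n) * ln (real n) / \<phi>) \<le> 1 / c2 * (\<alpha> * ln (real n) * ln (real n) / \<phi>)"
      using c by (intro mult_right_mono) auto
    show "0 \<le> 1 / c2 * (\<alpha> * ln (real n) * ln (real n) / \<phi>)" using alpha phi L1 c2 by simp
  qed (use lb in auto)
  also have "\<dots> = 1 / (\<phi> * (c2 / (\<alpha> * ln (real n) ^ 3)))" by (simp add: power3_eq_cube mult_ac)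
  finally show ?B .
  have l0: "0 < ln (real n)" "0 < ln (1 / b)" "0 < y" using L1 lb y by linarith+
  show ?C unfolding y_def[symmetric] using l0 alpha phi c2 by (intro mult_pos_pos divide_pos_pos) auto
  show ?D using l0 alpha phi c2 by (intro mult_pos_pos divide_pos_pos) auto
qed

text \<open>Routing dominates, with 176 * 126 * 8 = 177408 per level; one logarithm comes from the
  length limit and one from the number of levels, at most 2 ln n.\<close>

lemma time_le:
  "30 + 392 * real m + 3 * real Jm + real Jm * (10 + 176 * real m * (\<alpha> * (126 * (8 * ln (real n)) / \<phi>)))
     \<le> 400000 * (\<alpha> * real m / \<phi> * ln (real n) ^ 3)"
proof -
  define L where "L = ln (real n)"
  define Z where "Z = \<alpha> * real m / \<phi>"
  have L: "1 \<le> L" using L1 by (simp add: L_def)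
  have L2: "L \<le> L ^ 3" "L ^ 2 \<le> L ^ 3" using power_increasing[of 1 3 L] power_increasing[of 2 3 L] L by simp_all
  have J: "real Jm \<le> 2 * L" using Jm_le lb(2) by (simp add: L_def)
  have "real m * \<phi> \<le> real m * \<alpha>" using alpha phi by (intro mult_left_mono) auto
  hence mZ: "real m \<le> Z" unfolding Z_def using phi by (simp add: le_divide_eq mult_ac)
  have Z1: "1 \<le> Z" using mZ m by linarith
  have ZL: "Z \<le> Z * L ^ 3" "L ^ 3 \<le> Z * L ^ 3" "Z * L ^ 2 \<le> Z * L ^ 3"
    using L L2 Z1 by (simp_all add: mult_le_cancel_left1 mult_le_cancel_right1 mult_left_mono)
  have "real Jm * (177408 * (Z * L)) \<le> 2 * L * (177408 * (Z * L))"
    using J Z1 L by (intro mult_right_mono) auto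
  also have "\<dots> = 354816 * (Z * L ^ 2)" by (simp add: power2_eq_square)
  finally have "real Jm * (177408 * (Z * L)) \<le> 354816 * (Z * L ^ 2)" .
  hence "30 + 392 * real m + 3 * real Jm + (real Jm * 10 + real Jm * (177408 * (Z * L))) \<le> 400000 * (Z * L ^ 3)"
    using ZL mZ Z1 J L2 by linarith
  hence "30 + 392 * real m + 3 * real Jm + real Jm * (10 + 177408 * (Z * L)) \<le> 400000 * (Z * L ^ 3)"
    by (simp only: distrib_left)
  moreover have "176 * real m * (\<alpha> * (126 * (8 * L) / \<phi>)) = 177408 * (Z * L)" by (simp add: Z_def)
  ultimately show ?thesis unfolding L_def[symmetric] Z_def[symmetric] by (simp only:)
qed

end

text \<open>For the least j with 8 * 2^j b > 1, minimality gives 4 * 2^j b \<le> 1, and b \<le> 1/4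
  settles j = 0.\<close>

lemma exists_levels:
  fixes b :: real
  assumes "0 < b" "b \<le> 1 / 4"
  obtains Jm :: nat where "1 \<le> Jm" "4 * 2 ^ (Jm - 1) * b \<le> 1" "1 < 8 * 2 ^ (Jm - 1) * b"
proof -
  define j where "j = (LEAST j. 1 < 8 * 2 ^ j * b)"
  obtain i :: nat where "1 / (8 * b) < 2 ^ i" using real_arch_pow[of 2] by auto
  hence "1 < 8 * 2 ^ i * b" using assms(1) by (simp add: field_simps)
  hence j: "1 < 8 * 2 ^ j * b" unfolding j_def by (rule LeastI)
  have "4 * 2 ^ j * b \<le> 1"
  proof (cases j)
    case 0
    thus ?thesis using assms(2) by simp
  next
    case (Suc i)
    hence "\<not> 1 < 8 * 2 ^ i * b" unfolding j_def using not_less_Least by (metis lessI)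
    thus ?thesis using Suc by simp
  qed
  thus ?thesis using that[of "Suc j"] j by simp
qed

text \<open>The result flag still holds n, which is not 0, and array 0 is all zero, so a single
  assignment returns the cut {0}.\<close>

lemma exec_main_prog_edgeless:
  assumes "0 < n"
  shows "exec D (n ^ k) main_prog (input_state n [] \<alpha> \<phi> b) 2 0 0 (set_iarr 0 0 1 (input_state n [] \<alpha> \<phi> b))"
proof -
  have "exec D (n ^ k) (IPut 0 (K 0) (K 1)) (input_state n [] \<alpha> \<phi> b) 1 0 0
      (set_iarr 0 (ieval (K 0) (input_state n [] \<alpha> \<phi> b)) (ieval (K 1) (input_state n [] \<alpha> \<phi> b)) (input_state n [] \<alpha> \<phi> b))"
    by (rule exec.IPut) (use assms in simp)
  hence "exec D (n ^ k) main_prog (input_state n [] \<alpha> \<phi> b) (Suc 1) 0 0 (set_iarr 0 0 1 (input_state n [] \<alpha> \<phi> b))"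
    unfolding main_prog_def by (intro exec.CondFalse) (simp_all add: input_state_def)
  thus ?thesis by (simp add: numeral_2_eq_2)
qed

section \<open>Instances of the problem and the final bounds\<close>

locale cut_instance =
  fixes n :: nat and E :: "nat set set" and es :: "(nat \<times> nat) list" and \<alpha> \<phi> b :: real and D :: apsp_ds
  assumes n: "0 < n" and graph: "simple_graph {..<n} E" "lists_edges es E"
    and alpha: "1 \<le> \<alpha>" and apsp: "approx_apsp \<alpha> D" and phi: "0 < \<phi>" "\<phi> \<le> 1"
    and b: "1 / real n \<le> b" "b \<le> 1 / 4"
begin

abbreviation m :: nat where "m \<equiv> length es"

definition good :: "mstate \<Rightarrow> bool" where
  "good s \<longleftrightarrow> (case returned n s of
              Some S \<Rightarrow>
                is_cut {..<n} S \<and>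
                b * real (vol E {..<n}) \<le> real (vol E S) \<and>
                b * real (vol E {..<n}) \<le> real (vol E ({..<n} - S)) \<and>
                conductance {..<n} E S \<le> \<phi>
            | None \<Rightarrow>
                (\<forall>X. is_cut {..<n} X \<and>
                     8448 * b * real (vol E {..<n}) \<le> real (vol E X) \<and>
                     8448 * b * real (vol E {..<n}) \<le> real (vol E ({..<n} - X)) \<longrightarrow>
                     \<phi> * (1 / 200000000 / (\<alpha> * ln (real n) * ln (1 / b) * ln (ln (real n) * \<alpha> / (b * \<phi>))))
                       \<le> conductance {..<n} E X \<and>
                     \<phi> * (1 / 200000000 / (\<alpha> * ln (real n) ^ 3)) \<le> conductance {..<n} E X))"

lemma card_E: "card E = m" using graph(2) by (simp add: lists_edges_def)

lemma E_image: "E = (\<lambda>e. {fst (es ! e), snd (es ! e)}) ` {..<m}"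
proof -
  have "E = (\<lambda>(u, v). {u, v}) ` set es" using graph(2) unfolding lists_edges_def by (rule conjunct1)
  also have "set es = (!) es ` {..<m}" by (auto simp: set_conv_nth)
  finally show ?thesis by (simp add: image_image case_prod_beta)
qed

text \<open>The listing is as long as the edge set, so no edge is listed twice, not even with its
  ends exchanged.\<close>

lemma inj_edges: "inj_on (\<lambda>e. {fst (es ! e), snd (es ! e)}) {..<m}"
  by (rule eq_card_imp_inj_on) (simp_all add: E_image[symmetric] card_E)

lemma ends:
  assumes "e < m" shows "fst (es ! e) < n" "snd (es ! e) < n" "fst (es ! e) \<noteq> snd (es ! e)"
proof -
  have "{fst (es ! e), snd (es ! e)} \<in> E" using assms by (auto simp: E_image)
  then obtain u v where "u < n" "v < n" "u \<noteq> v" "{fst (es ! e), snd (es ! e)} = {u, v}"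
    using graph(1) by (fastforce simp: simple_graph_def)
  thus "fst (es ! e) < n" "snd (es ! e) < n" "fst (es ! e) \<noteq> snd (es ! e)" by (auto simp: doubleton_eq_iff)
qed

lemma m_le: "m \<le> n * n"
proof -
  have "E \<subseteq> (\<lambda>(u, v). {u, v}) ` ({..<n} \<times> {..<n})" using graph(1) by (fastforce simp: simple_graph_def)
  hence "card E \<le> card ({..<n} \<times> {..<n})" by (rule surj_card_le[rotated]) simp
  thus ?thesis by (simp add: card_E)
qed

lemma correct_nonempty:
  assumes m: "1 \<le> m"
  obtains t u q s where "exec D (n ^ 6) main_prog (input_state n es \<alpha> \<phi> b) t u q s"
    "real t \<le> 400000 * (\<alpha> * real m / \<phi> * ln (real n) ^ 3)" "real q \<le> 64 * real m" "good s"
proof -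
  have b0: "0 < b" using b n by (meson divide_pos_pos less_le_trans of_nat_0_less_iff zero_less_one)
  obtain Jm :: nat where J: "1 \<le> Jm" "4 * 2 ^ (Jm - 1) * b \<le> 1" "1 < 8 * 2 ^ (Jm - 1) * b"
    using exists_levels[OF b0 b(2)] by blast
  interpret params n m \<alpha> \<phi> b Jm
    using m m_le alpha phi n b J by unfold_locales auto
  interpret input n m "\<lambda>e. fst (es ! e)" "\<lambda>e. snd (es ! e)" "n ^ 6"
    by unfold_locales (use ends inj_edges big in auto)
  have "wp D (n ^ 6) main_prog (\<lambda>s _ _. good s) (input_state n es \<alpha> \<phi> b)
      (400000 * (\<alpha> * real m / \<phi> * ln (real n) ^ 3)) (64 * real m)"
  proof (rule wp_main[where lm = "8 * ln (real n)"])
    show "input_state n es \<alpha> \<phi> b = \<lparr>ivar = (\<lambda>_. 0)(0 := n, 1 := m), rvar = (\<lambda>_. 0)(0 := \<alpha>, 1 := \<phi>, 2 := b),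
        iarr = (\<lambda>_ _. 0)(0 := (\<lambda>i. if i < m then fst (es ! i) else 0), 1 := (\<lambda>i. if i < m then snd (es ! i) else 0)),
        rarr = (\<lambda>_ _. 0), dstr = None\<rparr>" by (simp add: input_state_def)
    fix s' T' q' l
    assume l: "real l \<le> 8 * ln (real n)"
      and o: "outcome n E \<phi> b (8 * \<alpha> * (126 * real l / \<phi>) * real Jm) (2 * (\<alpha> * (126 * real l / \<phi>) * 2 ^ (Jm - 1))) s'"
    have c2: "0 < 1 / (200000000 :: real)" "1 / 200000000 * 200000000 \<le> (1 :: real)" by simp_all
    note cc = conductance_const[OF l c2]
    show "good s'"
    proof (cases "returned n s'")
      case None
      have o': "B \<le> conductance {..<n} E X" if "is_cut {..<n} X"
        "8448 * b * real (vol E {..<n}) \<le> real (vol E X)" "8448 * b * real (vol E {..<n}) \<le> real (vol E ({..<n} - X))"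
        "\<forall>g. 2 ^ g \<le> 2 * (\<alpha> * (126 * real l / \<phi>) * 2 ^ (Jm - 1)) \<and> 2 ^ g \<le> 2 * real (card E) + 1 \<longrightarrow> real g + 1 \<le> \<Lambda>"
        "528 * (8 * \<alpha> * (126 * real l / \<phi>) * real Jm) * \<Lambda> \<le> 1 / B" "0 < B" for X \<Lambda> B
        by (rule o[unfolded outcome_def None option.case, THEN spec[of _ X], THEN spec[of _ \<Lambda>], THEN spec[of _ B], THEN mp]) (intro conjI that)
      show ?thesis unfolding good_def None option.case
      proof (intro allI impI conjI, goal_cases)
        case (1 X)
        have g: "\<forall>g. 2 ^ g \<le> 2 * (\<alpha> * (126 * real l / \<phi>) * 2 ^ (Jm - 1)) \<and> 2 ^ g \<le> 2 * real (card E) + 1 \<longrightarrow>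
            real g + 1 \<le> 13 * ln (ln (real n) * \<alpha> / (b * \<phi>))"
          by (intro allI impI, elim conjE) (rule levels_le[OF l])
        from 1 show ?case by (elim conjE, intro o'[OF _ _ _ g cc(1,3)])
      next
        case (2 X)
        have g: "\<forall>g. 2 ^ g \<le> 2 * (\<alpha> * (126 * real l / \<phi>) * 2 ^ (Jm - 1)) \<and> 2 ^ g \<le> 2 * real (card E) + 1 \<longrightarrow>
            real g + 1 \<le> 7 * ln (real n)"
          unfolding card_E by (intro allI impI, elim conjE) (rule levels_le')
        from 2 show ?case by (elim conjE, intro o'[OF _ _ _ g cc(2,4)])
      qed
    qed (use o in \<open>simp add: good_def outcome_def\<close>)
  next
    show "30 + 392 * real m + 3 * real Jm + real Jm * (10 + 176 * real m * (\<alpha> * (126 * (8 * ln (real n)) / \<phi>)))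
       \<le> 400000 * (\<alpha> * real m / \<phi> * ln (real n) ^ 3)" by (rule time_le)
    show "real l \<le> 8 * ln (real n)" if "2 ^ l \<le> 8 * (2 * m)" for l using that by (rule l_le)
    show "E = (\<lambda>e. {fst (es ! e), snd (es ! e)}) ` {..<m}" by (rule E_image)
    show "8 * (2 * m + 1) * (2 ^ (Jm - 1) + 1) \<le> n ^ 6" "2 * n + 1 \<le> n ^ 6" "16 * m + 16 \<le> n ^ 6" "2 ^ Jm \<le> n ^ 6"
      by (rule big)+
  qed (simp_all add: m[unfolded One_nat_def] apsp alpha phi b0 J[unfolded One_nat_def])
  thus ?thesis by (rule wpE) (rule that)
qed

lemma good_edgeless:
  assumes "es = []" shows "good (set_iarr 0 0 1 (input_state n es \<alpha> \<phi> b))"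
proof -
  have E: "E = {}" using assms E_image by simp
  have "1 / real n \<le> 1 / 4" using b by linarith
  hence "4 \<le> real n" using n by (simp add: field_simps)
  hence "4 \<le> n" by simp
  have ne: "{..<n} \<noteq> {0}"
  proof
    assume "{..<n} = {0}"
    hence "card {..<n} = card {0 :: nat}" by (rule arg_cong)
    thus False using \<open>4 \<le> n\<close> by simp
  qed
  have ret: "returned n (set_iarr 0 0 1 (input_state n es \<alpha> \<phi> b)) = Some {0}"
    using assms n by (auto simp: returned_def input_state_def set_iarr_def)
  have "{0} \<subseteq> {..<n}" using n by simp
  hence "is_cut {..<n} {0}" using ne by (simp add: is_cut_def psubset_eq)
  \<comment> \<open>All volumes are 0, and the conductance is 0 / 0, which is 0 by convention, hence
    at most \<phi>.\<close>
  thus ?thesis unfolding good_def ret option.case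
    using phi by (simp add: E vol_def degree_def conductance_def cut_edges_def)
qed

lemma correct:
  "\<exists>t u q s. exec D (n ^ 6) main_prog (input_state n es \<alpha> \<phi> b) t u q s \<and>
     real u \<le> 400000 * (\<alpha> * real (card E) / \<phi> * ln (real n) ^ 3) \<and> real q \<le> 400000 * real (card E) \<and>
     real t \<le> 400000 * (\<alpha> * real (max 1 (card E)) / \<phi> * ln (real n) ^ 3) \<and> good s"
proof (cases "es = []")
  case True
  have "1 / real n \<le> 1 / 4" using b by linarith
  hence "4 \<le> real n" using n by (simp add: field_simps)
  hence "1 \<le> ln (real n)" by (rule ln_ge_1)
  \<comment> \<open>Even without edges the program takes two steps, which \<open>max 1\<close> in
    the time bound accommodates.\<close>
  hence "1 * 1 \<le> \<alpha> / \<phi> * ln (real n) ^ 3" using alpha phi by (intro mult_mono) auto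
  moreover have c: "card E = 0" using True card_E by simp
  ultimately have t: "real 2 \<le> 400000 * (\<alpha> * real (max 1 (card E)) / \<phi> * ln (real n) ^ 3)" by simp
  have e: "exec D (n ^ 6) main_prog (input_state n es \<alpha> \<phi> b) 2 0 0 (set_iarr 0 0 1 (input_state n es \<alpha> \<phi> b))"
    unfolding True by (rule exec_main_prog_edgeless[OF n])
  have "real 0 \<le> 400000 * (\<alpha> * real (card E) / \<phi> * ln (real n) ^ 3)" "real 0 \<le> 400000 * real (card E)"
    by (simp_all add: c)
  with t e good_edgeless[OF True] show ?thesis
    by (intro exI[of _ 2] exI[of _ 0] exI[of _ "set_iarr 0 0 1 (input_state n es \<alpha> \<phi> b)"] conjI)
next
  case False
  hence m: "1 \<le> m" by (cases es) auto
  obtain t u q s where 1: "exec D (n ^ 6) main_prog (input_state n es \<alpha> \<phi> b) t u q s"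
    "real t \<le> 400000 * (\<alpha> * real m / \<phi> * ln (real n) ^ 3)" "real q \<le> 64 * real m" "good s"
    using correct_nonempty[OF m] by blast
  have "u \<le> t" using 1(1) by (rule exec_updates_le_time)
  hence "real u \<le> 400000 * (\<alpha> * real m / \<phi> * ln (real n) ^ 3)" using 1(2) by linarith
  moreover have "real q \<le> 400000 * real m" using 1(3) by linarith
  moreover have "max 1 m = m" using m by simp
  ultimately show ?thesis using 1 unfolding card_E
    by (intro exI[of _ t] exI[of _ u] exI[of _ q] exI[of _ s] conjI) simp_all
qed

end

no_notation Seq (infixr ";;" 60)
hide_const (open) V K

theorem theorem2p1:
  "\<exists>(LowConductanceCutOrCertify :: com) (K :: nat) (C :: real) (c1 :: real) (c2 :: real).
     0 < C \<and> 0 < c1 \<and> 0 < c2 \<and>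
     (\<forall>(n :: nat) (E :: nat set set) (es :: (nat \<times> nat) list)
        (\<alpha> :: real) (\<phi> :: real) (b :: real) (D :: apsp_ds).
        0 < n \<and> simple_graph {..<n} E \<and> lists_edges es E \<and>
        1 \<le> \<alpha> \<and> approx_apsp \<alpha> D \<and>
        0 < \<phi> \<and> \<phi> \<le> 1 \<and> 1 / real n \<le> b \<and> b \<le> 1 / 4 \<longrightarrow>
        (\<exists>t u q s.
           exec D (n ^ K) LowConductanceCutOrCertify (input_state n es \<alpha> \<phi> b) t u q s \<and>
           real u \<le> C * (\<alpha> * real (card E) / \<phi> * ln (real n) ^ 3) \<and>
           real q \<le> C * real (card E) \<and>
           real t \<le> C * (\<alpha> * real (max 1 (card E)) / \<phi> * ln (real n) ^ 3) \<and>
           (case returned n s of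
              Some S \<Rightarrow>
                is_cut {..<n} S \<and>
                b * real (vol E {..<n}) \<le> real (vol E S) \<and>
                b * real (vol E {..<n}) \<le> real (vol E ({..<n} - S)) \<and>
                conductance {..<n} E S \<le> \<phi>
            | None \<Rightarrow>
                (\<forall>X. is_cut {..<n} X \<and>
                     c1 * b * real (vol E {..<n}) \<le> real (vol E X) \<and>
                     c1 * b * real (vol E {..<n}) \<le> real (vol E ({..<n} - X)) \<longrightarrow>
                     \<phi> * (c2 / (\<alpha> * ln (real n) * ln (1 / b) * ln (ln (real n) * \<alpha> / (b * \<phi>))))
                       \<le> conductance {..<n} E X \<and>
                     \<phi> * (c2 / (\<alpha> * ln (real n) ^ 3)) \<le> conductance {..<n} E X))))"
proof (rule exI[of _ main_prog], rule exI[of _ 6], rule exI[of _ 400000], rule exI[of _ 8448],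
    rule exI[of _ "1 / 200000000"], intro conjI allI impI)
  \<comment> \<open>The word exponent 6 comes from \<open>big\<close>, the factor 400000 from
    \<open>time_le\<close>, 8448 from \<open>certI\<close>, and 1 / 200000000 from
    \<open>conductance_const\<close>.\<close>
  fix n :: nat and E :: "nat set set" and es :: "(nat \<times> nat) list" and \<alpha> \<phi> b :: real and D :: apsp_ds
  assume "0 < n \<and> simple_graph {..<n} E \<and> lists_edges es E \<and> 1 \<le> \<alpha> \<and> approx_apsp \<alpha> D \<and>
    0 < \<phi> \<and> \<phi> \<le> 1 \<and> 1 / real n \<le> b \<and> b \<le> 1 / 4"
  then interpret cut_instance n E es \<alpha> \<phi> b D by unfold_locales auto
  show "(\<exists>t u q s.
           exec D (n ^ 6) main_prog (input_state n es \<alpha> \<phi> b) t u q s \<and>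
           real u \<le> 400000 * (\<alpha> * real (card E) / \<phi> * ln (real n) ^ 3) \<and>
           real q \<le> 400000 * real (card E) \<and>
           real t \<le> 400000 * (\<alpha> * real (max 1 (card E)) / \<phi> * ln (real n) ^ 3) \<and>
           (case returned n s of
              Some S \<Rightarrow>
                is_cut {..<n} S \<and>
                b * real (vol E {..<n}) \<le> real (vol E S) \<and>
                b * real (vol E {..<n}) \<le> real (vol E ({..<n} - S)) \<and>
                conductance {..<n} E S \<le> \<phi>
            | None \<Rightarrow>
                (\<forall>X. is_cut {..<n} X \<and>
                     8448 * b * real (vol E {..<n}) \<le> real (vol E X) \<and>
                     8448 * b * real (vol E {..<n}) \<le> real (vol E ({..<n} - X)) \<longrightarrow>
                     \<phi> * (1 / 200000000 / (\<alpha> * ln (real n) * ln (1 / b) * ln (ln (real n) * \<alpha> / (b * \<phi>))))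
                       \<le> conductance {..<n} E X \<and>
                     \<phi> * (1 / 200000000 / (\<alpha> * ln (real n) ^ 3)) \<le> conductance {..<n} E X)))"
    using correct unfolding good_def .
qed simp_all

end
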